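(* Let $D$ be a commutative Dedekind domain that is not a field, with an automorphism $\sigma$, and let $R = D((x;\sigma))$ be the skew Laurent series ring. Then the right Krull dimension of $R$ is $1$, the right global dimension of $R$ is $1$, and the stable rank of $R$ is $2$. If $\sigma$ acts trivially on the ideal class group $G(D)$, then the general linear rank of $R$ is $1$.
   Context: A commutative Dedekind domain is a commutative domain in which every nonzero ideal is invertible. The skew Laurent series ring $D((x;\sigma))$ is the set of formal series $\sum_{i=k}^\infty a_i x^i$ with $k\in\mathbb Z$, $a_i\in D$, with termwise addition and multiplication determined by $x^i a=\sigma^i(a)x^i$ for $a\in D$, $i\in\mathbb Z$. We say $\sigma$ acts trivially on $G(D)$ if $\sigma(\mathfrak I)$ is isomorphic to $\mathfrak I$ as a $D$-module for every ideal $\mathfrak I$ of $D$. Invariants are as in McConnell–Robson, "Noncommutative Noetherian Rings". The right Krull dimension is the Gabriel–Rentschler Krull dimension of the right module $R_R$ (the deviation of its lattice of right ideals). A row $(a_1,\dots,a_m)\in R^m$ is unimodular if $a_1R+\dots+a_mR=R$; for $m\ge 2$ it is stable if there are $r_1,\dots,r_{m-1}\in R$ such that $(a_1+a_mr_1,\dots,a_{m-1}+a_mr_{m-1})$ is unimodular. The stable rank of $R$ is the least integer $n\geq 1$ such that every unimodular row of length $m>n$ is stable. The general linear rank of $R$ is the least integer $n\ge 1$ such that for every $m>n$ every unimodular row of length $m$ over $R$ is the first row of an invertible $m\times m$ matrix over $R$; equivalently, such that every stably free module of rank $\ge n$ is free. *)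

theory Defs
  imports
    "HOL-Algebra.Ideal_Product"
    "HOL-Algebra.Module"
    "HOL-Algebra.QuotRing"
    "HOL-Library.Extended_Nat"
begin

section \<open>Dedekind domains and the class group\<close>

text \<open>
  Every fractional ideal of a domain has the form $d^{-1}J$ with \<open>J\<close> an ideal and \<open>d \<noteq> 0\<close>.
  The equation $I \cdot (d^{-1}J) = D$ in the quotient field says exactly \<open>I J = d D\<close>,
  which can be stated inside \<open>D\<close>.
\<close>
definition invertible_ideal :: "('a, 'b) ring_scheme \<Rightarrow> 'a set \<Rightarrow> bool" where
  "invertible_ideal D I \<longleftrightarrow>
     ideal I D \<and>
     (\<exists>J d. ideal J D \<and> d \<in> carrier D \<and> d \<noteq> \<zero>\<^bsub>D\<^esub> \<and> ideal_prod D I J = PIdl\<^bsub>D\<^esub> d)"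

definition dedekind_domain :: "('a, 'b) ring_scheme \<Rightarrow> bool" where
  "dedekind_domain D \<longleftrightarrow>
     domain D \<and> (\<forall>I. ideal I D \<and> I \<noteq> {\<zero>\<^bsub>D\<^esub>} \<longrightarrow> invertible_ideal D I)"

definition isomorphic_ideals :: "('a, 'b) ring_scheme \<Rightarrow> 'a set \<Rightarrow> 'a set \<Rightarrow> bool" where
  "isomorphic_ideals D I J \<longleftrightarrow>
     (\<exists>\<phi>. bij_betw \<phi> I J \<and>
          (\<forall>a\<in>I. \<forall>b\<in>I. \<phi> (a \<oplus>\<^bsub>D\<^esub> b) = \<phi> a \<oplus>\<^bsub>D\<^esub> \<phi> b) \<and>
          (\<forall>r\<in>carrier D. \<forall>a\<in>I. \<phi> (r \<otimes>\<^bsub>D\<^esub> a) = r \<otimes>\<^bsub>D\<^esub> \<phi> a))"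

definition acts_trivially_on_class_group :: "('a, 'b) ring_scheme \<Rightarrow> ('a \<Rightarrow> 'a) \<Rightarrow> bool" where
  "acts_trivially_on_class_group D \<sigma> \<longleftrightarrow>
     (\<forall>I. ideal I D \<longrightarrow> isomorphic_ideals D (\<sigma> ` I) I)"


section \<open>Skew Laurent series\<close>

definition aut_power :: "('a, 'b) ring_scheme \<Rightarrow> ('a \<Rightarrow> 'a) \<Rightarrow> int \<Rightarrow> 'a \<Rightarrow> 'a" where
  "aut_power D \<sigma> i =
     (if 0 \<le> i then \<sigma> ^^ nat i else inv_into (carrier D) \<sigma> ^^ nat (- i))"

text \<open>
  The function \<open>f\<close> stands for the series $\sum_i f(i)\, x^i$, coefficients on the left.
  Since $(a x^i)(b x^j) = a\,\sigma^i(b)\, x^{i+j}$, the coefficient of $x^n$ in \<open>f g\<close> is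
  $\sum_i f(i)\, \sigma^i(g(n-i))$; the index set below is finite for all \<open>f\<close>, \<open>g\<close> in the carrier.
\<close>
definition skew_laurent :: "('a, 'b) ring_scheme \<Rightarrow> ('a \<Rightarrow> 'a) \<Rightarrow> (int \<Rightarrow> 'a) ring" where
  "skew_laurent D \<sigma> =
     \<lparr> carrier = {f. (\<forall>i. f i \<in> carrier D) \<and> (\<exists>k. \<forall>i<k. f i = \<zero>\<^bsub>D\<^esub>)},
       mult = (\<lambda>f g n. \<Oplus>\<^bsub>D\<^esub>i\<in>{i. f i \<noteq> \<zero>\<^bsub>D\<^esub> \<and> g (n - i) \<noteq> \<zero>\<^bsub>D\<^esub>}.
                  f i \<otimes>\<^bsub>D\<^esub> aut_power D \<sigma> i (g (n - i))),
       one = (\<lambda>i. if i = 0 then \<one>\<^bsub>D\<^esub> else \<zero>\<^bsub>D\<^esub>),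
       zero = (\<lambda>i. \<zero>\<^bsub>D\<^esub>),
       add = (\<lambda>f g i. f i \<oplus>\<^bsub>D\<^esub> g i) \<rparr>"


section \<open>Krull dimension\<close>

definition right_ideal :: "'r set \<Rightarrow> ('r, 's) ring_scheme \<Rightarrow> bool" where
  "right_ideal I R \<longleftrightarrow>
     additive_subgroup I R \<and> (\<forall>a\<in>I. \<forall>r\<in>carrier R. a \<otimes>\<^bsub>R\<^esub> r \<in> I)"

definition trivial_poset :: "'p::order set \<Rightarrow> bool" where
  "trivial_poset A \<longleftrightarrow> \<not> (\<exists>x\<in>A. \<exists>y\<in>A. x < y)"

definition factor :: "'p::order set \<Rightarrow> 'p \<Rightarrow> 'p \<Rightarrow> 'p set" where
  "factor A x y = {z \<in> A. y \<le> z \<and> z \<le> x}"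

definition descending_chain :: "'p::order set \<Rightarrow> (nat \<Rightarrow> 'p) \<Rightarrow> bool" where
  "descending_chain A c \<longleftrightarrow> (\<forall>i. c i \<in> A \<and> c (Suc i) \<le> c i)"

text \<open>
  \<open>has_deviation n A\<close> is the recursive definition of \<open>dev A = n\<close>, restricted to finite
  ordinals \<open>n\<close>. A trivial poset has deviation $-\infty$, so a factor of deviation \<open>< n\<close> is either
  trivial or of deviation \<open>k\<close> for some \<open>k < n\<close>. For \<open>n = 0\<close> the definition says that \<open>A\<close> is
  nontrivial and satisfies the descending chain condition.
\<close>
fun has_deviation :: "nat \<Rightarrow> 'p::order set \<Rightarrow> bool" where
  "has_deviation n A \<longleftrightarrow>
     \<not> trivial_poset A \<and>
     (\<forall>k\<in>{..<n}. \<not> has_deviation k A) \<and>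
     (\<forall>c. descending_chain A c \<longrightarrow>
        (\<forall>\<^sub>\<infinity>i. trivial_poset (factor A (c i) (c (Suc i))) \<or>
               (\<exists>k\<in>{..<n}. has_deviation k (factor A (c i) (c (Suc i))))))"

declare has_deviation.simps [simp del]

definition has_right_krull_dimension :: "('r, 's) ring_scheme \<Rightarrow> nat \<Rightarrow> bool" where
  "has_right_krull_dimension R n \<longleftrightarrow> has_deviation n {I. right_ideal I R}"


section \<open>Global dimension\<close>

text \<open>
  The library's module record is used for right modules over a noncommutative ring:
  \<open>r \<odot> m\<close> is to be read as \<open>m r\<close>, which explains the order of the factors in
  \<open>rsmult_assoc\<close>. The fields \<open>mult\<close> and \<open>one\<close> of the record play no role.
\<close>
locale right_module = R?: ring R + M?: abelian_group M
  for R (structure) and M :: "('r, 'm, 'n) module_scheme" (structure) +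
  assumes rsmult_closed:
      "\<lbrakk>r \<in> carrier R; m \<in> carrier M\<rbrakk> \<Longrightarrow> r \<odot>\<^bsub>M\<^esub> m \<in> carrier M"
    and rsmult_ring_distr:
      "\<lbrakk>r \<in> carrier R; s \<in> carrier R; m \<in> carrier M\<rbrakk> \<Longrightarrow>
       (r \<oplus>\<^bsub>R\<^esub> s) \<odot>\<^bsub>M\<^esub> m = r \<odot>\<^bsub>M\<^esub> m \<oplus>\<^bsub>M\<^esub> s \<odot>\<^bsub>M\<^esub> m"
    and rsmult_module_distr:
      "\<lbrakk>r \<in> carrier R; m \<in> carrier M; m' \<in> carrier M\<rbrakk> \<Longrightarrow>
       r \<odot>\<^bsub>M\<^esub> (m \<oplus>\<^bsub>M\<^esub> m') = r \<odot>\<^bsub>M\<^esub> m \<oplus>\<^bsub>M\<^esub> r \<odot>\<^bsub>M\<^esub> m'"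
    and rsmult_assoc:
      "\<lbrakk>r \<in> carrier R; s \<in> carrier R; m \<in> carrier M\<rbrakk> \<Longrightarrow>
       (r \<otimes>\<^bsub>R\<^esub> s) \<odot>\<^bsub>M\<^esub> m = s \<odot>\<^bsub>M\<^esub> (r \<odot>\<^bsub>M\<^esub> m)"
    and rsmult_one:
      "m \<in> carrier M \<Longrightarrow> \<one>\<^bsub>R\<^esub> \<odot>\<^bsub>M\<^esub> m = m"

definition rmod_hom ::
    "('r, 's) ring_scheme \<Rightarrow> ('r, 'm) module \<Rightarrow> ('r, 'n) module \<Rightarrow> ('m \<Rightarrow> 'n) set" where
  "rmod_hom R M N =
     {f \<in> carrier M \<rightarrow> carrier N.
        (\<forall>x\<in>carrier M. \<forall>y\<in>carrier M. f (x \<oplus>\<^bsub>M\<^esub> y) = f x \<oplus>\<^bsub>N\<^esub> f y) \<and>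
        (\<forall>r\<in>carrier R. \<forall>x\<in>carrier M. f (r \<odot>\<^bsub>M\<^esub> x) = r \<odot>\<^bsub>N\<^esub> f x)}"

definition rmod_ker :: "('r, 'm) module \<Rightarrow> ('r, 'n) module \<Rightarrow> ('m \<Rightarrow> 'n) \<Rightarrow> 'm set" where
  "rmod_ker M N f = {x \<in> carrier M. f x = \<zero>\<^bsub>N\<^esub>}"

text \<open>The free right module $R^{(X)}$, realised as finitely supported functions on \<open>X\<close>.\<close>
definition free_rmod :: "('r, 's) ring_scheme \<Rightarrow> 'x set \<Rightarrow> ('r, 'x \<Rightarrow> 'r) module" where
  "free_rmod R X =
     \<lparr> carrier = {f. (\<forall>x\<in>X. f x \<in> carrier R) \<and> (\<forall>x. x \<notin> X \<longrightarrow> f x = \<zero>\<^bsub>R\<^esub>) \<and>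
                     finite {x. f x \<noteq> \<zero>\<^bsub>R\<^esub>}},
       mult = undefined,
       one = undefined,
       zero = (\<lambda>x. \<zero>\<^bsub>R\<^esub>),
       add = (\<lambda>f g x. f x \<oplus>\<^bsub>R\<^esub> g x),
       smult = (\<lambda>r f x. f x \<otimes>\<^bsub>R\<^esub> r) \<rparr>"

text \<open>
  A module is projective iff it is (isomorphic to) a direct summand of a free module, the
  summand being given by its inclusion and projection. Taking \<open>X\<close> inside the type of \<open>P\<close> is no
  restriction: a projective \<open>P\<close> is a direct summand of the free module on the set \<open>carrier P\<close>.
\<close>
definition projective_rmod :: "('r, 's) ring_scheme \<Rightarrow> ('r, 'm) module \<Rightarrow> bool" where
  "projective_rmod R P \<longleftrightarrow>
     right_module R P \<and>
     (\<exists>(X :: 'm set) f g.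
        f \<in> rmod_hom R P (free_rmod R X) \<and> g \<in> rmod_hom R (free_rmod R X) P \<and>
        (\<forall>p\<in>carrier P. g (f p) = p))"

text \<open>
  A projective resolution $\cdots \to P_1 \to P_0 \to M \to 0$ of length at most \<open>n\<close>, i.e.\
  with \<open>P i = 0\<close> for \<open>i > n\<close>. The map \<open>d i\<close> goes from \<open>P (Suc i)\<close> to \<open>P i\<close>.
\<close>
definition projective_resolution ::
    "('r, 's) ring_scheme \<Rightarrow> ('r, 'm) module \<Rightarrow> nat \<Rightarrow>
     (nat \<Rightarrow> ('r, 'm) module) \<Rightarrow> (nat \<Rightarrow> 'm \<Rightarrow> 'm) \<Rightarrow> ('m \<Rightarrow> 'm) \<Rightarrow> bool" where
  "projective_resolution R M n P d \<epsilon> \<longleftrightarrow>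
     (\<forall>i. projective_rmod R (P i)) \<and>
     (\<forall>i>n. carrier (P i) = {\<zero>\<^bsub>P i\<^esub>}) \<and>
     \<epsilon> \<in> rmod_hom R (P 0) M \<and>
     (\<forall>i. d i \<in> rmod_hom R (P (Suc i)) (P i)) \<and>
     \<epsilon> ` carrier (P 0) = carrier M \<and>
     d 0 ` carrier (P 1) = rmod_ker (P 0) M \<epsilon> \<and>
     (\<forall>i. d (Suc i) ` carrier (P (Suc (Suc i))) = rmod_ker (P (Suc i)) (P i) (d i))"

definition projective_dimension :: "('r, 's) ring_scheme \<Rightarrow> ('r, 'm) module \<Rightarrow> enat" where
  "projective_dimension R M = Inf {enat n |n. \<exists>P d \<epsilon>. projective_resolution R M n P d \<epsilon>}"

text \<open>
  ``All right modules'' has to mean all modules whose elements come from some fixed type. The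
  type \<open>('r + 'm) list\<close>, for an arbitrary type \<open>'m\<close>, is infinite and at least as large as both
  \<open>R\<close> and \<open>'m\<close>. Hence it contains copies of all cyclic right \<open>R\<close>-modules, and of a free cover
  of each module it contains (so also of its projective resolutions). A statement for all \<open>'m\<close>
  covers modules of every cardinality.
\<close>
definition right_global_dimension :: "'m itself \<Rightarrow> ('r, 's) ring_scheme \<Rightarrow> enat" where
  "right_global_dimension _ R =
     Sup {projective_dimension R M |M :: ('r, ('r + 'm) list) module. right_module R M}"


section \<open>Stable rank and general linear rank\<close>

text \<open>A row of length \<open>m\<close> is a function on \<open>nat\<close> of which only the values at \<open>i < m\<close> matter.\<close>

definition unimodular_row :: "('r, 's) ring_scheme \<Rightarrow> nat \<Rightarrow> (nat \<Rightarrow> 'r) \<Rightarrow> bool" where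
  "unimodular_row R m a \<longleftrightarrow>
     a \<in> {..<m} \<rightarrow> carrier R \<and>
     {(\<Oplus>\<^bsub>R\<^esub>i\<in>{..<m}. a i \<otimes>\<^bsub>R\<^esub> b i) |b. b \<in> {..<m} \<rightarrow> carrier R} = carrier R"

definition stable_row :: "('r, 's) ring_scheme \<Rightarrow> nat \<Rightarrow> (nat \<Rightarrow> 'r) \<Rightarrow> bool" where
  "stable_row R m a \<longleftrightarrow>
     (\<exists>r \<in> {..<m - 1} \<rightarrow> carrier R.
        unimodular_row R (m - 1) (\<lambda>i. a i \<oplus>\<^bsub>R\<^esub> a (m - 1) \<otimes>\<^bsub>R\<^esub> r i))"

definition stable_rank :: "('r, 's) ring_scheme \<Rightarrow> enat" where
  "stable_rank R =
     Inf {enat n |n. 1 \<le> n \<and> (\<forall>m>n. \<forall>a. unimodular_row R m a \<longrightarrow> stable_row R m a)}"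

definition square_matrices :: "('r, 's) ring_scheme \<Rightarrow> nat \<Rightarrow> (nat \<Rightarrow> nat \<Rightarrow> 'r) set" where
  "square_matrices R m = {A. \<forall>i<m. \<forall>j<m. A i j \<in> carrier R}"

definition inverse_matrices ::
    "('r, 's) ring_scheme \<Rightarrow> nat \<Rightarrow> (nat \<Rightarrow> nat \<Rightarrow> 'r) \<Rightarrow> (nat \<Rightarrow> nat \<Rightarrow> 'r) \<Rightarrow> bool" where
  "inverse_matrices R m A B \<longleftrightarrow>
     (\<forall>i<m. \<forall>k<m.
        (\<Oplus>\<^bsub>R\<^esub>j\<in>{..<m}. A i j \<otimes>\<^bsub>R\<^esub> B j k) = (if i = k then \<one>\<^bsub>R\<^esub> else \<zero>\<^bsub>R\<^esub>) \<and>
        (\<Oplus>\<^bsub>R\<^esub>j\<in>{..<m}. B i j \<otimes>\<^bsub>R\<^esub> A j k) = (if i = k then \<one>\<^bsub>R\<^esub> else \<zero>\<^bsub>R\<^esub>))"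

definition invertible_matrix :: "('r, 's) ring_scheme \<Rightarrow> nat \<Rightarrow> (nat \<Rightarrow> nat \<Rightarrow> 'r) \<Rightarrow> bool" where
  "invertible_matrix R m A \<longleftrightarrow>
     A \<in> square_matrices R m \<and> (\<exists>B \<in> square_matrices R m. inverse_matrices R m A B)"

definition general_linear_rank :: "('r, 's) ring_scheme \<Rightarrow> enat" where
  "general_linear_rank R =
     Inf {enat n |n. 1 \<le> n \<and>
            (\<forall>m>n. \<forall>a. unimodular_row R m a \<longrightarrow>
               (\<exists>A. invertible_matrix R m A \<and> (\<forall>j<m. A 0 j = a j)))}"

end

theory Submission
  imports Defs "HOL-Algebra.Multiplicative_Group"
begin

text \<open>
  The proof compares a right ideal \<open>I\<close> of \<open>R = D((x;\<sigma>))\<close> with the ideal \<open>lead I\<close> of \<open>D\<close> that consists of the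
  lowest coefficients of its elements. As \<open>D\<close> is a Dedekind domain, \<open>lead I\<close> is projective, so lowest
  coefficients can be lifted linearly to elements of \<open>I\<close> (\<open>ex_lifting\<close>), and successive approximation shows
  that such a lifting is an isomorphism from the series with coefficients in \<open>lead I\<close> onto \<open>I\<close>
  (\<open>lifting_surj\<close>). Three facts follow. The map \<open>lead\<close> is strictly increasing (\<open>eq_if_lead_eq\<close>), \<open>I\<close> is
  projective (\<open>right_ideal_dual_basis\<close>), and \<open>I\<close> is principal if \<open>lead I\<close> is (\<open>principal_if_lead_principal\<close>).

  For the Krull dimension: by strict monotonicity the chain conditions of \<open>D\<close> pass to \<open>R\<close>: the ascending one, and the
  descending one above every nonzero right ideal. This bounds the Krull dimension by \<open>1\<close>, and the powers of a
  nonunit of \<open>D\<close> show that it is not \<open>0\<close>.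

  For the stable rank: in a domain with these two chain conditions, a unimodular pair modulo a nonzero right ideal can be
  shortened (\<open>stable_pair\<close>), so all unimodular rows of length at least three are stable. The row
  \<open>(t + x, t s)\<close> with \<open>\<sigma> s = t\<close> and a nonunit \<open>t\<close> is unimodular but not stable (\<open>stable_rank_not_1\<close>).

  For the global dimension: since all right ideals are projective, so are the submodules of free modules
  (\<open>free_submodule_section\<close>), hence every module has a projective resolution of length at most one. The module
  \<open>R/tR\<close> is not projective (\<open>ex_nonprojective_module\<close>).

  For the general linear rank: rows of length at least three are stable and can be completed by elementary operations.
  A unimodular pair \<open>(a, b)\<close> can be completed if its kernel is cyclic (\<open>completable_if_kernel_cyclic\<close>), that is, if the
  right ideal \<open>J\<close> of all \<open>r\<close> with \<open>a r \<in> b R\<close> is principal, and this holds if \<open>lead J\<close> is principal. The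
  quotient \<open>D / lead J\<close> is isomorphic to \<open>V 0 / V 1\<close>, where \<open>V k\<close> consists of the \<open>a s + b r\<close> with \<open>s\<close> of
  order at least \<open>k\<close>. Filtering it by order expresses \<open>lead J\<close> as a product of ideals \<open>N\<close>, one in each degree
  \<open>m\<close>, such that the ideals \<open>\<sigma>^m N\<close> are the quotients of consecutive graded pieces of \<open>V 0\<close>. These pieces lead from a
  principal ideal in low degrees to \<open>D\<close> in high degrees. So if \<open>\<sigma>\<close> does not change ideal classes, then \<open>lead J\<close> is
  principal (\<open>lead_J_principal\<close>).
\<close>


section \<open>Right ideals\<close>

text \<open>Frees the symbol \<open><+>\<close> for sums of ideals, where it would otherwise be ambiguous with sums of sets.\<close>

no_notation Sum_Type.Plus (infixr "<+>" 65)

context ring begin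

lemma right_idealI:
  assumes "I \<subseteq> carrier R" "\<zero> \<in> I"
    and "\<And>x y. x \<in> I \<Longrightarrow> y \<in> I \<Longrightarrow> x \<oplus> y \<in> I"
    and "\<And>x r. x \<in> I \<Longrightarrow> r \<in> carrier R \<Longrightarrow> x \<otimes> r \<in> I"
  shows "right_ideal I R"
proof -
  have "\<ominus> x \<in> I" if "x \<in> I" for x
    using assms(4)[OF that, of "\<ominus> \<one>"] assms(1) that by (auto simp: r_minus subset_iff)
  then have "additive_subgroup I R"
    using assms by (intro additive_subgroup.intro subgroup.intro) (auto simp: a_inv_def[symmetric])
  then show ?thesis using assms(4) by (auto simp: right_ideal_def)
qed

lemma
  assumes "right_ideal I R"
  shows right_ideal_subset: "I \<subseteq> carrier R"
    and right_ideal_carrier: "x \<in> I \<Longrightarrow> x \<in> carrier R"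
    and right_ideal_zero: "\<zero> \<in> I"
    and right_ideal_add: "x \<in> I \<Longrightarrow> y \<in> I \<Longrightarrow> x \<oplus> y \<in> I"
    and right_ideal_mult: "x \<in> I \<Longrightarrow> r \<in> carrier R \<Longrightarrow> x \<otimes> r \<in> I"
    and right_ideal_uminus: "x \<in> I \<Longrightarrow> \<ominus> x \<in> I"
    and right_ideal_minus: "x \<in> I \<Longrightarrow> y \<in> I \<Longrightarrow> x \<ominus> y \<in> I"
proof -
  have s: "additive_subgroup I R" and m: "\<And>a r. a \<in> I \<Longrightarrow> r \<in> carrier R \<Longrightarrow> a \<otimes> r \<in> I"
    using assms by (auto simp: right_ideal_def)
  interpret additive_subgroup I R by (rule s)
  show "I \<subseteq> carrier R" by (rule a_subset)
  show "x \<in> I \<Longrightarrow> x \<in> carrier R" by (rule a_Hcarr)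
  show "\<zero> \<in> I" by simp
  show "x \<in> I \<Longrightarrow> y \<in> I \<Longrightarrow> x \<oplus> y \<in> I" by simp
  show "x \<in> I \<Longrightarrow> r \<in> carrier R \<Longrightarrow> x \<otimes> r \<in> I" by (rule m)
  show "x \<in> I \<Longrightarrow> \<ominus> x \<in> I" using a_inv_closed abelian_group_axioms by blast
  then show "x \<in> I \<Longrightarrow> y \<in> I \<Longrightarrow> x \<ominus> y \<in> I"
    by (metis a_closed a_inv_closed abelian_group_axioms a_minus_def)
qed

lemma right_ideal_finsum:
  assumes "right_ideal I R" "\<And>i. i \<in> A \<Longrightarrow> f i \<in> I"
  shows "finsum R f A \<in> I"
  using assms(2)
proof (induction A rule: infinite_finite_induct)
  case (insert a A)
  then have "f \<in> A \<rightarrow> carrier R" "f a \<in> carrier R"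
    using right_ideal_carrier[OF assms(1)] by auto
  with insert show ?case by (simp add: right_ideal_add[OF assms(1)])
qed (use right_ideal_zero[OF assms(1)] in auto)

lemma right_ideal_Int:
  "right_ideal I R \<Longrightarrow> right_ideal J R \<Longrightarrow> right_ideal (I \<inter> J) R"
  by (rule right_idealI)
    (auto intro: right_ideal_carrier right_ideal_zero right_ideal_add right_ideal_mult)

lemma right_ideal_UNIV: "right_ideal (carrier R) R"
  by (rule right_idealI) auto

lemma right_ideal_eq_carrier: "right_ideal I R \<Longrightarrow> \<one> \<in> I \<Longrightarrow> I = carrier R"
  using right_ideal_mult[of I \<one>] right_ideal_subset[of I] by (metis l_one subsetI subset_antisym)

lemma set_add_iff: "x \<in> I <+> J \<longleftrightarrow> (\<exists>i\<in>I. \<exists>j\<in>J. x = i \<oplus> j)"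
  unfolding set_add_def' by blast

lemma right_ideal_set_add:
  assumes I: "right_ideal I R" and J: "right_ideal J R"
  shows "right_ideal (I <+> J) R"
proof (rule right_idealI)
  show "I <+> J \<subseteq> carrier R"
    by (auto simp: set_add_iff right_ideal_carrier[OF I] right_ideal_carrier[OF J])
  show "\<zero> \<in> I <+> J" using right_ideal_zero[OF I] right_ideal_zero[OF J] l_zero[OF zero_closed]
    unfolding set_add_iff by metis
next
  fix x y assume "x \<in> I <+> J" "y \<in> I <+> J"
  then obtain i j i' j' where *: "i \<in> I" "j \<in> J" "i' \<in> I" "j' \<in> J" "x = i \<oplus> j" "y = i' \<oplus> j'"
    by (auto simp: set_add_iff)
  then have "x \<oplus> y = (i \<oplus> i') \<oplus> (j \<oplus> j')"
    using right_ideal_carrier[OF I] right_ideal_carrier[OF J] by (simp add: a_ac)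
  then show "x \<oplus> y \<in> I <+> J"
    using * right_ideal_add[OF I] right_ideal_add[OF J] unfolding set_add_iff by metis
next
  fix x r assume "x \<in> I <+> J" and r: "r \<in> carrier R"
  then obtain i j where *: "i \<in> I" "j \<in> J" "x = i \<oplus> j" by (auto simp: set_add_iff)
  then have "x \<otimes> r = i \<otimes> r \<oplus> j \<otimes> r"
    using right_ideal_carrier[OF I] right_ideal_carrier[OF J] r by (simp add: l_distr)
  then show "x \<otimes> r \<in> I <+> J"
    using * r right_ideal_mult[OF I] right_ideal_mult[OF J] unfolding set_add_iff by metis
qed

lemma set_add_upper:
  assumes "right_ideal I R" "right_ideal J R"
  shows "I \<subseteq> I <+> J" "J \<subseteq> I <+> J"
proof -
  show "I \<subseteq> I <+> J"
    using right_ideal_zero[OF assms(2)] right_ideal_carrier[OF assms(1)]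
    unfolding set_add_iff subset_iff by (metis r_zero)
  show "J \<subseteq> I <+> J"
    using right_ideal_zero[OF assms(1)] right_ideal_carrier[OF assms(2)]
    unfolding set_add_iff subset_iff by (metis l_zero)
qed

lemma set_add_least: "right_ideal K R \<Longrightarrow> I \<subseteq> K \<Longrightarrow> J \<subseteq> K \<Longrightarrow> I <+> J \<subseteq> K"
  unfolding subset_iff set_add_iff using right_ideal_add by metis

definition principal_right :: "'a \<Rightarrow> 'a set" where
  "principal_right a = (\<lambda>r. a \<otimes> r) ` carrier R"

lemma principal_right_iff: "x \<in> principal_right a \<longleftrightarrow> (\<exists>r\<in>carrier R. x = a \<otimes> r)"
  by (auto simp: principal_right_def)

lemma right_ideal_multiples:
  assumes a: "a \<in> carrier R" shows "right_ideal (principal_right a) R"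
proof (rule right_idealI)
  show "principal_right a \<subseteq> carrier R" using a by (auto simp: principal_right_iff)
  show "\<zero> \<in> principal_right a" using a unfolding principal_right_iff by (metis r_null zero_closed)
  show "x \<oplus> y \<in> principal_right a" if "x \<in> principal_right a" "y \<in> principal_right a" for x y
    using that a by (auto simp: principal_right_iff r_distr[symmetric])
  show "x \<otimes> r \<in> principal_right a" if "x \<in> principal_right a" "r \<in> carrier R" for x r
    using that a by (auto simp: principal_right_iff m_assoc)
qed

lemma generator_in_multiples: "a \<in> carrier R \<Longrightarrow> a \<in> principal_right a"
  unfolding principal_right_iff by (metis one_closed r_one)

lemma multiples_least: "right_ideal I R \<Longrightarrow> a \<in> I \<Longrightarrow> principal_right a \<subseteq> I"
  by (auto simp: principal_right_iff right_ideal_mult)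

lemma set_add_principal:
  assumes "right_ideal J R" "a \<in> carrier R"
  shows "right_ideal (J <+> principal_right a) R" "J \<subseteq> J <+> principal_right a"
    "a \<in> J <+> principal_right a"
proof -
  note P = right_ideal_multiples[OF assms(2)]
  show "right_ideal (J <+> principal_right a) R" by (rule right_ideal_set_add[OF assms(1) P])
  show "J \<subseteq> J <+> principal_right a" by (rule set_add_upper(1)[OF assms(1) P])
  show "a \<in> J <+> principal_right a"
    by (rule subsetD[OF set_add_upper(2)[OF assms(1) P] generator_in_multiples[OF assms(2)]])
qed

end

section \<open>Domains with chain conditions modulo nonzero right ideals\<close>

text \<open>Rings in which \<open>R\<close> is a noetherian right module and every \<open>R/zR\<close> with \<open>z \<noteq> 0\<close> is artinian.
The chain conditions are stated through maximal and minimal members of families of right ideals, which is the form in which every argument below uses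
them, and in which they transfer easily from a Dedekind domain to its Laurent series ring.\<close>

locale right_one_dimensional = ring R for R (structure) +
  assumes no_zero_divisors: "\<lbrakk>a \<in> carrier R; b \<in> carrier R; a \<otimes> b = \<zero>\<rbrakk> \<Longrightarrow> a = \<zero> \<or> b = \<zero>"
    and ex_maximal: "\<lbrakk>\<A> \<noteq> {}; \<And>I. I \<in> \<A> \<Longrightarrow> right_ideal I R\<rbrakk> \<Longrightarrow>
          \<exists>M\<in>\<A>. \<forall>I\<in>\<A>. M \<subseteq> I \<longrightarrow> I = M"
    and ex_minimal: "\<lbrakk>\<A> \<noteq> {}; \<And>I. I \<in> \<A> \<Longrightarrow> right_ideal I R; \<And>I. I \<in> \<A> \<Longrightarrow> z \<in> I; z \<noteq> \<zero>\<rbrakk> \<Longrightarrow>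
          \<exists>M\<in>\<A>. \<forall>I\<in>\<A>. I \<subseteq> M \<longrightarrow> I = M"
begin

definition maximal_right :: "'a set \<Rightarrow> bool" where
  "maximal_right X \<longleftrightarrow> right_ideal X R \<and> \<one> \<notin> X \<and>
     (\<forall>Y. right_ideal Y R \<and> X \<subseteq> Y \<and> \<one> \<notin> Y \<longrightarrow> Y = X)"

text \<open>The preimage in \<open>R\<close> of the radical of the module \<open>R/J\<close>, that is, of the intersection of its maximal
submodules.\<close>

definition radical_over :: "'a set \<Rightarrow> 'a set" where
  "radical_over J = {r \<in> carrier R. \<forall>X. maximal_right X \<and> J \<subseteq> X \<longrightarrow> r \<in> X}"

lemma ex_maximal_right:
  assumes "right_ideal I R" "\<one> \<notin> I"
  obtains X where "maximal_right X" "I \<subseteq> X"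
proof -
  let ?A = "{Y. right_ideal Y R \<and> I \<subseteq> Y \<and> \<one> \<notin> Y}"
  have "\<exists>M\<in>?A. \<forall>Z\<in>?A. M \<subseteq> Z \<longrightarrow> Z = M"
    by (rule ex_maximal) (use assms in auto)
  then obtain M where M: "M \<in> ?A" "\<forall>Z\<in>?A. M \<subseteq> Z \<longrightarrow> Z = M" by blast
  have "maximal_right M"
    unfolding maximal_right_def
  proof (intro conjI allI impI)
    fix Y assume "right_ideal Y R \<and> M \<subseteq> Y \<and> \<one> \<notin> Y"
    then have "Y \<in> ?A" "M \<subseteq> Y" using M(1) by auto
    then show "Y = M" using M(2) by blast
  qed (use M(1) in auto)
  then show thesis using M(1) that by blast
qed

lemma right_ideal_radical_over:
  assumes "right_ideal J R" shows "right_ideal (radical_over J) R"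
  by (rule right_idealI)
    (auto simp: radical_over_def maximal_right_def right_ideal_zero right_ideal_add right_ideal_mult)

lemma subset_radical_over: "right_ideal J R \<Longrightarrow> J \<subseteq> radical_over J"
  by (auto simp: radical_over_def right_ideal_carrier)

text \<open>Modulo its radical, the artinian module \<open>R/J\<close> is semisimple, so submodules have complements. The complement is a right ideal
\<open>W'\<close> that is minimal with \<open>W + W' = R\<close>: an element of \<open>W \<inter> W'\<close> outside the radical misses some maximal
\<open>X\<close>, and then \<open>W' \<inter> X\<close> would be smaller.\<close>

lemma complement_over_radical:
  assumes J: "right_ideal J R" "J \<noteq> {\<zero>}"
    and W: "right_ideal W R" "radical_over J \<subseteq> W"
  obtains W' where "right_ideal W' R" "radical_over J \<subseteq> W'" "\<one> \<in> W <+> W'" "W \<inter> W' = radical_over J"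
proof -
  let ?J' = "radical_over J"
  obtain z where z: "z \<in> J" "z \<noteq> \<zero>" using J right_ideal_zero[OF J(1)] by auto
  let ?A = "{W'. right_ideal W' R \<and> ?J' \<subseteq> W' \<and> \<one> \<in> W <+> W'}"
  have "carrier R \<in> ?A"
    using right_ideal_UNIV right_ideal_subset[OF right_ideal_radical_over[OF J(1)]] 
      set_add_upper(2)[OF W(1) right_ideal_UNIV] by auto
  then have "\<exists>M\<in>?A. \<forall>I\<in>?A. I \<subseteq> M \<longrightarrow> I = M"
    using z subset_radical_over[OF J(1)] by (intro ex_minimal[of _ z]) auto
  then obtain W' where W': "right_ideal W' R" "?J' \<subseteq> W'" "\<one> \<in> W <+> W'"
    and min: "\<And>I. \<lbrakk>right_ideal I R; ?J' \<subseteq> I; \<one> \<in> W <+> I; I \<subseteq> W'\<rbrakk> \<Longrightarrow> I = W'" by auto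
  have "w \<in> ?J'" if w: "w \<in> W" "w \<in> W'" for w
  proof (rule ccontr)
    assume "w \<notin> ?J'"
    then obtain X where X: "maximal_right X" "J \<subseteq> X" "w \<notin> X"
      using w right_ideal_carrier[OF W(1)] by (auto simp: radical_over_def)
    then have RX: "right_ideal X R" by (simp add: maximal_right_def)
    have RI: "right_ideal (W \<inter> W') R" using W W' right_ideal_Int by blast
    have J'X: "?J' \<subseteq> X" using X by (auto simp: radical_over_def)
    have "\<one> \<in> X <+> (W \<inter> W')"
    proof (rule ccontr)
      assume "\<one> \<notin> X <+> (W \<inter> W')"
      moreover have "right_ideal (X <+> (W \<inter> W')) R" "X \<subseteq> X <+> (W \<inter> W')"
        using RX RI right_ideal_set_add set_add_upper by auto
      ultimately have "X <+> (W \<inter> W') = X" using X(1) by (simp add: maximal_right_def)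
      then show False using set_add_upper(2)[OF RX RI] w X(3) by auto
    qed
    then obtain p q where pq: "p \<in> X" "q \<in> W" "q \<in> W'" "\<one> = p \<oplus> q" by (auto simp: set_add_iff)
    obtain u v where uv: "u \<in> W" "v \<in> W'" "\<one> = u \<oplus> v" using W' by (auto simp: set_add_iff)
    have c: "p \<in> carrier R" "q \<in> carrier R" "u \<in> carrier R" "v \<in> carrier R"
      using pq uv RX W W' by (auto intro: right_ideal_carrier)
    \<comment> \<open>modular law: the part of \<open>v\<close> outside \<open>X\<close> can be moved into \<open>W\<close>\<close>
    have v: "v = p \<otimes> v \<oplus> q \<otimes> v" using c pq(4) by (metis l_distr l_one)
    have qv: "q \<otimes> v \<in> W" "q \<otimes> v \<in> W'" "p \<otimes> v \<in> X" 
      using pq c W W' RX by (auto intro: right_ideal_mult)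
    have "p \<otimes> v = v \<ominus> q \<otimes> v" using v c by (metis add.inv_solve_right m_closed a_minus_def)
    then have "p \<otimes> v \<in> W'" using uv(2) qv W' right_ideal_minus by metis
    moreover have "\<one> = (u \<oplus> q \<otimes> v) \<oplus> p \<otimes> v"
      using uv(3) v c by (metis a_assoc a_comm m_closed)
    ultimately have "\<one> \<in> W <+> (W' \<inter> X)"
      unfolding set_add_iff using uv qv W right_ideal_add by blast
    then have "W' \<inter> X = W'"
      using W' RX J'X by (intro min) (auto intro: right_ideal_Int)
    then show False using w X(3) by auto
  qed
  then show thesis using that W' W by blast
qed

text \<open>The descending chain \<open>J + a^n R\<close> becomes constant. Its equality of two consecutive members is used below in place of
Fitting's lemma, to turn an injective multiplication by \<open>a\<close> into a surjective one.\<close>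

lemma power_chain_stabilizes:
  assumes J: "right_ideal J R" "J \<noteq> {\<zero>}" and a: "a \<in> carrier R"
  obtains n :: nat and u where "u \<in> carrier R" "a [^] n \<otimes> (\<one> \<ominus> a \<otimes> u) \<in> J"
proof -
  obtain z where z: "z \<in> J" "z \<noteq> \<zero>" using J right_ideal_zero[OF J(1)] by auto
  have an: "a [^] n \<in> carrier R" for n :: nat using a by simp
  let ?c = "\<lambda>n::nat. J <+> principal_right (a [^] n)"
  have RI: "right_ideal (?c n) R" for n
    using J right_ideal_set_add right_ideal_multiples an by blast
  have "\<exists>M\<in>range ?c. \<forall>I\<in>range ?c. I \<subseteq> M \<longrightarrow> I = M"
    by (rule ex_minimal[of _ z])
      (use RI z set_add_upper(1)[OF J(1) right_ideal_multiples[OF an]] in auto)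
  then obtain n where n: "\<And>m. ?c m \<subseteq> ?c n \<Longrightarrow> ?c m = ?c n" by auto
  have "a [^] Suc n \<in> principal_right (a [^] n)"
    using a by (auto simp: nat_pow_Suc principal_right_iff)
  then have "?c (Suc n) \<subseteq> ?c n"
    using set_add_upper[OF J(1) right_ideal_multiples[OF an[of n]]]
      multiples_least[OF right_ideal_multiples[OF an]]
    by (intro set_add_least RI; meson subset_trans)
  then have "?c (Suc n) = ?c n" by (rule n)
  then have "a [^] n \<in> ?c (Suc n)"
    using set_add_upper(2)[OF J(1) right_ideal_multiples[OF an]] generator_in_multiples[OF an] by blast
  then obtain j u where ju: "j \<in> J" "u \<in> carrier R" "a [^] n = j \<oplus> a [^] Suc n \<otimes> u"
    by (auto simp: set_add_iff principal_right_def)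
  have jc: "j \<in> carrier R" using ju J right_ideal_carrier by blast
  have "j = a [^] n \<ominus> a [^] Suc n \<otimes> u"
    using ju an jc by (metis add.inv_solve_right m_closed a_minus_def)
  then have j: "j = a [^] n \<otimes> (\<one> \<ominus> a \<otimes> u)"
  proof -
    have "p \<ominus> p \<otimes> a \<otimes> u = p \<otimes> (\<one> \<ominus> a \<otimes> u)" if "p \<in> carrier R" for p
      using that a ju(2) by (simp add: r_distr a_minus_def r_minus m_assoc)
    then show ?thesis using \<open>j = _\<close> an by simp
  qed
  show thesis by (rule that[OF ju(2) ju(1)[unfolded j]])
qed

text \<open>The right Ore condition. If \<open>a^n (1 - a u) \<in> J\<close>, then moving factors \<open>a\<close> from left to right exhibits
\<open>s\<close>: with \<open>k\<close> least such that \<open>a^k (1 - a u) \<in> J\<close>, take \<open>s = a^(k-1) (1 - a u)\<close> if \<open>k >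
0\<close>, and use \<open>(1 - a u) a = a (1 - u a)\<close> if \<open>k = 0\<close>. The cases \<open>a = 0\<close> and \<open>a u = 1\<close> are
treated apart.\<close>

lemma ex_common_multiple:
  assumes J: "right_ideal J R" "J \<noteq> {\<zero>}" and a: "a \<in> carrier R"
  obtains s where "s \<in> carrier R" "s \<noteq> \<zero>" "a \<otimes> s \<in> J"
proof (cases "a = \<zero>")
  case True
  obtain z where "z \<in> J" "z \<noteq> \<zero>" using J right_ideal_zero[OF J(1)] by auto
  then show thesis using that[of z] True J right_ideal_zero right_ideal_carrier by auto
next
  case False
  obtain z where z: "z \<in> J" "z \<noteq> \<zero>" using J right_ideal_zero[OF J(1)] by auto
  have an: "a [^] n \<in> carrier R" for n :: nat using a by simp
  have a0: "a [^] n \<noteq> \<zero>" for n :: nat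
  proof (induction n)
    case 0
    have "\<one> \<noteq> \<zero>" using one_zeroD a False by blast
    then show ?case by simp
  next
    case (Suc n) then show ?case using no_zero_divisors[OF an a] False by (auto simp: nat_pow_Suc)
  qed
  obtain n :: nat and u where ju: "u \<in> carrier R" "a [^] n \<otimes> (\<one> \<ominus> a \<otimes> u) \<in> J"
    using power_chain_stabilizes[OF J a] .
  show thesis
  proof (cases "\<one> \<ominus> a \<otimes> u = \<zero>")
    case True
    then have "a \<otimes> u = \<one>" using a ju by (metis m_closed one_closed r_right_minus_eq)
    then have "a \<otimes> (u \<otimes> z) = z" using a ju z J right_ideal_carrier by (metis l_one m_assoc)
    moreover have "u \<otimes> z \<noteq> \<zero>" using calculation z a by auto
    ultimately show thesis using that[of "u \<otimes> z"] z ju J right_ideal_carrier by auto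
  next
    case False
    let ?v = "\<one> \<ominus> a \<otimes> u"
    have v: "?v \<in> carrier R" using a ju by simp
    define k where "k = (LEAST k::nat. a [^] k \<otimes> ?v \<in> J)"
    have k: "a [^] k \<otimes> ?v \<in> J" unfolding k_def using ju(2) by (rule LeastI[where P = "\<lambda>k::nat. a [^] k \<otimes> (\<one> \<ominus> a \<otimes> u) \<in> J"])
    show thesis
    proof (cases k)
      case 0
      then have "?v \<in> J" using k v by simp
      have "?v \<otimes> a \<in> J" using \<open>?v \<in> J\<close> a J right_ideal_mult by blast
      have "a \<otimes> (\<one> \<ominus> u \<otimes> a) = ?v \<otimes> a"
        using a ju(1) by (simp add: r_distr l_distr a_minus_def l_minus r_minus m_assoc)
      moreover have "?v \<otimes> a \<noteq> \<zero>" using no_zero_divisors[OF v a] False \<open>a \<noteq> \<zero>\<close> by auto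
      ultimately have "a \<otimes> (\<one> \<ominus> u \<otimes> a) \<noteq> \<zero>" "a \<otimes> (\<one> \<ominus> u \<otimes> a) \<in> J"
        using \<open>?v \<otimes> a \<in> J\<close> by simp_all
      then show thesis
        using that[of "\<one> \<ominus> u \<otimes> a"] a ju(1) by (metis m_closed minus_closed one_closed r_null)
    next
      case (Suc i)
      have "a [^] i \<otimes> ?v \<noteq> \<zero>" using no_zero_divisors[OF an v] a0 False by auto
      moreover have "a \<otimes> (a [^] i \<otimes> ?v) \<in> J"
        using k[unfolded Suc nat_pow_Suc2[OF a]] a v an[of i] by (simp add: m_assoc)
      ultimately show thesis using that[of "a [^] i \<otimes> ?v"] an v by auto
    qed
  qed
qed


end

section \<open>A stable range condition for pairs\<close>

context right_one_dimensional begin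

text \<open>Modulo a nonzero right ideal a unimodular pair \<open>(a, b)\<close> can be shortened. If \<open>R/J\<close> were a semisimple ring this
would be the classical fact that such rings have stable rank one. Here \<open>J\<close> is only a right ideal and \<open>R/J\<close> only a module, so
left multiplication by \<open>a + b r\<close> does not act on it. The proof chooses \<open>r\<close> such that \<open>K = (a + b r) R + rad J\<close>
is maximal. If \<open>K \<noteq> R\<close>, a simple submodule \<open>T\<close> of \<open>(b R + rad J) / rad J\<close> outside \<open>K\<close> is
considered. Maximality of \<open>K\<close> forces every \<open>s\<close> with \<open>(a + b r) s \<in> rad J\<close> to annihilate \<open>T\<close>.
The annihilator \<open>P\<close> of \<open>T\<close> is two-sided, so multiplication by \<open>a + b r\<close> does act on \<open>R/P\<close>. It is
injective there, hence surjective by the descending chain condition, and this puts \<open>T\<close> inside \<open>K\<close>.\<close>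

lemma stable_pair:
  assumes J: "right_ideal J R" "J \<noteq> {\<zero>}" and a: "a \<in> carrier R" and b: "b \<in> carrier R"
    and uni: "\<one> \<in> (J <+> principal_right a) <+> principal_right b"
  obtains r where "r \<in> carrier R" "\<one> \<in> J <+> principal_right (a \<oplus> b \<otimes> r)"
proof -
  obtain z where z: "z \<in> J" "z \<noteq> \<zero>" using J right_ideal_zero[OF J(1)] by auto
  define J' where "J' = radical_over J"
  have RJ': "right_ideal J' R" and JJ': "J \<subseteq> J'"
    using right_ideal_radical_over subset_radical_over J by (auto simp: J'_def)
  have J'0: "J' \<noteq> {\<zero>}" "z \<in> J'" using z JJ' by auto
  define Kf where "Kf r = J' <+> principal_right (a \<oplus> b \<otimes> r)" for r
  have RKf: "right_ideal (Kf r) R" "J' \<subseteq> Kf r" "a \<oplus> b \<otimes> r \<in> Kf r" if "r \<in> carrier R" for r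
    using that a b set_add_principal[OF RJ', of "a \<oplus> b \<otimes> r"] by (simp_all add: Kf_def)
  have "\<exists>M\<in>Kf ` carrier R. \<forall>I\<in>Kf ` carrier R. M \<subseteq> I \<longrightarrow> I = M"
    using RKf by (intro ex_maximal) auto
  then obtain r where r: "r \<in> carrier R"
    and maxr: "\<And>r'. r' \<in> carrier R \<Longrightarrow> Kf r \<subseteq> Kf r' \<Longrightarrow> Kf r' = Kf r" by auto
  define a' where "a' = a \<oplus> b \<otimes> r"
  define K where "K = Kf r"
  have a': "a' \<in> carrier R" using a b r by (simp add: a'_def)
  have RK: "right_ideal K R" "J' \<subseteq> K" "a' \<in> K" using RKf[OF r] by (auto simp: K_def a'_def)
  have Kiff: "x \<in> K \<longleftrightarrow> (\<exists>j\<in>J'. \<exists>u\<in>carrier R. x = j \<oplus> a' \<otimes> u)" for x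
    unfolding K_def Kf_def a'_def set_add_iff principal_right_def by blast
  have "\<one> \<in> K"
  proof (rule ccontr)
    assume nK: "\<one> \<notin> K"
    define V where "V = J' <+> principal_right b"
    have RV: "right_ideal V R" "J' \<subseteq> V" "b \<in> V"
      using set_add_principal[OF RJ' b] by (simp_all add: V_def)
    have "b \<notin> K"
    proof
      assume bK: "b \<in> K"
      have "a = a' \<oplus> b \<otimes> (\<ominus> r)" using a b r by (simp add: a'_def a_assoc r_minus r_neg)
      then have "a \<in> K" using bK RK r right_ideal_add right_ideal_mult by (metis a_inv_closed)
      have "(J <+> principal_right a) <+> principal_right b \<subseteq> K"
        using RK JJ' multiples_least[OF RK(1) \<open>a \<in> K\<close>] multiples_least[OF RK(1) bK] 
        by (intro set_add_least) auto
      then show False using uni nK by blast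
    qed
    \<comment> \<open>A right ideal minimal with this property is a simple module over \<open>J'\<close>.\<close>
    let ?T = "{T. right_ideal T R \<and> J' \<subseteq> T \<and> T \<subseteq> V \<and> \<not> T \<subseteq> K}"
    have "V \<in> ?T" using RV \<open>b \<notin> K\<close> by auto
    then have "\<exists>M\<in>?T. \<forall>I\<in>?T. I \<subseteq> M \<longrightarrow> I = M"
      using J'0 z(2) by (intro ex_minimal[of _ z]) blast+
    then obtain T where T: "right_ideal T R" "J' \<subseteq> T" "T \<subseteq> V" "\<not> T \<subseteq> K"
      and minT: "\<And>I. \<lbrakk>right_ideal I R; J' \<subseteq> I; I \<subseteq> T; I \<noteq> T\<rbrakk> \<Longrightarrow> I \<subseteq> K" 
      by (smt (verit) mem_Collect_eq subset_trans)
    \<comment> \<open>Otherwise a complement of \<open>T \<inter> K\<close> over \<open>J'\<close> would contain \<open>T\<close>, by minimality of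
      \<open>T\<close>.\<close>
    have TK: "T \<inter> K = J'"
    proof -
      have RTK: "right_ideal (T \<inter> K) R" "J' \<subseteq> T \<inter> K" using T RK right_ideal_Int by auto
      obtain W' where W': "right_ideal W' R" "J' \<subseteq> W'" "\<one> \<in> (T \<inter> K) <+> W'" "(T \<inter> K) \<inter> W' = J'"
        using complement_over_radical[OF J RTK(1)] RTK(2) unfolding J'_def by metis
      then obtain p q where pq: "p \<in> T" "p \<in> K" "q \<in> W'" "\<one> = p \<oplus> q" by (auto simp: set_add_iff)
      have "T \<inter> W' = T"
      proof (rule ccontr)
        assume "T \<inter> W' \<noteq> T"
        then have TW: "T \<inter> W' \<subseteq> K" using T W' by (intro minT) (auto intro: right_ideal_Int)
        have "t \<in> K" if t: "t \<in> T" for t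
        proof -
          have c: "p \<in> carrier R" "q \<in> carrier R" "t \<in> carrier R"
            using pq t T W' by (auto intro: right_ideal_carrier)
          have e: "t = p \<otimes> t \<oplus> q \<otimes> t" using c pq(4) by (metis l_distr l_one)
          then have "q \<otimes> t = t \<ominus> p \<otimes> t" using c by (metis a_comm a_minus_def add.inv_solve_right m_closed)
          moreover have "p \<otimes> t \<in> T" "p \<otimes> t \<in> K" using pq c T RK right_ideal_mult by auto
          ultimately have "q \<otimes> t \<in> T" using t T(1) right_ideal_minus by simp
          moreover have "q \<otimes> t \<in> W'" using pq c W' right_ideal_mult by auto
          ultimately show ?thesis using e TW \<open>p \<otimes> t \<in> K\<close> RK right_ideal_add by (metis IntI subsetD)
        qed
        then show False using T by auto
      qed
      then show ?thesis using W' by auto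
    qed
    have simp: "W = J'" if "right_ideal W R" "J' \<subseteq> W" "W \<subseteq> T" "W \<noteq> T" for W
      using minT[OF that] that TK by auto
    obtain t0 where t0: "t0 \<in> T" "t0 \<notin> K" using T by auto
    then have "t0 \<in> V" using T(3) by blast
    then obtain j r1 where jr: "j \<in> J'" "r1 \<in> carrier R" "t0 = j \<oplus> b \<otimes> r1"
      by (auto simp: V_def set_add_iff principal_right_def)
    define t where "t = b \<otimes> r1"
    have tc: "t \<in> carrier R" using b jr by (simp add: t_def)
    have jc: "j \<in> carrier R" using jr RJ' right_ideal_carrier by blast
    have "t = t0 \<ominus> j" using jr jc tc by (simp add: t_def a_minus_def a_comm[of j] a_assoc r_neg)
    then have tT: "t \<in> T" using t0 jr T right_ideal_minus by auto
    have tK: "t \<notin> K" using t0 jr RK right_ideal_add unfolding t_def by auto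
    \<comment> \<open>Replacing \<open>r\<close> by \<open>r + r1 \<rho>\<close> replaces \<open>a'\<close> by \<open>a' + t \<rho>\<close>. If
      \<open>t \<rho> s\<close> were not in \<open>J'\<close>, the new right ideal would contain all of \<open>T\<close>, hence \<open>a'\<close>, and
      would be larger than \<open>K\<close>.\<close>
    have ann: "t \<otimes> \<rho> \<otimes> s \<in> J'" if \<rho>: "\<rho> \<in> carrier R" and s: "s \<in> carrier R" "a' \<otimes> s \<in> J'" for \<rho> s
    proof (rule ccontr)
      assume n: "t \<otimes> \<rho> \<otimes> s \<notin> J'"
      define r' where "r' = r \<oplus> r1 \<otimes> \<rho>"
      have r': "r' \<in> carrier R" using r jr \<rho> by (simp add: r'_def)
      have e: "a \<oplus> b \<otimes> r' = a' \<oplus> t \<otimes> \<rho>"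
        using a b r jr \<rho> by (simp add: r'_def a'_def t_def r_distr a_assoc m_assoc)
      note R1 = RKf[OF r', unfolded e]
      have "t \<otimes> \<rho> \<otimes> s = (a' \<oplus> t \<otimes> \<rho>) \<otimes> s \<ominus> a' \<otimes> s"
        using a' tc \<rho> s by (simp add: l_distr a_minus_def a_comm[of "a' \<otimes> s"] a_assoc r_neg)
      then have "t \<otimes> \<rho> \<otimes> s \<in> Kf r'"
        using R1 s right_ideal_mult right_ideal_minus by auto
      moreover have t\<rho>: "t \<otimes> \<rho> \<in> T" "t \<otimes> \<rho> \<otimes> s \<in> T" using tT \<rho> s T right_ideal_mult by auto
      ultimately have "Kf r' \<inter> T = T"
        using simp[of "Kf r' \<inter> T"] n R1 T right_ideal_Int by blast
      then have TK1: "T \<subseteq> Kf r'" by auto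
      have "a' = (a' \<oplus> t \<otimes> \<rho>) \<ominus> t \<otimes> \<rho>"
        using a' tc \<rho> by (simp add: a_minus_def a_assoc r_neg)
      then have "a' \<in> Kf r'" using R1 TK1 t\<rho> right_ideal_minus by (metis subsetD)
      then have "K \<subseteq> Kf r'"
        using R1 multiples_least[OF R1(1)] unfolding K_def Kf_def[of r] a'_def by (intro set_add_least) auto
      then have "Kf r' = K" using maxr[OF r'] by (simp add: K_def)
      then show False using TK1 T by auto
    qed
    \<comment> \<open>The annihilator of the simple module \<open>T/J'\<close>, a two-sided ideal.\<close>
    define P where "P = {p \<in> carrier R. \<forall>\<rho>\<in>carrier R. t \<otimes> \<rho> \<otimes> p \<in> J'}"
    have RP: "right_ideal P R"
    proof (rule right_idealI)
      show "P \<subseteq> carrier R" by (auto simp: P_def)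
      show "\<zero> \<in> P" using tc right_ideal_zero[OF RJ'] by (auto simp: P_def)
      show "x \<oplus> y \<in> P" if "x \<in> P" "y \<in> P" for x y
        using that tc right_ideal_add[OF RJ'] by (auto simp: P_def r_distr)
      show "x \<otimes> s \<in> P" if "x \<in> P" "s \<in> carrier R" for x s
        using that tc right_ideal_mult[OF RJ'] by (auto simp: P_def m_assoc[symmetric])
    qed
    have Pc: "p \<in> carrier R" if "p \<in> P" for p using that by (simp add: P_def)
    have Pl: "u \<otimes> p \<in> P" if "u \<in> carrier R" "p \<in> P" for u p
    proof -
      have "t \<otimes> \<rho> \<otimes> (u \<otimes> p) = t \<otimes> (\<rho> \<otimes> u) \<otimes> p" if "\<rho> \<in> carrier R" for \<rho>
        using that \<open>u \<in> _\<close> tc Pc[OF \<open>p \<in> P\<close>] by (simp add: m_assoc)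
      then show ?thesis using that by (simp add: P_def)
    qed
    have AP: "s \<in> P" if "s \<in> carrier R" "a' \<otimes> s \<in> J'" for s
      using that ann by (auto simp: P_def)
    have TP: "\<tau> \<otimes> p \<in> J'" if \<tau>: "\<tau> \<in> T" and p: "p \<in> P" for \<tau> p
    proof -
      let ?W = "J' <+> principal_right t"
      have W: "right_ideal ?W R" "J' \<subseteq> ?W" "?W \<subseteq> T" "t \<in> ?W"
        using set_add_principal[OF RJ' tc] set_add_least[OF T(1,2) multiples_least[OF T(1) tT]] by auto
      moreover have "t \<notin> J'" using tK RK by auto
      ultimately have "?W = T" using simp[of ?W] by blast
      then obtain i \<rho> where i: "i \<in> J'" "\<rho> \<in> carrier R" "\<tau> = i \<oplus> t \<otimes> \<rho>"
        using \<tau> by (auto simp: set_add_iff principal_right_def)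
      have "\<tau> \<otimes> p = i \<otimes> p \<oplus> t \<otimes> \<rho> \<otimes> p"
        using i tc Pc[OF p] right_ideal_carrier[OF RJ' i(1)] by (simp add: l_distr)
      then show ?thesis
        using i p Pc[OF p] right_ideal_mult[OF RJ'] right_ideal_add[OF RJ'] by (auto simp: P_def)
    qed
    \<comment> \<open>The decomposition \<open>R/J' = K/J' \<oplus> T/J' \<oplus> Y/J'\<close>, with \<open>1 = k + \<tau> + y\<close>.\<close>
    have RKT: "right_ideal (K <+> T) R" "J' \<subseteq> K <+> T"
      using RK T right_ideal_set_add set_add_upper[OF RK(1) T(1)] by auto
    obtain Y where Y: "right_ideal Y R" "J' \<subseteq> Y" "\<one> \<in> (K <+> T) <+> Y" "(K <+> T) \<inter> Y = J'"
      using complement_over_radical[OF J RKT(1)] RKT(2) unfolding J'_def by metis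
    then obtain k \<tau> y where kty: "k \<in> K" "\<tau> \<in> T" "y \<in> Y" "\<one> = k \<oplus> \<tau> \<oplus> y"
      by (auto simp: set_add_iff)
    have ktc: "k \<in> carrier R" "\<tau> \<in> carrier R" "y \<in> carrier R"
      using kty RK T Y by (auto intro: right_ideal_carrier)
    have ind: "x \<in> J'" "w \<in> J'" if "x \<in> K" "w \<in> T" "v \<in> Y" "x \<oplus> w \<oplus> v \<in> J'" for x w v
    proof -
      have c: "x \<in> carrier R" "w \<in> carrier R" "v \<in> carrier R"
        using that RK T Y by (auto intro: right_ideal_carrier)
      have xw: "x \<oplus> w \<in> K <+> T" using that by (auto simp: set_add_iff)
      have "v = (x \<oplus> w \<oplus> v) \<ominus> (x \<oplus> w)"
        using c by (simp add: a_minus_def a_comm[of "x \<oplus> w"] a_assoc[of v] r_neg)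
      then have "v \<in> K <+> T" using that xw RKT right_ideal_minus by (metis subsetD)
      then have vJ: "v \<in> J'" using that Y by auto
      have "x \<oplus> w = (x \<oplus> w \<oplus> v) \<ominus> v" using c by (simp add: a_minus_def a_assoc r_neg)
      then have xwJ: "x \<oplus> w \<in> J'" using that vJ RJ' right_ideal_minus by metis
      have "w = (x \<oplus> w) \<ominus> x" using c by (simp add: a_minus_def a_comm[of x] a_assoc r_neg)
      then have "w \<in> K" using xwJ that RK right_ideal_minus by (metis subsetD)
      then show wJ: "w \<in> J'" using that TK by auto
      have "x = (x \<oplus> w) \<ominus> w" using c by (simp add: a_minus_def a_assoc r_neg)
      then show "x \<in> J'" using xwJ wJ RJ' right_ideal_minus by metis
    qed
    have dec: "k \<otimes> p \<in> K" "\<tau> \<otimes> p \<in> J'" "y \<otimes> p \<in> Y" "p = k \<otimes> p \<oplus> \<tau> \<otimes> p \<oplus> y \<otimes> p" if "p \<in> P" for p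
    proof -
      show "k \<otimes> p \<in> K" "\<tau> \<otimes> p \<in> J'" "y \<otimes> p \<in> Y"
        using that kty RK Y Pc TP by (auto intro: right_ideal_mult)
      have "p = (k \<oplus> \<tau> \<oplus> y) \<otimes> p" by (metis kty(4) Pc[OF that] l_one)
      then show "p = k \<otimes> p \<oplus> \<tau> \<otimes> p \<oplus> y \<otimes> p" using ktc Pc[OF that] by (simp add: l_distr)
    qed
    \<comment> \<open>Multiplication by \<open>a'\<close> is injective on \<open>R/P\<close>: for \<open>p = a' s\<close> in \<open>P\<close> the
      component \<open>\<tau> p\<close> vanishes modulo \<open>J'\<close>, so \<open>p\<close> and \<open>k p\<close> agree modulo \<open>J'\<close>,
      and \<open>k\<close> is a multiple of \<open>a'\<close> modulo \<open>J'\<close>.\<close>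
    have inj: "s \<in> P" if s: "s \<in> carrier R" "a' \<otimes> s \<in> P" for s
    proof -
      define p where "p = a' \<otimes> s"
      have p: "p \<in> P" "p \<in> carrier R" "p \<in> K" using s Pc RK right_ideal_mult by (auto simp: p_def)
      note d = dec[OF p(1)]
      have c: "k \<otimes> p \<in> carrier R" "\<tau> \<otimes> p \<in> carrier R" "y \<otimes> p \<in> carrier R" using ktc p by auto
      have "(p \<ominus> k \<otimes> p) \<oplus> \<ominus> (\<tau> \<otimes> p) \<oplus> \<ominus> (y \<otimes> p) = p \<ominus> (k \<otimes> p \<oplus> \<tau> \<otimes> p \<oplus> y \<otimes> p)"
        using c p by (simp add: a_minus_def minus_add a_ac)
      also have "\<dots> = \<zero>" using d(4) p by (metis r_right_minus_eq)
      finally have "p \<ominus> k \<otimes> p \<in> J'"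
        using ind(1)[of "p \<ominus> k \<otimes> p" "\<ominus> (\<tau> \<otimes> p)" "\<ominus> (y \<otimes> p)"] d p RK T Y RJ'
          right_ideal_minus right_ideal_uminus right_ideal_zero by (metis subsetD)
      moreover obtain i u where iu: "i \<in> J'" "u \<in> carrier R" "k = i \<oplus> a' \<otimes> u"
        using kty Kiff by auto
      have ic: "i \<in> carrier R" using iu RJ' right_ideal_carrier by blast
      have "a' \<otimes> (s \<ominus> u \<otimes> p) = (p \<ominus> k \<otimes> p) \<oplus> i \<otimes> p"
        using a' s iu ic p by (simp add: p_def[symmetric] a_minus_def r_distr l_distr r_minus minus_add 
            m_assoc a_assoc l_neg a_comm[of "\<ominus> (i \<otimes> p)"])
      ultimately have "a' \<otimes> (s \<ominus> u \<otimes> p) \<in> J'"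
        using iu p RJ' right_ideal_add right_ideal_mult by metis
      then have "s \<ominus> u \<otimes> p \<in> P" using s iu p by (intro AP) auto
      moreover have "s = (s \<ominus> u \<otimes> p) \<oplus> u \<otimes> p"
        using s iu p by (simp add: a_minus_def a_assoc l_neg)
      ultimately show ?thesis using Pl[OF iu(2) p(1)] RP right_ideal_add by metis
    qed
    \<comment> \<open>The ideal \<open>P\<close> is nonzero, so the descending chain condition applies above it.\<close>
    obtain s where s: "s \<in> carrier R" "s \<noteq> \<zero>" "a' \<otimes> s \<in> J'"
      using ex_common_multiple[OF RJ' J'0(1) a'] .
    then have "P \<noteq> {\<zero>}" using AP by blast
    then obtain n :: nat and u where u: "u \<in> carrier R" "a' [^] n \<otimes> (\<one> \<ominus> a' \<otimes> u) \<in> P"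
      using power_chain_stabilizes[OF RP _ a'] by blast
    from u(2) have "\<one> \<ominus> a' \<otimes> u \<in> P"
    proof (induction n)
      case 0 then show ?case using a' u by simp
    next
      case (Suc n)
      have "a' \<otimes> (a' [^] n \<otimes> (\<one> \<ominus> a' \<otimes> u)) \<in> P"
        using Suc.prems[unfolded nat_pow_Suc2[OF a']] a' u(1) by (simp add: m_assoc)
      then show ?case using a' u(1) by (intro Suc.IH) (rule inj[rotated], simp_all)
    qed
    then have q: "(\<one> \<ominus> a' \<otimes> u) \<otimes> t \<in> P" using RP tc right_ideal_mult by blast
    \<comment> \<open>Since \<open>t = a' u t + q\<close> and \<open>q \<in> P\<close> has no component in \<open>T\<close>, neither has
      \<open>t\<close>.\<close>
    define q where "q = (\<one> \<ominus> a' \<otimes> u) \<otimes> t"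
    have qc: "q \<in> carrier R" "q \<in> P" using q Pc by (auto simp: q_def)
    have aut: "a' \<otimes> (u \<otimes> t) \<in> K" using RK u tc right_ideal_mult by auto
    have teq: "t = a' \<otimes> (u \<otimes> t) \<oplus> q"
      using a' u tc by (simp add: q_def a_minus_def l_distr l_minus m_assoc a_comm[of t] r_neg2)
    note d = dec[OF qc(2)]
    have c: "k \<otimes> q \<in> carrier R" "\<tau> \<otimes> q \<in> carrier R" "y \<otimes> q \<in> carrier R" "a' \<otimes> (u \<otimes> t) \<in> carrier R"
      using ktc qc a' u tc by auto
    have "t = a' \<otimes> (u \<otimes> t) \<oplus> (k \<otimes> q \<oplus> \<tau> \<otimes> q \<oplus> y \<otimes> q)" using teq d(4) by simp
    also have "\<dots> = (a' \<otimes> (u \<otimes> t) \<oplus> k \<otimes> q) \<oplus> \<tau> \<otimes> q \<oplus> y \<otimes> q"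
      using c by (simp add: a_assoc)
    finally have teq2: "t = (a' \<otimes> (u \<otimes> t) \<oplus> k \<otimes> q) \<oplus> \<tau> \<otimes> q \<oplus> y \<otimes> q" .
    define K1 where "K1 = a' \<otimes> (u \<otimes> t) \<oplus> k \<otimes> q"
    have K1: "K1 \<in> K" "K1 \<in> carrier R"
      using aut d RK right_ideal_add c by (auto simp: K1_def)
    have t2: "t = K1 \<oplus> \<tau> \<otimes> q \<oplus> y \<otimes> q" using teq2 by (simp add: K1_def)
    have "\<ominus> K1 \<oplus> t \<oplus> \<ominus> (y \<otimes> q) = \<tau> \<otimes> q"
    proof -
      have "\<ominus> K1 \<oplus> t \<oplus> \<ominus> (y \<otimes> q) = \<ominus> K1 \<oplus> (K1 \<oplus> \<tau> \<otimes> q \<oplus> y \<otimes> q) \<oplus> \<ominus> (y \<otimes> q)" using t2 by simp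
      also have "\<dots> = \<tau> \<otimes> q" using K1 c by (simp add: a_assoc r_neg r_neg1)
      finally show ?thesis .
    qed
    then have "t \<in> J'"
      using ind(2)[of "\<ominus> K1" t "\<ominus> (y \<otimes> q)"] K1 tT d RK Y right_ideal_uminus by metis
    then show False using tK RK by auto
  qed
  have Rn: "right_ideal (J <+> principal_right a') R"
    using J a' right_ideal_set_add right_ideal_multiples by blast
  have "\<one> \<in> J <+> principal_right a'"
  proof (rule ccontr)
    assume "\<one> \<notin> J <+> principal_right a'"
    then obtain X where X: "maximal_right X" "J <+> principal_right a' \<subseteq> X"
      using ex_maximal_right[OF Rn] by blast
    then have "J \<subseteq> X" "principal_right a' \<subseteq> X"
      using set_add_upper[OF J(1) right_ideal_multiples[OF a']] by auto
    then have "J' \<subseteq> X" using X by (auto simp: J'_def radical_over_def)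
    then have "K \<subseteq> X" using X(1) \<open>principal_right a' \<subseteq> X\<close>
      unfolding K_def Kf_def a'_def by (intro set_add_least) (auto simp: maximal_right_def)
    then show False using \<open>\<one> \<in> K\<close> X(1) by (auto simp: maximal_right_def)
  qed
  then show thesis using that r by (auto simp: a'_def)
qed

end

section \<open>Dedekind domains\<close>

lemma (in abelian_monoid) finsum_lessThan_add:
  fixes n m :: nat
  assumes "f \<in> {..<n + m} \<rightarrow> carrier G"
  shows "finsum G f {..<n + m} = finsum G f {..<n} \<oplus> (\<Oplus>i\<in>{..<m}. f (n + i))"
  using assms
proof (induction m)
  case 0
  then show ?case by simp
next
  case (Suc m)
  have c: "f \<in> {..<n + m} \<rightarrow> carrier G" "f (n + m) \<in> carrier G" "f \<in> {..<n} \<rightarrow> carrier G"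
    "(\<lambda>i. f (n + i)) \<in> {..<m} \<rightarrow> carrier G"
    using Suc.prems by (auto simp: Pi_iff)
  have "finsum G f {..<n + Suc m} = f (n + m) \<oplus> finsum G f {..<n + m}"
    using c by (simp add: lessThan_Suc)
  also have "\<dots> = finsum G f {..<n} \<oplus> (f (n + m) \<oplus> (\<Oplus>i\<in>{..<m}. f (n + i)))"
    using c Suc.IH by (simp add: a_lcomm)
  also have "f (n + m) \<oplus> (\<Oplus>i\<in>{..<m}. f (n + i)) = (\<Oplus>i\<in>{..<Suc m}. f (n + i))"
    using c by (simp add: lessThan_Suc)
  finally show ?case .
qed

lemma (in cring) ideal_iff_right_ideal: "ideal I R \<longleftrightarrow> right_ideal I R"
proof
  assume "ideal I R"
  then interpret ideal I R .
  show "right_ideal I R" by (rule right_idealI) (use a_subset I_r_closed in auto)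
next
  assume I: "right_ideal I R"
  show "ideal I R"
  proof (rule idealI[OF ring_axioms])
    show "subgroup I (add_monoid R)"
      using I by (simp add: right_ideal_def additive_subgroup_def)
    show "a \<otimes> x \<in> I" if "a \<in> I" "x \<in> carrier R" for a x
      using right_ideal_mult[OF I] that by blast
    then show "x \<otimes> a \<in> I" if "a \<in> I" "x \<in> carrier R" for a x
      using that right_ideal_carrier[OF I] m_comm by metis
  qed
qed

lemma (in ring) ideal_prod_finite_sum:
  assumes I: "ideal I R" and J: "ideal J R" and s: "s \<in> I \<cdot> J"
  shows "\<exists>(n::nat) l y. (\<forall>j<n. l j \<in> I \<and> y j \<in> J) \<and> s = (\<Oplus>j\<in>{..<n}. l j \<otimes> y j)"
  using s
proof (induction s rule: ideal_prod.induct)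
    case (prod i j)
    then have "i \<in> carrier R" "j \<in> carrier R" using I J ideal.Icarr by metis+
    with prod show ?case
      by (intro exI[of _ 1] exI[of _ "\<lambda>_. i"] exI[of _ "\<lambda>_. j"]) (simp add: lessThan_Suc)
  next
    case (sum s1 s2)
    then obtain n m :: nat and l y l' y' where 1: "\<forall>j<n. l j \<in> I \<and> y j \<in> J"
      "s1 = (\<Oplus>j\<in>{..<n}. l j \<otimes> y j)" and 2: "\<forall>j<m. l' j \<in> I \<and> y' j \<in> J"
      "s2 = (\<Oplus>j\<in>{..<m}. l' j \<otimes> y' j)" by blast
    define L where "L j = (if j < n then l j else l' (j - n))" for j
    define Y where "Y j = (if j < n then y j else y' (j - n))" for j
    have mem: "\<forall>j<n + m. L j \<in> I \<and> Y j \<in> J" using 1 2 by (auto simp: L_def Y_def)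
    then have c: "(\<lambda>j. L j \<otimes> Y j) \<in> {..<n + m} \<rightarrow> carrier R"
      using ideal.Icarr[OF I] ideal.Icarr[OF J] by simp
    have "(\<Oplus>j\<in>{..<n + m}. L j \<otimes> Y j) = (\<Oplus>j\<in>{..<n}. L j \<otimes> Y j) \<oplus> (\<Oplus>j\<in>{..<m}. L (n + j) \<otimes> Y (n + j))"
      by (rule finsum_lessThan_add[OF c])
    also have "(\<Oplus>j\<in>{..<n}. L j \<otimes> Y j) = s1"
      unfolding 1(2) by (rule finsum_cong') (use 1(1) ideal.Icarr[OF I] ideal.Icarr[OF J] in \<open>auto simp: L_def Y_def\<close>)
    also have "(\<Oplus>j\<in>{..<m}. L (n + j) \<otimes> Y (n + j)) = s2"
      unfolding 2(2) by (rule finsum_cong') (use 2(1) ideal.Icarr[OF I] ideal.Icarr[OF J] in \<open>auto simp: L_def Y_def\<close>)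
    finally show ?case using mem by metis
qed

locale dedekind = domain D for D (structure) +
  assumes invertible: "\<lbrakk>ideal I D; I \<noteq> {\<zero>}\<rbrakk> \<Longrightarrow> invertible_ideal D I"
begin

lemma ideal_sum_closed:
  assumes "ideal I D" "\<And>j. j \<in> A \<Longrightarrow> f j \<in> I" shows "finsum D f A \<in> I"
  using assms right_ideal_finsum ideal_iff_right_ideal by blast

text \<open>The maps \<open>i \<mapsto> y j i / d\<close> from \<open>I\<close> to \<open>D\<close> form, together with the generators \<open>l
j\<close>, a dual basis of the module \<open>I\<close>. The denominator \<open>d\<close> is carried along so that no fraction field is needed.\<close>

definition dual_basis :: "'a set \<Rightarrow> nat \<Rightarrow> (nat \<Rightarrow> 'a) \<Rightarrow> (nat \<Rightarrow> 'a) \<Rightarrow> 'a \<Rightarrow> bool" where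
  "dual_basis I n l y d \<longleftrightarrow> d \<in> carrier D \<and> d \<noteq> \<zero> \<and>
     (\<forall>j<n. l j \<in> I) \<and> (\<forall>j<n. y j \<in> carrier D) \<and> (\<Oplus>j\<in>{..<n}. l j \<otimes> y j) = d \<and>
     (\<forall>j<n. \<forall>i\<in>I. \<exists>z\<in>carrier D. y j \<otimes> i = d \<otimes> z)"

lemma dual_basisD:
  assumes "dual_basis I n l y d"
  shows "d \<in> carrier D" "d \<noteq> \<zero>" "\<And>j. j < n \<Longrightarrow> l j \<in> I" "\<And>j. j < n \<Longrightarrow> y j \<in> carrier D"
    "(\<Oplus>j\<in>{..<n}. l j \<otimes> y j) = d"
    "\<And>j i. j < n \<Longrightarrow> i \<in> I \<Longrightarrow> \<exists>z\<in>carrier D. y j \<otimes> i = d \<otimes> z"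
  using assms by (auto simp: dual_basis_def)

text \<open>If \<open>I J = d D\<close>, a representation of \<open>d\<close> as an element of \<open>I J\<close> has the required form.\<close>

lemma ex_dual_basis:
  assumes I: "ideal I D" "I \<noteq> {\<zero>}"
  shows "\<exists>n l y d. dual_basis I n l y d"
proof -
  obtain J d where J: "ideal J D" "d \<in> carrier D" "d \<noteq> \<zero>" "I \<cdot> J = PIdl d"
    using invertible[OF I] by (auto simp: invertible_ideal_def)
  have "d \<in> I \<cdot> J" using J cgenideal_self by simp
  then obtain n :: nat and l y where ly: "\<forall>j<n. l j \<in> I \<and> y j \<in> J"
    "d = (\<Oplus>j\<in>{..<n}. l j \<otimes> y j)" using ideal_prod_finite_sum[OF I(1) J(1)] by blast
  have "\<exists>z\<in>carrier D. y j \<otimes> i = d \<otimes> z" if "j < n" "i \<in> I" for i j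
  proof -
    have "i \<otimes> y j \<in> PIdl d" using that ly(1) J(4) ideal_prod.prod by metis
    then obtain z where "z \<in> carrier D" "i \<otimes> y j = z \<otimes> d" by (auto simp: cgenideal_def)
    moreover have "i \<in> carrier D" "y j \<in> carrier D"
      using that ly I(1) J(1) ideal.Icarr by metis+
    ultimately show ?thesis using J(2) m_comm by metis
  qed
  moreover have "\<forall>j<n. y j \<in> carrier D" using ly ideal.Icarr[OF J(1)] by blast
  ultimately have "dual_basis I n l y d" using J(2,3) ly by (simp add: dual_basis_def)
  then show ?thesis by blast
qed

text \<open>The elements \<open>l j\<close> of a dual basis generate. Generation is stated by comparison with all other ideals, the form that applies
to unions of chains.\<close>

lemma finitely_generated:
  assumes I: "ideal I D" "I \<noteq> {\<zero>}"
  shows "\<exists>(n::nat) l. (\<forall>j<n. l j \<in> I) \<and>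
    (\<forall>I'. ideal I' D \<longrightarrow> (\<forall>j<n. l j \<in> I') \<longrightarrow> I \<subseteq> I')"
proof -
  obtain n l y d where "dual_basis I n l y d" using ex_dual_basis[OF I] by blast
  note * = dual_basisD[OF this]
  have lc: "j < n \<Longrightarrow> l j \<in> carrier D" for j using *(3) ideal.Icarr[OF I(1)] by blast
  have "i \<in> I'" if I': "ideal I' D" "\<forall>j<n. l j \<in> I'" and i: "i \<in> I" for I' i
  proof -
    have ic: "i \<in> carrier D" using i ideal.Icarr[OF I(1)] by blast
    obtain z where z: "\<And>j. j < n \<Longrightarrow> z j \<in> carrier D \<and> y j \<otimes> i = d \<otimes> z j"
      using *(6)[OF _ i] by metis
    have "d \<otimes> i = (\<Oplus>j\<in>{..<n}. (l j \<otimes> y j) \<otimes> i)"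
      unfolding *(5)[symmetric] using lc *(4) ic by (intro finsum_ldistr) auto
    also have "\<dots> = (\<Oplus>j\<in>{..<n}. d \<otimes> (l j \<otimes> z j))"
      by (rule finsum_cong') (use lc *(1,4) ic z in \<open>auto simp: m_assoc m_lcomm\<close>)
    also have "\<dots> = d \<otimes> (\<Oplus>j\<in>{..<n}. l j \<otimes> z j)"
      using lc *(1) z by (intro finsum_rdistr[symmetric]) auto
    finally have "i = (\<Oplus>j\<in>{..<n}. l j \<otimes> z j)"
      using *(1,2) ic lc z by (subst (asm) m_lcancel) auto
    then show "i \<in> I'"
      using z I' by (auto intro!: ideal_sum_closed ideal.I_r_closed)
  qed
  then show ?thesis using *(3) by blast
qed

text \<open>Zorn's lemma, where the union of a chain is one of its members because it is finitely generated.\<close>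

lemma ex_maximal_ideal:
  assumes A: "\<A> \<noteq> {}" "\<And>I. I \<in> \<A> \<Longrightarrow> ideal I D"
  shows "\<exists>M\<in>\<A>. \<forall>I\<in>\<A>. M \<subseteq> I \<longrightarrow> I = M"
proof (rule subset_Zorn_nonempty[OF A(1)])
  fix \<C> assume C: "\<C> \<noteq> {}" "subset.chain \<A> \<C>"
  then have CA: "\<C> \<subseteq> \<A>" and lin: "\<And>X Y. X \<in> \<C> \<Longrightarrow> Y \<in> \<C> \<Longrightarrow> X \<subseteq> Y \<or> Y \<subseteq> X"
    by (auto simp: subset_chain_def)
  have id: "X \<in> \<C> \<Longrightarrow> ideal X D" for X using CA A by auto
  have idr: "X \<in> \<C> \<Longrightarrow> right_ideal X D" for X using id ideal_iff_right_ideal by auto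
  have "right_ideal (\<Union>\<C>) D"
  proof (rule right_idealI)
    show "\<Union>\<C> \<subseteq> carrier D" using right_ideal_subset[OF idr] by auto
    show "\<zero> \<in> \<Union>\<C>" using right_ideal_zero[OF idr] C(1) by auto
    show "x \<oplus> y \<in> \<Union>\<C>" if xy: "x \<in> \<Union>\<C>" "y \<in> \<Union>\<C>" for x y
    proof -
      obtain X Y where "X \<in> \<C>" "Y \<in> \<C>" "x \<in> X" "y \<in> Y" using xy by blast
      then obtain Z where "Z \<in> \<C>" "x \<in> Z" "y \<in> Z" using lin[of X Y] by blast
      then show ?thesis using right_ideal_add[OF idr] by blast
    qed
    show "x \<otimes> r \<in> \<Union>\<C>" if "x \<in> \<Union>\<C>" "r \<in> carrier D" for x r
      using that right_ideal_mult[OF idr] by blast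
  qed
  then have U: "ideal (\<Union>\<C>) D" by (simp add: ideal_iff_right_ideal)
  show "\<Union>\<C> \<in> \<A>"
  proof (cases "\<Union>\<C> = {\<zero>}")
    case True
    obtain X where X: "X \<in> \<C>" using C(1) by blast
    then have "X = {\<zero>}" using True right_ideal_zero[OF idr[OF X]] by blast
    then show ?thesis using True X CA by auto
  next
    case False
    obtain n :: nat and l where l': "\<forall>j<n. l j \<in> \<Union>\<C>"
      "\<forall>I'. ideal I' D \<longrightarrow> (\<forall>j<n. l j \<in> I') \<longrightarrow> \<Union>\<C> \<subseteq> I'"
      using finitely_generated[OF U False] by blast
    note l = l'[rule_format]
    have "\<exists>X\<in>\<C>. \<forall>j<m. l j \<in> X" if "m \<le> n" for m using that
    proof (induction m)
      case 0 then show ?case using C(1) by auto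
    next
      case (Suc m)
      then obtain X where X: "X \<in> \<C>" "\<forall>j<m. l j \<in> X" by auto
      obtain Y where Y: "Y \<in> \<C>" "l m \<in> Y" using l(1)[of m] Suc.prems by auto
      have "X \<subseteq> Y \<or> Y \<subseteq> X" using lin X Y by auto
      then obtain Z where "Z \<in> \<C>" "X \<subseteq> Z" "Y \<subseteq> Z" using X Y by blast
      then show ?case using X Y by (intro bexI[of _ Z]) (auto simp: less_Suc_eq)
    qed
    then obtain X where X: "X \<in> \<C>" "\<forall>j<n. l j \<in> X" by auto
    then have "\<Union>\<C> \<subseteq> X" using l(2)[OF id] by blast
    then have "\<Union>\<C> = X" using X by blast
    then show ?thesis using X CA by auto
  qed
qed

definition colon :: "'a set \<Rightarrow> 'a set \<Rightarrow> 'a set" where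
  "colon B A = {d \<in> carrier D. \<forall>a\<in>A. d \<otimes> a \<in> B}"

lemma ideal_colon:
  assumes A: "ideal A D" and B: "ideal B D" shows "ideal (colon B A) D"
proof -
  have rB: "right_ideal B D" and Ac: "\<And>a. a \<in> A \<Longrightarrow> a \<in> carrier D"
    using B ideal_iff_right_ideal ideal.Icarr[OF A] by auto
  have "right_ideal (colon B A) D"
  proof (rule right_idealI)
    show "x \<otimes> r \<in> colon B A" if "x \<in> colon B A" "r \<in> carrier D" for x r
    proof -
      have "x \<otimes> r \<otimes> a = x \<otimes> a \<otimes> r" if "a \<in> A" for a
        using that \<open>r \<in> _\<close> \<open>x \<in> _\<close> Ac by (simp add: colon_def m_assoc m_comm[of r])
      then show ?thesis using that right_ideal_mult[OF rB] by (auto simp: colon_def)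
    qed
  qed (use rB Ac in \<open>auto simp: colon_def l_distr right_ideal_zero right_ideal_add\<close>)
  then show ?thesis by (simp add: ideal_iff_right_ideal)
qed

lemma ideal_prod_subset: "ideal K D \<Longrightarrow> (\<And>a b. a \<in> A \<Longrightarrow> b \<in> B \<Longrightarrow> a \<otimes> b \<in> K) \<Longrightarrow> A \<cdot> B \<subseteq> K"
proof
  fix x assume K: "ideal K D" "\<And>a b. a \<in> A \<Longrightarrow> b \<in> B \<Longrightarrow> a \<otimes> b \<in> K" and x: "x \<in> A \<cdot> B"
  have rK: "right_ideal K D" using K ideal_iff_right_ideal by simp
  show "x \<in> K" using x by induction (use K right_ideal_add[OF rK] in auto)
qed

text \<open>Containment is divisibility. With a dual basis of \<open>A\<close>, every \<open>b\<close> is the sum of the \<open>l j * (y j * b /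
d)\<close>, and \<open>y j * b / d\<close> lies in \<open>colon B A\<close>.\<close>

lemma prod_colon:
  assumes A: "ideal A D" "A \<noteq> {\<zero>}" and B: "ideal B D" "B \<subseteq> A"
  shows "A \<cdot> colon B A = B"
proof
  have Ac: "\<And>a. a \<in> A \<Longrightarrow> a \<in> carrier D" using ideal.Icarr[OF A(1)] by auto
  show "A \<cdot> colon B A \<subseteq> B"
    using Ac m_comm by (intro ideal_prod_subset B) (auto simp: colon_def)
  show "B \<subseteq> A \<cdot> colon B A"
  proof
    fix b assume b: "b \<in> B"
    have bc: "b \<in> carrier D" using b B Ac by auto
    obtain n l y d where "dual_basis A n l y d" using ex_dual_basis[OF A] by blast
  note * = dual_basisD[OF this]
    have lc: "j < n \<Longrightarrow> l j \<in> carrier D" for j using *(3) Ac by blast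
    have bA: "b \<in> A" using b B by auto
    obtain z where z: "\<And>j. j < n \<Longrightarrow> z j \<in> carrier D \<and> y j \<otimes> b = d \<otimes> z j"
      using *(6)[OF _ bA] by metis
    have zc: "z j \<in> colon B A" if j: "j < n" for j
    proof -
      have "z j \<otimes> a \<in> B" if a: "a \<in> A" for a
      proof -
        obtain w where w: "w \<in> carrier D" "y j \<otimes> a = d \<otimes> w" using *(6)[OF j a] by blast
        have "d \<otimes> (z j \<otimes> a) = (y j \<otimes> b) \<otimes> a" using z[OF j] *(1) Ac[OF a] by (simp add: m_assoc)
        also have "\<dots> = (y j \<otimes> a) \<otimes> b" using *(4)[OF j] Ac[OF a] bc by (simp add: m_assoc m_comm[of b])
        also have "\<dots> = d \<otimes> (w \<otimes> b)" using w *(1) bc by (simp add: m_assoc)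
        finally have "z j \<otimes> a = w \<otimes> b"
          using *(1,2) z[OF j] Ac[OF a] w bc by (subst (asm) m_lcancel) auto
        then show ?thesis using b w B(1) ideal.I_l_closed by metis
      qed
      then show ?thesis using z[OF j] by (simp add: colon_def)
    qed
    have "d \<otimes> b = (\<Oplus>j\<in>{..<n}. (l j \<otimes> y j) \<otimes> b)"
      unfolding *(5)[symmetric] using lc *(4) bc by (intro finsum_ldistr) auto
    also have "\<dots> = (\<Oplus>j\<in>{..<n}. d \<otimes> (l j \<otimes> z j))"
      by (rule finsum_cong') (use lc *(1,4) bc z in \<open>auto simp: m_assoc m_lcomm\<close>)
    also have "\<dots> = d \<otimes> (\<Oplus>j\<in>{..<n}. l j \<otimes> z j)"
      using lc *(1) z by (intro finsum_rdistr[symmetric]) auto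
    finally have e: "b = (\<Oplus>j\<in>{..<n}. l j \<otimes> z j)"
      using *(1,2) bc lc z by (subst (asm) m_lcancel) auto
    show "b \<in> A \<cdot> colon B A"
      unfolding e using zc *(3)
      by (intro ideal_sum_closed ideal_prod_is_ideal ideal_colon A(1) B(1)) (auto intro: ideal_prod.prod)
  qed
qed

lemma PIdl_prod:
  assumes c: "c \<in> carrier D" and A: "ideal A D"
  shows "(PIdl c) \<cdot> A = (\<lambda>a. c \<otimes> a) ` A"
proof
  have Ac: "\<And>a. a \<in> A \<Longrightarrow> a \<in> carrier D" using ideal.Icarr[OF A] by auto
  show "(\<lambda>a. c \<otimes> a) ` A \<subseteq> (PIdl c) \<cdot> A"
    using cgenideal_self[OF c] by (auto intro: ideal_prod.prod)
  show "(PIdl c) \<cdot> A \<subseteq> (\<lambda>a. c \<otimes> a) ` A"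
  proof
    fix x assume "x \<in> (PIdl c) \<cdot> A"
    then show "x \<in> (\<lambda>a. c \<otimes> a) ` A"
    proof induction
      case (prod i j)
      then obtain u where u: "u \<in> carrier D" "i = u \<otimes> c" by (auto simp: cgenideal_def)
      have "i \<otimes> j = c \<otimes> (u \<otimes> j)" using u c Ac prod(2) by (simp add: m_ac)
      moreover have "u \<otimes> j \<in> A" using A u prod ideal.I_l_closed by metis
      ultimately show ?case by blast
    next
      case (sum s1 s2)
      then obtain a b where "a \<in> A" "b \<in> A" "s1 = c \<otimes> a" "s2 = c \<otimes> b" by auto
      then have "s1 \<oplus> s2 = c \<otimes> (a \<oplus> b)" "a \<oplus> b \<in> A"
        using c Ac A additive_subgroup.a_closed[OF ideal.axioms(1)] by (auto simp: r_distr)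
      then show ?case by blast
    qed
  qed
qed

lemma scaled_ideal_inj:
  assumes c: "c \<in> carrier D" "c \<noteq> \<zero>" and A: "A \<subseteq> carrier D" "B \<subseteq> carrier D"
    and eq: "(\<lambda>a. c \<otimes> a) ` A = (\<lambda>a. c \<otimes> a) ` B"
  shows "A = B"
proof -
  have "inj_on (\<lambda>a. c \<otimes> a) (carrier D)" using c by (auto intro!: inj_onI simp: m_lcancel)
  then show ?thesis using A eq inj_on_image_eq_iff by metis
qed

lemma ideal_prod_cancel:
  assumes A: "ideal A D" "A \<noteq> {\<zero>}" and B: "ideal B D" and C: "ideal C D"
    and eq: "A \<cdot> B = A \<cdot> C"
  shows "B = C"
proof -
  obtain J d where J: "ideal J D" "d \<in> carrier D" "d \<noteq> \<zero>" "A \<cdot> J = PIdl d"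
    using invertible[OF A] by (auto simp: invertible_ideal_def)
  have "(PIdl d) \<cdot> X = J \<cdot> (A \<cdot> X)" if "ideal X D" for X
    using that J A ideal_prod_assoc ideal_prod_commute by metis
  then have "(PIdl d) \<cdot> B = (PIdl d) \<cdot> C" using B C eq by simp
  then show ?thesis
    using scaled_ideal_inj[OF J(2,3)] PIdl_prod[OF J(2)] B C ideal.Icarr by (metis subsetI)
qed

text \<open>Among the ideals containing \<open>z\<close>, the map \<open>I \<mapsto> colon (z D) I\<close> reverses inclusions and is injective,
because \<open>I\<close> times its image is \<open>z D\<close>. So the ascending chain condition turns into the descending one.\<close>

lemma ex_minimal_ideal:
  assumes A: "\<A> \<noteq> {}" "\<And>I. I \<in> \<A> \<Longrightarrow> ideal I D" and z: "\<And>I. I \<in> \<A> \<Longrightarrow> z \<in> I" "z \<noteq> \<zero>"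
  shows "\<exists>M\<in>\<A>. \<forall>I\<in>\<A>. I \<subseteq> M \<longrightarrow> I = M"
proof -
  obtain I0 where "I0 \<in> \<A>" using A(1) by blast
  then have zc: "z \<in> carrier D" using A(2) z(1) ideal.Icarr by metis
  let ?c = "\<lambda>I. colon (PIdl z) I"
  have "\<exists>M\<in>?c ` \<A>. \<forall>I\<in>?c ` \<A>. M \<subseteq> I \<longrightarrow> I = M"
    by (rule ex_maximal_ideal) (use A zc in \<open>auto intro: ideal_colon cgenideal_ideal\<close>)
  then obtain M where M: "M \<in> \<A>" "\<And>I. I \<in> \<A> \<Longrightarrow> ?c M \<subseteq> ?c I \<Longrightarrow> ?c I = ?c M" by auto
  have "I = M" if I: "I \<in> \<A>" "I \<subseteq> M" for I
  proof -
    have "?c M \<subseteq> ?c I" using I by (auto simp: colon_def)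
    then have eq: "?c I = ?c M" using M I by auto
    have p: "X \<cdot> ?c X = PIdl z" "?c X \<noteq> {\<zero>}" "X \<noteq> {\<zero>}" if X: "X \<in> \<A>" for X
    proof -
      show X0: "X \<noteq> {\<zero>}" using z X by auto
      show p: "X \<cdot> ?c X = PIdl z"
        using X X0 A z zc by (intro prod_colon cgenideal_ideal cgenideal_minimal) auto
      show "?c X \<noteq> {\<zero>}"
      proof
        assume "?c X = {\<zero>}"
        then have "PIdl z = {\<zero>}" using p ideal_prod_zero A(2) X by metis
        then show False using cgenideal_self[OF zc] z by auto
      qed
    qed
    have cI: "ideal (?c M) D" using ideal_colon cgenideal_ideal zc A(2) M(1) by metis
    show ?thesis
      using ideal_prod_cancel[OF cI p(2)[OF M(1)] A(2)[OF I(1)] A(2)[OF M(1)]] p(1) I M eq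
        ideal_prod_commute cI A(2) by metis
  qed
  then show ?thesis using M(1) by blast
qed

end

section \<open>The skew Laurent series ring\<close>

lemma (in abelian_monoid) finsum_swap:
  assumes A: "finite A" and B: "finite B"
    and f: "\<And>a b. a \<in> A \<Longrightarrow> b \<in> B \<Longrightarrow> f a b \<in> carrier G"
  shows "(\<Oplus>a\<in>A. \<Oplus>b\<in>B. f a b) = (\<Oplus>b\<in>B. \<Oplus>a\<in>A. f a b)"
  using A f
proof (induction A)
  case empty
  then show ?case by simp
next
  case (insert x A)
  have c: "(\<lambda>b. f x b) \<in> B \<rightarrow> carrier G" "(\<lambda>b. \<Oplus>a\<in>A. f a b) \<in> B \<rightarrow> carrier G"
    "(\<lambda>a. \<Oplus>b\<in>B. f a b) \<in> A \<rightarrow> carrier G"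
    using insert.prems by (auto intro!: finsum_closed)
  have "(\<Oplus>a\<in>insert x A. \<Oplus>b\<in>B. f a b) = (\<Oplus>b\<in>B. f x b) \<oplus> (\<Oplus>a\<in>A. \<Oplus>b\<in>B. f a b)"
    using insert c by (intro finsum_insert) (auto intro!: finsum_closed)
  also have "\<dots> = (\<Oplus>b\<in>B. f x b) \<oplus> (\<Oplus>b\<in>B. \<Oplus>a\<in>A. f a b)"
    using insert by simp
  also have "\<dots> = (\<Oplus>b\<in>B. f x b \<oplus> (\<Oplus>a\<in>A. f a b))"
    using c by (intro finsum_addf[symmetric])
  also have "\<dots> = (\<Oplus>b\<in>B. \<Oplus>a\<in>insert x A. f a b)"
    using insert c by (intro finsum_cong') (auto intro!: finsum_insert[symmetric] finsum_closed)
  finally show ?case .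
qed

locale skew_laurent_ring = domain D for D (structure) +
  fixes \<sigma> :: "'a \<Rightarrow> 'a"
  assumes sigma: "\<sigma> \<in> ring_iso D D"
begin

abbreviation R where "R \<equiv> skew_laurent D \<sigma>"
abbreviation tw :: "int \<Rightarrow> 'a \<Rightarrow> 'a" where "tw \<equiv> aut_power D \<sigma>"

lemma sigma_bij: "bij_betw \<sigma> (carrier D) (carrier D)"
  and sigma_closed: "a \<in> carrier D \<Longrightarrow> \<sigma> a \<in> carrier D"
  and sigma_add: "a \<in> carrier D \<Longrightarrow> b \<in> carrier D \<Longrightarrow> \<sigma> (a \<oplus> b) = \<sigma> a \<oplus> \<sigma> b"
  and sigma_mult: "a \<in> carrier D \<Longrightarrow> b \<in> carrier D \<Longrightarrow> \<sigma> (a \<otimes> b) = \<sigma> a \<otimes> \<sigma> b"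
  and sigma_one: "\<sigma> \<one> = \<one>"
  by (fact ring_iso_memE[OF sigma])+

abbreviation tau where "tau \<equiv> inv_into (carrier D) \<sigma>"

lemma tau_closed: "a \<in> carrier D \<Longrightarrow> tau a \<in> carrier D"
  using sigma_bij by (metis bij_betw_imp_surj_on inv_into_into)

lemma sigma_tau: "a \<in> carrier D \<Longrightarrow> \<sigma> (tau a) = a"
  using sigma_bij by (metis bij_betw_inv_into_right)

lemma tau_sigma: "a \<in> carrier D \<Longrightarrow> tau (\<sigma> a) = a"
  using sigma_bij by (metis bij_betw_inv_into_left)

lemma tau_hom:
  "a \<in> carrier D \<Longrightarrow> b \<in> carrier D \<Longrightarrow> tau (a \<oplus> b) = tau a \<oplus> tau b"
  "a \<in> carrier D \<Longrightarrow> b \<in> carrier D \<Longrightarrow> tau (a \<otimes> b) = tau a \<otimes> tau b"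
  "tau \<one> = \<one>"
proof -
  show "tau (a \<oplus> b) = tau a \<oplus> tau b" if "a \<in> carrier D" "b \<in> carrier D"
    using that tau_sigma[of "tau a \<oplus> tau b"] by (simp add: sigma_add tau_closed sigma_tau)
  show "tau (a \<otimes> b) = tau a \<otimes> tau b" if "a \<in> carrier D" "b \<in> carrier D"
    using that tau_sigma[of "tau a \<otimes> tau b"] by (simp add: sigma_mult tau_closed sigma_tau)
  show "tau \<one> = \<one>" using tau_sigma[of \<one>] by (simp add: sigma_one)
qed

lemma tw_hom:
  "a \<in> carrier D \<Longrightarrow> tw i a \<in> carrier D"
  "a \<in> carrier D \<Longrightarrow> b \<in> carrier D \<Longrightarrow> tw i (a \<oplus> b) = tw i a \<oplus> tw i b"
  "a \<in> carrier D \<Longrightarrow> b \<in> carrier D \<Longrightarrow> tw i (a \<otimes> b) = tw i a \<otimes> tw i b"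
  "tw i \<one> = \<one>"
proof -
  have 1: "(a \<in> carrier D \<longrightarrow> (\<sigma> ^^ n) a \<in> carrier D) \<and> (a \<in> carrier D \<longrightarrow> (tau ^^ n) a \<in> carrier D)" for n a
    by (induction n) (auto simp: sigma_closed tau_closed)
  have 2: "a \<in> carrier D \<and> b \<in> carrier D \<longrightarrow> (\<sigma> ^^ n) (a \<oplus> b) = (\<sigma> ^^ n) a \<oplus> (\<sigma> ^^ n) b
      \<and> (tau ^^ n) (a \<oplus> b) = (tau ^^ n) a \<oplus> (tau ^^ n) b
      \<and> (\<sigma> ^^ n) (a \<otimes> b) = (\<sigma> ^^ n) a \<otimes> (\<sigma> ^^ n) b
      \<and> (tau ^^ n) (a \<otimes> b) = (tau ^^ n) a \<otimes> (tau ^^ n) b" for n a b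
    by (induction n) (auto simp: sigma_add sigma_mult tau_hom 1)
  have 3: "(\<sigma> ^^ n) \<one> = \<one> \<and> (tau ^^ n) \<one> = \<one>" for n
    by (induction n) (auto simp: sigma_one tau_hom)
  show "a \<in> carrier D \<Longrightarrow> tw i a \<in> carrier D" using 1 by (simp add: aut_power_def)
  show "a \<in> carrier D \<Longrightarrow> b \<in> carrier D \<Longrightarrow> tw i (a \<oplus> b) = tw i a \<oplus> tw i b"
    using 2 by (simp add: aut_power_def)
  show "a \<in> carrier D \<Longrightarrow> b \<in> carrier D \<Longrightarrow> tw i (a \<otimes> b) = tw i a \<otimes> tw i b"
    using 2 by (simp add: aut_power_def)
  show "tw i \<one> = \<one>" using 3 by (simp add: aut_power_def)
qed

lemma tw_0 [simp]: "tw 0 a = a"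
  by (simp add: aut_power_def)

lemma tw_1: "tw 1 a = \<sigma> a"
  by (simp add: aut_power_def)

lemma tw_succ: "a \<in> carrier D \<Longrightarrow> tw (i + 1) a = \<sigma> (tw i a)"
proof (cases "0 \<le> i")
  case True
  then have "nat (i + 1) = Suc (nat i)" by simp
  with True show ?thesis by (simp add: aut_power_def)
next
  case False
  assume a: "a \<in> carrier D"
  from False have e: "nat (- i) = Suc (nat (- (i + 1)))" by simp
  have "tw (i + 1) a = (tau ^^ nat (- (i + 1))) a"
    using False by (auto simp: aut_power_def)
  moreover have "tw i a = tau ((tau ^^ nat (- (i + 1))) a)"
    using False e by (simp add: aut_power_def)
  moreover have "(tau ^^ n) a \<in> carrier D" for n
    using a by (induction n) (auto simp: tau_closed)
  ultimately show ?thesis using sigma_tau by simp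
qed

lemma tw_pred: "a \<in> carrier D \<Longrightarrow> tw (i - 1) a = tau (tw i a)"
  using tw_succ[of a "i - 1"] tau_sigma tw_hom(1) by simp

lemma tw_add: "a \<in> carrier D \<Longrightarrow> tw (i + j) a = tw i (tw j a)"
proof (induction i rule: int_induct[where k = 0])
  case base
  then show ?case by simp
next
  case (step1 i)
  then have "tw (i + 1 + j) a = \<sigma> (tw (i + j) a)"
    using tw_succ[of a "i + j"] by (simp add: algebra_simps)
  then show ?case using step1 tw_succ[of "tw j a" i] tw_hom(1) by simp
next
  case (step2 i)
  then have "tw (i - 1 + j) a = tau (tw (i + j) a)"
    using tw_pred[of a "i + j"] by (simp add: algebra_simps)
  then show ?case using step2 tw_pred[of "tw j a" i] tw_hom(1) by simp
qed

lemma tw_cancel [simp]: "a \<in> carrier D \<Longrightarrow> tw i (tw (- i) a) = a" "a \<in> carrier D \<Longrightarrow> tw (- i) (tw i a) = a"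
  using tw_add[of a i "- i"] tw_add[of a "- i" i] by auto

lemma tw_zero [simp]: "tw i \<zero> = \<zero>"
  using tw_hom(2)[of \<zero> \<zero> i] tw_hom(1)[of \<zero> i] by (metis add.r_cancel_one' r_zero zero_closed)

lemma tw_eq_zero: "a \<in> carrier D \<Longrightarrow> tw i a = \<zero> \<longleftrightarrow> a = \<zero>"
  using tw_cancel(2)[of a i] tw_zero[of "- i"] tw_zero[of i] by metis

lemma tw_finsum: "f \<in> A \<rightarrow> carrier D \<Longrightarrow> tw i (\<Oplus>a\<in>A. f a) = (\<Oplus>a\<in>A. tw i (f a))"
proof (induction A rule: infinite_finite_induct)
  case (insert x A)
  then have c: "f x \<in> carrier D" "f \<in> A \<rightarrow> carrier D" "(\<lambda>a. tw i (f a)) \<in> A \<rightarrow> carrier D"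
    by (auto simp: tw_hom Pi_iff)
  with insert show ?case by (simp add: tw_hom)
qed simp_all

definition order_ge :: "int \<Rightarrow> (int \<Rightarrow> 'a) \<Rightarrow> bool" where
  "order_ge k f \<longleftrightarrow> (\<forall>i<k. f i = \<zero>)"

lemma order_geD: "order_ge k f \<Longrightarrow> i < k \<Longrightarrow> f i = \<zero>"
  by (simp add: order_ge_def)

lemma order_ge_mono: "order_ge k f \<Longrightarrow> l \<le> k \<Longrightarrow> order_ge l f"
  by (auto simp: order_ge_def)

lemma carrier_R: "f \<in> carrier R \<longleftrightarrow> (\<forall>i. f i \<in> carrier D) \<and> (\<exists>k. order_ge k f)"
  by (auto simp: skew_laurent_def order_ge_def)

lemma coeff_closed: "f \<in> carrier R \<Longrightarrow> f i \<in> carrier D"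
  by (simp add: carrier_R)

lemma ex_ge: "f \<in> carrier R \<Longrightarrow> \<exists>k. order_ge k f"
  by (simp add: carrier_R)

lemma order_ge_common: "f \<in> carrier R \<Longrightarrow> g \<in> carrier R \<Longrightarrow> \<exists>k. order_ge k f \<and> order_ge k g"
  using ex_ge[of f] ex_ge[of g] order_ge_mono by (meson min.cobounded1 min.cobounded2)

lemma zero_R: "\<zero>\<^bsub>R\<^esub> = (\<lambda>i. \<zero>)"
  and one_R: "\<one>\<^bsub>R\<^esub> = (\<lambda>i. if i = 0 then \<one> else \<zero>)"
  and add_R: "f \<oplus>\<^bsub>R\<^esub> g = (\<lambda>i. f i \<oplus> g i)"
  by (auto simp: skew_laurent_def)

lemma coeff_zero [simp]: "\<zero>\<^bsub>R\<^esub> i = \<zero>"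
  and coeff_add: "(f \<oplus>\<^bsub>R\<^esub> g) i = f i \<oplus> g i"
  by (auto simp: zero_R add_R)

text \<open>The product may be computed with any finite index set that covers the orders of the factors, so that different products can be compared
over a common index set.\<close>

lemma coeff_mult:
  assumes f: "f \<in> carrier R" "order_ge k f" and g: "g \<in> carrier R" "order_ge l g"
    and F: "finite F" "{k..n - l} \<subseteq> F"
  shows "(f \<otimes>\<^bsub>R\<^esub> g) n = (\<Oplus>i\<in>F. f i \<otimes> tw i (g (n - i)))"
proof -
  let ?S = "{i. f i \<noteq> \<zero> \<and> g (n - i) \<noteq> \<zero>}"
  have "?S \<subseteq> {k..n - l}"
  proof
    fix i assume "i \<in> ?S"
    then have "\<not> i < k" "\<not> n - i < l" using order_geD f(2) g(2) by auto
    then show "i \<in> {k..n - l}" by auto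
  qed
  then have S: "?S \<subseteq> F" using F by auto
  have "(f \<otimes>\<^bsub>R\<^esub> g) n = (\<Oplus>i\<in>?S. f i \<otimes> tw i (g (n - i)))"
    by (simp add: skew_laurent_def)
  also have "\<dots> = (\<Oplus>i\<in>F. f i \<otimes> tw i (g (n - i)))"
    using S F(1) coeff_closed[OF f(1)] coeff_closed[OF g(1)]
    by (intro add.finprod_mono_neutral_cong_left) (auto simp: tw_hom tw_eq_zero)
  finally show ?thesis .
qed

lemma order_ge_mult:
  assumes "f \<in> carrier R" "order_ge k f" "g \<in> carrier R" "order_ge l g" shows "order_ge (k + l) (f \<otimes>\<^bsub>R\<^esub> g)"
  unfolding order_ge_def
proof (intro allI impI)
  fix n assume "n < k + l"
  then have "{k..n - l} \<subseteq> {}" by auto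
  then show "(f \<otimes>\<^bsub>R\<^esub> g) n = \<zero>" using coeff_mult[OF assms, of "{}"] by simp
qed

lemma lowest_coeff_mult:
  assumes "f \<in> carrier R" "order_ge k f" "g \<in> carrier R" "order_ge l g"
  shows "(f \<otimes>\<^bsub>R\<^esub> g) (k + l) = f k \<otimes> tw k (g l)"
  using coeff_mult[OF assms, of "{k}" "k + l"] coeff_closed assms by (simp add: tw_hom)

lemma mult_R_closed:
  assumes f: "f \<in> carrier R" and g: "g \<in> carrier R" shows "f \<otimes>\<^bsub>R\<^esub> g \<in> carrier R"
proof -
  obtain k l where kl: "order_ge k f" "order_ge l g" using f g ex_ge by blast
  have "(f \<otimes>\<^bsub>R\<^esub> g) n \<in> carrier D" for n
    unfolding coeff_mult[OF f kl(1) g kl(2) finite_atLeastAtMost_int subset_refl]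
    using coeff_closed f g by (intro finsum_closed) (auto simp: tw_hom)
  then show ?thesis using order_ge_mult[OF f kl(1) g kl(2)] carrier_R by blast
qed

lemma add_R_closed: "f \<in> carrier R \<Longrightarrow> g \<in> carrier R \<Longrightarrow> f \<oplus>\<^bsub>R\<^esub> g \<in> carrier R"
proof -
  assume f: "f \<in> carrier R" and g: "g \<in> carrier R"
  then obtain k where "order_ge k f" "order_ge k g" using order_ge_common by blast
  then have "order_ge k (f \<oplus>\<^bsub>R\<^esub> g)" by (simp add: order_ge_def coeff_add)
  then show ?thesis using f g by (auto simp: carrier_R coeff_add)
qed

text \<open>Both sides are sums over the same rectangle of indices \<open>(i, j)\<close>, where \<open>i\<close> counts the power of \<open>x\<close>
in \<open>f\<close> and \<open>j\<close> the one in \<open>f g\<close>.\<close>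

lemma mult_R_assoc:
  assumes f: "f \<in> carrier R" and g: "g \<in> carrier R" and h: "h \<in> carrier R"
  shows "(f \<otimes>\<^bsub>R\<^esub> g) \<otimes>\<^bsub>R\<^esub> h = f \<otimes>\<^bsub>R\<^esub> (g \<otimes>\<^bsub>R\<^esub> h)"
proof
  fix n
  obtain k l p where k: "order_ge k f" and l: "order_ge l g" and p: "order_ge p h"
    using ex_ge[OF f] ex_ge[OF g] ex_ge[OF h] by blast
  note c = coeff_closed[OF f] coeff_closed[OF g] coeff_closed[OF h]
  let ?J = "{k + l..n - p}" and ?I = "{k..n - (l + p)}"
  let ?t = "\<lambda>i j. f i \<otimes> tw i (g (j - i)) \<otimes> tw j (h (n - j))"
  have "((f \<otimes>\<^bsub>R\<^esub> g) \<otimes>\<^bsub>R\<^esub> h) n = (\<Oplus>j\<in>?J. (f \<otimes>\<^bsub>R\<^esub> g) j \<otimes> tw j (h (n - j)))"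
    by (rule coeff_mult[OF mult_R_closed[OF f g] order_ge_mult[OF f k g l] h p]) auto
  also have "\<dots> = (\<Oplus>j\<in>?J. \<Oplus>i\<in>?I. ?t i j)"
  proof (rule finsum_cong')
    fix j assume j: "j \<in> ?J"
    have "(f \<otimes>\<^bsub>R\<^esub> g) j = (\<Oplus>i\<in>?I. f i \<otimes> tw i (g (j - i)))"
      using j by (intro coeff_mult[OF f k g l]) auto
    then show "(f \<otimes>\<^bsub>R\<^esub> g) j \<otimes> tw j (h (n - j)) = (\<Oplus>i\<in>?I. ?t i j)"
      using c by (simp add: finsum_ldistr tw_hom Pi_iff)
  qed (auto intro!: finsum_closed simp: c tw_hom)
  also have "\<dots> = (\<Oplus>i\<in>?I. \<Oplus>j\<in>?J. ?t i j)"
    by (rule finsum_swap) (auto simp: c tw_hom)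
  also have "\<dots> = (\<Oplus>i\<in>?I. f i \<otimes> tw i ((g \<otimes>\<^bsub>R\<^esub> h) (n - i)))"
  proof (rule finsum_cong')
    fix i assume i: "i \<in> ?I"
    have im: "(\<lambda>j. j - i) ` ?J = {k + l - i..n - p - i}"
      using image_diff_atLeastAtMost[of i] by (auto simp: image_iff intro: bexI[of _ "_ + i"])
    have "(g \<otimes>\<^bsub>R\<^esub> h) (n - i) = (\<Oplus>m\<in>(\<lambda>j. j - i) ` ?J. g m \<otimes> tw m (h (n - i - m)))"
      using i unfolding im by (intro coeff_mult[OF g l h p]) auto
    also have "\<dots> = (\<Oplus>j\<in>?J. g (j - i) \<otimes> tw (j - i) (h (n - i - (j - i))))"
      by (rule finsum_reindex) (auto simp: c tw_hom inj_on_def)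
    also have "\<dots> = (\<Oplus>j\<in>?J. g (j - i) \<otimes> tw (j - i) (h (n - j)))"
      by simp
    finally have "tw i ((g \<otimes>\<^bsub>R\<^esub> h) (n - i)) = (\<Oplus>j\<in>?J. tw i (g (j - i) \<otimes> tw (j - i) (h (n - j))))"
      using c by (simp add: tw_finsum tw_hom Pi_iff)
    also have "\<dots> = (\<Oplus>j\<in>?J. tw i (g (j - i)) \<otimes> tw j (h (n - j)))"
      by (rule finsum_cong') (auto simp: c tw_hom tw_add[symmetric])
    finally show "(\<Oplus>j\<in>?J. ?t i j) = f i \<otimes> tw i ((g \<otimes>\<^bsub>R\<^esub> h) (n - i))"
      using c by (simp add: finsum_rdistr tw_hom Pi_iff m_assoc)
  qed (auto simp: c tw_hom coeff_closed mult_R_closed g h)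
  also have "\<dots> = (f \<otimes>\<^bsub>R\<^esub> (g \<otimes>\<^bsub>R\<^esub> h)) n"
    by (rule coeff_mult[OF f k mult_R_closed[OF g h] order_ge_mult[OF g l h p], symmetric]) auto
  finally show "((f \<otimes>\<^bsub>R\<^esub> g) \<otimes>\<^bsub>R\<^esub> h) n = (f \<otimes>\<^bsub>R\<^esub> (g \<otimes>\<^bsub>R\<^esub> h)) n" .
qed

lemma mult_R_distr:
  assumes f: "f \<in> carrier R" and g: "g \<in> carrier R" and h: "h \<in> carrier R"
  shows "(f \<oplus>\<^bsub>R\<^esub> g) \<otimes>\<^bsub>R\<^esub> h = f \<otimes>\<^bsub>R\<^esub> h \<oplus>\<^bsub>R\<^esub> g \<otimes>\<^bsub>R\<^esub> h"
    "h \<otimes>\<^bsub>R\<^esub> (f \<oplus>\<^bsub>R\<^esub> g) = h \<otimes>\<^bsub>R\<^esub> f \<oplus>\<^bsub>R\<^esub> h \<otimes>\<^bsub>R\<^esub> g"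
proof -
  note c = coeff_closed[OF f] coeff_closed[OF g] coeff_closed[OF h]
  obtain k l where k: "order_ge k f" "order_ge k g" and l: "order_ge l h" using order_ge_common[OF f g] ex_ge[OF h] by blast
  have k': "order_ge k (f \<oplus>\<^bsub>R\<^esub> g)" using k by (simp add: order_ge_def coeff_add)
  note fg = add_R_closed[OF f g]
  show "(f \<oplus>\<^bsub>R\<^esub> g) \<otimes>\<^bsub>R\<^esub> h = f \<otimes>\<^bsub>R\<^esub> h \<oplus>\<^bsub>R\<^esub> g \<otimes>\<^bsub>R\<^esub> h"
  proof
    fix n
    note e = coeff_mult[OF _ _ h l finite_atLeastAtMost_int subset_refl, of _ k n]
    show "((f \<oplus>\<^bsub>R\<^esub> g) \<otimes>\<^bsub>R\<^esub> h) n = (f \<otimes>\<^bsub>R\<^esub> h \<oplus>\<^bsub>R\<^esub> g \<otimes>\<^bsub>R\<^esub> h) n"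
      unfolding coeff_add e[OF f k(1)] e[OF g k(2)] e[OF fg k']
      using c by (subst finsum_addf[symmetric]) (auto simp: tw_hom l_distr intro!: finsum_cong')
  qed
  show "h \<otimes>\<^bsub>R\<^esub> (f \<oplus>\<^bsub>R\<^esub> g) = h \<otimes>\<^bsub>R\<^esub> f \<oplus>\<^bsub>R\<^esub> h \<otimes>\<^bsub>R\<^esub> g"
  proof
    fix n
    note e = coeff_mult[OF h l _ _ finite_atLeastAtMost_int subset_refl, of _ k n]
    show "(h \<otimes>\<^bsub>R\<^esub> (f \<oplus>\<^bsub>R\<^esub> g)) n = (h \<otimes>\<^bsub>R\<^esub> f \<oplus>\<^bsub>R\<^esub> h \<otimes>\<^bsub>R\<^esub> g) n"
      unfolding coeff_add e[OF f k(1)] e[OF g k(2)] e[OF fg k']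
      using c by (subst finsum_addf[symmetric]) (auto simp: tw_hom r_distr intro!: finsum_cong')
  qed
qed

definition monomial :: "'a \<Rightarrow> int \<Rightarrow> int \<Rightarrow> 'a" where
  "monomial a k = (\<lambda>i. if i = k then a else \<zero>)"

lemma order_ge_monomial: "order_ge k (monomial a k)"
  by (simp add: order_ge_def monomial_def)

lemma monomial_closed: "a \<in> carrier D \<Longrightarrow> monomial a k \<in> carrier R"
  using order_ge_monomial by (auto simp: carrier_R monomial_def)

lemma coeff_mult_monomial:
  assumes f: "f \<in> carrier R" and a: "a \<in> carrier D"
  shows "(f \<otimes>\<^bsub>R\<^esub> monomial a k) n = f (n - k) \<otimes> tw (n - k) a"
proof -
  obtain l where l: "order_ge l f" using ex_ge f by blast
  note c = coeff_closed[OF f]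
  have "(f \<otimes>\<^bsub>R\<^esub> monomial a k) n = (\<Oplus>i\<in>{l..n-k} \<union> {n-k}. f i \<otimes> tw i (monomial a k (n - i)))"
    by (rule coeff_mult[OF f l monomial_closed[OF a] order_ge_monomial]) auto
  also have "\<dots> = (\<Oplus>i\<in>{n-k}. f i \<otimes> tw i (monomial a k (n - i)))"
    by (rule add.finprod_mono_neutral_cong_right) (use c a in \<open>auto simp: monomial_def tw_hom\<close>)
  also have "\<dots> = f (n - k) \<otimes> tw (n - k) a"
    using c a by (simp add: monomial_def tw_hom)
  finally show ?thesis .
qed

lemma coeff_monomial_mult:
  assumes f: "f \<in> carrier R" and a: "a \<in> carrier D"
  shows "(monomial a k \<otimes>\<^bsub>R\<^esub> f) n = a \<otimes> tw k (f (n - k))"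
proof -
  obtain l where l: "order_ge l f" using ex_ge f by blast
  note c = coeff_closed[OF f]
  have "(monomial a k \<otimes>\<^bsub>R\<^esub> f) n = (\<Oplus>i\<in>{k..n-l} \<union> {k}. monomial a k i \<otimes> tw i (f (n - i)))"
    by (rule coeff_mult[OF monomial_closed[OF a] order_ge_monomial f l]) auto
  also have "\<dots> = (\<Oplus>i\<in>{k}. monomial a k i \<otimes> tw i (f (n - i)))"
    by (rule add.finprod_mono_neutral_cong_right) (use c a in \<open>auto simp: monomial_def tw_hom\<close>)
  also have "\<dots> = a \<otimes> tw k (f (n - k))"
    using c a by (simp add: monomial_def tw_hom)
  finally show ?thesis .
qed

lemma one_R_monomial: "\<one>\<^bsub>R\<^esub> = monomial \<one> 0"
  by (simp add: one_R monomial_def)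

lemma ring_R: "ring R"
proof (rule ringI)
  show "abelian_group R"
  proof (rule abelian_groupI)
    show "\<exists>g\<in>carrier R. g \<oplus>\<^bsub>R\<^esub> f = \<zero>\<^bsub>R\<^esub>" if f: "f \<in> carrier R" for f
    proof
      show "(\<lambda>i. \<ominus> f i) \<in> carrier R" using f by (auto simp: carrier_R order_ge_def)
      show "(\<lambda>i. \<ominus> f i) \<oplus>\<^bsub>R\<^esub> f = \<zero>\<^bsub>R\<^esub>"
        using coeff_closed[OF f] by (auto simp: add_R zero_R l_neg)
    qed
    show "\<zero>\<^bsub>R\<^esub> \<in> carrier R" by (auto simp: carrier_R zero_R order_ge_def)
    fix f g h assume f: "f \<in> carrier R" and g: "g \<in> carrier R"
    show "f \<oplus>\<^bsub>R\<^esub> g \<in> carrier R" using f g by (rule add_R_closed)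
    show "\<zero>\<^bsub>R\<^esub> \<oplus>\<^bsub>R\<^esub> f = f" using coeff_closed[OF f] by (simp add: add_R zero_R)
    show "f \<oplus>\<^bsub>R\<^esub> g = g \<oplus>\<^bsub>R\<^esub> f"
      unfolding add_R by (rule ext) (rule a_comm[OF coeff_closed[OF f] coeff_closed[OF g]])
    assume h: "h \<in> carrier R"
    show "f \<oplus>\<^bsub>R\<^esub> g \<oplus>\<^bsub>R\<^esub> h = f \<oplus>\<^bsub>R\<^esub> (g \<oplus>\<^bsub>R\<^esub> h)"
      unfolding add_R by (rule ext) (rule a_assoc[OF coeff_closed[OF f] coeff_closed[OF g] coeff_closed[OF h]])
  qed
  show "monoid R"
  proof (rule monoidI)
    show "\<one>\<^bsub>R\<^esub> \<in> carrier R" by (simp add: one_R_monomial monomial_closed)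
    show "\<one>\<^bsub>R\<^esub> \<otimes>\<^bsub>R\<^esub> f = f" if "f \<in> carrier R" for f
      using that by (auto simp: one_R_monomial coeff_monomial_mult coeff_closed)
    show "f \<otimes>\<^bsub>R\<^esub> \<one>\<^bsub>R\<^esub> = f" if "f \<in> carrier R" for f
      using that by (auto simp: one_R_monomial coeff_mult_monomial coeff_closed tw_hom)
  qed (auto simp: mult_R_closed mult_R_assoc)
qed (auto simp: mult_R_distr)

end

sublocale skew_laurent_ring \<subseteq> R: ring "skew_laurent D \<sigma>"
  by (rule ring_R)

context skew_laurent_ring begin

lemma coeff_uminus: "f \<in> carrier R \<Longrightarrow> (\<ominus>\<^bsub>R\<^esub> f) i = \<ominus> (f i)"
  by (metis R.a_inv_closed R.l_neg coeff_add coeff_closed coeff_zero minus_equality)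

lemma coeff_minus: "f \<in> carrier R \<Longrightarrow> g \<in> carrier R \<Longrightarrow> (f \<ominus>\<^bsub>R\<^esub> g) i = f i \<ominus> g i"
  by (simp add: a_minus_def coeff_add coeff_uminus)

lemma order_ge_add: "order_ge k f \<Longrightarrow> order_ge k g \<Longrightarrow> order_ge k (f \<oplus>\<^bsub>R\<^esub> g)"
  by (simp add: order_ge_def coeff_add)

lemma order_ge_minus: "f \<in> carrier R \<Longrightarrow> g \<in> carrier R \<Longrightarrow> order_ge k f \<Longrightarrow> order_ge k g \<Longrightarrow> order_ge k (f \<ominus>\<^bsub>R\<^esub> g)"
  by (simp add: order_ge_def coeff_minus r_right_minus_eq)

lemma coeff_finsum: "f \<in> A \<rightarrow> carrier R \<Longrightarrow> finsum R f A i = (\<Oplus>a\<in>A. f a i)"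
proof (induction A rule: infinite_finite_induct)
  case (insert x A)
  then have "f x \<in> carrier R" "f \<in> A \<rightarrow> carrier R" "(\<lambda>a. f a i) \<in> A \<rightarrow> carrier D" "f x i \<in> carrier D"
    by (auto simp: coeff_closed Pi_iff)
  with insert show ?case by (simp add: coeff_add)
qed simp_all

lemma order_ge_suc: "order_ge k f \<Longrightarrow> f k = \<zero> \<Longrightarrow> order_ge (k + 1) f"
  by (auto simp: order_ge_def order.order_iff_strict)

lemma eq_zero_if_ge: "(\<And>n. order_ge (k + int n) f) \<Longrightarrow> f = \<zero>\<^bsub>R\<^esub>"
proof
  fix i assume *: "\<And>n. order_ge (k + int n) f"
  have "i < k + int (nat (i + 1 - k))" by simp
  from order_geD[OF * this] show "f i = \<zero>\<^bsub>R\<^esub> i" by simp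
qed

lemma ex_order:
  assumes f: "f \<in> carrier R" "f \<noteq> \<zero>\<^bsub>R\<^esub>"
  shows "\<exists>k. order_ge k f \<and> f k \<noteq> \<zero>"
proof (rule ccontr)
  assume *: "\<nexists>k. order_ge k f \<and> f k \<noteq> \<zero>"
  obtain k where k: "order_ge k f" using ex_ge f by blast
  have "order_ge (k + int n) f" for n
  proof (induction n)
    case (Suc n)
    then have "order_ge (k + int n + 1) f" using * order_ge_suc by blast
    then show ?case by (simp add: algebra_simps)
  qed (simp add: k)
  then show False using eq_zero_if_ge f by blast
qed

lemma R_no_zero_divisors:
  assumes f: "f \<in> carrier R" and g: "g \<in> carrier R" and fg: "f \<otimes>\<^bsub>R\<^esub> g = \<zero>\<^bsub>R\<^esub>"
  shows "f = \<zero>\<^bsub>R\<^esub> \<or> g = \<zero>\<^bsub>R\<^esub>"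
proof (rule ccontr)
  assume "\<not> ?thesis"
  then obtain k l where kl: "order_ge k f" "f k \<noteq> \<zero>" "order_ge l g" "g l \<noteq> \<zero>"
    using ex_order f g by metis
  have "f k \<otimes> tw k (g l) = \<zero>"
    using lowest_coeff_mult[OF f kl(1) g kl(3)] fg by simp
  then show False
    using kl coeff_closed f g tw_hom(1) tw_eq_zero integral by metis
qed

lemma R_one_not_zero: "\<one>\<^bsub>R\<^esub> \<noteq> \<zero>\<^bsub>R\<^esub>"
proof
  assume "\<one>\<^bsub>R\<^esub> = \<zero>\<^bsub>R\<^esub>"
  then have "\<one>\<^bsub>R\<^esub> 0 = \<zero>\<^bsub>R\<^esub> 0" by simp
  then show False by (simp add: one_R)
qed

lemma monomial_nonzero:
  assumes "a \<noteq> \<zero>" shows "monomial a k \<noteq> \<zero>\<^bsub>R\<^esub>"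
proof
  assume "monomial a k = \<zero>\<^bsub>R\<^esub>"
  then have "monomial a k k = \<zero>\<^bsub>R\<^esub> k" by simp
  then show False using assms by (simp add: monomial_def)
qed

text \<open>The coefficient of \<open>x^0\<close> in \<open>t r\<close> is a multiple of \<open>t\<close>.\<close>

lemma monomial_not_right_invertible:
  assumes t: "t \<in> carrier D" "\<And>u. u \<in> carrier D \<Longrightarrow> t \<otimes> u \<noteq> \<one>" and r: "r \<in> carrier R"
  shows "monomial t 0 \<otimes>\<^bsub>R\<^esub> r \<noteq> \<one>\<^bsub>R\<^esub>"
proof
  assume "monomial t 0 \<otimes>\<^bsub>R\<^esub> r = \<one>\<^bsub>R\<^esub>"
  then have "t \<otimes> r 0 = \<one>" using coeff_monomial_mult[OF r t(1), of 0 0] by (simp add: one_R)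
  then show False using t(2) coeff_closed[OF r] by blast
qed

lemma monomial_mult: "a \<in> carrier D \<Longrightarrow> b \<in> carrier D \<Longrightarrow> monomial a k \<otimes>\<^bsub>R\<^esub> monomial b l = monomial (a \<otimes> tw k b) (k + l)"
  by (rule ext) (simp add: coeff_mult_monomial monomial_closed, simp add: monomial_def tw_hom)

lemma monomial_unit: "monomial \<one> k \<otimes>\<^bsub>R\<^esub> monomial \<one> (- k) = \<one>\<^bsub>R\<^esub>" "monomial \<one> (- k) \<otimes>\<^bsub>R\<^esub> monomial \<one> k = \<one>\<^bsub>R\<^esub>"
  by (simp_all add: monomial_mult tw_hom one_R_monomial)

end

section \<open>Right ideals and their ideals of lowest coefficients\<close>

context dedekind begin

text \<open>The dual basis with its denominators cleared: coordinate functions \<open>h j\<close> that are \<open>D\<close>-linear on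
\<open>L\<close>.\<close>

lemma projective_coordinates:
  assumes L: "ideal L D" "L \<noteq> {\<zero>}"
  shows "\<exists>(n::nat) l h. (\<forall>j<n. l j \<in> L) \<and> (\<forall>j<n. \<forall>a\<in>L. h j a \<in> carrier D) \<and>
    (\<forall>j<n. \<forall>a\<in>L. \<forall>b\<in>L. h j (a \<oplus> b) = h j a \<oplus> h j b) \<and>
    (\<forall>j<n. \<forall>a\<in>L. \<forall>r\<in>carrier D. h j (a \<otimes> r) = h j a \<otimes> r) \<and>
    (\<forall>a\<in>L. (\<Oplus>j\<in>{..<n}. l j \<otimes> h j a) = a)"
proof -
  have Lc: "\<And>a. a \<in> L \<Longrightarrow> a \<in> carrier D" using ideal.Icarr[OF L(1)] by auto
  obtain n l y d where "dual_basis L n l y d" using ex_dual_basis[OF L] by blast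
  note * = dual_basisD[OF this]
  define h where "h j a = (SOME z. z \<in> carrier D \<and> y j \<otimes> a = d \<otimes> z)" for j a
  have h: "h j a \<in> carrier D \<and> y j \<otimes> a = d \<otimes> h j a" if "j < n" "a \<in> L" for j a
    unfolding h_def by (rule someI_ex) (use *(6)[OF that] in blast)
  have uniq: "h j a = z" if "j < n" "a \<in> L" "z \<in> carrier D" "y j \<otimes> a = d \<otimes> z" for j a z
    using h[OF that(1,2)] that(3,4) *(1,2) m_lcancel by metis
  have add: "h j (a \<oplus> b) = h j a \<oplus> h j b" if "j < n" "a \<in> L" "b \<in> L" for j a b
  proof (rule uniq)
    show "a \<oplus> b \<in> L" using that L(1) additive_subgroup.a_closed ideal.axioms(1) by metis
    show "y j \<otimes> (a \<oplus> b) = d \<otimes> (h j a \<oplus> h j b)"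
      using that h[of j a] h[of j b] *(1) *(4)[OF that(1)] Lc by (simp add: r_distr)
  qed (use that h in auto)
  have mult: "h j (a \<otimes> r) = h j a \<otimes> r" if "j < n" "a \<in> L" "r \<in> carrier D" for j a r
  proof (rule uniq)
    show "a \<otimes> r \<in> L" using that L(1) ideal.I_r_closed by metis
    show "y j \<otimes> (a \<otimes> r) = d \<otimes> (h j a \<otimes> r)"
      using that h[of j a] *(1) *(4)[OF that(1)] Lc by (simp add: m_assoc[symmetric])
  qed (use that h in auto)
  have sum: "(\<Oplus>j\<in>{..<n}. l j \<otimes> h j a) = a" if a: "a \<in> L" for a
  proof -
    have lc: "j < n \<Longrightarrow> l j \<in> carrier D" for j using *(3) Lc by blast
    have "d \<otimes> (\<Oplus>j\<in>{..<n}. l j \<otimes> h j a) = (\<Oplus>j\<in>{..<n}. d \<otimes> (l j \<otimes> h j a))"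
      using lc *(1) h a by (intro finsum_rdistr) auto
    also have "\<dots> = (\<Oplus>j\<in>{..<n}. (l j \<otimes> y j) \<otimes> a)"
      by (rule finsum_cong') (use lc *(1,4) Lc[OF a] h[OF _ a] in \<open>auto simp: m_assoc m_lcomm\<close>)
    also have "\<dots> = d \<otimes> a"
      unfolding *(5)[symmetric] using lc *(4) Lc[OF a] by (intro finsum_ldistr[symmetric]) auto
    finally show ?thesis
      using *(1,2) Lc[OF a] lc h[OF _ a] by (subst (asm) m_lcancel) auto
  qed
  show ?thesis
    by (rule exI[of _ n], rule exI[of _ l], rule exI[of _ h]) (use *(3) h add mult sum in auto)
qed

end

locale skew_dedekind = dedekind D + skew_laurent_ring D \<sigma> for D (structure) and \<sigma>
begin

text \<open>Because \<open>x\<close> is a unit, restricting to order at least \<open>0\<close> loses no lowest coefficient. The elements of higher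
order contribute \<open>0\<close>.\<close>

definition lead :: "(int \<Rightarrow> 'a) set \<Rightarrow> 'a set" where
  "lead I = (\<lambda>f. f 0) ` {f \<in> I. order_ge 0 f}"

lemma lead_mono: "I \<subseteq> J \<Longrightarrow> lead I \<subseteq> lead J"
  by (auto simp: lead_def)

lemma monomial_shift: "f \<in> carrier R \<Longrightarrow> (f \<otimes>\<^bsub>R\<^esub> monomial \<one> k) n = f (n - k)"
  by (simp add: coeff_mult_monomial tw_hom coeff_closed)

lemma lead_coeff:
  assumes I: "right_ideal I R" and f: "f \<in> I" "order_ge k f" shows "f k \<in> lead I"
proof -
  have fc: "f \<in> carrier R" using R.right_ideal_carrier[OF I f(1)] .
  let ?g = "f \<otimes>\<^bsub>R\<^esub> monomial \<one> (- k)"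
  have "?g \<in> I" using R.right_ideal_mult[OF I f(1)] monomial_closed by simp
  moreover have "order_ge 0 ?g" using f(2) fc by (simp add: order_ge_def monomial_shift)
  moreover have "?g 0 = f k" using fc by (simp add: monomial_shift)
  ultimately show ?thesis unfolding lead_def by (metis (mono_tags, lifting) image_eqI mem_Collect_eq)
qed

lemma ideal_lead:
  assumes I: "right_ideal I R" shows "ideal (lead I) D"
proof -
  note Ic = R.right_ideal_carrier[OF I]
  have "right_ideal (lead I) D"
  proof (rule right_idealI)
    show "lead I \<subseteq> carrier D" using Ic coeff_closed by (auto simp: lead_def)
    show "\<zero> \<in> lead I"
      using lead_coeff[OF I R.right_ideal_zero[OF I], of 0] by (simp add: order_ge_def)
    show "x \<oplus> y \<in> lead I" if xy: "x \<in> lead I" "y \<in> lead I" for x y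
    proof -
      obtain f g where "f \<in> I" "order_ge 0 f" "x = f 0" "g \<in> I" "order_ge 0 g" "y = g 0"
        using xy by (auto simp: lead_def)
      then show ?thesis
        using lead_coeff[OF I R.right_ideal_add[OF I, of f g] order_ge_add[of 0 f g]] by (simp add: coeff_add)
    qed
    show "x \<otimes> d \<in> lead I" if x: "x \<in> lead I" and d: "d \<in> carrier D" for x d
    proof -
      obtain f where f: "f \<in> I" "order_ge 0 f" "x = f 0" using x by (auto simp: lead_def)
      have g: "order_ge 0 (f \<otimes>\<^bsub>R\<^esub> monomial d 0)"
        using order_ge_mult[OF Ic[OF f(1)] f(2) monomial_closed[OF d] order_ge_monomial] by simp
      show ?thesis
        using lead_coeff[OF I R.right_ideal_mult[OF I f(1) monomial_closed[OF d]] g] f d Ic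
        by (simp add: coeff_mult_monomial)
    qed
  qed
  then show ?thesis by (simp add: ideal_iff_right_ideal)
qed

lemma lead_nonzero:
  assumes I: "right_ideal I R" "I \<noteq> {\<zero>\<^bsub>R\<^esub>}" shows "lead I \<noteq> {\<zero>}"
proof -
  obtain f where f: "f \<in> I" "f \<noteq> \<zero>\<^bsub>R\<^esub>" using I R.right_ideal_zero[OF I(1)] by auto
  then obtain k where k: "order_ge k f" "f k \<noteq> \<zero>" using ex_order R.right_ideal_carrier[OF I(1)] by metis
  then show ?thesis using lead_coeff[OF I(1) f(1) k(1)] by auto
qed

text \<open>For an ideal \<open>L\<close> this is the induced right ideal \<open>L((x))\<close>, the standard right ideal with \<open>L\<close> as its
ideal of lowest coefficients.\<close>

definition coeffs_in :: "'a set \<Rightarrow> (int \<Rightarrow> 'a) set" where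
  "coeffs_in L = {f \<in> carrier R. \<forall>i. f i \<in> L}"

lemma right_ideal_coeffs_in:
  assumes L: "ideal L D" shows "right_ideal (coeffs_in L) R"
proof -
  have rL: "right_ideal L D" using L ideal_iff_right_ideal by simp
  show ?thesis
  proof (rule R.right_idealI)
    show "f \<otimes>\<^bsub>R\<^esub> r \<in> coeffs_in L" if f: "f \<in> coeffs_in L" and r: "r \<in> carrier R" for f r
    proof -
      have fc: "f \<in> carrier R" "\<And>i. f i \<in> L" using f by (auto simp: coeffs_in_def)
      obtain k l where kl: "order_ge k f" "order_ge l r" using ex_ge[OF fc(1)] ex_ge[OF r] by blast
      have t: "tw i (r j) \<in> carrier D" for i j using tw_hom(1) coeff_closed[OF r] by blast
      have "(f \<otimes>\<^bsub>R\<^esub> r) n \<in> L" for n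
        unfolding coeff_mult[OF fc(1) kl(1) r kl(2) finite_atLeastAtMost_int subset_refl]
        by (rule right_ideal_finsum[OF rL]) (intro right_ideal_mult[OF rL] fc t)
      then show ?thesis using fc r by (simp add: coeffs_in_def)
    qed
  qed (auto simp: coeffs_in_def right_ideal_zero[OF rL] right_ideal_add[OF rL] coeff_add)
qed

text \<open>An \<open>R\<close>-linear map defined on \<open>L((x))\<close> that does not change lowest terms.\<close>

definition lifting :: "'a set \<Rightarrow> ((int \<Rightarrow> 'a) \<Rightarrow> (int \<Rightarrow> 'a)) \<Rightarrow> bool" where
  "lifting L S \<longleftrightarrow> (\<forall>f\<in>coeffs_in L. S f \<in> carrier R) \<and>
     (\<forall>f\<in>coeffs_in L. \<forall>g\<in>coeffs_in L. S (f \<oplus>\<^bsub>R\<^esub> g) = S f \<oplus>\<^bsub>R\<^esub> S g) \<and>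
     (\<forall>f\<in>coeffs_in L. \<forall>r\<in>carrier R. S (f \<otimes>\<^bsub>R\<^esub> r) = S f \<otimes>\<^bsub>R\<^esub> r) \<and>
     (\<forall>f\<in>coeffs_in L. \<forall>k. order_ge k f \<longrightarrow> order_ge k (S f) \<and> S f k = f k)"

lemma
  assumes L: "ideal L D" and S: "lifting L S"
  shows lifting_closed: "f \<in> coeffs_in L \<Longrightarrow> S f \<in> carrier R"
    and lifting_minus: "f \<in> coeffs_in L \<Longrightarrow> g \<in> coeffs_in L \<Longrightarrow> S (f \<ominus>\<^bsub>R\<^esub> g) = S f \<ominus>\<^bsub>R\<^esub> S g"
    and lifting_zero: "S \<zero>\<^bsub>R\<^esub> = \<zero>\<^bsub>R\<^esub>"
    and lifting_inj: "inj_on S (coeffs_in L)"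
proof -
  note RL = right_ideal_coeffs_in[OF L]
  show c: "f \<in> coeffs_in L \<Longrightarrow> S f \<in> carrier R" for f using S by (auto simp: lifting_def)
  show m: "S (f \<ominus>\<^bsub>R\<^esub> g) = S f \<ominus>\<^bsub>R\<^esub> S g" if f: "f \<in> coeffs_in L" and g: "g \<in> coeffs_in L" for f g
  proof -
    have fg: "f \<in> carrier R" "g \<in> carrier R" using f g by (auto simp: coeffs_in_def)
    have d: "f \<ominus>\<^bsub>R\<^esub> g \<in> coeffs_in L" using R.right_ideal_minus[OF RL f g] .
    have "f = (f \<ominus>\<^bsub>R\<^esub> g) \<oplus>\<^bsub>R\<^esub> g" using fg by (simp add: a_minus_def R.a_assoc R.l_neg)
    then have "S f = S (f \<ominus>\<^bsub>R\<^esub> g) \<oplus>\<^bsub>R\<^esub> S g" using S d g unfolding lifting_def by metis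
    then show ?thesis using c[OF d] c[OF g] by (simp add: a_minus_def R.a_assoc R.r_neg)
  qed
  have z: "\<zero>\<^bsub>R\<^esub> \<in> coeffs_in L" using R.right_ideal_zero[OF RL] .
  show z0: "S \<zero>\<^bsub>R\<^esub> = \<zero>\<^bsub>R\<^esub>"
    using m[OF z z] c[OF z] by (simp add: R.r_right_minus_eq[THEN iffD2])
  show "inj_on S (coeffs_in L)"
  proof (rule inj_onI)
    fix f g assume f: "f \<in> coeffs_in L" and g: "g \<in> coeffs_in L" and e: "S f = S g"
    have fg: "f \<in> carrier R" "g \<in> carrier R" using f g by (auto simp: coeffs_in_def)
    let ?d = "f \<ominus>\<^bsub>R\<^esub> g"
    have d: "?d \<in> coeffs_in L" using R.right_ideal_minus[OF RL f g] .
    have Sd: "S ?d = \<zero>\<^bsub>R\<^esub>" using m[OF f g] e c[OF g] by simp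
    have "?d = \<zero>\<^bsub>R\<^esub>"
    proof (rule ccontr)
      assume "?d \<noteq> \<zero>\<^bsub>R\<^esub>"
      then obtain k where "order_ge k ?d" "?d k \<noteq> \<zero>" using ex_order fg by blast
      then show False using S d Sd unfolding lifting_def by (metis coeff_zero)
    qed
    then show "f = g" using fg by simp
  qed
qed

text \<open>Successive approximation. If \<open>g - S f\<close> has order at least \<open>k\<close>, its coefficient at \<open>k\<close> lies in
\<open>lead I\<close>, hence in \<open>L\<close>, so it can be removed by adding a monomial to \<open>f\<close>. The monomials have increasing degrees
and sum up to a series. Linearity of \<open>S\<close> does not reach infinite sums, but \<open>S\<close> preserves orders, which is enough to pass to
the limit.\<close>

lemma lifting_surj:
  assumes L: "ideal L D" and S: "lifting L S" and I: "right_ideal I R" 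
    and SI: "\<And>f. f \<in> coeffs_in L \<Longrightarrow> S f \<in> I" and lead: "lead I \<subseteq> L" and g: "g \<in> I"
  shows "\<exists>f\<in>coeffs_in L. S f = g"
proof -
  note RL = right_ideal_coeffs_in[OF L]
  have Lz: "\<zero> \<in> L" using right_ideal_zero L ideal_iff_right_ideal by blast
  have gc: "g \<in> carrier R" using R.right_ideal_carrier[OF I g] .
  obtain k where k: "order_ge k g" using ex_ge[OF gc] by blast
  \<comment> \<open>The partial sums of the approximation. Step \<open>m\<close> corrects the coefficient at \<open>k + m\<close>.\<close>
  define F where "F = rec_nat \<zero>\<^bsub>R\<^esub> (\<lambda>m f. f \<oplus>\<^bsub>R\<^esub> monomial ((g \<ominus>\<^bsub>R\<^esub> S f) (k + int m)) (k + int m))"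
  have F0: "F 0 = \<zero>\<^bsub>R\<^esub>" by (simp add: F_def)
  have FS: "F (Suc m) = F m \<oplus>\<^bsub>R\<^esub> monomial ((g \<ominus>\<^bsub>R\<^esub> S (F m)) (k + int m)) (k + int m)" for m by (simp add: F_def)
  have inv: "F m \<in> coeffs_in L \<and> order_ge (k + int m) (g \<ominus>\<^bsub>R\<^esub> S (F m)) \<and> order_ge k (F m)" for m
  proof (induction m)
    case 0
    have "g \<ominus>\<^bsub>R\<^esub> S (F 0) = g"
      unfolding F0 lifting_zero[OF L S] using gc by (simp add: a_minus_def)
    then have "order_ge (k + int 0) (g \<ominus>\<^bsub>R\<^esub> S (F 0))" using k by simp
    moreover have "F 0 \<in> coeffs_in L" unfolding F0 by (rule R.right_ideal_zero[OF RL])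
    moreover have "order_ge k (F 0)" unfolding F0 order_ge_def by simp
    ultimately show ?case by blast
  next
    case (Suc m)
    let ?e = "g \<ominus>\<^bsub>R\<^esub> S (F m)"
    define a where "a = ?e (k + int m)"
    define u where "u = monomial a (k + int m)"
    note Fm = Suc.IH[THEN conjunct1] Suc.IH[THEN conjunct2, THEN conjunct1] Suc.IH[THEN conjunct2, THEN conjunct2]
    have e: "?e \<in> I" by (rule R.right_ideal_minus[OF I g SI[OF Fm(1)]])
    then have aL: "a \<in> L" using lead_coeff[OF I e Fm(2)] lead by (auto simp: a_def)
    then have ac: "a \<in> carrier D" using L ideal.Icarr by metis
    have u: "u \<in> coeffs_in L" using monomial_closed[OF ac] aL Lz by (auto simp: coeffs_in_def u_def monomial_def)
    have Su: "order_ge (k + int m) (S u)" "S u (k + int m) = a"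
      using S u order_ge_monomial unfolding lifting_def u_def by (auto simp: monomial_def)
    have FSu: "F (Suc m) = F m \<oplus>\<^bsub>R\<^esub> u" by (simp add: FS u_def a_def)
    have Fs: "F (Suc m) \<in> coeffs_in L" unfolding FSu using R.right_ideal_add[OF RL] Fm u by auto
    have SFs: "S (F (Suc m)) = S (F m) \<oplus>\<^bsub>R\<^esub> S u" unfolding FSu using S Fm u by (simp add: lifting_def)
    have cc: "S (F m) \<in> carrier R" "S u \<in> carrier R" "?e \<in> carrier R"
      using lifting_closed[OF L S] Fm u gc by auto
    have ee: "g \<ominus>\<^bsub>R\<^esub> S (F (Suc m)) = ?e \<ominus>\<^bsub>R\<^esub> S u"
      unfolding SFs using gc cc by (simp add: a_minus_def R.minus_add R.a_assoc)
    have "order_ge (k + int m + 1) (?e \<ominus>\<^bsub>R\<^esub> S u)"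
    proof (rule order_ge_suc)
      show "order_ge (k + int m) (?e \<ominus>\<^bsub>R\<^esub> S u)" using order_ge_minus[OF cc(3,2) Fm(2) Su(1)] .
      show "(?e \<ominus>\<^bsub>R\<^esub> S u) (k + int m) = \<zero>"
        using cc ac by (simp add: coeff_minus[OF cc(3,2)] Su(2) a_def[symmetric] r_right_minus_eq)
    qed
    moreover have "order_ge k (F (Suc m))"
      unfolding FSu u_def by (rule order_ge_add[OF Fm(3) order_ge_mono[OF order_ge_monomial]]) simp
    moreover have "k + int (Suc m) = k + int m + 1" by simp
    ultimately show ?case using Fs by (simp only: ee)
  qed
  have FSi: "F (Suc m) i = F m i" if "i \<noteq> k + int m" for m i
  proof -
    have "F m \<in> carrier R" using inv[of m] unfolding coeffs_in_def by blast
    then have "F m i \<in> carrier D" by (rule coeff_closed)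
    moreover have "monomial a (k + int m) i = \<zero>" for a using that by (simp add: monomial_def)
    ultimately show ?thesis unfolding FS coeff_add by simp
  qed
  define f where "f i = F (Suc (nat (i - k))) i" for i
  have stab: "F (nat (i - k) + 1 + m) i = f i" for i m
  proof (induction m)
    case (Suc m)
    have "i \<noteq> k + int (nat (i - k) + 1 + m)" by linarith
    then show ?case using Suc FSi by simp
  qed (simp add: f_def)
  have fF: "f i = F m i" if "i < k + int m" for i m
  proof -
    have "m = nat (i - k) + 1 + (m - (nat (i - k) + 1)) \<or> i < k" using that by linarith
    then show ?thesis
    proof
      assume "m = nat (i - k) + 1 + (m - (nat (i - k) + 1))"
      then show ?thesis using stab by metis
    next
      assume "i < k"
      then show ?thesis using inv order_geD unfolding f_def by metis
    qed
  qed
  have f: "f \<in> coeffs_in L"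
  proof -
    have "f i \<in> L" for i using inv[of "Suc (nat (i - k))"] unfolding f_def coeffs_in_def by blast
    moreover have "order_ge k f" using inv[of 0] fF[of _ 0] by (auto simp: order_ge_def F0)
    moreover have "f i \<in> carrier D" for i using calculation(1) L ideal.Icarr by metis
    ultimately show ?thesis by (auto simp: coeffs_in_def carrier_R)
  qed
  have fc: "f \<in> carrier R" "S f \<in> carrier R" using f lifting_closed[OF L S] by (auto simp: coeffs_in_def)
  have "order_ge (k + int m) (g \<ominus>\<^bsub>R\<^esub> S f)" for m
  proof -
    have Fm: "F m \<in> coeffs_in L" "order_ge (k + int m) (g \<ominus>\<^bsub>R\<^esub> S (F m))" using inv by auto
    have Fc: "F m \<in> carrier R" "S (F m) \<in> carrier R" using Fm lifting_closed[OF L S] by (auto simp: coeffs_in_def)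
    let ?d = "f \<ominus>\<^bsub>R\<^esub> F m"
    have "order_ge (k + int m) ?d" using fF fc Fc by (simp add: order_ge_def coeff_minus coeff_closed r_right_minus_eq)
    moreover have "?d \<in> coeffs_in L" using R.right_ideal_minus[OF RL f Fm(1)] .
    ultimately have "order_ge (k + int m) (S f \<ominus>\<^bsub>R\<^esub> S (F m))"
      using S lifting_minus[OF L S f Fm(1)] unfolding lifting_def by metis
    then have "order_ge (k + int m) ((g \<ominus>\<^bsub>R\<^esub> S (F m)) \<ominus>\<^bsub>R\<^esub> (S f \<ominus>\<^bsub>R\<^esub> S (F m)))"
      using order_ge_minus Fm fc Fc gc by simp
    moreover have "(g \<ominus>\<^bsub>R\<^esub> S (F m)) \<ominus>\<^bsub>R\<^esub> (S f \<ominus>\<^bsub>R\<^esub> S (F m)) = g \<ominus>\<^bsub>R\<^esub> S f"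
      using fc Fc gc by (simp add: a_minus_def R.minus_add R.a_assoc R.a_comm[of "\<ominus>\<^bsub>R\<^esub> S f"] R.r_neg1)
    ultimately show ?thesis by simp
  qed
  then have "g \<ominus>\<^bsub>R\<^esub> S f = \<zero>\<^bsub>R\<^esub>" by (rule eq_zero_if_ge)
  then have "S f = g" using fc gc by simp
  then show ?thesis using f by blast
qed

text \<open>Write \<open>a = \<Sum>j. l j * h j a\<close> on \<open>lead I\<close> with \<open>D\<close>-linear \<open>h j\<close>, and choose
\<open>g j \<in> I\<close> with lowest coefficient \<open>l j\<close>. Applying \<open>h j\<close> to every coefficient is \<open>R\<close>-linear,
since multiplying by \<open>R\<close> from the right only multiplies coefficients by elements of \<open>D\<close>. So \<open>f \<mapsto> \<Sum>j. g j
* h j f\<close> is a lifting with values in \<open>I\<close>.\<close>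

lemma ex_lifting:
  assumes I: "right_ideal I R" "I \<noteq> {\<zero>\<^bsub>R\<^esub>}"
  shows "\<exists>(n::nat) g c. (\<forall>j<n. g j \<in> I) \<and>
    (\<forall>j<n. \<forall>f\<in>coeffs_in (lead I). c j f \<in> carrier R) \<and>
    (\<forall>j<n. \<forall>f\<in>coeffs_in (lead I). \<forall>f'\<in>coeffs_in (lead I). c j (f \<oplus>\<^bsub>R\<^esub> f') = c j f \<oplus>\<^bsub>R\<^esub> c j f') \<and>
    (\<forall>j<n. \<forall>f\<in>coeffs_in (lead I). \<forall>r\<in>carrier R. c j (f \<otimes>\<^bsub>R\<^esub> r) = c j f \<otimes>\<^bsub>R\<^esub> r) \<and>
    lifting (lead I) (\<lambda>f. \<Oplus>\<^bsub>R\<^esub>j\<in>{..<n}. g j \<otimes>\<^bsub>R\<^esub> c j f)"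
proof -
  let ?L = "lead I"
  note L = ideal_lead[OF I(1)] lead_nonzero[OF I]
  have rL: "right_ideal ?L D" using L ideal_iff_right_ideal by blast
  obtain n :: nat and l h where l: "\<forall>j<n. l j \<in> ?L" and h: "\<forall>j<n. \<forall>a\<in>?L. h j a \<in> carrier D"
    and hadd: "\<forall>j<n. \<forall>a\<in>?L. \<forall>b\<in>?L. h j (a \<oplus> b) = h j a \<oplus> h j b"
    and hmult: "\<forall>j<n. \<forall>a\<in>?L. \<forall>r\<in>carrier D. h j (a \<otimes> r) = h j a \<otimes> r"
    and hsum: "\<forall>a\<in>?L. (\<Oplus>j\<in>{..<n}. l j \<otimes> h j a) = a"
    using projective_coordinates[OF L] by blast
  define g where "g j = (SOME f. f \<in> I \<and> order_ge 0 f \<and> f 0 = l j)" for j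
  have g: "g j \<in> I \<and> order_ge 0 (g j) \<and> g j 0 = l j" if "j < n" for j
  proof -
    have "l j \<in> ?L" using l that by blast
    then obtain f where "f \<in> I" "order_ge 0 f" "f 0 = l j" unfolding lead_def by auto
    then have "\<exists>f. f \<in> I \<and> order_ge 0 f \<and> f 0 = l j" by blast
    then show ?thesis unfolding g_def by (rule someI_ex)
  qed
  have gc: "g j \<in> carrier R" if "j < n" for j
    by (rule R.right_ideal_carrier[OF I(1) g[OF that, THEN conjunct1]])
  have h0: "h j \<zero> = \<zero>" if "j < n" for j
  proof -
    note z = right_ideal_zero[OF rL]
    have "h j (\<zero> \<otimes> \<zero>) = h j \<zero> \<otimes> \<zero>" using hmult that z zero_closed by blast
    moreover have "h j \<zero> \<in> carrier D" using h that z by blast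
    ultimately show ?thesis by simp
  qed
  have hfin: "h j (finsum D u A) = (\<Oplus>i\<in>A. h j (u i))" if "j < n" "finite A" "\<forall>i\<in>A. u i \<in> ?L" for j u and A :: "int set"
    using that(2,3)
  proof (induction A)
    case empty
    then show ?case using h0[OF that(1)] by simp
  next
    case (insert x A)
    then have c: "u x \<in> carrier D" "u \<in> A \<rightarrow> carrier D" "(\<lambda>i. h j (u i)) \<in> A \<rightarrow> carrier D"
      "h j (u x) \<in> carrier D"
      using right_ideal_carrier[OF rL] h that(1) by auto
    have "finsum D u A \<in> ?L" by (rule right_ideal_finsum[OF rL]) (use insert in blast)
    with c have "h j (finsum D u (insert x A)) = h j (u x) \<oplus> h j (finsum D u A)"
      using insert hadd that(1) by simp
    also have "\<dots> = (\<Oplus>i\<in>insert x A. h j (u i))" using insert c by simp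
    finally show ?case .
  qed
  define c where "c j f = (\<lambda>i. h j (f i))" for j and f :: "int \<Rightarrow> 'a"
  have fL: "f i \<in> ?L" "f \<in> carrier R" if "f \<in> coeffs_in ?L" for f i using that by (auto simp: coeffs_in_def)
  have cge: "order_ge k (c j f)" if "j < n" "order_ge k f" for j k f using that h0 by (auto simp: order_ge_def c_def)
  have cc: "c j f \<in> carrier R" if "j < n" "f \<in> coeffs_in ?L" for j f
  proof -
    have "\<exists>k. order_ge k f" by (rule ex_ge[OF fL(2)[OF that(2)]])
    then obtain k where "order_ge k f" by blast
    then have "order_ge k (c j f)" by (rule cge[OF that(1)])
    moreover have "c j f i \<in> carrier D" for i
      using h that(1) fL(1)[OF that(2)] by (simp add: c_def)
    ultimately show ?thesis unfolding carrier_R by blast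
  qed
  have cadd: "c j (f \<oplus>\<^bsub>R\<^esub> f') = c j f \<oplus>\<^bsub>R\<^esub> c j f'" if "j < n" "f \<in> coeffs_in ?L" "f' \<in> coeffs_in ?L" for j f f'
    using hadd that fL by (auto simp: c_def add_R)
  have cmult: "c j (f \<otimes>\<^bsub>R\<^esub> r) = c j f \<otimes>\<^bsub>R\<^esub> r" if j: "j < n" and f: "f \<in> coeffs_in ?L" and r: "r \<in> carrier R" for j f r
  proof
    fix m
    obtain k p where kl: "order_ge k f" "order_ge p r" using ex_ge[OF fL(2)[OF f]] ex_ge[OF r] by blast
    have t: "tw i (r s) \<in> carrier D" for i s using coeff_closed[OF r] tw_hom by simp
    have "(f \<otimes>\<^bsub>R\<^esub> r) m = (\<Oplus>i\<in>{k..m-p}. f i \<otimes> tw i (r (m - i)))"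
      by (rule coeff_mult[OF fL(2)[OF f] kl(1) r kl(2)]) auto
    then have "c j (f \<otimes>\<^bsub>R\<^esub> r) m = h j (\<Oplus>i\<in>{k..m-p}. f i \<otimes> tw i (r (m - i)))" by (simp add: c_def)
    also have "\<dots> = (\<Oplus>i\<in>{k..m-p}. h j (f i \<otimes> tw i (r (m - i))))"
      using right_ideal_mult[OF rL] fL[OF f] t by (intro hfin j) auto
    also have "\<dots> = (\<Oplus>i\<in>{k..m-p}. c j f i \<otimes> tw i (r (m - i)))"
      using j h hmult fL[OF f] t by (intro finsum_cong') (auto simp: c_def)
    also have "\<dots> = (c j f \<otimes>\<^bsub>R\<^esub> r) m"
      by (rule coeff_mult[OF cc[OF j f] cge[OF j kl(1)] r kl(2), symmetric]) auto
    finally show "c j (f \<otimes>\<^bsub>R\<^esub> r) m = (c j f \<otimes>\<^bsub>R\<^esub> r) m" .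
  qed
  define S where "S f = (\<Oplus>\<^bsub>R\<^esub>j\<in>{..<n}. g j \<otimes>\<^bsub>R\<^esub> c j f)" for f
  have tc: "(\<lambda>j. g j \<otimes>\<^bsub>R\<^esub> c j f) \<in> {..<n} \<rightarrow> carrier R" if "f \<in> coeffs_in ?L" for f
    using gc cc that by auto
  note RL = right_ideal_coeffs_in[OF L(1)]
  have "lifting ?L S"
    unfolding lifting_def
  proof (intro conjI ballI allI impI)
    fix f assume f: "f \<in> coeffs_in ?L"
    show "S f \<in> carrier R" unfolding S_def by (rule R.finsum_closed[OF tc[OF f]])
    show "S (f \<oplus>\<^bsub>R\<^esub> f') = S f \<oplus>\<^bsub>R\<^esub> S f'" if f': "f' \<in> coeffs_in ?L" for f'
    proof -
      have "S (f \<oplus>\<^bsub>R\<^esub> f') = (\<Oplus>\<^bsub>R\<^esub>j\<in>{..<n}. g j \<otimes>\<^bsub>R\<^esub> c j f \<oplus>\<^bsub>R\<^esub> g j \<otimes>\<^bsub>R\<^esub> c j f')"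
        unfolding S_def using cadd f f' gc cc by (intro R.finsum_cong') (auto simp: R.r_distr)
      then show ?thesis unfolding S_def using R.finsum_addf[OF tc[OF f] tc[OF f']] by simp
    qed
    show "S (f \<otimes>\<^bsub>R\<^esub> r) = S f \<otimes>\<^bsub>R\<^esub> r" if r: "r \<in> carrier R" for r
    proof -
      have "S (f \<otimes>\<^bsub>R\<^esub> r) = (\<Oplus>\<^bsub>R\<^esub>j\<in>{..<n}. (g j \<otimes>\<^bsub>R\<^esub> c j f) \<otimes>\<^bsub>R\<^esub> r)"
        unfolding S_def using cmult f r gc cc by (intro R.finsum_cong') (auto simp: R.m_assoc)
      then show ?thesis unfolding S_def using R.finsum_ldistr[OF _ r tc[OF f]] by simp
    qed
    fix k assume k: "order_ge k f"
    have gek: "order_ge k (g j \<otimes>\<^bsub>R\<^esub> c j f)" if "j < n" for j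
      using order_ge_mult[OF gc[OF that] _ cc[OF that f] cge[OF that k], of 0] g[OF that] by simp
    have co: "S f i = (\<Oplus>j\<in>{..<n}. (g j \<otimes>\<^bsub>R\<^esub> c j f) i)" for i
      unfolding S_def by (rule coeff_finsum[OF tc[OF f]])
    show "order_ge k (S f)"
      unfolding order_ge_def co using gek order_geD by (auto intro!: add.finprod_one_eqI)
    have "S f k = (\<Oplus>j\<in>{..<n}. l j \<otimes> h j (f k))"
      unfolding co
    proof (rule finsum_cong')
      fix j assume "j \<in> {..<n}"
      then have j: "j < n" by simp
      show "(g j \<otimes>\<^bsub>R\<^esub> c j f) k = l j \<otimes> h j (f k)"
        using lowest_coeff_mult[OF gc[OF j] _ cc[OF j f] cge[OF j k], of 0] g[OF j] by (simp add: c_def)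
    qed (use l h fL[OF f] right_ideal_carrier[OF rL] in auto)
    then show "S f k = f k" using hsum fL[OF f] by simp
  qed
  moreover have "S = (\<lambda>f. \<Oplus>\<^bsub>R\<^esub>j\<in>{..<n}. g j \<otimes>\<^bsub>R\<^esub> c j f)" by (rule ext) (simp add: S_def)
  ultimately show ?thesis
    by (intro exI[of _ n] exI[of _ g] exI[of _ c]) (use g cc cadd cmult in auto)
qed

lemma lifting_into_ideal:
  assumes I: "right_ideal I R" and "\<forall>j<n. g j \<in> I" "\<forall>j<(n::nat). \<forall>f\<in>F. c j f \<in> carrier R" "f \<in> F"
  shows "(\<Oplus>\<^bsub>R\<^esub>j\<in>{..<n}. g j \<otimes>\<^bsub>R\<^esub> c j f) \<in> I"
  by (rule R.right_ideal_finsum[OF I]) (use assms R.right_ideal_mult[OF I] in auto)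

text \<open>The lifting built from \<open>I\<close> has values in \<open>I\<close> and, by approximation, meets every element of
\<open>J\<close>.\<close>

lemma eq_if_lead_eq:
  assumes I: "right_ideal I R" and J: "right_ideal J R" and IJ: "I \<subseteq> J" "lead J \<subseteq> lead I"
  shows "I = J"
proof (cases "I = {\<zero>\<^bsub>R\<^esub>}")
  case True
  have "lead I = {\<zero>}" using True by (auto simp: lead_def order_ge_def)
  then have "lead J = {\<zero>}" using IJ ideal_lead[OF J] additive_subgroup.zero_closed ideal.axioms(1) by blast
  then show ?thesis using True lead_nonzero[OF J] by blast
next
  case False
  obtain n :: nat and g c where *: "\<forall>j<n. g j \<in> I"
    "\<forall>j<n. \<forall>f\<in>coeffs_in (lead I). c j f \<in> carrier R"
    "lifting (lead I) (\<lambda>f. \<Oplus>\<^bsub>R\<^esub>j\<in>{..<n}. g j \<otimes>\<^bsub>R\<^esub> c j f)"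
    using ex_lifting[OF I False] by blast
  note SI = lifting_into_ideal[OF I *(1,2)]
  have "x \<in> I" if "x \<in> J" for x
    using lifting_surj[OF ideal_lead[OF I] *(3) J _ IJ(2) that] SI IJ(1) by blast
  then show ?thesis using IJ by blast
qed

text \<open>A lifting is an isomorphism from \<open>(lead I)((x))\<close> onto \<open>I\<close>. Its inverse carries the coordinate functions of the
induced right ideal to coordinate functions of \<open>I\<close>, so \<open>I\<close> is projective.\<close>

lemma right_ideal_dual_basis:
  assumes I: "right_ideal I R"
  shows "\<exists>(n::nat) g c. (\<forall>j<n. g j \<in> I) \<and> (\<forall>j<n. \<forall>f\<in>I. c j f \<in> carrier R) \<and>
    (\<forall>j<n. \<forall>f\<in>I. \<forall>f'\<in>I. c j (f \<oplus>\<^bsub>R\<^esub> f') = c j f \<oplus>\<^bsub>R\<^esub> c j f') \<and>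
    (\<forall>j<n. \<forall>f\<in>I. \<forall>r\<in>carrier R. c j (f \<otimes>\<^bsub>R\<^esub> r) = c j f \<otimes>\<^bsub>R\<^esub> r) \<and>
    (\<forall>f\<in>I. (\<Oplus>\<^bsub>R\<^esub>j\<in>{..<n}. g j \<otimes>\<^bsub>R\<^esub> c j f) = f)"
proof (cases "I = {\<zero>\<^bsub>R\<^esub>}")
  case True
  then show ?thesis by (intro exI[of _ 0]) auto
next
  case False
  let ?L = "lead I"
  obtain n :: nat and g c where *: "\<forall>j<n. g j \<in> I"
    "\<forall>j<n. \<forall>f\<in>coeffs_in ?L. c j f \<in> carrier R"
    "\<forall>j<n. \<forall>f\<in>coeffs_in ?L. \<forall>f'\<in>coeffs_in ?L. c j (f \<oplus>\<^bsub>R\<^esub> f') = c j f \<oplus>\<^bsub>R\<^esub> c j f'"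
    "\<forall>j<n. \<forall>f\<in>coeffs_in ?L. \<forall>r\<in>carrier R. c j (f \<otimes>\<^bsub>R\<^esub> r) = c j f \<otimes>\<^bsub>R\<^esub> r"
    "lifting ?L (\<lambda>f. \<Oplus>\<^bsub>R\<^esub>j\<in>{..<n}. g j \<otimes>\<^bsub>R\<^esub> c j f)"
    using ex_lifting[OF I False] by blast
  define S where "S = (\<lambda>f. \<Oplus>\<^bsub>R\<^esub>j\<in>{..<n}. g j \<otimes>\<^bsub>R\<^esub> c j f)"
  note L = ideal_lead[OF I]
  note RL = right_ideal_coeffs_in[OF L]
  have S: "lifting ?L S" using *(5) by (simp add: S_def)
  have SI: "f \<in> coeffs_in ?L \<Longrightarrow> S f \<in> I" for f
    using lifting_into_ideal[OF I *(1,2)] by (simp add: S_def)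
  define T where "T f = inv_into (coeffs_in ?L) S f" for f
  have T: "T f \<in> coeffs_in ?L" "S (T f) = f" if "f \<in> I" for f
  proof -
    have "f \<in> S ` coeffs_in ?L" using lifting_surj[OF L S I SI _ that] by blast
    then show "T f \<in> coeffs_in ?L" "S (T f) = f" 
      unfolding T_def by (fact inv_into_into, fact f_inv_into_f)
  qed
  have TS: "T (S f) = f" if "f \<in> coeffs_in ?L" for f
    unfolding T_def using inv_into_f_f[OF lifting_inj[OF L S] that] .
  have Tadd: "T (f \<oplus>\<^bsub>R\<^esub> f') = T f \<oplus>\<^bsub>R\<^esub> T f'" if "f \<in> I" "f' \<in> I" for f f'
  proof -
    have "S (T f \<oplus>\<^bsub>R\<^esub> T f') = f \<oplus>\<^bsub>R\<^esub> f'" using S T[OF that(1)] T[OF that(2)] unfolding lifting_def by simp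
    then show ?thesis using TS[OF R.right_ideal_add[OF RL T(1)[OF that(1)] T(1)[OF that(2)]]] by simp
  qed
  have Tmult: "T (f \<otimes>\<^bsub>R\<^esub> r) = T f \<otimes>\<^bsub>R\<^esub> r" if "f \<in> I" "r \<in> carrier R" for f r
  proof -
    have "S (T f \<otimes>\<^bsub>R\<^esub> r) = f \<otimes>\<^bsub>R\<^esub> r" using S T[OF that(1)] that(2) unfolding lifting_def by simp
    then show ?thesis using TS[OF R.right_ideal_mult[OF RL T(1)[OF that(1)] that(2)]] by simp
  qed
  show ?thesis
    by (rule exI[of _ n], rule exI[of _ g], rule exI[of _ "\<lambda>j f. c j (T f)"])
      (use * T Tadd Tmult in \<open>auto simp: S_def\<close>)
qed

text \<open>An element of \<open>I\<close> with lowest coefficient \<open>c\<close> generates a right ideal with the same ideal of lowest coefficients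
as \<open>I\<close>.\<close>

lemma principal_if_lead_principal:
  assumes I: "right_ideal I R" and c: "c \<in> carrier D" "lead I = PIdl c"
  shows "\<exists>g\<in>I. I = R.principal_right g"
proof -
  have "c \<in> lead I" using c cgenideal_self by simp
  then obtain g where g: "g \<in> I" "order_ge 0 g" "g 0 = c" by (auto simp: lead_def)
  have gc: "g \<in> carrier R" using g R.right_ideal_carrier[OF I] by blast
  note Rg = R.right_ideal_multiples[OF gc]
  have "lead I \<subseteq> lead (R.principal_right g)"
  proof
    fix x assume "x \<in> lead I"
    then obtain a where a: "a \<in> carrier D" "x = a \<otimes> c" using c by (auto simp: cgenideal_def)
    have "g \<otimes>\<^bsub>R\<^esub> monomial a 0 \<in> R.principal_right g" using monomial_closed[OF a(1)] by (auto simp: R.principal_right_iff)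
    moreover have "order_ge 0 (g \<otimes>\<^bsub>R\<^esub> monomial a 0)" using order_ge_mult[OF gc g(2) monomial_closed[OF a(1)] order_ge_monomial] by simp
    ultimately have "(g \<otimes>\<^bsub>R\<^esub> monomial a 0) 0 \<in> lead (R.principal_right g)" using lead_coeff[OF Rg] by blast
    then show "x \<in> lead (R.principal_right g)" using a g gc c by (simp add: coeff_mult_monomial m_comm)
  qed
  then have "R.principal_right g = I"
    using eq_if_lead_eq[OF Rg I R.multiples_least[OF I g(1)]] by simp
  then show ?thesis using g by blast
qed

end

text \<open>The map \<open>lead\<close> is strictly increasing, so it transports both chain conditions from \<open>D\<close> to \<open>R\<close>. A
common nonzero element \<open>z\<close> of the right ideals yields its lowest coefficient as a common nonzero element of their images.\<close>

sublocale skew_dedekind \<subseteq> R1: right_one_dimensional "skew_laurent D \<sigma>"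
proof
  show "a = \<zero>\<^bsub>R\<^esub> \<or> b = \<zero>\<^bsub>R\<^esub>" if "a \<in> carrier R" "b \<in> carrier R" "a \<otimes>\<^bsub>R\<^esub> b = \<zero>\<^bsub>R\<^esub>" for a b
    using that by (rule R_no_zero_divisors)
next
  fix \<A> assume A: "\<A> \<noteq> {}" "\<And>I. I \<in> \<A> \<Longrightarrow> right_ideal I R"
  have "\<exists>M\<in>lead ` \<A>. \<forall>I\<in>lead ` \<A>. M \<subseteq> I \<longrightarrow> I = M"
    by (rule ex_maximal_ideal) (use A ideal_lead in auto)
  then obtain M where M: "M \<in> \<A>" "\<And>I. I \<in> \<A> \<Longrightarrow> lead M \<subseteq> lead I \<Longrightarrow> lead I = lead M" by auto
  have "I = M" if "I \<in> \<A>" "M \<subseteq> I" for I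
    using eq_if_lead_eq[OF A(2)[OF M(1)] A(2)[OF that(1)] that(2)] M(2)[OF that(1) lead_mono[OF that(2)]] by simp
  then show "\<exists>M\<in>\<A>. \<forall>I\<in>\<A>. M \<subseteq> I \<longrightarrow> I = M" using M(1) by blast
next
  fix \<A> z assume A: "\<A> \<noteq> {}" "\<And>I. I \<in> \<A> \<Longrightarrow> right_ideal I R" "\<And>I. I \<in> \<A> \<Longrightarrow> z \<in> I" "z \<noteq> \<zero>\<^bsub>R\<^esub>"
  obtain I0 where I0: "I0 \<in> \<A>" using A(1) by blast
  then have "z \<in> carrier R" using A(2,3) R.right_ideal_carrier by blast
  then obtain k where k: "order_ge k z" "z k \<noteq> \<zero>" using ex_order A(4) by blast
  have "\<exists>M\<in>lead ` \<A>. \<forall>I\<in>lead ` \<A>. I \<subseteq> M \<longrightarrow> I = M"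
    by (rule ex_minimal_ideal[of _ "z k"]) (use A(1) ideal_lead[OF A(2)] lead_coeff[OF A(2) A(3) k(1)] k(2) in auto)
  then obtain M where M: "M \<in> \<A>" "\<And>I. I \<in> \<A> \<Longrightarrow> lead I \<subseteq> lead M \<Longrightarrow> lead I = lead M" by auto
  have "I = M" if "I \<in> \<A>" "I \<subseteq> M" for I
    using eq_if_lead_eq[OF A(2)[OF that(1)] A(2)[OF M(1)] that(2)] M(2)[OF that(1) lead_mono[OF that(2)]] by simp
  then show "\<exists>M\<in>\<A>. \<forall>I\<in>\<A>. I \<subseteq> M \<longrightarrow> I = M" using M(1) by blast
qed

section \<open>Krull dimension and stable rank\<close>

context ring begin

definition row_ideal :: "nat \<Rightarrow> (nat \<Rightarrow> 'a) \<Rightarrow> 'a set" where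
  "row_ideal m a = {(\<Oplus>i\<in>{..<m}. a i \<otimes> b i) |b. b \<in> {..<m} \<rightarrow> carrier R}"

lemma right_ideal_row_ideal:
  assumes a: "a \<in> {..<m} \<rightarrow> carrier R" shows "right_ideal (row_ideal m a) R"
proof (rule right_idealI)
  have c: "(\<lambda>i. a i \<otimes> b i) \<in> {..<m} \<rightarrow> carrier R" if "b \<in> {..<m} \<rightarrow> carrier R" for b
    using a that by (auto simp: Pi_iff)
  show "row_ideal m a \<subseteq> carrier R" using c by (auto simp: row_ideal_def)
  have "(\<Oplus>i\<in>{..<m}. a i \<otimes> \<zero>) = \<zero>"
    by (rule add.finprod_one_eqI) (use a in \<open>auto simp: Pi_iff\<close>)
  then show "\<zero> \<in> row_ideal m a"
    unfolding row_ideal_def by (intro CollectI exI[of _ "\<lambda>_. \<zero>"]) auto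
  show "x \<oplus> y \<in> row_ideal m a" if "x \<in> row_ideal m a" "y \<in> row_ideal m a" for x y
  proof -
    obtain b b' where b: "b \<in> {..<m} \<rightarrow> carrier R" "x = (\<Oplus>i\<in>{..<m}. a i \<otimes> b i)"
      "b' \<in> {..<m} \<rightarrow> carrier R" "y = (\<Oplus>i\<in>{..<m}. a i \<otimes> b' i)"
      using \<open>x \<in> _\<close> \<open>y \<in> _\<close> by (auto simp: row_ideal_def)
    have "(\<Oplus>i\<in>{..<m}. a i \<otimes> (b i \<oplus> b' i)) = (\<Oplus>i\<in>{..<m}. a i \<otimes> b i \<oplus> a i \<otimes> b' i)"
      using a b by (intro finsum_cong') (auto simp: Pi_iff r_distr)
    then have "x \<oplus> y = (\<Oplus>i\<in>{..<m}. a i \<otimes> (b i \<oplus> b' i))"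
      using b finsum_addf[OF c[OF b(1)] c[OF b(3)]] by simp
    moreover have "(\<lambda>i. b i \<oplus> b' i) \<in> {..<m} \<rightarrow> carrier R" using b by (auto simp: Pi_iff)
    ultimately show ?thesis
      unfolding row_ideal_def by (intro CollectI exI[of _ "\<lambda>i. b i \<oplus> b' i"] conjI)
  qed
  show "x \<otimes> r \<in> row_ideal m a" if "x \<in> row_ideal m a" and r: "r \<in> carrier R" for x r
  proof -
    obtain b where b: "b \<in> {..<m} \<rightarrow> carrier R" "x = (\<Oplus>i\<in>{..<m}. a i \<otimes> b i)"
      using \<open>x \<in> _\<close> by (auto simp: row_ideal_def)
    have "x \<otimes> r = (\<Oplus>i\<in>{..<m}. a i \<otimes> b i \<otimes> r)"
      unfolding b(2) by (rule finsum_ldistr[OF _ r c[OF b(1)]]) simp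
    also have "\<dots> = (\<Oplus>i\<in>{..<m}. a i \<otimes> (b i \<otimes> r))"
      using a b(1) r by (intro finsum_cong') (auto simp: Pi_iff m_assoc)
    finally have "x \<otimes> r = (\<Oplus>i\<in>{..<m}. a i \<otimes> (b i \<otimes> r))" .
    moreover have "(\<lambda>i. b i \<otimes> r) \<in> {..<m} \<rightarrow> carrier R" using b r by (auto simp: Pi_iff)
    ultimately show ?thesis
      unfolding row_ideal_def by (intro CollectI exI[of _ "\<lambda>i. b i \<otimes> r"] conjI)
  qed
qed

lemma entry_in_row_ideal:
  assumes a: "a \<in> {..<m} \<rightarrow> carrier R" and i: "i < m" shows "a i \<in> row_ideal m a"
proof -
  have "(\<Oplus>j\<in>{..<m}. a j \<otimes> (if i = j then \<one> else \<zero>)) = (\<Oplus>j\<in>{..<m}. if i = j then a j else \<zero>)"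
    using a by (intro finsum_cong') (auto simp: Pi_iff)
  also have "\<dots> = a i" using a i by (intro finsum_singleton) (auto simp: Pi_iff)
  finally have e: "a i = (\<Oplus>j\<in>{..<m}. a j \<otimes> (if i = j then \<one> else \<zero>))" by simp
  show ?thesis
    unfolding row_ideal_def
    by (rule CollectI, rule exI[of _ "\<lambda>j. if i = j then \<one> else \<zero>"]) (use e in auto)
qed

lemma row_ideal_least:
  assumes K: "right_ideal K R" and a: "\<And>i. i < m \<Longrightarrow> a i \<in> K" shows "row_ideal m a \<subseteq> K"
proof
  fix x assume "x \<in> row_ideal m a"
  then obtain b where b: "b \<in> {..<m} \<rightarrow> carrier R" "x = (\<Oplus>i\<in>{..<m}. a i \<otimes> b i)"
    by (auto simp: row_ideal_def)
  show "x \<in> K" unfolding b(2)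
    by (rule right_ideal_finsum[OF K], rule right_ideal_mult[OF K]) (use a b(1) in \<open>auto simp: Pi_iff\<close>)
qed

lemma unimodular_row_iff:
  "unimodular_row R m a \<longleftrightarrow> a \<in> {..<m} \<rightarrow> carrier R \<and> \<one> \<in> row_ideal m a"
proof -
  have "row_ideal m a = carrier R \<longleftrightarrow> \<one> \<in> row_ideal m a" if "a \<in> {..<m} \<rightarrow> carrier R"
    using right_ideal_eq_carrier[OF right_ideal_row_ideal[OF that]] by auto
  then show ?thesis unfolding unimodular_row_def row_ideal_def by blast
qed

lemma unimodular_row_iff_sum:
  "unimodular_row R m a \<longleftrightarrow> a \<in> {..<m} \<rightarrow> carrier R \<and>
     (\<exists>b. b \<in> {..<m} \<rightarrow> carrier R \<and> \<one> = (\<Oplus>i\<in>{..<m}. a i \<otimes> b i))"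
  unfolding unimodular_row_iff row_ideal_def by blast

end

context right_one_dimensional begin

text \<open>If the last entry is \<open>0\<close>, it can be dropped. Otherwise a multiple of it makes the first entry nonzero. The entries other than
the last two then generate a nonzero right ideal \<open>J\<close>, modulo which the pair of the last two entries can be shortened. Length at least
three is needed for \<open>J\<close> to be nonzero.\<close>

lemma stable_if_unimodular:
  assumes m: "2 < m" and uni: "unimodular_row R m a" shows "stable_row R m a"
proof -
  obtain k where mk: "m = Suc (Suc k)" "0 < k" using m by (metis Suc_less_eq2 less_2_cases_iff numeral_2_eq_2 old.nat.exhaust zero_less_Suc gr0I less_nat_zero_code)
  have ac: "\<And>i. i < m \<Longrightarrow> a i \<in> carrier R" and aP: "a \<in> {..<m} \<rightarrow> carrier R" and one: "\<one> \<in> row_ideal m a"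
    using uni unimodular_row_iff by (auto simp: Pi_iff)
  let ?c = "a (Suc k)"
  have cc: "?c \<in> carrier R" using ac mk by simp
  show ?thesis
  proof (cases "?c = \<zero>")
    case True
    have P: "a \<in> {..<Suc k} \<rightarrow> carrier R" using ac mk by auto
    note RI = right_ideal_row_ideal[OF P]
    have "a i \<in> row_ideal (Suc k) a" if "i < m" for i
    proof (cases "i = Suc k")
      case True
      then show ?thesis using \<open>?c = \<zero>\<close> right_ideal_zero[OF RI] by simp
    next
      case False
      then show ?thesis using that mk entry_in_row_ideal[OF P] by simp
    qed
    then have "\<one> \<in> row_ideal (Suc k) a" using one row_ideal_least[OF RI] by blast
    then have u: "unimodular_row R (Suc k) a" using P unimodular_row_iff by blast
    have "unimodular_row R (Suc k) (\<lambda>i. a i \<oplus> ?c \<otimes> \<zero>)"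
    proof -
      have P': "(\<lambda>i. a i \<oplus> ?c \<otimes> \<zero>) \<in> {..<Suc k} \<rightarrow> carrier R" using P cc by (auto simp: Pi_iff)
      have "a i \<in> row_ideal (Suc k) (\<lambda>i. a i \<oplus> ?c \<otimes> \<zero>)" if "i < Suc k" for i
        using entry_in_row_ideal[OF P' that] ac[of i] that mk cc by simp
      then have "row_ideal (Suc k) a \<subseteq> row_ideal (Suc k) (\<lambda>i. a i \<oplus> ?c \<otimes> \<zero>)"
        by (rule row_ideal_least[OF right_ideal_row_ideal[OF P']])
      then show ?thesis using P' u unimodular_row_iff by blast
    qed
    then show ?thesis unfolding stable_row_def mk(1) by (intro bexI[of _ "\<lambda>_. \<zero>"]) auto
  next
    case False
    define r0 where "r0 = (if a 0 = \<zero> then \<one> else \<zero>)"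
    have r0: "r0 \<in> carrier R" "a 0 \<oplus> ?c \<otimes> r0 \<noteq> \<zero>" using False cc ac[of 0] mk by (auto simp: r0_def)
    define a' where "a' i = (if i = 0 then a 0 \<oplus> ?c \<otimes> r0 else a i)" for i
    have a': "a' \<in> {..<k} \<rightarrow> carrier R" using ac mk cc r0 by (auto simp: a'_def)
    define J where "J = row_ideal k a'"
    have RJ: "right_ideal J R" unfolding J_def by (rule right_ideal_row_ideal[OF a'])
    have "a' 0 \<in> J" unfolding J_def by (rule entry_in_row_ideal[OF a' mk(2)])
    then have J0: "J \<noteq> {\<zero>}" using r0 by (auto simp: a'_def)
    have bc: "a k \<in> carrier R" using ac mk by simp
    let ?K1 = "J <+> principal_right (a k)" and ?K = "(J <+> principal_right (a k)) <+> principal_right ?c"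
    note K1 = set_add_principal[OF RJ bc]
    note K = set_add_principal[OF K1(1) cc]
    have "a i \<in> ?K" if i: "i < m" for i
    proof -
      have a'K: "a' i \<in> ?K" if "i < k" for i
        using entry_in_row_ideal[OF a' that] K1 K unfolding J_def by blast
      consider "i = 0" | "0 < i" "i < k" | "i = k" | "i = Suc k" using i mk by linarith
      then show ?thesis
      proof cases
        case 1
        have "a 0 = a' 0 \<ominus> ?c \<otimes> r0"
          using r0 cc ac[of 0] mk by (simp add: a'_def a_minus_def a_assoc r_neg)
        then show ?thesis
          using 1 a'K[OF mk(2)] right_ideal_minus[OF K(1)] right_ideal_mult[OF K(1) K(3) r0(1)] by metis
      next
        case 2
        then show ?thesis using a'K[of i] by (simp add: a'_def)
      next
        case 3
        then show ?thesis using K1 K by blast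
      next
        case 4
        then show ?thesis using K by simp
      qed
    qed
    then have "\<one> \<in> ?K" using one row_ideal_least[OF K(1)] by blast
    then obtain r1 where r1: "r1 \<in> carrier R" "\<one> \<in> J <+> principal_right (a k \<oplus> ?c \<otimes> r1)"
      using stable_pair[OF RJ J0 bc cc] by blast
    define r where "r i = (if i = 0 then r0 else if i = k then r1 else \<zero>)" for i
    let ?a = "\<lambda>i. a i \<oplus> ?c \<otimes> r i"
    have rc: "r \<in> {..<Suc k} \<rightarrow> carrier R" using r0 r1 by (auto simp: r_def)
    have P: "?a \<in> {..<Suc k} \<rightarrow> carrier R" using ac mk cc r0 r1 by (auto simp: r_def)
    note N = right_ideal_row_ideal[OF P]
    have "a' i \<in> row_ideal (Suc k) ?a" if "i < k" for i
      using entry_in_row_ideal[OF P, of i] that ac[of i] cc mk by (auto simp: a'_def r_def split: if_splits)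
    then have "J \<subseteq> row_ideal (Suc k) ?a" unfolding J_def by (rule row_ideal_least[OF N])
    moreover have "a k \<oplus> ?c \<otimes> r1 \<in> row_ideal (Suc k) ?a"
      using entry_in_row_ideal[OF P, of k] mk by (simp add: r_def)
    ultimately have "\<one> \<in> row_ideal (Suc k) ?a"
      using r1(2) set_add_least[OF N _ multiples_least[OF N]] by blast
    then have "unimodular_row R (Suc k) ?a" using P unimodular_row_iff by blast
    then show ?thesis unfolding stable_row_def mk(1) using rc by auto
  qed
qed

lemma stable_rank_le_2: "stable_rank R \<le> 2"
  unfolding stable_rank_def
  by (rule Inf_lower) (use stable_if_unimodular in \<open>auto intro!: exI[of _ 2] simp: numeral_eq_enat\<close>)

lemma factor_trivial_eq: "trivial_poset (factor A x x)"
  by (auto simp: trivial_poset_def factor_def)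

text \<open>Between \<open>J\<close> and any larger right ideal all descending chains become constant.\<close>

lemma has_deviation_0_above_nonzero:
  assumes J: "right_ideal J R" "J \<noteq> {\<zero>}"
  shows "trivial_poset (factor {I. right_ideal I R} K J) \<or> has_deviation 0 (factor {I. right_ideal I R} K J)"
proof -
  let ?F = "factor {I. right_ideal I R} K J"
  obtain z where z: "z \<in> J" "z \<noteq> \<zero>" using J right_ideal_zero[OF J(1)] by auto
  have "\<forall>\<^sub>\<infinity>i. trivial_poset (factor ?F (c i) (c (Suc i)))" if c: "descending_chain ?F c" for c
  proof -
    have cF: "c i \<in> ?F" "c (Suc i) \<subseteq> c i" for i using c by (auto simp: descending_chain_def)
    have "\<exists>M\<in>range c. \<forall>I\<in>range c. I \<subseteq> M \<longrightarrow> I = M"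
    proof (rule ex_minimal[of _ z])
      show "right_ideal I R" if "I \<in> range c" for I using that cF(1) by (auto simp: factor_def)
      show "z \<in> I" if "I \<in> range c" for I using that cF(1) z(1) by (auto simp: factor_def)
    qed (use z(2) in auto)
    then obtain n where n: "\<And>i. c i \<subseteq> c n \<Longrightarrow> c i = c n" by auto
    have "c i = c n" if "n \<le> i" for i
      using lift_Suc_antimono_le[of c, OF cF(2) that] n by blast
    then have "\<forall>i\<ge>n. trivial_poset (factor ?F (c i) (c (Suc i)))"
      using factor_trivial_eq by (metis le_Suc_eq)
    then show ?thesis unfolding MOST_nat_le by blast
  qed
  then show ?thesis by (subst has_deviation.simps) auto
qed

text \<open>The powers of a nonunit \<open>t\<close> generate a strictly descending chain, so the deviation of the lattice is not \<open>0\<close>. In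
any descending chain all members are nonzero, or the chain ends in \<open>0\<close>. In both cases almost all factors have deviation at most
\<open>0\<close>.\<close>

lemma right_krull_dimension_1:
  assumes t: "t \<in> carrier R" "t \<noteq> \<zero>" "\<And>u. u \<in> carrier R \<Longrightarrow> t \<otimes> u \<noteq> \<one>"
  shows "has_right_krull_dimension R 1"
proof -
  let ?A = "{I. right_ideal I R}"
  have one0: "\<one> \<noteq> \<zero>" using t(1,2) one_zeroD by blast
  have tn: "t [^] n \<in> carrier R" for n :: nat using t by simp
  have tn0: "t [^] n \<noteq> \<zero>" for n :: nat
    by (induction n) (use one0 t no_zero_divisors[OF tn t(1)] in auto)
  have zA: "{\<zero>} \<in> ?A" using right_idealI[of "{\<zero>}"] by auto
  have nontriv: "\<not> trivial_poset ?A"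
  proof -
    have "{\<zero>} \<subset> carrier R" using one0 by auto
    then show ?thesis using zA right_ideal_UNIV unfolding trivial_poset_def by blast
  qed
  have not0: "\<not> has_deviation 0 ?A"
  proof
    assume "has_deviation 0 ?A"
    then have *: "\<And>c. descending_chain ?A c \<Longrightarrow> \<forall>\<^sub>\<infinity>i. trivial_poset (factor ?A (c i) (c (Suc i)))"
      by (subst (asm) has_deviation.simps) auto
    let ?c = "\<lambda>i::nat. principal_right (t [^] i)"
    have RI: "right_ideal (?c i) R" for i by (rule right_ideal_multiples[OF tn])
    have sub: "?c (Suc i) \<subseteq> ?c i" for i
      by (rule multiples_least[OF RI]) (use t in \<open>auto simp: principal_right_iff\<close>)
    have "?c (Suc i) \<noteq> ?c i" for i
    proof
      assume "?c (Suc i) = ?c i"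
      then have "t [^] i \<in> ?c (Suc i)" using generator_in_multiples[OF tn] by blast
      then obtain u where u: "u \<in> carrier R" "t [^] i = t [^] i \<otimes> t \<otimes> u"
        by (auto simp: principal_right_iff)
      have tu: "t \<otimes> u \<in> carrier R" using t u by simp
      have "t [^] i \<otimes> (\<one> \<ominus> t \<otimes> u) = t [^] i \<ominus> t [^] i \<otimes> t \<otimes> u"
        using tn[of i] t u(1) by (simp add: r_distr a_minus_def r_minus m_assoc)
      also have "\<dots> = \<zero>" using u(2) tn[of i] by simp
      finally have "\<one> \<ominus> t \<otimes> u = \<zero>" using no_zero_divisors[OF tn[of i]] tn0[of i] tu by blast
      then have "t \<otimes> u = \<one>" using tu by simp
      then show False using t u by blast
    qed
    then have lt: "?c (Suc i) < ?c i" for i using sub by auto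
    have "descending_chain ?A ?c" unfolding descending_chain_def using RI sub by blast
    then have "\<forall>\<^sub>\<infinity>i. trivial_poset (factor ?A (?c i) (?c (Suc i)))" by (rule *)
    then obtain i where "trivial_poset (factor ?A (?c i) (?c (Suc i)))"
      unfolding MOST_nat_le by blast
    then show False
      using RI lt[of i] sub[of i] unfolding trivial_poset_def factor_def by blast
  qed
  have "\<forall>\<^sub>\<infinity>i. trivial_poset (factor ?A (c i) (c (Suc i))) \<or> has_deviation 0 (factor ?A (c i) (c (Suc i)))"
    if c: "descending_chain ?A c" for c
  proof -
    have cA: "right_ideal (c i) R" "c (Suc i) \<subseteq> c i" for i using c by (auto simp: descending_chain_def)
    show ?thesis
    proof (cases "\<exists>n. c n = {\<zero>}")
      case True
      then obtain n where n: "c n = {\<zero>}" by blast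
      have "c i = {\<zero>}" if "n \<le> i" for i
        using lift_Suc_antimono_le[of c, OF cA(2) that] n right_ideal_zero[OF cA(1)[of i]] by blast
      then have "\<forall>i\<ge>n. trivial_poset (factor ?A (c i) (c (Suc i)))"
        using factor_trivial_eq by (metis le_Suc_eq)
      then show ?thesis unfolding MOST_nat_le by blast
    next
      case False
      then show ?thesis using has_deviation_0_above_nonzero[OF cA(1)] by simp
    qed
  qed
  then show ?thesis
    unfolding has_right_krull_dimension_def
    using nontriv not0 by (subst has_deviation.simps) (simp add: lessThan_Suc)
qed

end

context skew_dedekind begin

lemma ex_nonunit:
  assumes "\<not> field D" obtains t where "t \<in> carrier D" "t \<noteq> \<zero>" "\<And>u. u \<in> carrier D \<Longrightarrow> t \<otimes> u \<noteq> \<one>"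
proof -
  have "Units D \<noteq> carrier D - {\<zero>}"
    using assms domain_axioms by (auto simp: field_def field_axioms_def)
  moreover have "Units D \<subseteq> carrier D - {\<zero>}"
    using Units_closed by (auto simp: Units_def)
  ultimately obtain t where t: "t \<in> carrier D" "t \<noteq> \<zero>" "t \<notin> Units D" by blast
  have "t \<otimes> u \<noteq> \<one>" if "u \<in> carrier D" for u
    using t that m_comm by (auto simp: Units_def)
  then show thesis using that t by blast
qed

text \<open>The row \<open>(t + x, t s)\<close> with \<open>\<sigma> s = t\<close>, where \<open>t\<close> is a nonunit. It is unimodular, because
\<open>x s = t x\<close> gives \<open>(t + x) (x^-1 - s x^-2) = 1 - t s x^-2\<close>. But every \<open>t + x + t s r\<close> has its lowest
coefficient in \<open>t D\<close>: its coefficient at \<open>0\<close> is \<open>t (1 + s r 0)\<close>, which is nonzero since \<open>s\<close> is a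
nonunit, so the order is at most \<open>0\<close>, and the summand \<open>x\<close> does not contribute. A right invertible series has a unit as its
lowest coefficient.\<close>

lemma stable_rank_not_1:
  assumes t: "t \<in> carrier D" "t \<noteq> \<zero>" "\<And>u. u \<in> carrier D \<Longrightarrow> t \<otimes> u \<noteq> \<one>"
  shows "\<exists>a. unimodular_row R 2 a \<and> \<not> stable_row R 2 a"
proof -
  define s where "s = tw (- 1) t"
  have s: "s \<in> carrier D" "tw 1 s = t" using t tw_hom(1) tw_cancel(1)[of t 1] by (auto simp: s_def)
  have snu: "s \<otimes> u \<noteq> \<one>" if u: "u \<in> carrier D" for u
  proof
    assume "s \<otimes> u = \<one>"
    then have "t \<otimes> tw 1 u = \<one>" using s u tw_hom(3,4) by metis
    then show False using t(3) tw_hom(1) u by blast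
  qed
  define a where "a i = (if i = (0::nat) then monomial t 0 \<oplus>\<^bsub>R\<^esub> monomial \<one> 1 else monomial (t \<otimes> s) 0)" for i
  define b where "b i = (if i = (0::nat) then monomial \<one> (- 1) \<ominus>\<^bsub>R\<^esub> monomial s (- 2) else monomial \<one> (- 2))" for i
  have ac: "a i \<in> carrier R" "b i \<in> carrier R" for i using t s by (auto simp: a_def b_def monomial_closed)
  have two: "{..<2::nat} = {0, 1}" by auto
  have m: "monomial x k \<in> carrier R" if "x \<in> carrier D" for x k using that by (rule monomial_closed)
  have "a 0 \<otimes>\<^bsub>R\<^esub> b 0 = (monomial t (-1) \<ominus>\<^bsub>R\<^esub> monomial (t \<otimes> s) (-2)) \<oplus>\<^bsub>R\<^esub> (monomial \<one> 0 \<ominus>\<^bsub>R\<^esub> monomial t (-1))"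
  proof -
    have "(A \<oplus>\<^bsub>R\<^esub> B) \<otimes>\<^bsub>R\<^esub> (C \<ominus>\<^bsub>R\<^esub> E) =
        (A \<otimes>\<^bsub>R\<^esub> C \<ominus>\<^bsub>R\<^esub> A \<otimes>\<^bsub>R\<^esub> E) \<oplus>\<^bsub>R\<^esub> (B \<otimes>\<^bsub>R\<^esub> C \<ominus>\<^bsub>R\<^esub> B \<otimes>\<^bsub>R\<^esub> E)"
      if "A \<in> carrier R" "B \<in> carrier R" "C \<in> carrier R" "E \<in> carrier R" for A B C E
      using that by algebra
    then show ?thesis using t s m by (simp add: a_def b_def monomial_mult tw_hom)
  qed
  moreover have "a 1 \<otimes>\<^bsub>R\<^esub> b 1 = monomial (t \<otimes> s) (-2)"
    using t s by (simp add: a_def b_def monomial_mult tw_hom)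
  ultimately have "a 0 \<otimes>\<^bsub>R\<^esub> b 0 \<oplus>\<^bsub>R\<^esub> a 1 \<otimes>\<^bsub>R\<^esub> b 1 =
     ((monomial t (-1) \<ominus>\<^bsub>R\<^esub> monomial (t \<otimes> s) (-2)) \<oplus>\<^bsub>R\<^esub> (monomial \<one> 0 \<ominus>\<^bsub>R\<^esub> monomial t (-1))) \<oplus>\<^bsub>R\<^esub> monomial (t \<otimes> s) (-2)" by simp
  also have "\<dots> = monomial \<one> 0"
  proof -
    have "((p \<ominus>\<^bsub>R\<^esub> q) \<oplus>\<^bsub>R\<^esub> (e \<ominus>\<^bsub>R\<^esub> p)) \<oplus>\<^bsub>R\<^esub> q = e" if "p \<in> carrier R" "q \<in> carrier R" "e \<in> carrier R" for p q e
      using that by algebra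
    then show ?thesis using m t s by simp
  qed
  finally have one: "\<one>\<^bsub>R\<^esub> = (\<Oplus>\<^bsub>R\<^esub>i\<in>{..<2}. a i \<otimes>\<^bsub>R\<^esub> b i)"
    unfolding two using ac by (simp add: one_R_monomial)
  have "unimodular_row R 2 a"
    unfolding R.unimodular_row_iff_sum using ac one by (intro conjI exI[of _ b]) auto
  moreover have "\<not> stable_row R 2 a"
  proof
    assume "stable_row R 2 a"
    then obtain r where r: "r 0 \<in> carrier R" "unimodular_row R 1 (\<lambda>i. a i \<oplus>\<^bsub>R\<^esub> a 1 \<otimes>\<^bsub>R\<^esub> r i)"
      by (auto simp: stable_row_def)
    define u where "u = a 0 \<oplus>\<^bsub>R\<^esub> a 1 \<otimes>\<^bsub>R\<^esub> r 0"
    have uc: "u \<in> carrier R" using ac r by (simp add: u_def)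
    obtain v' where "v' \<in> {..<1} \<rightarrow> carrier R" "\<one>\<^bsub>R\<^esub> = (\<Oplus>\<^bsub>R\<^esub>i\<in>{..<1::nat}. (a i \<oplus>\<^bsub>R\<^esub> a 1 \<otimes>\<^bsub>R\<^esub> r i) \<otimes>\<^bsub>R\<^esub> v' i)"
      using r(2) unfolding R.unimodular_row_iff_sum by blast
    then have v: "v' 0 \<in> carrier R" "u \<otimes>\<^bsub>R\<^esub> v' 0 = \<one>\<^bsub>R\<^esub>"
      using uc by (auto simp: u_def lessThan_Suc)
    define v where "v = v' 0"
    note one0 = R_one_not_zero
    have "u \<noteq> \<zero>\<^bsub>R\<^esub>" "v \<noteq> \<zero>\<^bsub>R\<^esub>" using v one0 uc by (auto simp: v_def)
    then obtain k l where kl: "order_ge k u" "u k \<noteq> \<zero>" "order_ge l v" "v l \<noteq> \<zero>" using ex_order uc v(1) v_def by metis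
    have vl: "tw k (v l) \<in> carrier D" "tw k (v l) \<noteq> \<zero>" 
      using coeff_closed v(1) kl tw_hom(1) tw_eq_zero by (auto simp: v_def)
    have "\<one>\<^bsub>R\<^esub> (k + l) = u k \<otimes> tw k (v l)"
      using lowest_coeff_mult[OF uc kl(1) _ kl(3)] v by (simp add: v_def)
    moreover have "u k \<otimes> tw k (v l) \<noteq> \<zero>" using kl vl uc coeff_closed integral by blast
    ultimately have eq1: "u k \<otimes> tw k (v l) = \<one>" by (auto simp: one_R split: if_splits)
    have un: "u n = (if n = 0 then t else \<zero>) \<oplus> (if n = 1 then \<one> else \<zero>) \<oplus> t \<otimes> s \<otimes> r 0 n" for n
      using t s r coeff_closed[OF r(1)] by (simp add: u_def a_def coeff_add coeff_monomial_mult) (simp add: monomial_def)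
    have rn: "r 0 n \<in> carrier D" for n using coeff_closed[OF r(1)] .
    \<comment> \<open>A nonzero coefficient of \<open>u\<close> at \<open>0\<close> bounds its order \<open>k\<close>.\<close>
    have "k \<le> 0"
    proof (rule ccontr)
      assume "\<not> k \<le> 0"
      then have "u 0 = \<zero>" using order_geD[OF kl(1)] by simp
      then have "t \<otimes> (\<one> \<oplus> s \<otimes> r 0 0) = \<zero>"
        using un[of 0] t s rn[of 0] by (simp add: r_distr m_assoc)
      then have "\<one> \<oplus> s \<otimes> r 0 0 = \<zero>" using t s rn[of 0] integral by (metis a_closed m_closed one_closed)
      then have "s \<otimes> (\<ominus> r 0 0) = \<one>"
        using s rn[of 0] by (metis m_closed one_closed minus_equality r_minus minus_minus a_inv_closed)
      then show False using snu rn[of 0] by blast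
    qed
    then have "u k = t \<otimes> ((if k = 0 then \<one> else \<zero>) \<oplus> s \<otimes> r 0 k)"
      using un[of k] t s rn[of k] by (auto simp: r_distr m_assoc)
    then have "t \<otimes> (((if k = 0 then \<one> else \<zero>) \<oplus> s \<otimes> r 0 k) \<otimes> tw k (v l)) = \<one>"
      using eq1 t s rn[of k] vl by (simp add: m_assoc)
    then show False using t(3) s rn[of k] vl by simp
  qed
  ultimately show ?thesis by blast
qed

lemma stable_rank_2:
  assumes "\<not> field D" shows "stable_rank R = 2"
proof (rule antisym[OF R1.stable_rank_le_2])
  obtain t where "t \<in> carrier D" "t \<noteq> \<zero>" "\<And>u. u \<in> carrier D \<Longrightarrow> t \<otimes> u \<noteq> \<one>"
    using ex_nonunit[OF assms] by blast
  then obtain a where a: "unimodular_row R 2 a" "\<not> stable_row R 2 a" using stable_rank_not_1 by blast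
  show "2 \<le> stable_rank R"
    unfolding stable_rank_def
  proof (rule Inf_greatest)
    fix x assume "x \<in> {enat n |n. 1 \<le> n \<and> (\<forall>m>n. \<forall>a. unimodular_row R m a \<longrightarrow> stable_row R m a)}"
    then obtain n where n: "x = enat n" "\<forall>m>n. \<forall>a. unimodular_row R m a \<longrightarrow> stable_row R m a" by blast
    then have "\<not> n < 2" using a by blast
    then show "2 \<le> x" using n(1) by (simp add: numeral_eq_enat)
  qed
qed

lemma right_krull_dimension:
  assumes "\<not> field D" shows "has_right_krull_dimension R 1"
proof -
  obtain t where t: "t \<in> carrier D" "t \<noteq> \<zero>" "\<And>u. u \<in> carrier D \<Longrightarrow> t \<otimes> u \<noteq> \<one>"
    using ex_nonunit[OF assms] by blast
  show ?thesis
    by (rule R1.right_krull_dimension_1[OF monomial_closed monomial_nonzero monomial_not_right_invertible]) (use t in auto)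
qed

end

section \<open>Invertible matrices and completion of rows\<close>

context ring begin

definition mmul :: "nat \<Rightarrow> (nat \<Rightarrow> nat \<Rightarrow> 'a) \<Rightarrow> (nat \<Rightarrow> nat \<Rightarrow> 'a) \<Rightarrow> nat \<Rightarrow> nat \<Rightarrow> 'a" where
  "mmul m A B i k = (\<Oplus>j\<in>{..<m}. A i j \<otimes> B j k)"

definition delta :: "nat \<Rightarrow> nat \<Rightarrow> 'a" where
  "delta i j = (if i = j then \<one> else \<zero>)"

lemma mmul_closed:
  assumes "\<And>j. j < m \<Longrightarrow> A i j \<in> carrier R" "\<And>j. j < m \<Longrightarrow> B j k \<in> carrier R"
  shows "mmul m A B i k \<in> carrier R"
  unfolding mmul_def using assms by (intro finsum_closed) auto

lemma mmul_cong:
  assumes "\<And>j. j < m \<Longrightarrow> A i j = A' i j" "\<And>j. j < m \<Longrightarrow> B j k = B' j k"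
    "\<And>j. j < m \<Longrightarrow> A' i j \<in> carrier R" "\<And>j. j < m \<Longrightarrow> B' j k \<in> carrier R"
  shows "mmul m A B i k = mmul m A' B' i k"
  unfolding mmul_def using assms by (intro finsum_cong') auto

lemma mmul_assoc:
  assumes A: "\<And>j. j < m \<Longrightarrow> A i j \<in> carrier R"
    and B: "\<And>j k. j < m \<Longrightarrow> k < m \<Longrightarrow> B j k \<in> carrier R"
    and C: "\<And>k. k < m \<Longrightarrow> C k l \<in> carrier R"
  shows "mmul m (mmul m A B) C i l = mmul m A (mmul m B C) i l"
proof -
  have "mmul m (mmul m A B) C i l = (\<Oplus>k\<in>{..<m}. \<Oplus>j\<in>{..<m}. A i j \<otimes> B j k \<otimes> C k l)"
    unfolding mmul_def using A B C
    by (intro finsum_cong' finsum_ldistr) (auto intro!: finsum_closed)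
  also have "\<dots> = (\<Oplus>j\<in>{..<m}. \<Oplus>k\<in>{..<m}. A i j \<otimes> B j k \<otimes> C k l)"
    using A B C by (intro finsum_swap) auto
  also have "\<dots> = (\<Oplus>j\<in>{..<m}. A i j \<otimes> (\<Oplus>k\<in>{..<m}. B j k \<otimes> C k l))"
  proof (rule finsum_cong')
    fix j assume "j \<in> {..<m}"
    then have j: "j < m" by simp
    have "(\<Oplus>k\<in>{..<m}. A i j \<otimes> B j k \<otimes> C k l) = (\<Oplus>k\<in>{..<m}. A i j \<otimes> (B j k \<otimes> C k l))"
      using A[OF j] B[OF j] C by (intro finsum_cong') (auto simp: m_assoc)
    also have "\<dots> = A i j \<otimes> (\<Oplus>k\<in>{..<m}. B j k \<otimes> C k l)"
      using A[OF j] B[OF j] C by (intro finsum_rdistr[symmetric]) auto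
    finally show "(\<Oplus>k\<in>{..<m}. A i j \<otimes> B j k \<otimes> C k l) = A i j \<otimes> (\<Oplus>k\<in>{..<m}. B j k \<otimes> C k l)" .
  qed (use A B C in \<open>auto intro!: finsum_closed\<close>)
  finally show ?thesis unfolding mmul_def .
qed

lemma delta_closed [simp]: "delta i j \<in> carrier R"
  by (simp add: delta_def)

lemma mmul_delta_left:
  assumes i: "i < m" and B: "\<And>j. j < m \<Longrightarrow> B j k \<in> carrier R"
  shows "mmul m delta B i k = B i k"
proof -
  have "mmul m delta B i k = (\<Oplus>j\<in>{..<m}. if i = j then B j k else \<zero>)"
    unfolding mmul_def using B by (intro finsum_cong') (auto simp: delta_def)
  also have "\<dots> = B i k" using i B by (intro finsum_singleton) auto
  finally show ?thesis .
qed

lemma mmul_delta_right: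
  assumes k: "k < m" and A: "\<And>j. j < m \<Longrightarrow> A i j \<in> carrier R"
  shows "mmul m A delta i k = A i k"
proof -
  have "mmul m A delta i k = (\<Oplus>j\<in>{..<m}. if k = j then A i j else \<zero>)"
    unfolding mmul_def using A by (intro finsum_cong') (auto simp: delta_def)
  also have "\<dots> = A i k" using k A by (intro finsum_singleton) auto
  finally show ?thesis .
qed

lemma mmul_add_left:
  assumes "\<And>j. j < m \<Longrightarrow> A i j \<in> carrier R" "\<And>j. j < m \<Longrightarrow> A' i j \<in> carrier R"
    "\<And>j. j < m \<Longrightarrow> B j k \<in> carrier R"
  shows "mmul m (\<lambda>i j. A i j \<oplus> A' i j) B i k = mmul m A B i k \<oplus> mmul m A' B i k"
proof -
  have "mmul m (\<lambda>i j. A i j \<oplus> A' i j) B i k = (\<Oplus>j\<in>{..<m}. A i j \<otimes> B j k \<oplus> A' i j \<otimes> B j k)"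
    unfolding mmul_def using assms by (intro finsum_cong') (auto simp: l_distr)
  also have "\<dots> = mmul m A B i k \<oplus> mmul m A' B i k"
    unfolding mmul_def using assms by (intro finsum_addf) auto
  finally show ?thesis .
qed

lemma mmul_add_right:
  assumes "\<And>j. j < m \<Longrightarrow> A i j \<in> carrier R" "\<And>j. j < m \<Longrightarrow> B j k \<in> carrier R"
    "\<And>j. j < m \<Longrightarrow> B' j k \<in> carrier R"
  shows "mmul m A (\<lambda>i j. B i j \<oplus> B' i j) i k = mmul m A B i k \<oplus> mmul m A B' i k"
proof -
  have "mmul m A (\<lambda>i j. B i j \<oplus> B' i j) i k = (\<Oplus>j\<in>{..<m}. A i j \<otimes> B j k \<oplus> A i j \<otimes> B' j k)"
    unfolding mmul_def using assms by (intro finsum_cong') (auto simp: r_distr)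
  also have "\<dots> = mmul m A B i k \<oplus> mmul m A B' i k"
    unfolding mmul_def using assms by (intro finsum_addf) auto
  finally show ?thesis .
qed

lemma square_matricesD: "A \<in> square_matrices R m \<Longrightarrow> i < m \<Longrightarrow> j < m \<Longrightarrow> A i j \<in> carrier R"
  by (simp add: square_matrices_def)

lemma inverse_matrices_iff:
  "inverse_matrices R m A B \<longleftrightarrow>
     (\<forall>i<m. \<forall>k<m. mmul m A B i k = delta i k \<and> mmul m B A i k = delta i k)"
  by (simp add: inverse_matrices_def mmul_def delta_def)

lemma invertible_mmul:
  assumes A: "invertible_matrix R m A" and E: "invertible_matrix R m E"
  shows "invertible_matrix R m (mmul m A E)"
proof -
  obtain B F where B: "B \<in> square_matrices R m" "inverse_matrices R m A B"
    and F: "F \<in> square_matrices R m" "inverse_matrices R m E F" 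
    using A E unfolding invertible_matrix_def by blast
  have AE: "A \<in> square_matrices R m" "E \<in> square_matrices R m"
    using A E unfolding invertible_matrix_def by blast+
  have key: "mmul m (mmul m X Y) (mmul m Y' X') i k = delta i k"
    if X: "X \<in> square_matrices R m" "X' \<in> square_matrices R m" "Y \<in> square_matrices R m" "Y' \<in> square_matrices R m"
      and XX: "\<And>i k. i < m \<Longrightarrow> k < m \<Longrightarrow> mmul m X X' i k = delta i k"
      and YY: "\<And>i k. i < m \<Longrightarrow> k < m \<Longrightarrow> mmul m Y Y' i k = delta i k"
      and ik: "i < m" "k < m" for X X' Y Y' i k
  proof -
    note c = square_matricesD[OF X(1)] square_matricesD[OF X(2)] square_matricesD[OF X(3)] square_matricesD[OF X(4)]
    have "mmul m (mmul m X Y) (mmul m Y' X') i k = mmul m X (mmul m Y (mmul m Y' X')) i k"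
      using ik c by (intro mmul_assoc) (auto intro!: mmul_closed)
    also have "\<dots> = mmul m X X' i k"
    proof (rule mmul_cong)
      fix j assume j: "j < m"
      have "mmul m Y (mmul m Y' X') j k = mmul m (mmul m Y Y') X' j k"
        using ik j c by (intro mmul_assoc[symmetric]) auto
      also have "\<dots> = mmul m delta X' j k" using ik j c YY by (intro mmul_cong) auto
      also have "\<dots> = X' j k" using ik j c by (intro mmul_delta_left) auto
      finally show "mmul m Y (mmul m Y' X') j k = X' j k" .
    qed (use ik c in auto)
    finally show ?thesis using XX ik by simp
  qed
  have "inverse_matrices R m (mmul m A E) (mmul m F B)"
    using key[OF AE(1) B(1) AE(2) F(1)] key[OF F(1) AE(2) B(1) AE(1)] B F
    unfolding inverse_matrices_iff by blast
  moreover have "mmul m A E \<in> square_matrices R m" "mmul m F B \<in> square_matrices R m"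
    using AE B F by (auto simp: square_matrices_def intro!: mmul_closed)
  ultimately show ?thesis unfolding invertible_matrix_def by blast
qed

text \<open>A matrix \<open>N\<close> supported in the rows from \<open>P\<close> and the columns outside \<open>P\<close> satisfies \<open>N * N =
0\<close>, so \<open>1 - N\<close> is the inverse of \<open>1 + N\<close>.\<close>

lemma invertible_transvection:
  assumes N: "\<And>i j. i < m \<Longrightarrow> j < m \<Longrightarrow> N i j \<in> carrier R"
    and P: "\<And>i j. i < m \<Longrightarrow> j < m \<Longrightarrow> \<not> (i \<in> P \<and> j \<notin> P) \<Longrightarrow> N i j = \<zero>"
  shows "invertible_matrix R m (\<lambda>i j. delta i j \<oplus> N i j)"
proof -
  let ?M = "\<lambda>i j. \<ominus> N i j"
  have key: "mmul m (\<lambda>i j. delta i j \<oplus> X i j) (\<lambda>i j. delta i j \<oplus> Y i j) i k = delta i k"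
    if X: "\<And>i j. i < m \<Longrightarrow> j < m \<Longrightarrow> X i j \<in> carrier R" "\<And>i j. i < m \<Longrightarrow> j < m \<Longrightarrow> \<not> (i \<in> P \<and> j \<notin> P) \<Longrightarrow> X i j = \<zero>"
      and Y: "\<And>i j. i < m \<Longrightarrow> j < m \<Longrightarrow> Y i j \<in> carrier R" "\<And>i j. i < m \<Longrightarrow> j < m \<Longrightarrow> \<not> (i \<in> P \<and> j \<notin> P) \<Longrightarrow> Y i j = \<zero>"
      and XY: "\<And>i j. i < m \<Longrightarrow> j < m \<Longrightarrow> Y i j \<oplus> X i j = \<zero>" and ik: "i < m" "k < m" for X Y i k
  proof -
    have z: "mmul m X Y i k = \<zero>"
      unfolding mmul_def
    proof (rule add.finprod_one_eqI)
      fix j assume "j \<in> {..<m}"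
      then have j: "j < m" by simp
      show "X i j \<otimes> Y j k = \<zero>"
      proof (cases "j \<in> P")
        case True then show ?thesis using X(2)[OF ik(1) j] Y(1)[OF j ik(2)] by simp
      next
        case False then show ?thesis using Y(2)[OF j ik(2)] X(1)[OF ik(1) j] by simp
      qed
    qed
    have "mmul m (\<lambda>i j. delta i j \<oplus> X i j) (\<lambda>i j. delta i j \<oplus> Y i j) i k =
       mmul m delta (\<lambda>i j. delta i j \<oplus> Y i j) i k \<oplus> mmul m X (\<lambda>i j. delta i j \<oplus> Y i j) i k"
      using X Y ik by (intro mmul_add_left) auto
    also have "mmul m delta (\<lambda>i j. delta i j \<oplus> Y i j) i k = delta i k \<oplus> Y i k"
      using Y ik by (intro mmul_delta_left) auto
    also have "mmul m X (\<lambda>i j. delta i j \<oplus> Y i j) i k = mmul m X delta i k \<oplus> mmul m X Y i k"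
      using X Y ik by (intro mmul_add_right) auto
    also have "mmul m X delta i k = X i k" using X ik by (intro mmul_delta_right) auto
    finally show ?thesis using z X(1)[OF ik] Y(1)[OF ik] XY[OF ik] by (simp add: a_assoc)
  qed
  have "inverse_matrices R m (\<lambda>i j. delta i j \<oplus> N i j) (\<lambda>i j. delta i j \<oplus> ?M i j)"
    unfolding inverse_matrices_iff
  proof (intro allI impI conjI)
    have P': "\<ominus> N i j = \<zero>" if "i < m" "j < m" "\<not> (i \<in> P \<and> j \<notin> P)" for i j
      using P[OF that] by simp
    fix i k assume ik: "i < m" "k < m"
    show "mmul m (\<lambda>i j. delta i j \<oplus> N i j) (\<lambda>i j. delta i j \<oplus> ?M i j) i k = delta i k"
      by (rule key[OF N P _ P' _ ik]) (simp_all add: N l_neg)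
    show "mmul m (\<lambda>i j. delta i j \<oplus> ?M i j) (\<lambda>i j. delta i j \<oplus> N i j) i k = delta i k"
      by (rule key[OF _ P' N P _ ik]) (simp_all add: N r_neg)
  qed
  then show ?thesis
    unfolding invertible_matrix_def square_matrices_def using N by (intro conjI bexI) auto
qed

text \<open>The orbit relation of the general linear group on rows. The row is the first row of \<open>\<lambda>_. a\<close>, so that the lemmas on
matrix products apply to it.\<close>

definition row_equiv :: "nat \<Rightarrow> (nat \<Rightarrow> 'a) \<Rightarrow> (nat \<Rightarrow> 'a) \<Rightarrow> bool" where
  "row_equiv m a b \<longleftrightarrow> (\<forall>j<m. a j \<in> carrier R) \<and> (\<exists>E. invertible_matrix R m E \<and>
     (\<forall>j<m. b j = mmul m (\<lambda>_. a) E 0 j))"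

lemma row_equiv_trans:
  assumes "row_equiv m a b" "row_equiv m b c" shows "row_equiv m a c"
proof -
  obtain E F where a: "\<forall>j<m. a j \<in> carrier R" and E: "invertible_matrix R m E" "\<forall>j<m. b j = mmul m (\<lambda>_. a) E 0 j"
    and F: "invertible_matrix R m F" "\<forall>j<m. c j = mmul m (\<lambda>_. b) F 0 j" and b: "\<forall>j<m. b j \<in> carrier R"
    using assms unfolding row_equiv_def by blast
  have EF: "E \<in> square_matrices R m" "F \<in> square_matrices R m" using E F by (auto simp: invertible_matrix_def)
  have "c j = mmul m (\<lambda>_. a) (mmul m E F) 0 j" if j: "j < m" for j
  proof -
    have "c j = mmul m (mmul m (\<lambda>_. a) E) F 0 j"
      using F(2) j E(2) b square_matricesD[OF EF(2)] by (auto intro!: mmul_cong)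
    then show ?thesis
      using mmul_assoc[of m "\<lambda>_. a" 0 E F j] a j square_matricesD[OF EF(1)] square_matricesD[OF EF(2)] by auto
  qed
  then show ?thesis using a invertible_mmul[OF E(1) F(1)] unfolding row_equiv_def by blast
qed

text \<open>If \<open>a E\<close> is the first unit row, then \<open>a\<close> is the first row of the inverse of \<open>E\<close>.\<close>

lemma completable_if_row_equiv_unit:
  assumes e: "row_equiv m a (delta 0)" and m: "0 < m"
  shows "\<exists>A. invertible_matrix R m A \<and> (\<forall>j<m. A 0 j = a j)"
proof -
  obtain E where a: "\<forall>j<m. a j \<in> carrier R" and E: "invertible_matrix R m E" "\<forall>j<m. delta 0 j = mmul m (\<lambda>_. a) E 0 j"
    using e unfolding row_equiv_def by blast
  then obtain F where EF: "E \<in> square_matrices R m" "F \<in> square_matrices R m" "inverse_matrices R m E F"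
    unfolding invertible_matrix_def by blast
  note c = square_matricesD[OF EF(1)] square_matricesD[OF EF(2)]
  have "F 0 j = a j" if j: "j < m" for j
  proof -
    have "F 0 j = mmul m delta F 0 j" using m j c by (intro mmul_delta_left[symmetric]) auto
    also have "\<dots> = mmul m (mmul m (\<lambda>_. a) E) F 0 j"
      using E(2) j c by (intro mmul_cong) (auto simp flip: E(2)[rule_format])
    also have "\<dots> = mmul m (\<lambda>_. a) (mmul m E F) 0 j" using a j c by (intro mmul_assoc) auto
    also have "\<dots> = mmul m (\<lambda>_. a) delta 0 j"
      using EF(3) a j by (intro mmul_cong) (auto simp: inverse_matrices_iff)
    also have "\<dots> = a j" using a j by (intro mmul_delta_right) auto
    finally show ?thesis .
  qed
  moreover have "invertible_matrix R m F"
    using EF unfolding invertible_matrix_def inverse_matrices_iff by blast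
  ultimately show ?thesis by blast
qed

lemma row_equiv_add_last:
  assumes a: "\<And>j. j < Suc n \<Longrightarrow> a j \<in> carrier R" and r: "\<And>j. j < n \<Longrightarrow> r j \<in> carrier R"
  shows "row_equiv (Suc n) a (\<lambda>j. if j < n then a j \<oplus> a n \<otimes> r j else a j)"
proof -
  define N where "N i j = (if i = n \<and> j < n then r j else \<zero>)" for i j
  have Nc: "N i j \<in> carrier R" for i j using r by (auto simp: N_def)
  have inv: "invertible_matrix R (Suc n) (\<lambda>i j. delta i j \<oplus> N i j)"
    by (rule invertible_transvection[where P = "{n}"]) (use Nc in \<open>auto simp: N_def\<close>)
  have "mmul (Suc n) (\<lambda>_. a) (\<lambda>i j. delta i j \<oplus> N i j) 0 j = (if j < n then a j \<oplus> a n \<otimes> r j else a j)"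
    if j: "j < Suc n" for j
  proof -
    have "mmul (Suc n) (\<lambda>_. a) N 0 j = (\<Oplus>i\<in>{..<Suc n}. if n = i then a n \<otimes> N n j else \<zero>)"
      unfolding mmul_def using a Nc r by (intro finsum_cong') (auto simp: N_def)
    also have "\<dots> = a n \<otimes> N n j"
      using a Nc by (intro finsum_singleton) auto
    finally have "mmul (Suc n) (\<lambda>_. a) N 0 j = a n \<otimes> N n j" .
    moreover have "mmul (Suc n) (\<lambda>_. a) (\<lambda>i j. delta i j \<oplus> N i j) 0 j = a j \<oplus> mmul (Suc n) (\<lambda>_. a) N 0 j"
      using mmul_add_right[of "Suc n" "\<lambda>_. a" 0 delta j N] mmul_delta_right[OF j, of "\<lambda>_. a" 0] a Nc by auto
    ultimately show ?thesis using a[OF j] a[of n] by (simp add: N_def)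
  qed
  then show ?thesis unfolding row_equiv_def using a inv by (metis (no_types, lifting))
qed

lemma row_equiv_add_to_last:
  assumes a: "\<And>j. j < Suc n \<Longrightarrow> a j \<in> carrier R" and r: "\<And>j. j < n \<Longrightarrow> r j \<in> carrier R"
  shows "row_equiv (Suc n) a (\<lambda>j. if j = n then a n \<oplus> (\<Oplus>i\<in>{..<n}. a i \<otimes> r i) else a j)"
proof -
  define N where "N i j = (if i < n \<and> j = n then r i else \<zero>)" for i j
  have Nc: "N i j \<in> carrier R" for i j using r by (auto simp: N_def)
  have inv: "invertible_matrix R (Suc n) (\<lambda>i j. delta i j \<oplus> N i j)"
    by (rule invertible_transvection[where P = "{..<n}"]) (use Nc in \<open>auto simp: N_def\<close>)
  have "mmul (Suc n) (\<lambda>_. a) (\<lambda>i j. delta i j \<oplus> N i j) 0 j =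
     (if j = n then a n \<oplus> (\<Oplus>i\<in>{..<n}. a i \<otimes> r i) else a j)"
    if j: "j < Suc n" for j
  proof -
    have "mmul (Suc n) (\<lambda>_. a) N 0 j = a n \<otimes> N n j \<oplus> (\<Oplus>i\<in>{..<n}. a i \<otimes> N i j)"
      unfolding mmul_def lessThan_Suc using a Nc by (intro finsum_insert) auto
    also have "a n \<otimes> N n j = \<zero>" using a by (simp add: N_def)
    also have "(\<Oplus>i\<in>{..<n}. a i \<otimes> N i j) = (if j = n then \<Oplus>i\<in>{..<n}. a i \<otimes> r i else \<zero>)"
    proof (cases "j = n")
      case True
      then show ?thesis using a r by (auto intro!: finsum_cong' simp: N_def)
    next
      case False
      then show ?thesis using a by (auto intro!: add.finprod_one_eqI simp: N_def)
    qed
    finally have "mmul (Suc n) (\<lambda>_. a) N 0 j = \<zero> \<oplus> (if j = n then \<Oplus>i\<in>{..<n}. a i \<otimes> r i else \<zero>)" .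
    moreover have "mmul (Suc n) (\<lambda>_. a) (\<lambda>i j. delta i j \<oplus> N i j) 0 j = a j \<oplus> mmul (Suc n) (\<lambda>_. a) N 0 j"
      using mmul_add_right[of "Suc n" "\<lambda>_. a" 0 delta j N] mmul_delta_right[OF j, of "\<lambda>_. a" 0] a Nc by auto
    moreover have "(\<Oplus>i\<in>{..<n}. a i \<otimes> r i) \<in> carrier R" using a r by (intro finsum_closed) auto
    ultimately show ?thesis using a[OF j] by simp
  qed
  then show ?thesis unfolding row_equiv_def using a inv by (metis (no_types, lifting))
qed

text \<open>Stability makes the first \<open>n\<close> entries unimodular by adding multiples of the last entry to them. Then the last entry can be
changed to \<open>1\<close>, which in turn changes the other entries to those of the first unit row, and their first entry clears the last one. Every
step is multiplication by a transvection.\<close>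

lemma completable_if_stable:
  assumes n: "0 < n" and a: "unimodular_row R (Suc n) a" and st: "stable_row R (Suc n) a"
  shows "\<exists>A. invertible_matrix R (Suc n) A \<and> (\<forall>j<Suc n. A 0 j = a j)"
proof (rule completable_if_row_equiv_unit)
  have ac: "\<And>j. j < Suc n \<Longrightarrow> a j \<in> carrier R" using a by (auto simp: unimodular_row_def Pi_iff)
  obtain r where r: "\<And>j. j < n \<Longrightarrow> r j \<in> carrier R" "unimodular_row R n (\<lambda>i. a i \<oplus> a n \<otimes> r i)"
    using st unfolding stable_row_def by (auto simp: Pi_iff)
  define a1 where "a1 = (\<lambda>j. if j < n then a j \<oplus> a n \<otimes> r j else a j)"
  have e1: "row_equiv (Suc n) a a1" unfolding a1_def by (rule row_equiv_add_last[OF ac r(1)])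
  have a1c: "\<And>j. j < Suc n \<Longrightarrow> a1 j \<in> carrier R" using ac r by (auto simp: a1_def)
  obtain b where b: "b \<in> {..<n} \<rightarrow> carrier R" "\<one> = (\<Oplus>i\<in>{..<n}. (a i \<oplus> a n \<otimes> r i) \<otimes> b i)"
    using r(2) unfolding unimodular_row_iff_sum by blast
  have b1: "\<one> = (\<Oplus>i\<in>{..<n}. a1 i \<otimes> b i)"
    using b a1c by (subst b(2)) (auto intro!: finsum_cong' simp: a1_def ac r(1) Pi_iff)
  define c where "c i = b i \<otimes> (\<one> \<ominus> a1 n)" for i
  have cc: "\<And>j. j < n \<Longrightarrow> c j \<in> carrier R" using b(1) a1c by (auto simp: c_def Pi_iff)
  define a2 where "a2 = (\<lambda>j. if j = n then a1 n \<oplus> (\<Oplus>i\<in>{..<n}. a1 i \<otimes> c i) else a1 j)"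
  have e2: "row_equiv (Suc n) a1 a2" unfolding a2_def by (rule row_equiv_add_to_last[OF a1c cc])
  have "(\<Oplus>i\<in>{..<n}. a1 i \<otimes> c i) = (\<Oplus>i\<in>{..<n}. a1 i \<otimes> b i \<otimes> (\<one> \<ominus> a1 n))"
    using b(1) a1c by (auto intro!: finsum_cong' simp: c_def m_assoc Pi_iff)
  also have "\<dots> = (\<Oplus>i\<in>{..<n}. a1 i \<otimes> b i) \<otimes> (\<one> \<ominus> a1 n)"
    using b(1) a1c by (intro finsum_ldistr[symmetric]) (auto simp: Pi_iff)
  also have "\<dots> = \<one> \<ominus> a1 n" using b1[symmetric] a1c by simp
  finally have "a1 n \<oplus> (\<Oplus>i\<in>{..<n}. a1 i \<otimes> c i) = \<one>"
    using a1c[of n] by (simp add: a_minus_def a_lcomm r_neg)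
  then have a2n: "a2 n = \<one>" by (simp add: a2_def)
  have a2c: "\<And>j. j < Suc n \<Longrightarrow> a2 j \<in> carrier R" using a1c a2n by (auto simp: a2_def)
  define d where "d j = delta 0 j \<ominus> a2 j" for j
  have dc: "\<And>j. j < n \<Longrightarrow> d j \<in> carrier R" using a2c by (auto simp: d_def)
  define a3 where "a3 = (\<lambda>j. if j < n then a2 j \<oplus> a2 n \<otimes> d j else a2 j)"
  have e3: "row_equiv (Suc n) a2 a3" unfolding a3_def by (rule row_equiv_add_last[OF a2c dc])
  have a3j: "a3 j = delta 0 j" if "j < n" for j
    using that a2c[of j] dc[of j] a2n by (simp add: a3_def d_def a_minus_def a_lcomm[of "a2 j" "delta 0 j"] r_neg)
  have a3n: "a3 n = \<one>" using a2n by (simp add: a3_def)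
  have a3c: "\<And>j. j < Suc n \<Longrightarrow> a3 j \<in> carrier R" using a3j a3n by (metis delta_closed less_SucE one_closed)
  define f where "f j = \<ominus> (delta 0 j)" for j
  have fc: "f j \<in> carrier R" for j unfolding f_def by (rule a_inv_closed[OF delta_closed])
  have e4: "row_equiv (Suc n) a3 (\<lambda>j. if j = n then a3 n \<oplus> (\<Oplus>i\<in>{..<n}. a3 i \<otimes> f i) else a3 j)"
    by (rule row_equiv_add_to_last[OF a3c fc])
  have "(\<Oplus>i\<in>{..<n}. a3 i \<otimes> f i) = (\<Oplus>i\<in>{..<n}. if 0 = i then \<ominus> \<one> else \<zero>)"
    by (rule finsum_cong') (auto simp: a3j f_def delta_def)
  also have "\<dots> = \<ominus> \<one>" using n by (intro finsum_singleton) auto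
  finally have last: "a3 n \<oplus> (\<Oplus>i\<in>{..<n}. a3 i \<otimes> f i) = \<zero>" using a3n by (simp add: r_neg)
  have "(if j = n then a3 n \<oplus> (\<Oplus>i\<in>{..<n}. a3 i \<otimes> f i) else a3 j) = delta 0 j" if "j < Suc n" for j
    using that last a3j[of j] n by (auto simp: delta_def)
  then have e4': "row_equiv (Suc n) a3 (delta 0)" using e4 unfolding row_equiv_def by (metis (no_types, lifting))
  show "row_equiv (Suc n) a (delta 0)"
    using e1 e2 e3 e4' row_equiv_trans by blast
qed simp

end

context right_one_dimensional begin

text \<open>The map \<open>(x, y) \<mapsto> a 0 x + a 1 y\<close> is split by \<open>(u, v)\<close>, and its kernel is free on \<open>(p, q)\<close>.
So the columns \<open>(u, v)\<close> and \<open>(p, q)\<close> form a basis of \<open>R^2\<close>, and the inverse of this matrix has first row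
\<open>a\<close>. Its second row expresses the projections of the two unit vectors to the kernel through the generator.\<close>

lemma completable_if_kernel_cyclic:
  assumes a: "a 0 \<in> carrier R" "a (Suc 0) \<in> carrier R" and u: "u \<in> carrier R" "v \<in> carrier R"
    and uv: "a 0 \<otimes> u \<oplus> a (Suc 0) \<otimes> v = \<one>"
    and pq: "p \<in> carrier R" "q \<in> carrier R" "p \<noteq> \<zero> \<or> q \<noteq> \<zero>" "a 0 \<otimes> p \<oplus> a (Suc 0) \<otimes> q = \<zero>"
    and ker: "\<And>x y. x \<in> carrier R \<Longrightarrow> y \<in> carrier R \<Longrightarrow> a 0 \<otimes> x \<oplus> a (Suc 0) \<otimes> y = \<zero> \<Longrightarrow>
       \<exists>z\<in>carrier R. x = p \<otimes> z \<and> y = q \<otimes> z"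
  shows "\<exists>A. invertible_matrix R 2 A \<and> (\<forall>j<2. A 0 j = a j)"
proof -
  define a0 where "a0 = a 0"
  define a1 where "a1 = a (Suc 0)"
  have c: "a0 \<in> carrier R" "a1 \<in> carrier R" using a by (auto simp: a0_def a1_def)
  note uv = uv[folded a0_def a1_def] and pq0 = pq(4)[folded a0_def a1_def] and ker = ker[folded a0_def a1_def]
  have "a0 \<otimes> (\<one> \<ominus> u \<otimes> a0) \<oplus> a1 \<otimes> (\<ominus> (v \<otimes> a0)) = a0 \<ominus> (a0 \<otimes> u \<oplus> a1 \<otimes> v) \<otimes> a0"
    using c u by (simp add: r_distr l_distr a_minus_def r_minus m_assoc minus_add a_assoc)
  then have "a0 \<otimes> (\<one> \<ominus> u \<otimes> a0) \<oplus> a1 \<otimes> (\<ominus> (v \<otimes> a0)) = \<zero>" unfolding uv using c by simp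
  then obtain z1 where z1: "z1 \<in> carrier R" "\<one> \<ominus> u \<otimes> a0 = p \<otimes> z1" "\<ominus> (v \<otimes> a0) = q \<otimes> z1"
    using ker[of "\<one> \<ominus> u \<otimes> a0" "\<ominus> (v \<otimes> a0)"] c u by auto
  have "a0 \<otimes> (\<ominus> (u \<otimes> a1)) \<oplus> a1 \<otimes> (\<one> \<ominus> v \<otimes> a1) = a1 \<ominus> (a0 \<otimes> u \<oplus> a1 \<otimes> v) \<otimes> a1"
    using c u by (simp add: r_distr l_distr a_minus_def r_minus m_assoc minus_add a_lcomm)
  then have "a0 \<otimes> (\<ominus> (u \<otimes> a1)) \<oplus> a1 \<otimes> (\<one> \<ominus> v \<otimes> a1) = \<zero>" unfolding uv using c by simp
  then obtain z2 where z2: "z2 \<in> carrier R" "\<ominus> (u \<otimes> a1) = p \<otimes> z2" "\<one> \<ominus> v \<otimes> a1 = q \<otimes> z2"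
    using ker[of "\<ominus> (u \<otimes> a1)" "\<one> \<ominus> v \<otimes> a1"] c u by auto
  \<comment> \<open>Identities for the second row are checked after multiplying by the generator of the kernel.\<close>
  have cancel: "w = \<zero>" if "w \<in> carrier R" "p \<otimes> w = \<zero>" "q \<otimes> w = \<zero>" for w
    using that pq no_zero_divisors by blast
  have AB1: "z1 \<otimes> u \<oplus> z2 \<otimes> v = \<zero>"
  proof (rule cancel)
    show "z1 \<otimes> u \<oplus> z2 \<otimes> v \<in> carrier R" using z1 z2 u by simp
    have "p \<otimes> (z1 \<otimes> u \<oplus> z2 \<otimes> v) = (p \<otimes> z1) \<otimes> u \<oplus> (p \<otimes> z2) \<otimes> v"
      using z1 z2 u pq by (simp add: r_distr m_assoc)
    also have "\<dots> = u \<ominus> u \<otimes> (a0 \<otimes> u \<oplus> a1 \<otimes> v)"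
      unfolding z1(2)[symmetric] z2(2)[symmetric] using c u
      by (simp add: r_distr l_distr a_minus_def l_minus m_assoc minus_add a_assoc)
    finally show "p \<otimes> (z1 \<otimes> u \<oplus> z2 \<otimes> v) = \<zero>" unfolding uv using u by simp
    have "q \<otimes> (z1 \<otimes> u \<oplus> z2 \<otimes> v) = (q \<otimes> z1) \<otimes> u \<oplus> (q \<otimes> z2) \<otimes> v"
      using z1 z2 u pq by (simp add: r_distr m_assoc)
    also have "\<dots> = v \<ominus> v \<otimes> (a0 \<otimes> u \<oplus> a1 \<otimes> v)"
      unfolding z1(3)[symmetric] z2(3)[symmetric] using c u
      by (simp add: r_distr l_distr a_minus_def l_minus m_assoc minus_add a_lcomm)
    finally show "q \<otimes> (z1 \<otimes> u \<oplus> z2 \<otimes> v) = \<zero>" unfolding uv using u by simp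
  qed
  have AB2: "z1 \<otimes> p \<oplus> z2 \<otimes> q = \<one>"
  proof -
    have "(z1 \<otimes> p \<oplus> z2 \<otimes> q) \<ominus> \<one> = \<zero>"
    proof (rule cancel)
      show "(z1 \<otimes> p \<oplus> z2 \<otimes> q) \<ominus> \<one> \<in> carrier R" using z1 z2 pq by simp
      have "p \<otimes> ((z1 \<otimes> p \<oplus> z2 \<otimes> q) \<ominus> \<one>) = (p \<otimes> z1) \<otimes> p \<oplus> (p \<otimes> z2) \<otimes> q \<ominus> p"
        using z1 z2 pq by (simp add: r_distr a_minus_def r_minus m_assoc)
      also have "\<dots> = \<ominus> (u \<otimes> (a0 \<otimes> p \<oplus> a1 \<otimes> q))"
        unfolding z1(2)[symmetric] z2(2)[symmetric] using c u pq
        by (simp add: r_distr l_distr a_minus_def l_minus m_assoc minus_add a_ac r_neg r_neg1 r_neg2)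
      finally show "p \<otimes> ((z1 \<otimes> p \<oplus> z2 \<otimes> q) \<ominus> \<one>) = \<zero>" unfolding pq0 using u by simp
      have "q \<otimes> ((z1 \<otimes> p \<oplus> z2 \<otimes> q) \<ominus> \<one>) = (q \<otimes> z1) \<otimes> p \<oplus> (q \<otimes> z2) \<otimes> q \<ominus> q"
        using z1 z2 pq by (simp add: r_distr a_minus_def r_minus m_assoc)
      also have "\<dots> = \<ominus> (v \<otimes> (a0 \<otimes> p \<oplus> a1 \<otimes> q))"
        unfolding z1(3)[symmetric] z2(3)[symmetric] using c u pq
        by (simp add: r_distr l_distr a_minus_def l_minus m_assoc minus_add a_ac r_neg r_neg1 r_neg2)
      finally show "q \<otimes> ((z1 \<otimes> p \<oplus> z2 \<otimes> q) \<ominus> \<one>) = \<zero>" unfolding pq0 using u by simp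
    qed
    then show ?thesis using z1 z2 pq by simp
  qed
  have BA: "u \<otimes> a0 \<oplus> p \<otimes> z1 = \<one>" "u \<otimes> a1 \<oplus> p \<otimes> z2 = \<zero>" "v \<otimes> a0 \<oplus> q \<otimes> z1 = \<zero>" "v \<otimes> a1 \<oplus> q \<otimes> z2 = \<one>"
    unfolding z1(2,3)[symmetric] z2(2,3)[symmetric] using c u by (simp_all add: a_minus_def a_lcomm r_neg)
  define A where "A i j = (if i = 0 then (if j = 0 then a0 else a1) else if j = 0 then z1 else z2)" for i j :: nat
  define B where "B i j = (if i = 0 then (if j = 0 then u else p) else if j = 0 then v else q)" for i j :: nat
  have two: "{..<2::nat} = {0, Suc 0}" by auto
  have AM: "A \<in> square_matrices R 2" "B \<in> square_matrices R 2"
    using c u pq z1 z2 by (auto simp: square_matrices_def A_def B_def)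
  have "inverse_matrices R 2 A B"
    unfolding inverse_matrices_def two
    using c u pq z1(1) z2(1) uv pq0 AB1 AB2 BA by (auto simp: A_def B_def less_2_cases_iff)
  then have "invertible_matrix R 2 A" using AM unfolding invertible_matrix_def by blast
  moreover have "\<forall>j<2. A 0 j = a j" by (auto simp: A_def a0_def a1_def less_2_cases_iff)
  ultimately show ?thesis by blast
qed

end

section \<open>Ideal classes\<close>

context dedekind begin

text \<open>Equality of ideal classes, written without fractions.\<close>

definition ideal_sim :: "'a set \<Rightarrow> 'a set \<Rightarrow> bool" where
  "ideal_sim A B \<longleftrightarrow> (\<exists>c\<in>carrier D. \<exists>d\<in>carrier D. c \<noteq> \<zero> \<and> d \<noteq> \<zero> \<and>
     (PIdl c) \<cdot> A = (PIdl d) \<cdot> B)"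

lemma ideal_sim_refl: "ideal_sim A A"
  unfolding ideal_sim_def using one_closed one_not_zero by blast

lemma ideal_sim_sym: "ideal_sim A B \<Longrightarrow> ideal_sim B A"
  unfolding ideal_sim_def by metis

lemma PIdl_PIdl:
  assumes "c \<in> carrier D" "e \<in> carrier D" shows "(PIdl c) \<cdot> (PIdl e) = PIdl (c \<otimes> e)"
proof -
  have "(PIdl c) \<cdot> (PIdl e) = (\<lambda>a. c \<otimes> a) ` (PIdl e)"
    by (rule PIdl_prod[OF assms(1) cgenideal_ideal[OF assms(2)]])
  also have "\<dots> = PIdl (c \<otimes> e)"
  proof -
    have P: "PIdl x = (\<lambda>y. y \<otimes> x) ` carrier D" for x by (auto simp: cgenideal_def)
    show ?thesis unfolding P image_image using assms by (intro image_cong) (auto simp: m_lcomm)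
  qed
  finally show ?thesis .
qed

lemma ideal_sim_trans:
  assumes AB: "ideal_sim A B" and BC: "ideal_sim B C" and id: "ideal A D" "ideal B D" "ideal C D"
  shows "ideal_sim A C"
proof -
  obtain c d where cd: "c \<in> carrier D" "d \<in> carrier D" "c \<noteq> \<zero>" "d \<noteq> \<zero>" "(PIdl c) \<cdot> A = (PIdl d) \<cdot> B"
    using AB unfolding ideal_sim_def by blast
  obtain e f where ef: "e \<in> carrier D" "f \<in> carrier D" "e \<noteq> \<zero>" "f \<noteq> \<zero>" "(PIdl e) \<cdot> B = (PIdl f) \<cdot> C"
    using BC unfolding ideal_sim_def by blast
  note P = cgenideal_ideal[OF cd(1)] cgenideal_ideal[OF cd(2)] cgenideal_ideal[OF ef(1)] cgenideal_ideal[OF ef(2)]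
  have "(PIdl (e \<otimes> c)) \<cdot> A = (PIdl e) \<cdot> ((PIdl c) \<cdot> A)"
    using PIdl_PIdl[OF ef(1) cd(1)] ideal_prod_assoc[OF P(3) P(1) id(1)] by simp
  also have "\<dots> = ((PIdl e) \<cdot> (PIdl d)) \<cdot> B"
    using cd(5) ideal_prod_assoc[OF P(3) P(2) id(2)] by simp
  also have "\<dots> = (PIdl d) \<cdot> ((PIdl e) \<cdot> B)"
    using ideal_prod_commute[OF P(3) P(2)] ideal_prod_assoc[OF P(2) P(3) id(2)] by simp
  also have "\<dots> = (PIdl (d \<otimes> f)) \<cdot> C"
    using ef(5) PIdl_PIdl[OF cd(2) ef(2)] ideal_prod_assoc[OF P(2) P(4) id(3)] by simp
  finally show ?thesis
    unfolding ideal_sim_def using cd ef integral_iff by (metis m_closed)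
qed

lemma ideal_sim_prod:
  assumes AB: "ideal_sim A B" and id: "ideal A D" "ideal B D" "ideal C D"
  shows "ideal_sim (C \<cdot> A) (C \<cdot> B)"
proof -
  obtain c d where cd: "c \<in> carrier D" "d \<in> carrier D" "c \<noteq> \<zero>" "d \<noteq> \<zero>" "(PIdl c) \<cdot> A = (PIdl d) \<cdot> B"
    using AB unfolding ideal_sim_def by blast
  have swap: "(PIdl x) \<cdot> (C \<cdot> X) = C \<cdot> ((PIdl x) \<cdot> X)" if "x \<in> carrier D" "ideal X D" for x X
    using ideal_prod_assoc[OF cgenideal_ideal[OF that(1)] id(3) that(2)]
      ideal_prod_assoc[OF id(3) cgenideal_ideal[OF that(1)] that(2)]
      ideal_prod_commute[OF cgenideal_ideal[OF that(1)] id(3)] by simp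
  have "(PIdl c) \<cdot> (C \<cdot> A) = (PIdl d) \<cdot> (C \<cdot> B)"
    using swap[OF cd(1) id(1)] swap[OF cd(2) id(2)] cd(5) by simp
  then show ?thesis unfolding ideal_sim_def using cd by blast
qed

lemma principal_if_sim_carrier:
  assumes id: "ideal A D" and sim: "ideal_sim A (carrier D)" shows "\<exists>x\<in>carrier D. A = PIdl x"
proof -
  obtain c d where cd: "c \<in> carrier D" "d \<in> carrier D" "c \<noteq> \<zero>" "(PIdl c) \<cdot> A = (PIdl d) \<cdot> carrier D"
    using sim unfolding ideal_sim_def by blast
  note P = cgenideal_ideal[OF cd(1)] cgenideal_ideal[OF cd(2)]
  have e: "(\<lambda>a. c \<otimes> a) ` A = PIdl d"
    using cd(4) PIdl_prod[OF cd(1) id] ideal_prod_one[OF P(2)] by simp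
  then have "d \<in> (\<lambda>a. c \<otimes> a) ` A" using cgenideal_self[OF cd(2)] by simp
  then obtain x where x: "x \<in> A" "d = c \<otimes> x" by blast
  have xc: "x \<in> carrier D" using x id ideal.Icarr by metis
  have "(\<lambda>a. c \<otimes> a) ` A = (\<lambda>a. c \<otimes> a) ` (PIdl x)"
    using e x(2) PIdl_PIdl[OF cd(1) xc] PIdl_prod[OF cd(1) cgenideal_ideal[OF xc]] by simp
  then have "A = PIdl x"
    using scaled_ideal_inj[OF cd(1,3)] id cgenideal_ideal[OF xc] ideal.Icarr by (metis subsetI)
  then show ?thesis using xc by blast
qed

text \<open>A linear map \<open>\<phi>\<close> satisfies \<open>\<phi> x0 * x = x0 * \<phi> x\<close>, so it is multiplication by the fraction
\<open>\<phi> x0 / x0\<close>.\<close>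

lemma ideal_sim_if_isomorphic:
  assumes A: "ideal A D" and B: "ideal B D" and iso: "isomorphic_ideals D A B"
  shows "ideal_sim A B"
proof -
  obtain \<phi> where bij: "bij_betw \<phi> A B"
    and lin: "\<And>r x. r \<in> carrier D \<Longrightarrow> x \<in> A \<Longrightarrow> \<phi> (r \<otimes> x) = r \<otimes> \<phi> x"
    using iso unfolding isomorphic_ideals_def by blast
  have Ac: "x \<in> A \<Longrightarrow> x \<in> carrier D" and Bc: "x \<in> B \<Longrightarrow> x \<in> carrier D" for x
    using A B ideal.Icarr by metis+
  have img: "\<phi> ` A = B" and inj: "inj_on \<phi> A" using bij by (auto simp: bij_betw_def)
  have z: "\<zero> \<in> A" "\<zero> \<in> B" using A B ideal_iff_right_ideal right_ideal_zero by blast+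
  have \<phi>0: "\<phi> \<zero> = \<zero>"
    using lin[OF zero_closed z(1)] img z(1) Bc by (metis imageI l_null zero_closed)
  show ?thesis
  proof (cases "A = {\<zero>}")
    case True
    then have "B = {\<zero>}" using img \<phi>0 by auto
    then show ?thesis using True ideal_sim_refl by simp
  next
    case False
    then obtain x0 where x0: "x0 \<in> A" "x0 \<noteq> \<zero>" using z by blast
    have p0: "\<phi> x0 \<in> B" using img x0 by blast
    have "\<phi> x0 \<noteq> \<zero>" using inj x0 z \<phi>0 by (metis inj_onD)
    moreover have comm: "x0 \<otimes> \<phi> x = \<phi> x0 \<otimes> x" if x: "x \<in> A" for x
      using lin[OF Ac[OF x0(1)] x] lin[OF Ac[OF x] x0(1)] Ac x x0 p0 Bc m_comm by metis
    have "(\<lambda>y. \<phi> x0 \<otimes> y) ` A = (\<lambda>y. x0 \<otimes> y) ` B"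
      unfolding img[symmetric] image_image using comm by (intro image_cong) auto
    then have "(PIdl (\<phi> x0)) \<cdot> A = (PIdl x0) \<cdot> B"
      using PIdl_prod[OF Bc[OF p0] A] PIdl_prod[OF Ac[OF x0(1)] B] by simp
    ultimately show ?thesis
      unfolding ideal_sim_def using x0 Ac Bc p0 by blast
  qed
qed

end

context skew_dedekind begin

lemma ideal_tw_image:
  assumes N: "ideal N D" shows "ideal (tw m ` N) D"
proof -
  have rN: "right_ideal N D" using N ideal_iff_right_ideal by simp
  note c = right_ideal_carrier[OF rN]
  have "right_ideal (tw m ` N) D"
  proof (rule right_idealI)
    show "tw m ` N \<subseteq> carrier D" using c tw_hom by auto
    show "\<zero> \<in> tw m ` N" using right_ideal_zero[OF rN] tw_zero by (metis imageI)
    show "x \<oplus> y \<in> tw m ` N" if xy: "x \<in> tw m ` N" "y \<in> tw m ` N" for x y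
    proof -
      obtain x' y' where "x' \<in> N" "y' \<in> N" "x = tw m x'" "y = tw m y'" using xy by blast
      then have "x \<oplus> y = tw m (x' \<oplus> y')" "x' \<oplus> y' \<in> N"
        using c tw_hom(2) right_ideal_add[OF rN] by auto
      then show ?thesis by blast
    qed
    show "x \<otimes> r \<in> tw m ` N" if xN: "x \<in> tw m ` N" and r: "r \<in> carrier D" for x r
    proof -
      obtain x' where x: "x' \<in> N" "x = tw m x'" using xN by blast
      have r': "tw (- m) r \<in> carrier D" using tw_hom(1)[OF r] .
      have "x \<otimes> r = tw m (x' \<otimes> tw (- m) r)" using x c r r' by (simp add: tw_hom(3))
      then show ?thesis using right_ideal_mult[OF rN x(1) r'] by blast
    qed
  qed
  then show ?thesis by (simp add: ideal_iff_right_ideal)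
qed

lemma ideal_sim_tw_image:
  assumes triv: "acts_trivially_on_class_group D \<sigma>" and N: "ideal N D"
  shows "ideal_sim (tw m ` N) N"
proof -
  have s: "ideal_sim (\<sigma> ` I) I" if I: "ideal I D" for I
  proof -
    have "\<sigma> ` I = tw 1 ` I" by (simp add: tw_1)
    then have "ideal (\<sigma> ` I) D" using ideal_tw_image[OF I] by metis
    then show ?thesis
      using triv I ideal_sim_if_isomorphic unfolding acts_trivially_on_class_group_def by blast
  qed
  have succ: "tw (i + 1) ` N = \<sigma> ` tw i ` N" for i
    unfolding image_image using ideal.Icarr[OF N] by (intro image_cong) (auto simp: tw_succ)
  show ?thesis
  proof (induction m rule: int_induct[where k = 0])
    case base
    then show ?case using ideal_sim_refl by simp
  next
    case (step1 i)
    then show ?case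
      using ideal_sim_trans[OF _ step1(2)] s[OF ideal_tw_image[OF N]] ideal_tw_image[OF N] N
      unfolding succ by (metis succ)
  next
    case (step2 i)
    have e: "tw i ` N = \<sigma> ` tw (i - 1) ` N" using succ[of "i - 1"] by simp
    have "ideal_sim (tw (i - 1) ` N) (tw i ` N)"
      unfolding e by (rule ideal_sim_sym[OF s[OF ideal_tw_image[OF N]]])
    then show ?case by (rule ideal_sim_trans[OF _ step2(2)]) (intro ideal_tw_image N)+
  qed
qed

section \<open>Kernels of unimodular pairs\<close>

text \<open>The graded piece of degree \<open>m\<close> for the filtration of \<open>W\<close> by order.\<close>

definition gr :: "int \<Rightarrow> (int \<Rightarrow> 'a) set \<Rightarrow> 'a set" where
  "gr m W = (\<lambda>f. f m) ` {f \<in> W. order_ge m f}"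

lemma grI: "f \<in> W \<Longrightarrow> order_ge m f \<Longrightarrow> f m \<in> gr m W"
  by (auto simp: gr_def)

lemma grE: "x \<in> gr m W \<Longrightarrow> (\<And>f. f \<in> W \<Longrightarrow> order_ge m f \<Longrightarrow> x = f m \<Longrightarrow> P) \<Longrightarrow> P"
  by (auto simp: gr_def)

end

text \<open>The kernel of the pair \<open>(a, b)\<close> is isomorphic to the right ideal of all \<open>r\<close> with \<open>a r \<in> b R\<close>,
so the task is to find the class of its ideal of lowest coefficients. Multiplying \<open>b\<close> by a power of \<open>x\<close> normalises its order
to \<open>0\<close>.\<close>

locale unimodular_pair = skew_dedekind D \<sigma> for D (structure) and \<sigma> +
  fixes a b u v :: "int \<Rightarrow> 'a"
  assumes a: "a \<in> carrier R" and b: "b \<in> carrier R" and u: "u \<in> carrier R" and v: "v \<in> carrier R"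
    and uv: "a \<otimes>\<^bsub>R\<^esub> u \<oplus>\<^bsub>R\<^esub> b \<otimes>\<^bsub>R\<^esub> v = \<one>\<^bsub>R\<^esub>"
    and b0: "order_ge 0 b" "b 0 \<noteq> \<zero>"
begin

text \<open>The \<open>D\<close>-modules \<open>a x^k D[[x]] + b R\<close>. Multiplication by \<open>x\<close> maps \<open>V 0\<close> onto \<open>V
1\<close>, and \<open>d \<mapsto> a d\<close> induces an isomorphism of \<open>D / lead J\<close> with \<open>V 0 / V 1\<close>, where
\<open>J\<close> is the right ideal described above. Comparing the graded pieces of \<open>V 0\<close> and \<open>V 1\<close> therefore computes the
class of \<open>lead J\<close>.\<close>

definition V :: "int \<Rightarrow> (int \<Rightarrow> 'a) set" where
  "V k = {a \<otimes>\<^bsub>R\<^esub> s \<oplus>\<^bsub>R\<^esub> b \<otimes>\<^bsub>R\<^esub> r |s r. s \<in> carrier R \<and> order_ge k s \<and> r \<in> carrier R}"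

lemma VI: "s \<in> carrier R \<Longrightarrow> order_ge k s \<Longrightarrow> r \<in> carrier R \<Longrightarrow> a \<otimes>\<^bsub>R\<^esub> s \<oplus>\<^bsub>R\<^esub> b \<otimes>\<^bsub>R\<^esub> r \<in> V k"
  by (auto simp: V_def)

lemma VE:
  assumes "f \<in> V k"
  obtains s r where "s \<in> carrier R" "order_ge k s" "r \<in> carrier R" "f = a \<otimes>\<^bsub>R\<^esub> s \<oplus>\<^bsub>R\<^esub> b \<otimes>\<^bsub>R\<^esub> r"
  using assms by (auto simp: V_def)

lemma V_closed: "f \<in> V k \<Longrightarrow> f \<in> carrier R"
  using a b by (auto elim!: VE)

lemma V_minus:
  assumes f: "f \<in> V k" and g: "g \<in> V k" shows "f \<ominus>\<^bsub>R\<^esub> g \<in> V k"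
proof -
  obtain s r where f': "s \<in> carrier R" "order_ge k s" "r \<in> carrier R" "f = a \<otimes>\<^bsub>R\<^esub> s \<oplus>\<^bsub>R\<^esub> b \<otimes>\<^bsub>R\<^esub> r"
    using VE[OF f] .
  obtain s' r' where g': "s' \<in> carrier R" "order_ge k s'" "r' \<in> carrier R" "g = a \<otimes>\<^bsub>R\<^esub> s' \<oplus>\<^bsub>R\<^esub> b \<otimes>\<^bsub>R\<^esub> r'"
    using VE[OF g] .
  have "f \<ominus>\<^bsub>R\<^esub> g = a \<otimes>\<^bsub>R\<^esub> (s \<ominus>\<^bsub>R\<^esub> s') \<oplus>\<^bsub>R\<^esub> b \<otimes>\<^bsub>R\<^esub> (r \<ominus>\<^bsub>R\<^esub> r')"
    unfolding f'(4) g'(4) using f'(1,3) g'(1,3) a b by algebra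
  then show ?thesis using VI[of "s \<ominus>\<^bsub>R\<^esub> s'" k "r \<ominus>\<^bsub>R\<^esub> r'"] f' g' order_ge_minus by simp
qed

lemma V_zero: "\<zero>\<^bsub>R\<^esub> \<in> V k"
proof -
  have "order_ge k \<zero>\<^bsub>R\<^esub>" by (simp add: order_ge_def)
  then show ?thesis using VI[of "\<zero>\<^bsub>R\<^esub>" k "\<zero>\<^bsub>R\<^esub>"] a b by simp
qed

lemma V_add:
  assumes f: "f \<in> V k" and g: "g \<in> V k" shows "f \<oplus>\<^bsub>R\<^esub> g \<in> V k"
proof -
  have "f \<oplus>\<^bsub>R\<^esub> g = f \<ominus>\<^bsub>R\<^esub> (\<zero>\<^bsub>R\<^esub> \<ominus>\<^bsub>R\<^esub> g)"
    using V_closed[OF f] V_closed[OF g] by (simp add: a_minus_def)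
  then show ?thesis using V_minus[OF f V_minus[OF V_zero g]] by simp
qed

lemma V_mult:
  assumes f: "f \<in> V k" and g: "g \<in> carrier R" "order_ge j g" shows "f \<otimes>\<^bsub>R\<^esub> g \<in> V (k + j)"
proof -
  obtain s r where f': "s \<in> carrier R" "order_ge k s" "r \<in> carrier R" "f = a \<otimes>\<^bsub>R\<^esub> s \<oplus>\<^bsub>R\<^esub> b \<otimes>\<^bsub>R\<^esub> r"
    using VE[OF f] .
  have "f \<otimes>\<^bsub>R\<^esub> g = a \<otimes>\<^bsub>R\<^esub> (s \<otimes>\<^bsub>R\<^esub> g) \<oplus>\<^bsub>R\<^esub> b \<otimes>\<^bsub>R\<^esub> (r \<otimes>\<^bsub>R\<^esub> g)"
    unfolding f'(4) using f' g a b by (simp add: R.l_distr R.m_assoc)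
  then show ?thesis
    using VI[of "s \<otimes>\<^bsub>R\<^esub> g" "k + j" "r \<otimes>\<^bsub>R\<^esub> g"] order_ge_mult[OF f'(1,2) g] f' g by simp
qed

lemma V_monomial: "f \<in> V k \<Longrightarrow> d \<in> carrier D \<Longrightarrow> f \<otimes>\<^bsub>R\<^esub> monomial d 0 \<in> V k"
  using V_mult[of f k "monomial d 0" 0] monomial_closed order_ge_monomial by simp

lemma V_mono: "f \<in> V 1 \<Longrightarrow> f \<in> V 0"
  by (auto elim!: VE intro!: VI intro: order_ge_mono)

lemma V_b: "r \<in> carrier R \<Longrightarrow> b \<otimes>\<^bsub>R\<^esub> r \<in> V k"
  using VI[of "\<zero>\<^bsub>R\<^esub>" k r] a b by (simp add: order_ge_def)

lemma V_a: "d \<in> carrier D \<Longrightarrow> a \<otimes>\<^bsub>R\<^esub> monomial d 0 \<in> V 0"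
  using VI[of "monomial d 0" 0 "\<zero>\<^bsub>R\<^esub>"] a b monomial_closed order_ge_monomial by simp

lemma V_decomp:
  assumes f: "f \<in> V 0" shows "\<exists>e\<in>carrier D. \<exists>w\<in>V 1. f = a \<otimes>\<^bsub>R\<^esub> monomial e 0 \<oplus>\<^bsub>R\<^esub> w"
proof -
  obtain s r where f': "s \<in> carrier R" "order_ge 0 s" "r \<in> carrier R" "f = a \<otimes>\<^bsub>R\<^esub> s \<oplus>\<^bsub>R\<^esub> b \<otimes>\<^bsub>R\<^esub> r"
    using VE[OF f] .
  define e where "e = s 0"
  have e: "e \<in> carrier D" using coeff_closed[OF f'(1)] by (simp add: e_def)
  note m = monomial_closed[OF e, of 0]
  have "(s \<ominus>\<^bsub>R\<^esub> monomial e 0) 0 = \<zero>"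
    unfolding coeff_minus[OF f'(1) m] using e by (simp add: monomial_def e_def)
  then have "order_ge (0 + 1) (s \<ominus>\<^bsub>R\<^esub> monomial e 0)"
    by (rule order_ge_suc[OF order_ge_minus[OF f'(1) m f'(2) order_ge_monomial]])
  then have "a \<otimes>\<^bsub>R\<^esub> (s \<ominus>\<^bsub>R\<^esub> monomial e 0) \<oplus>\<^bsub>R\<^esub> b \<otimes>\<^bsub>R\<^esub> r \<in> V 1"
    using f' m by (intro VI) simp_all
  moreover have "f = a \<otimes>\<^bsub>R\<^esub> monomial e 0 \<oplus>\<^bsub>R\<^esub> (a \<otimes>\<^bsub>R\<^esub> (s \<ominus>\<^bsub>R\<^esub> monomial e 0) \<oplus>\<^bsub>R\<^esub> b \<otimes>\<^bsub>R\<^esub> r)"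
    unfolding f'(4) using f'(1,3) a b m by algebra
  ultimately show ?thesis using e by blast
qed

lemma gr_V_shift: "gr m (V 1) = gr (m - 1) (V 0)"
proof
  show "gr m (V 1) \<subseteq> gr (m - 1) (V 0)"
  proof
    fix x assume "x \<in> gr m (V 1)"
    then obtain f where f: "f \<in> V 1" "order_ge m f" "x = f m" by (rule grE)
    let ?g = "f \<otimes>\<^bsub>R\<^esub> monomial \<one> (- 1)"
    note fc = V_closed[OF f(1)]
    have "?g \<in> V 0" using V_mult[OF f(1) monomial_closed order_ge_monomial, of \<one> "- 1"] by simp
    moreover have "order_ge (m - 1) ?g" using f(2) fc by (simp add: order_ge_def monomial_shift)
    moreover have "?g (m - 1) = x" using f(3) fc by (simp add: monomial_shift)
    ultimately show "x \<in> gr (m - 1) (V 0)" using grI by metis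
  qed
  show "gr (m - 1) (V 0) \<subseteq> gr m (V 1)"
  proof
    fix x assume "x \<in> gr (m - 1) (V 0)"
    then obtain f where f: "f \<in> V 0" "order_ge (m - 1) f" "x = f (m - 1)" by (rule grE)
    let ?g = "f \<otimes>\<^bsub>R\<^esub> monomial \<one> 1"
    note fc = V_closed[OF f(1)]
    have "?g \<in> V 1" using V_mult[OF f(1) monomial_closed order_ge_monomial, of \<one> 1] by simp
    moreover have "order_ge m ?g" using f(2) fc by (simp add: order_ge_def monomial_shift)
    moreover have "?g m = x" using f(3) fc by (simp add: monomial_shift)
    ultimately show "x \<in> gr m (V 1)" using grI by metis
  qed
qed

lemma ideal_gr_V: "ideal (gr m (V k)) D"
proof -
  have "right_ideal (gr m (V k)) D"
  proof (rule right_idealI)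
    show "gr m (V k) \<subseteq> carrier D" using V_closed coeff_closed by (auto simp: gr_def)
    show "\<zero> \<in> gr m (V k)" using grI[OF V_zero, of m k] by (simp add: order_ge_def)
    show "x \<oplus> y \<in> gr m (V k)" if xy: "x \<in> gr m (V k)" "y \<in> gr m (V k)" for x y
    proof -
      obtain f g where "f \<in> V k" "order_ge m f" "x = f m" "g \<in> V k" "order_ge m g" "y = g m"
        using xy by (auto simp: gr_def)
      then show ?thesis using grI[OF V_add[of f k g] order_ge_add[of m f g]] by (simp add: coeff_add)
    qed
    show "x \<otimes> r \<in> gr m (V k)" if x: "x \<in> gr m (V k)" and r: "r \<in> carrier D" for x r
    proof -
      obtain f where f: "f \<in> V k" "order_ge m f" "x = f m" using x by (rule grE)
      have r': "tw (- m) r \<in> carrier D" using tw_hom(1)[OF r] .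
      have g: "order_ge m (f \<otimes>\<^bsub>R\<^esub> monomial (tw (- m) r) 0)"
        using order_ge_mult[OF V_closed[OF f(1)] f(2) monomial_closed[OF r'] order_ge_monomial[of 0]] by simp
      have "(f \<otimes>\<^bsub>R\<^esub> monomial (tw (- m) r) 0) m = x \<otimes> r"
        using V_closed[OF f(1)] r r' f(3) by (simp add: coeff_mult_monomial)
      then show ?thesis using grI[OF V_monomial[OF f(1) r'] g] by simp
    qed
  qed
  then show ?thesis by (simp add: ideal_iff_right_ideal)
qed

lemma b0_closed: "b 0 \<in> carrier D"
  using coeff_closed[OF b] .

lemma b0_in_gr: "b 0 \<in> gr m (V k)"
proof -
  have "order_ge m (b \<otimes>\<^bsub>R\<^esub> monomial \<one> m)" using b0(1) b by (simp add: order_ge_def monomial_shift)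
  from grI[OF V_b[OF monomial_closed] this] show ?thesis using b by (simp add: monomial_shift)
qed

lemma gr_V_nonzero: "gr m (V k) \<noteq> {\<zero>}"
  using b0_in_gr b0(2) by blast

text \<open>In degrees below the order of \<open>a\<close> only multiples of \<open>b\<close> contribute.\<close>

lemma gr_V_below:
  assumes p: "order_ge p a" and m: "m < p" shows "gr m (V 0) = PIdl (b 0)"
proof
  show "PIdl (b 0) \<subseteq> gr m (V 0)" by (rule cgenideal_minimal[OF ideal_gr_V b0_in_gr])
  show "gr m (V 0) \<subseteq> PIdl (b 0)"
  proof
    fix x assume "x \<in> gr m (V 0)"
    then obtain f where f: "f \<in> V 0" "order_ge m f" "x = f m" by (rule grE)
    obtain s r where f': "s \<in> carrier R" "order_ge 0 s" "r \<in> carrier R" "f = a \<otimes>\<^bsub>R\<^esub> s \<oplus>\<^bsub>R\<^esub> b \<otimes>\<^bsub>R\<^esub> r"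
      using VE[OF f(1)] .
    have as: "(a \<otimes>\<^bsub>R\<^esub> s) i = \<zero>" if "i \<le> m" for i
      using order_geD[OF order_ge_mult[OF a p f'(1,2)]] that m by simp
    have rb: "b \<otimes>\<^bsub>R\<^esub> r \<in> carrier R" using b f' by simp
    have br: "(b \<otimes>\<^bsub>R\<^esub> r) i = f i" if "i \<le> m" for i
      unfolding f'(4) coeff_add as[OF that] using coeff_closed[OF rb] by simp
    have "order_ge m r"
    proof (cases "r = \<zero>\<^bsub>R\<^esub>")
      case True then show ?thesis by (simp add: order_ge_def)
    next
      case False
      then obtain k where k: "order_ge k r" "r k \<noteq> \<zero>" using ex_order f'(3) by blast
      have "(b \<otimes>\<^bsub>R\<^esub> r) k = b 0 \<otimes> r k"
        using lowest_coeff_mult[OF b b0(1) f'(3) k(1)] by simp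
      then have "(b \<otimes>\<^bsub>R\<^esub> r) k \<noteq> \<zero>"
        using b0 k(2) b0_closed coeff_closed[OF f'(3)] integral by metis
      then have "\<not> k < m" using br[of k] order_geD[OF f(2), of k] by auto
      then show ?thesis using order_ge_mono[OF k(1)] by simp
    qed
    then have "x = b 0 \<otimes> r m"
      using lowest_coeff_mult[OF b b0(1) f'(3), of m] br[of m] f(3) by simp
    then show "x \<in> PIdl (b 0)"
      using coeff_closed[OF f'(3), of m] b0_closed m_comm by (auto simp: cgenideal_def)
  qed
qed

text \<open>If \<open>f\<close> has high order, then \<open>f = a (u f) + b (v f)\<close>, where \<open>u f\<close> has order at least
\<open>1\<close>.\<close>

lemma V_contains_high: "\<exists>q. \<forall>f\<in>carrier R. order_ge q f \<longrightarrow> f \<in> V 1"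
proof -
  obtain n where n: "order_ge n u" using ex_ge[OF u] by blast
  have "f \<in> V 1" if f: "f \<in> carrier R" "order_ge (1 - n) f" for f
  proof -
    have "f = a \<otimes>\<^bsub>R\<^esub> (u \<otimes>\<^bsub>R\<^esub> f) \<oplus>\<^bsub>R\<^esub> b \<otimes>\<^bsub>R\<^esub> (v \<otimes>\<^bsub>R\<^esub> f)"
    proof -
      have "f = (a \<otimes>\<^bsub>R\<^esub> u \<oplus>\<^bsub>R\<^esub> b \<otimes>\<^bsub>R\<^esub> v) \<otimes>\<^bsub>R\<^esub> f" unfolding uv using f by simp
      then show ?thesis using a b u v f by (simp add: R.l_distr R.m_assoc)
    qed
    moreover have "a \<otimes>\<^bsub>R\<^esub> (u \<otimes>\<^bsub>R\<^esub> f) \<oplus>\<^bsub>R\<^esub> b \<otimes>\<^bsub>R\<^esub> (v \<otimes>\<^bsub>R\<^esub> f) \<in> V 1"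
      using order_ge_mult[OF u n f] u v f by (intro VI) simp_all
    ultimately show ?thesis by metis
  qed
  then show ?thesis by blast
qed

text \<open>The projection to the first coordinate of the kernel of \<open>(a, b)\<close>, up to the sign of the second coordinate.\<close>

definition J :: "(int \<Rightarrow> 'a) set" where
  "J = {r \<in> carrier R. \<exists>y\<in>carrier R. a \<otimes>\<^bsub>R\<^esub> r = b \<otimes>\<^bsub>R\<^esub> y}"

lemma right_ideal_J: "right_ideal J R"
proof (rule R.right_idealI)
  show "J \<subseteq> carrier R" by (auto simp: J_def)
  show "\<zero>\<^bsub>R\<^esub> \<in> J" using a b by (auto simp: J_def intro!: bexI[of _ "\<zero>\<^bsub>R\<^esub>"])
  show "x \<oplus>\<^bsub>R\<^esub> y \<in> J" if xy: "x \<in> J" "y \<in> J" for x y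
  proof -
    obtain p q where "x \<in> carrier R" "y \<in> carrier R" "p \<in> carrier R" "q \<in> carrier R"
      "a \<otimes>\<^bsub>R\<^esub> x = b \<otimes>\<^bsub>R\<^esub> p" "a \<otimes>\<^bsub>R\<^esub> y = b \<otimes>\<^bsub>R\<^esub> q" using xy by (auto simp: J_def)
    then have "a \<otimes>\<^bsub>R\<^esub> (x \<oplus>\<^bsub>R\<^esub> y) = b \<otimes>\<^bsub>R\<^esub> (p \<oplus>\<^bsub>R\<^esub> q)" "x \<oplus>\<^bsub>R\<^esub> y \<in> carrier R" "p \<oplus>\<^bsub>R\<^esub> q \<in> carrier R"
      using a b by (simp_all add: R.r_distr)
    then show ?thesis unfolding J_def by blast
  qed
  show "x \<otimes>\<^bsub>R\<^esub> r \<in> J" if x: "x \<in> J" and r: "r \<in> carrier R" for x r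
  proof -
    obtain p where "x \<in> carrier R" "p \<in> carrier R" "a \<otimes>\<^bsub>R\<^esub> x = b \<otimes>\<^bsub>R\<^esub> p" using x by (auto simp: J_def)
    then have "a \<otimes>\<^bsub>R\<^esub> (x \<otimes>\<^bsub>R\<^esub> r) = b \<otimes>\<^bsub>R\<^esub> (p \<otimes>\<^bsub>R\<^esub> r)" "x \<otimes>\<^bsub>R\<^esub> r \<in> carrier R" "p \<otimes>\<^bsub>R\<^esub> r \<in> carrier R"
      using a b r by (simp_all add: R.m_assoc[symmetric])
    then show ?thesis unfolding J_def by blast
  qed
qed

lemma b_nonzero: "b \<noteq> \<zero>\<^bsub>R\<^esub>"
  using b0(2) by auto

lemma J_nonzero: "J \<noteq> {\<zero>\<^bsub>R\<^esub>}"
proof -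
  have "b \<in> R.principal_right b" using R.generator_in_multiples[OF b] .
  then have "R.principal_right b \<noteq> {\<zero>\<^bsub>R\<^esub>}" using b_nonzero by blast
  then obtain s where "s \<in> carrier R" "s \<noteq> \<zero>\<^bsub>R\<^esub>" "a \<otimes>\<^bsub>R\<^esub> s \<in> R.principal_right b"
    using R1.ex_common_multiple[OF R.right_ideal_multiples[OF b] _ a] by blast
  then show ?thesis by (auto simp: J_def R.principal_right_iff)
qed

text \<open>The kernel of \<open>d \<mapsto> a d\<close> modulo \<open>V 1\<close>.\<close>

lemma lead_J_iff: "d \<in> lead J \<longleftrightarrow> d \<in> carrier D \<and> a \<otimes>\<^bsub>R\<^esub> monomial d 0 \<in> V 1"
proof
  assume "d \<in> lead J"
  then obtain f where f: "f \<in> J" "order_ge 0 f" "d = f 0" by (auto simp: lead_def)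
  then obtain y where y: "f \<in> carrier R" "y \<in> carrier R" "a \<otimes>\<^bsub>R\<^esub> f = b \<otimes>\<^bsub>R\<^esub> y" by (auto simp: J_def)
  have d: "d \<in> carrier D" using coeff_closed[OF y(1)] f by simp
  note m = monomial_closed[OF d, of 0]
  have "(monomial d 0 \<ominus>\<^bsub>R\<^esub> f) 0 = \<zero>"
    unfolding coeff_minus[OF m y(1)] using d by (simp add: monomial_def f(3)[symmetric])
  then have "order_ge (0 + 1) (monomial d 0 \<ominus>\<^bsub>R\<^esub> f)"
    by (rule order_ge_suc[OF order_ge_minus[OF m y(1) order_ge_monomial f(2)]])
  then have "a \<otimes>\<^bsub>R\<^esub> (monomial d 0 \<ominus>\<^bsub>R\<^esub> f) \<oplus>\<^bsub>R\<^esub> b \<otimes>\<^bsub>R\<^esub> y \<in> V 1" using m y by (intro VI) simp_all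
  moreover have "a \<otimes>\<^bsub>R\<^esub> monomial d 0 = a \<otimes>\<^bsub>R\<^esub> (monomial d 0 \<ominus>\<^bsub>R\<^esub> f) \<oplus>\<^bsub>R\<^esub> a \<otimes>\<^bsub>R\<^esub> f"
    using a m y(1) by algebra
  ultimately show "d \<in> carrier D \<and> a \<otimes>\<^bsub>R\<^esub> monomial d 0 \<in> V 1" using d y(3) by simp
next
  assume *: "d \<in> carrier D \<and> a \<otimes>\<^bsub>R\<^esub> monomial d 0 \<in> V 1"
  then obtain s r where s: "s \<in> carrier R" "order_ge 1 s" "r \<in> carrier R"
    "a \<otimes>\<^bsub>R\<^esub> monomial d 0 = a \<otimes>\<^bsub>R\<^esub> s \<oplus>\<^bsub>R\<^esub> b \<otimes>\<^bsub>R\<^esub> r" using VE by blast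
  have d: "d \<in> carrier D" using * by simp
  note m = monomial_closed[OF d, of 0]
  have "a \<otimes>\<^bsub>R\<^esub> (monomial d 0 \<ominus>\<^bsub>R\<^esub> s) = a \<otimes>\<^bsub>R\<^esub> monomial d 0 \<ominus>\<^bsub>R\<^esub> a \<otimes>\<^bsub>R\<^esub> s" using a m s(1) by algebra
  also have "\<dots> = b \<otimes>\<^bsub>R\<^esub> r" unfolding s(4) using a b s(1,3) by algebra
  finally have "monomial d 0 \<ominus>\<^bsub>R\<^esub> s \<in> J" using m s(1,3) unfolding J_def by blast
  moreover have "order_ge 0 (monomial d 0 \<ominus>\<^bsub>R\<^esub> s)"
    using order_ge_minus[OF m s(1) order_ge_monomial] order_ge_mono[OF s(2)] by simp
  moreover have "(monomial d 0 \<ominus>\<^bsub>R\<^esub> s) 0 = d"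
    unfolding coeff_minus[OF m s(1)] using order_geD[OF s(2), of 0] d by (simp add: monomial_def a_minus_def)
  ultimately show "d \<in> lead J" using lead_coeff[OF right_ideal_J] by metis
qed

text \<open>The filtration of \<open>V 0 / V 1\<close> by order, pulled back along \<open>d \<mapsto> a d\<close>. It descends from \<open>D\<close>
to \<open>lead J\<close>.\<close>

definition Q :: "int \<Rightarrow> 'a set" where
  "Q m = {d \<in> carrier D. \<exists>w\<in>V 1. order_ge m (a \<otimes>\<^bsub>R\<^esub> monomial d 0 \<ominus>\<^bsub>R\<^esub> w)}"

lemma a_monomial_closed: "d \<in> carrier D \<Longrightarrow> a \<otimes>\<^bsub>R\<^esub> monomial d 0 \<in> carrier R"
  using a monomial_closed by simp

lemma monomial_add: "c \<in> carrier D \<Longrightarrow> d \<in> carrier D \<Longrightarrow> monomial (c \<oplus> d) k = monomial c k \<oplus>\<^bsub>R\<^esub> monomial d k"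
  by (rule ext) (simp add: coeff_add, simp add: monomial_def)

lemma ideal_Q: "ideal (Q m) D"
proof -
  have "right_ideal (Q m) D"
  proof (rule right_idealI)
    show "Q m \<subseteq> carrier D" by (auto simp: Q_def)
    have "monomial \<zero> 0 = \<zero>\<^bsub>R\<^esub>" by (rule ext) (simp add: monomial_def)
    then have "a \<otimes>\<^bsub>R\<^esub> monomial \<zero> 0 \<ominus>\<^bsub>R\<^esub> \<zero>\<^bsub>R\<^esub> = \<zero>\<^bsub>R\<^esub>" using a by simp
    then have "order_ge m (a \<otimes>\<^bsub>R\<^esub> monomial \<zero> 0 \<ominus>\<^bsub>R\<^esub> \<zero>\<^bsub>R\<^esub>)" by (simp add: order_ge_def)
    then show "\<zero> \<in> Q m" unfolding Q_def using V_zero by blast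
    show "x \<oplus> y \<in> Q m" if xy: "x \<in> Q m" "y \<in> Q m" for x y
    proof -
      obtain w z where w: "x \<in> carrier D" "y \<in> carrier D" "w \<in> V 1" "z \<in> V 1"
        "order_ge m (a \<otimes>\<^bsub>R\<^esub> monomial x 0 \<ominus>\<^bsub>R\<^esub> w)" "order_ge m (a \<otimes>\<^bsub>R\<^esub> monomial y 0 \<ominus>\<^bsub>R\<^esub> z)"
        using xy by (auto simp: Q_def)
      have "a \<otimes>\<^bsub>R\<^esub> monomial (x \<oplus> y) 0 \<ominus>\<^bsub>R\<^esub> (w \<oplus>\<^bsub>R\<^esub> z) =
          (a \<otimes>\<^bsub>R\<^esub> monomial x 0 \<ominus>\<^bsub>R\<^esub> w) \<oplus>\<^bsub>R\<^esub> (a \<otimes>\<^bsub>R\<^esub> monomial y 0 \<ominus>\<^bsub>R\<^esub> z)"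
        unfolding monomial_add[OF w(1,2)]
        using a monomial_closed[OF w(1), of 0] monomial_closed[OF w(2), of 0] V_closed[OF w(3)] V_closed[OF w(4)] by algebra
      then have "order_ge m (a \<otimes>\<^bsub>R\<^esub> monomial (x \<oplus> y) 0 \<ominus>\<^bsub>R\<^esub> (w \<oplus>\<^bsub>R\<^esub> z))" using order_ge_add[OF w(5,6)] by simp
      then show ?thesis unfolding Q_def using w V_add[OF w(3,4)] by blast
    qed
    show "x \<otimes> r \<in> Q m" if x: "x \<in> Q m" and r: "r \<in> carrier D" for x r
    proof -
      obtain w where w: "x \<in> carrier D" "w \<in> V 1" "order_ge m (a \<otimes>\<^bsub>R\<^esub> monomial x 0 \<ominus>\<^bsub>R\<^esub> w)"
        using x by (auto simp: Q_def)
      have mm: "monomial (x \<otimes> r) 0 = monomial x 0 \<otimes>\<^bsub>R\<^esub> monomial r 0" using w r by (simp add: monomial_mult)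
      have c: "monomial x 0 \<in> carrier R" "monomial r 0 \<in> carrier R" "w \<in> carrier R"
        using w r monomial_closed V_closed by auto
      have e: "a \<otimes>\<^bsub>R\<^esub> monomial (x \<otimes> r) 0 \<ominus>\<^bsub>R\<^esub> w \<otimes>\<^bsub>R\<^esub> monomial r 0 = (a \<otimes>\<^bsub>R\<^esub> monomial x 0 \<ominus>\<^bsub>R\<^esub> w) \<otimes>\<^bsub>R\<^esub> monomial r 0"
        unfolding mm using a c by algebra
      have "order_ge m ((a \<otimes>\<^bsub>R\<^esub> monomial x 0 \<ominus>\<^bsub>R\<^esub> w) \<otimes>\<^bsub>R\<^esub> monomial r 0)"
        using order_ge_mult[OF _ w(3) c(2) order_ge_monomial[of 0]] a c by simp
      then have "order_ge m (a \<otimes>\<^bsub>R\<^esub> monomial (x \<otimes> r) 0 \<ominus>\<^bsub>R\<^esub> w \<otimes>\<^bsub>R\<^esub> monomial r 0)" unfolding e .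
      then show ?thesis unfolding Q_def using V_monomial[OF w(2) r] m_closed[OF w(1) r] by blast
    qed
  qed
  then show ?thesis by (simp add: ideal_iff_right_ideal)
qed

lemma Q_antimono: "Q (m + 1) \<subseteq> Q m"
proof
  fix d assume "d \<in> Q (m + 1)"
  then obtain w where "d \<in> carrier D" "w \<in> V 1" "order_ge (m + 1) (a \<otimes>\<^bsub>R\<^esub> monomial d 0 \<ominus>\<^bsub>R\<^esub> w)"
    by (auto simp: Q_def)
  moreover from this(3) have "order_ge m (a \<otimes>\<^bsub>R\<^esub> monomial d 0 \<ominus>\<^bsub>R\<^esub> w)" by (rule order_ge_mono) simp
  ultimately show "d \<in> Q m" unfolding Q_def by blast
qed

lemma Q_below:
  assumes p: "order_ge p a" shows "Q p = carrier D"
proof -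
  have "d \<in> Q p" if d: "d \<in> carrier D" for d
  proof -
    have "a \<otimes>\<^bsub>R\<^esub> monomial d 0 \<ominus>\<^bsub>R\<^esub> \<zero>\<^bsub>R\<^esub> = a \<otimes>\<^bsub>R\<^esub> monomial d 0" using a_monomial_closed[OF d] by (simp add: a_minus_def)
    moreover have "order_ge p (a \<otimes>\<^bsub>R\<^esub> monomial d 0)" using order_ge_mult[OF a p monomial_closed[OF d] order_ge_monomial[of 0]] by simp
    ultimately have "order_ge p (a \<otimes>\<^bsub>R\<^esub> monomial d 0 \<ominus>\<^bsub>R\<^esub> \<zero>\<^bsub>R\<^esub>)" by simp
    then show ?thesis unfolding Q_def using V_zero d by blast
  qed
  moreover have "Q p \<subseteq> carrier D" unfolding Q_def by blast
  ultimately show ?thesis by blast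
qed

lemma lead_J_subset_Q: "lead J \<subseteq> Q m"
proof
  fix d assume "d \<in> lead J"
  then have d: "d \<in> carrier D" "a \<otimes>\<^bsub>R\<^esub> monomial d 0 \<in> V 1" using lead_J_iff by auto
  have "a \<otimes>\<^bsub>R\<^esub> monomial d 0 \<ominus>\<^bsub>R\<^esub> a \<otimes>\<^bsub>R\<^esub> monomial d 0 = \<zero>\<^bsub>R\<^esub>" using a_monomial_closed[OF d(1)] by simp
  then have "order_ge m (a \<otimes>\<^bsub>R\<^esub> monomial d 0 \<ominus>\<^bsub>R\<^esub> a \<otimes>\<^bsub>R\<^esub> monomial d 0)" by (simp add: order_ge_def)
  then show "d \<in> Q m" unfolding Q_def using d by blast
qed

lemma Q_nonzero: "Q m \<noteq> {\<zero>}"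
proof -
  have "lead J \<noteq> {\<zero>}" using lead_nonzero[OF right_ideal_J J_nonzero] .
  moreover have "\<zero> \<in> lead J"
    using ideal_lead[OF right_ideal_J] ideal_iff_right_ideal right_ideal_zero by blast
  ultimately show ?thesis using lead_J_subset_Q[of m] by blast
qed

lemma Q_above:
  assumes q: "\<forall>f\<in>carrier R. order_ge q f \<longrightarrow> f \<in> V 1" shows "Q q = lead J"
proof
  show "Q q \<subseteq> lead J"
  proof
    fix d assume "d \<in> Q q"
    then obtain w where w: "d \<in> carrier D" "w \<in> V 1" "order_ge q (a \<otimes>\<^bsub>R\<^esub> monomial d 0 \<ominus>\<^bsub>R\<^esub> w)"
      by (auto simp: Q_def)
    have c: "a \<otimes>\<^bsub>R\<^esub> monomial d 0 \<in> carrier R" "w \<in> carrier R" using a_monomial_closed w V_closed by auto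
    have "a \<otimes>\<^bsub>R\<^esub> monomial d 0 \<ominus>\<^bsub>R\<^esub> w \<in> V 1" using q w(3) c by simp
    from V_add[OF this w(2)] have "(a \<otimes>\<^bsub>R\<^esub> monomial d 0 \<ominus>\<^bsub>R\<^esub> w) \<oplus>\<^bsub>R\<^esub> w \<in> V 1" .
    moreover have "(a \<otimes>\<^bsub>R\<^esub> monomial d 0 \<ominus>\<^bsub>R\<^esub> w) \<oplus>\<^bsub>R\<^esub> w = a \<otimes>\<^bsub>R\<^esub> monomial d 0"
      using c by (simp add: a_minus_def R.a_assoc R.l_neg)
    ultimately show "d \<in> lead J" using lead_J_iff w by simp
  qed
qed (rule lead_J_subset_Q)

lemma gr_V_above:
  assumes q: "\<forall>f\<in>carrier R. order_ge q f \<longrightarrow> f \<in> V 1" and m: "q \<le> m" shows "gr m (V 1) = carrier D"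
proof
  show "gr m (V 1) \<subseteq> carrier D" using V_closed coeff_closed by (auto simp: gr_def)
  show "carrier D \<subseteq> gr m (V 1)"
  proof
    fix d assume d: "d \<in> carrier D"
    have "monomial d m \<in> V 1" using q monomial_closed[OF d] order_ge_mono[OF order_ge_monomial m] by blast
    from grI[OF this order_ge_monomial] show "d \<in> gr m (V 1)" by (simp add: monomial_def)
  qed
qed

text \<open>The graded pieces of \<open>V 0 / V 1\<close> are \<open>Q m / Q (m+1)\<close> on the one hand and \<open>gr m (V 0) / gr m (V 1)\<close>
on the other. Passing to the coefficient at \<open>m\<close> moves a scalar across \<open>x^m\<close>, so their annihilators correspond under the
twist by \<open>\<sigma>^m\<close>.\<close>

lemma colon_tw:
  assumes d: "d \<in> carrier D"
  shows "d \<in> colon (Q (m + 1)) (Q m) \<longleftrightarrow> tw m d \<in> colon (gr m (V 1)) (gr m (V 0))"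
proof
  note md = monomial_closed[OF d, of 0]
  assume *: "d \<in> colon (Q (m + 1)) (Q m)"
  have "tw m d \<otimes> x \<in> gr m (V 1)" if x: "x \<in> gr m (V 0)" for x
  proof -
    obtain f where f: "f \<in> V 0" "order_ge m f" "x = f m" using x by (rule grE)
    obtain e w where e: "e \<in> carrier D" "w \<in> V 1" "f = a \<otimes>\<^bsub>R\<^esub> monomial e 0 \<oplus>\<^bsub>R\<^esub> w" using V_decomp[OF f(1)] by blast
    note me = monomial_closed[OF e(1), of 0]
    have c: "w \<in> carrier R" "f \<in> carrier R" using V_closed e f by auto
    have "\<zero>\<^bsub>R\<^esub> \<ominus>\<^bsub>R\<^esub> w \<in> V 1" using V_minus[OF V_zero e(2)] .
    moreover have "a \<otimes>\<^bsub>R\<^esub> monomial e 0 \<ominus>\<^bsub>R\<^esub> (\<zero>\<^bsub>R\<^esub> \<ominus>\<^bsub>R\<^esub> w) = f"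
      unfolding e(3) using c a_monomial_closed[OF e(1)] by (simp add: a_minus_def)
    ultimately have "e \<in> Q m" unfolding Q_def using e(1) f(2) by (metis (mono_tags, lifting) mem_Collect_eq)
    then have "d \<otimes> e \<in> Q (m + 1)" using * by (simp add: colon_def)
    then obtain w' where w': "w' \<in> V 1" "order_ge (m + 1) (a \<otimes>\<^bsub>R\<^esub> monomial (d \<otimes> e) 0 \<ominus>\<^bsub>R\<^esub> w')"
      by (auto simp: Q_def)
    have mm: "monomial (d \<otimes> e) 0 = monomial e 0 \<otimes>\<^bsub>R\<^esub> monomial d 0" using d e by (simp add: monomial_mult m_comm)
    have c': "w' \<in> carrier R" using V_closed w' by auto
    let ?g = "w \<otimes>\<^bsub>R\<^esub> monomial d 0 \<oplus>\<^bsub>R\<^esub> w'"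
    have g: "?g \<in> V 1" using V_add[OF V_monomial[OF e(2) d] w'(1)] .
    have g_eq: "?g = f \<otimes>\<^bsub>R\<^esub> monomial d 0 \<ominus>\<^bsub>R\<^esub> (a \<otimes>\<^bsub>R\<^esub> monomial (d \<otimes> e) 0 \<ominus>\<^bsub>R\<^esub> w')"
      unfolding e(3) mm using a me md c c' by algebra
    let ?h = "a \<otimes>\<^bsub>R\<^esub> monomial (d \<otimes> e) 0 \<ominus>\<^bsub>R\<^esub> w'"
    have hc: "?h \<in> carrier R" using a_monomial_closed d e c' by simp
    have fd: "f \<otimes>\<^bsub>R\<^esub> monomial d 0 \<in> carrier R" "order_ge m (f \<otimes>\<^bsub>R\<^esub> monomial d 0)"
      using c md order_ge_mult[OF c(2) f(2) md order_ge_monomial[of 0]] by auto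
    have "order_ge m ?g" unfolding g_eq by (rule order_ge_minus[OF fd(1) hc fd(2) order_ge_mono[OF w'(2)]]) simp
    moreover have "?g m = tw m d \<otimes> x"
      unfolding g_eq coeff_minus[OF fd(1) hc] using order_geD[OF w'(2), of m] d f(3) coeff_closed[OF c(2), of m]
      by (simp add: coeff_mult_monomial[OF c(2) d] a_minus_def tw_hom m_comm)
    ultimately show ?thesis using grI[OF g] by metis
  qed
  then show "tw m d \<in> colon (gr m (V 1)) (gr m (V 0))" using tw_hom(1)[OF d] by (simp add: colon_def)
next
  note md = monomial_closed[OF d, of 0]
  assume *: "tw m d \<in> colon (gr m (V 1)) (gr m (V 0))"
  have "d \<otimes> e \<in> Q (m + 1)" if eQ: "e \<in> Q m" for e
  proof -
    obtain w where e: "e \<in> carrier D" "w \<in> V 1" "order_ge m (a \<otimes>\<^bsub>R\<^esub> monomial e 0 \<ominus>\<^bsub>R\<^esub> w)"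
      using eQ by (auto simp: Q_def)
    note me = monomial_closed[OF e(1), of 0]
    let ?f = "a \<otimes>\<^bsub>R\<^esub> monomial e 0 \<ominus>\<^bsub>R\<^esub> w"
    have c: "w \<in> carrier R" "?f \<in> carrier R" using V_closed e a_monomial_closed by auto
    have f: "?f \<in> V 0" using V_minus[OF V_a[OF e(1)] V_mono[OF e(2)]] .
    have "tw m d \<otimes> ?f m \<in> gr m (V 1)" using * grI[OF f e(3)] by (simp add: colon_def)
    then obtain g where g: "g \<in> V 1" "order_ge m g" "tw m d \<otimes> ?f m = g m" by (rule grE)
    have gc: "g \<in> carrier R" using V_closed g by auto
    have fd: "?f \<otimes>\<^bsub>R\<^esub> monomial d 0 \<in> carrier R" "order_ge m (?f \<otimes>\<^bsub>R\<^esub> monomial d 0)"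
      using c md order_ge_mult[OF c(2) e(3) md order_ge_monomial[of 0]] by auto
    have "order_ge (m + 1) (?f \<otimes>\<^bsub>R\<^esub> monomial d 0 \<ominus>\<^bsub>R\<^esub> g)"
    proof (rule order_ge_suc[OF order_ge_minus[OF fd(1) gc fd(2) g(2)]])
      have "(?f \<otimes>\<^bsub>R\<^esub> monomial d 0) m = ?f m \<otimes> tw m d" using coeff_mult_monomial[OF c(2) d, of 0 m] by simp
      also have "\<dots> = g m" using g(3) m_comm[OF coeff_closed[OF c(2)] tw_hom(1)[OF d]] by simp
      finally show "(?f \<otimes>\<^bsub>R\<^esub> monomial d 0 \<ominus>\<^bsub>R\<^esub> g) m = \<zero>"
        unfolding coeff_minus[OF fd(1) gc] using coeff_closed[OF gc] by (simp add: r_right_minus_eq)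
    qed
    moreover have "?f \<otimes>\<^bsub>R\<^esub> monomial d 0 \<ominus>\<^bsub>R\<^esub> g = a \<otimes>\<^bsub>R\<^esub> monomial (d \<otimes> e) 0 \<ominus>\<^bsub>R\<^esub> (w \<otimes>\<^bsub>R\<^esub> monomial d 0 \<oplus>\<^bsub>R\<^esub> g)"
    proof -
      have mm: "monomial (d \<otimes> e) 0 = monomial e 0 \<otimes>\<^bsub>R\<^esub> monomial d 0" using d e by (simp add: monomial_mult m_comm)
      show ?thesis unfolding mm using a me md c(1) gc by algebra
    qed
    moreover have "w \<otimes>\<^bsub>R\<^esub> monomial d 0 \<oplus>\<^bsub>R\<^esub> g \<in> V 1" using V_add[OF V_monomial[OF e(2) d] g(1)] .
    ultimately have "order_ge (m + 1) (a \<otimes>\<^bsub>R\<^esub> monomial (d \<otimes> e) 0 \<ominus>\<^bsub>R\<^esub> (w \<otimes>\<^bsub>R\<^esub> monomial d 0 \<oplus>\<^bsub>R\<^esub> g))"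
      and "w \<otimes>\<^bsub>R\<^esub> monomial d 0 \<oplus>\<^bsub>R\<^esub> g \<in> V 1" by simp_all
    then show ?thesis unfolding Q_def using m_closed[OF d e(1)] by blast
  qed
  then show "d \<in> colon (Q (m + 1)) (Q m)" using d by (simp add: colon_def)
qed

text \<open>Containment is divisibility in \<open>D\<close>, and the two quotients \<open>Q (m+1) : Q m\<close> and \<open>gr m (V 1) : gr m (V
0)\<close> agree up to the twist.\<close>

lemma graded_step:
  "\<exists>N. ideal N D \<and> Q (m + 1) = Q m \<cdot> N \<and> gr m (V 1) = gr m (V 0) \<cdot> (tw m ` N)"
proof (intro exI conjI)
  let ?N = "colon (Q (m + 1)) (Q m)"
  show "ideal ?N D" by (rule ideal_colon[OF ideal_Q ideal_Q])
  show "Q (m + 1) = Q m \<cdot> ?N"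
    by (rule prod_colon[OF ideal_Q Q_nonzero ideal_Q Q_antimono, symmetric])
  have "tw m ` ?N = colon (gr m (V 1)) (gr m (V 0))"
  proof (rule subset_antisym; rule subsetI)
    fix y assume "y \<in> tw m ` ?N"
    then show "y \<in> colon (gr m (V 1)) (gr m (V 0))" using colon_tw by (auto simp: colon_def)
  next
    fix y assume y: "y \<in> colon (gr m (V 1)) (gr m (V 0))"
    then have yc: "y \<in> carrier D" by (simp add: colon_def)
    then have c: "tw (- m) y \<in> carrier D" "tw m (tw (- m) y) = y" using tw_hom(1) by simp_all
    then have "tw (- m) y \<in> ?N" using colon_tw[OF c(1), of m] y by simp
    then show "y \<in> tw m ` ?N" using c(2) by (metis imageI)
  qed
  moreover have "gr m (V 1) \<subseteq> gr m (V 0)" using V_mono by (auto simp: gr_def)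
  ultimately show "gr m (V 1) = gr m (V 0) \<cdot> (tw m ` ?N)"
    using prod_colon[OF ideal_gr_V gr_V_nonzero ideal_gr_V] by simp
qed

text \<open>When \<open>\<sigma>\<close> acts trivially on classes, the class of \<open>gr (m-1) (V 0) * Q m\<close> does not depend on
\<open>m\<close>: by the previous lemma, with \<open>gr m (V 1) = gr (m-1) (V 0)\<close>, increasing \<open>m\<close> trades a factor
\<open>\<sigma>^m N\<close> for a factor \<open>N\<close>. For small \<open>m\<close> the product is \<open>b 0 * D\<close>, and for large
\<open>m\<close> it is \<open>lead J\<close>.\<close>

lemma lead_J_principal:
  assumes triv: "acts_trivially_on_class_group D \<sigma>"
  shows "\<exists>c\<in>carrier D. lead J = PIdl c"
proof (rule principal_if_sim_carrier[OF ideal_lead[OF right_ideal_J]])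
  obtain p where p: "order_ge p a" using ex_ge[OF a] by blast
  obtain q where q: "\<forall>f\<in>carrier R. order_ge q f \<longrightarrow> f \<in> V 1" using V_contains_high by blast
  note P = ideal_prod_is_ideal[OF ideal_gr_V ideal_Q]
  have inv: "ideal_sim (gr (m - 1) (V 0) \<cdot> Q m) (carrier D)" if "p \<le> m" for m
    using that
  proof (induction m rule: int_ge_induct)
    case base
    have "gr (p - 1) (V 0) \<cdot> Q p = PIdl (b 0)"
      using gr_V_below[OF p, of "p - 1"] Q_below[OF p] ideal_prod_one[OF cgenideal_ideal[OF b0_closed]] by simp
    moreover have "(PIdl \<one>) \<cdot> (PIdl (b 0)) = (PIdl (b 0)) \<cdot> carrier D"
      using PIdl_PIdl[OF one_closed b0_closed] ideal_prod_one[OF cgenideal_ideal[OF b0_closed]] b0_closed by simp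
    ultimately show ?case
      unfolding ideal_sim_def
      by (intro bexI[of _ \<one>] bexI[of _ "b 0"]) (use b0 b0_closed one_not_zero in simp_all)
  next
    case (step m)
    obtain N where N: "ideal N D" "Q (m + 1) = Q m \<cdot> N" "gr m (V 1) = gr m (V 0) \<cdot> (tw m ` N)"
      using graded_step by blast
    have assoc: "gr m (V 0) \<cdot> (Q m \<cdot> X) = (gr m (V 0) \<cdot> Q m) \<cdot> X"
      "(gr m (V 0) \<cdot> Q m) \<cdot> X = (gr m (V 0) \<cdot> X) \<cdot> Q m" if X: "ideal X D" for X
      using ideal_prod_assoc[OF ideal_gr_V ideal_Q X, of m 0 m] ideal_prod_assoc[OF ideal_gr_V X ideal_Q, of m 0 m]
        ideal_prod_commute[OF ideal_Q X, of m] by simp_all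
    note t = ideal_tw_image[OF N(1), of m]
    have "ideal_sim ((gr m (V 0) \<cdot> Q m) \<cdot> N) ((gr m (V 0) \<cdot> Q m) \<cdot> (tw m ` N))"
      by (rule ideal_sim_prod[OF ideal_sim_sym[OF ideal_sim_tw_image[OF triv N(1)]] N(1) t P])
    moreover have "(gr m (V 0) \<cdot> Q m) \<cdot> N = gr (m + 1 - 1) (V 0) \<cdot> Q (m + 1)"
      using assoc(1)[OF N(1)] N(2) by simp
    moreover have "(gr m (V 0) \<cdot> Q m) \<cdot> (tw m ` N) = gr (m - 1) (V 0) \<cdot> Q m"
      using assoc(2)[OF t] N(3) gr_V_shift by simp
    ultimately have "ideal_sim (gr (m + 1 - 1) (V 0) \<cdot> Q (m + 1)) (gr (m - 1) (V 0) \<cdot> Q m)" by simp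
    then show ?case by (rule ideal_sim_trans[OF _ step(2) P P oneideal])
  qed
  define m where "m = max p q"
  have m: "p \<le> m" "q \<le> m" by (auto simp: m_def)
  have q': "\<forall>f\<in>carrier R. order_ge m f \<longrightarrow> f \<in> V 1" using q order_ge_mono[OF _ m(2)] by blast
  have "gr (m - 1) (V 0) = carrier D" using gr_V_above[OF q m(2)] gr_V_shift by simp
  then have "gr (m - 1) (V 0) \<cdot> Q m = lead J"
    using Q_above[OF q'] ideal_prod_one[OF ideal_lead[OF right_ideal_J]]
      ideal_prod_commute[OF oneideal ideal_lead[OF right_ideal_J]] by simp
  then show "ideal_sim (lead J) (carrier D)" using inv[OF m(1)] by simp
qed

lemma kernel_cyclic:
  assumes triv: "acts_trivially_on_class_group D \<sigma>"
  shows "\<exists>p\<in>carrier R. \<exists>q\<in>carrier R. p \<noteq> \<zero>\<^bsub>R\<^esub> \<and> a \<otimes>\<^bsub>R\<^esub> p \<oplus>\<^bsub>R\<^esub> b \<otimes>\<^bsub>R\<^esub> q = \<zero>\<^bsub>R\<^esub> \<and>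
    (\<forall>x\<in>carrier R. \<forall>y\<in>carrier R. a \<otimes>\<^bsub>R\<^esub> x \<oplus>\<^bsub>R\<^esub> b \<otimes>\<^bsub>R\<^esub> y = \<zero>\<^bsub>R\<^esub> \<longrightarrow>
       (\<exists>z\<in>carrier R. x = p \<otimes>\<^bsub>R\<^esub> z \<and> y = q \<otimes>\<^bsub>R\<^esub> z))"
proof -
  obtain c where c: "c \<in> carrier D" "lead J = PIdl c" using lead_J_principal[OF triv] by blast
  obtain g where g: "g \<in> J" "J = R.principal_right g"
    using principal_if_lead_principal[OF right_ideal_J c] by blast
  obtain h where h: "g \<in> carrier R" "h \<in> carrier R" "a \<otimes>\<^bsub>R\<^esub> g = b \<otimes>\<^bsub>R\<^esub> h" using g(1) by (auto simp: J_def)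
  have g0: "g \<noteq> \<zero>\<^bsub>R\<^esub>"
  proof
    assume g0: "g = \<zero>\<^bsub>R\<^esub>"
    have "x = \<zero>\<^bsub>R\<^esub>" if "x \<in> J" for x
      using that unfolding g(2) R.principal_right_iff g0 by auto
    then have "J = {\<zero>\<^bsub>R\<^esub>}" using R.right_ideal_zero[OF right_ideal_J] by blast
    then show False using J_nonzero by simp
  qed
  have bcancel: "y = y'" if "y \<in> carrier R" "y' \<in> carrier R" "b \<otimes>\<^bsub>R\<^esub> y = b \<otimes>\<^bsub>R\<^esub> y'" for y y'
  proof -
    have "b \<otimes>\<^bsub>R\<^esub> (y \<ominus>\<^bsub>R\<^esub> y') = b \<otimes>\<^bsub>R\<^esub> y \<ominus>\<^bsub>R\<^esub> b \<otimes>\<^bsub>R\<^esub> y'" using b that(1,2) by algebra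
    also have "\<dots> = \<zero>\<^bsub>R\<^esub>" using that b by simp
    finally have "y \<ominus>\<^bsub>R\<^esub> y' = \<zero>\<^bsub>R\<^esub>"
      using R_no_zero_divisors[OF b R.minus_closed[OF that(1,2)]] b_nonzero by blast
    then show ?thesis using that(1,2) by simp
  qed
  have "\<exists>z\<in>carrier R. x = g \<otimes>\<^bsub>R\<^esub> z \<and> y = (\<ominus>\<^bsub>R\<^esub> h) \<otimes>\<^bsub>R\<^esub> z"
    if x: "x \<in> carrier R" and y: "y \<in> carrier R" and xy: "a \<otimes>\<^bsub>R\<^esub> x \<oplus>\<^bsub>R\<^esub> b \<otimes>\<^bsub>R\<^esub> y = \<zero>\<^bsub>R\<^esub>" for x y
  proof -
    have ax: "a \<otimes>\<^bsub>R\<^esub> x = b \<otimes>\<^bsub>R\<^esub> (\<ominus>\<^bsub>R\<^esub> y)"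
    proof -
      have "a \<otimes>\<^bsub>R\<^esub> x = (a \<otimes>\<^bsub>R\<^esub> x \<oplus>\<^bsub>R\<^esub> b \<otimes>\<^bsub>R\<^esub> y) \<oplus>\<^bsub>R\<^esub> b \<otimes>\<^bsub>R\<^esub> (\<ominus>\<^bsub>R\<^esub> y)"
        using a b x y by algebra
      also have "\<dots> = b \<otimes>\<^bsub>R\<^esub> (\<ominus>\<^bsub>R\<^esub> y)" unfolding xy using b y by simp
      finally show ?thesis .
    qed
    then have "x \<in> J" using x y unfolding J_def by blast
    then obtain z where z: "z \<in> carrier R" "x = g \<otimes>\<^bsub>R\<^esub> z" using g(2) by (auto simp: R.principal_right_iff)
    have "b \<otimes>\<^bsub>R\<^esub> (\<ominus>\<^bsub>R\<^esub> y) = b \<otimes>\<^bsub>R\<^esub> (h \<otimes>\<^bsub>R\<^esub> z)"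
      using ax z h a b by (simp add: R.m_assoc[symmetric])
    have hz: "h \<otimes>\<^bsub>R\<^esub> z \<in> carrier R" "\<ominus>\<^bsub>R\<^esub> y \<in> carrier R" using h z y by simp_all
    have e: "\<ominus>\<^bsub>R\<^esub> y = h \<otimes>\<^bsub>R\<^esub> z" by (rule bcancel[OF hz(2,1)]) fact
    have "y = \<ominus>\<^bsub>R\<^esub> (\<ominus>\<^bsub>R\<^esub> y)" by (rule R.minus_minus[OF y, symmetric])
    also have "\<dots> = \<ominus>\<^bsub>R\<^esub> (h \<otimes>\<^bsub>R\<^esub> z)" by (simp only: e)
    also have "\<dots> = (\<ominus>\<^bsub>R\<^esub> h) \<otimes>\<^bsub>R\<^esub> z" by (rule R.l_minus[OF h(2) z(1), symmetric])
    finally have "y = (\<ominus>\<^bsub>R\<^esub> h) \<otimes>\<^bsub>R\<^esub> z" .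
    then show ?thesis using z by blast
  qed
  moreover have "a \<otimes>\<^bsub>R\<^esub> g \<oplus>\<^bsub>R\<^esub> b \<otimes>\<^bsub>R\<^esub> (\<ominus>\<^bsub>R\<^esub> h) = \<zero>\<^bsub>R\<^esub>"
    using h b by (simp add: R.r_minus R.r_neg)
  ultimately show ?thesis using h g0 by (intro bexI[of _ g] bexI[of _ "\<ominus>\<^bsub>R\<^esub> h"]) auto
qed

end

context skew_dedekind begin

text \<open>Multiplying the second entry by a power of \<open>x\<close> changes the kernel only by an automorphism of its second coordinate.\<close>

lemma completable_pair:
  assumes triv: "acts_trivially_on_class_group D \<sigma>" and uni: "unimodular_row R 2 a"
  shows "\<exists>A. invertible_matrix R 2 A \<and> (\<forall>j<2. A 0 j = a j)"
proof -
  have two: "{..<2::nat} = {0, Suc 0}" by auto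
  obtain w where w: "w \<in> {..<2} \<rightarrow> carrier R" "\<one>\<^bsub>R\<^esub> = (\<Oplus>\<^bsub>R\<^esub>i\<in>{..<2::nat}. a i \<otimes>\<^bsub>R\<^esub> w i)" and aP: "a \<in> {..<2} \<rightarrow> carrier R"
    using uni unfolding R.unimodular_row_iff_sum by blast
  have ac: "a 0 \<in> carrier R" "a (Suc 0) \<in> carrier R" and wc: "w 0 \<in> carrier R" "w (Suc 0) \<in> carrier R"
    using aP w by (auto simp: Pi_iff)
  have aw: "a 0 \<otimes>\<^bsub>R\<^esub> w 0 \<oplus>\<^bsub>R\<^esub> a (Suc 0) \<otimes>\<^bsub>R\<^esub> w (Suc 0) = \<one>\<^bsub>R\<^esub>"
    using w(2) ac wc unfolding two by simp
  note one0 = R_one_not_zero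
  show ?thesis
  proof (cases "a (Suc 0) = \<zero>\<^bsub>R\<^esub>")
    case True
    have a00: "a 0 \<noteq> \<zero>\<^bsub>R\<^esub>" using aw True ac wc one0 by auto
    show ?thesis
    proof (rule R1.completable_if_kernel_cyclic[OF ac wc aw R.zero_closed R.one_closed])
      show "\<zero>\<^bsub>R\<^esub> \<noteq> \<zero>\<^bsub>R\<^esub> \<or> \<one>\<^bsub>R\<^esub> \<noteq> \<zero>\<^bsub>R\<^esub>" using one0 by simp
      show "a 0 \<otimes>\<^bsub>R\<^esub> \<zero>\<^bsub>R\<^esub> \<oplus>\<^bsub>R\<^esub> a (Suc 0) \<otimes>\<^bsub>R\<^esub> \<one>\<^bsub>R\<^esub> = \<zero>\<^bsub>R\<^esub>" using True ac by simp
      fix x y assume x: "x \<in> carrier R" and y: "y \<in> carrier R"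
        and xy: "a 0 \<otimes>\<^bsub>R\<^esub> x \<oplus>\<^bsub>R\<^esub> a (Suc 0) \<otimes>\<^bsub>R\<^esub> y = \<zero>\<^bsub>R\<^esub>"
      have "a 0 \<otimes>\<^bsub>R\<^esub> x = \<zero>\<^bsub>R\<^esub>" using xy True ac x y by simp
      then have "x = \<zero>\<^bsub>R\<^esub>" using R_no_zero_divisors[OF ac(1) x] a00 by blast
      then show "\<exists>z\<in>carrier R. x = \<zero>\<^bsub>R\<^esub> \<otimes>\<^bsub>R\<^esub> z \<and> y = \<one>\<^bsub>R\<^esub> \<otimes>\<^bsub>R\<^esub> z"
        using y by (intro bexI[of _ y]) auto
    qed
  next
    case False
    then obtain k where k: "order_ge k (a (Suc 0))" "a (Suc 0) k \<noteq> \<zero>" using ex_order ac(2) by blast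
    \<comment> \<open>The power of \<open>x\<close> that moves the lowest coefficient of the second entry to degree \<open>0\<close>.\<close>
    define t where "t = monomial \<one> (- k)"
    define t' where "t' = monomial \<one> k"
    have t: "t \<in> carrier R" "t' \<in> carrier R" "t \<otimes>\<^bsub>R\<^esub> t' = \<one>\<^bsub>R\<^esub>" "t' \<otimes>\<^bsub>R\<^esub> t = \<one>\<^bsub>R\<^esub>"
      using monomial_unit by (auto simp: t_def t'_def monomial_closed)
    define b where "b = a (Suc 0) \<otimes>\<^bsub>R\<^esub> t"
    have bt: "b \<otimes>\<^bsub>R\<^esub> (t' \<otimes>\<^bsub>R\<^esub> y) = a (Suc 0) \<otimes>\<^bsub>R\<^esub> y" if y: "y \<in> carrier R" for y
    proof -
      have "b \<otimes>\<^bsub>R\<^esub> (t' \<otimes>\<^bsub>R\<^esub> y) = a (Suc 0) \<otimes>\<^bsub>R\<^esub> (t \<otimes>\<^bsub>R\<^esub> t') \<otimes>\<^bsub>R\<^esub> y"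
        using ac t(1,2) y by (simp add: b_def R.m_assoc)
      then show ?thesis using t ac y by simp
    qed
    interpret P: unimodular_pair D \<sigma> "a 0" b "w 0" "t' \<otimes>\<^bsub>R\<^esub> w (Suc 0)"
    proof
      show "a 0 \<in> carrier R" "w 0 \<in> carrier R" "t' \<otimes>\<^bsub>R\<^esub> w (Suc 0) \<in> carrier R" "b \<in> carrier R"
        using ac wc t by (auto simp: b_def)
      show "a 0 \<otimes>\<^bsub>R\<^esub> w 0 \<oplus>\<^bsub>R\<^esub> b \<otimes>\<^bsub>R\<^esub> (t' \<otimes>\<^bsub>R\<^esub> w (Suc 0)) = \<one>\<^bsub>R\<^esub>" using bt[OF wc(2)] aw by simp
      show "order_ge 0 b" using k(1) ac(2) by (simp add: order_ge_def b_def t_def monomial_shift)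
      show "b 0 \<noteq> \<zero>" using k(2) ac(2) by (simp add: b_def t_def monomial_shift)
    qed
    obtain p q where pq: "p \<in> carrier R" "q \<in> carrier R" "p \<noteq> \<zero>\<^bsub>R\<^esub>" "a 0 \<otimes>\<^bsub>R\<^esub> p \<oplus>\<^bsub>R\<^esub> b \<otimes>\<^bsub>R\<^esub> q = \<zero>\<^bsub>R\<^esub>"
      and ker: "\<forall>x\<in>carrier R. \<forall>y\<in>carrier R. a 0 \<otimes>\<^bsub>R\<^esub> x \<oplus>\<^bsub>R\<^esub> b \<otimes>\<^bsub>R\<^esub> y = \<zero>\<^bsub>R\<^esub> \<longrightarrow>
       (\<exists>z\<in>carrier R. x = p \<otimes>\<^bsub>R\<^esub> z \<and> y = q \<otimes>\<^bsub>R\<^esub> z)"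
      using P.kernel_cyclic[OF triv] by blast
    have tq: "t \<otimes>\<^bsub>R\<^esub> q \<in> carrier R" using t pq by simp
    show ?thesis
    proof (rule R1.completable_if_kernel_cyclic[OF ac wc aw pq(1) tq])
      show "p \<noteq> \<zero>\<^bsub>R\<^esub> \<or> t \<otimes>\<^bsub>R\<^esub> q \<noteq> \<zero>\<^bsub>R\<^esub>" using pq by simp
      show "a 0 \<otimes>\<^bsub>R\<^esub> p \<oplus>\<^bsub>R\<^esub> a (Suc 0) \<otimes>\<^bsub>R\<^esub> (t \<otimes>\<^bsub>R\<^esub> q) = \<zero>\<^bsub>R\<^esub>"
        using pq ac t by (simp add: b_def R.m_assoc)
      fix x y assume x: "x \<in> carrier R" and y: "y \<in> carrier R"
        and xy: "a 0 \<otimes>\<^bsub>R\<^esub> x \<oplus>\<^bsub>R\<^esub> a (Suc 0) \<otimes>\<^bsub>R\<^esub> y = \<zero>\<^bsub>R\<^esub>"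
      have "t' \<otimes>\<^bsub>R\<^esub> y \<in> carrier R" "a 0 \<otimes>\<^bsub>R\<^esub> x \<oplus>\<^bsub>R\<^esub> b \<otimes>\<^bsub>R\<^esub> (t' \<otimes>\<^bsub>R\<^esub> y) = \<zero>\<^bsub>R\<^esub>"
        using xy bt[OF y] t y by auto
      then obtain z where z: "z \<in> carrier R" "x = p \<otimes>\<^bsub>R\<^esub> z" "t' \<otimes>\<^bsub>R\<^esub> y = q \<otimes>\<^bsub>R\<^esub> z"
        using ker x by blast
      have "y = t \<otimes>\<^bsub>R\<^esub> (t' \<otimes>\<^bsub>R\<^esub> y)" using t y by (simp add: R.m_assoc[symmetric])
      also have "\<dots> = t \<otimes>\<^bsub>R\<^esub> q \<otimes>\<^bsub>R\<^esub> z" using z t pq by (simp add: R.m_assoc)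
      finally show "\<exists>z\<in>carrier R. x = p \<otimes>\<^bsub>R\<^esub> z \<and> y = t \<otimes>\<^bsub>R\<^esub> q \<otimes>\<^bsub>R\<^esub> z" using z by blast
    qed
  qed
qed

text \<open>Rows of length two are completed through their kernels, and longer rows by stability.\<close>

lemma general_linear_rank_1:
  assumes triv: "acts_trivially_on_class_group D \<sigma>" shows "general_linear_rank R = 1"
proof (rule antisym)
  have "\<exists>A. invertible_matrix R m A \<and> (\<forall>j<m. A 0 j = a j)"
    if m: "1 < m" and uni: "unimodular_row R m a" for m a
  proof (cases "m = 2")
    case True
    then show ?thesis using completable_pair[OF triv] uni by simp
  next
    case False
    then have "2 < m" using m by simp
    define n where "n = m - 1"
    have n: "m = Suc n" "0 < n" using m by (simp_all add: n_def)
    show ?thesis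
      using R.completable_if_stable[OF n(2) uni[unfolded n(1)]
          R1.stable_if_unimodular[OF \<open>2 < m\<close> uni, unfolded n(1)]] by (simp only: n(1))
  qed
  then show "general_linear_rank R \<le> 1"
    unfolding general_linear_rank_def by (intro Inf_lower) (auto intro!: exI[of _ 1] simp: one_enat_def)
  show "1 \<le> general_linear_rank R"
    unfolding general_linear_rank_def by (rule Inf_greatest) (auto simp: one_enat_def)
qed

end

section \<open>Modules over right hereditary rings\<close>

context right_module begin

lemma smult_r_zero: "r \<in> carrier R \<Longrightarrow> r \<odot>\<^bsub>M\<^esub> \<zero>\<^bsub>M\<^esub> = \<zero>\<^bsub>M\<^esub>"
proof -
  assume r: "r \<in> carrier R"
  have "r \<odot>\<^bsub>M\<^esub> \<zero>\<^bsub>M\<^esub> \<oplus>\<^bsub>M\<^esub> r \<odot>\<^bsub>M\<^esub> \<zero>\<^bsub>M\<^esub> = r \<odot>\<^bsub>M\<^esub> \<zero>\<^bsub>M\<^esub>"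
    using rsmult_module_distr[OF r M.zero_closed M.zero_closed] by simp
  then show ?thesis using rsmult_closed[OF r M.zero_closed] M.add.r_cancel_one' by metis
qed

lemma smult_l_zero: "m \<in> carrier M \<Longrightarrow> \<zero> \<odot>\<^bsub>M\<^esub> m = \<zero>\<^bsub>M\<^esub>"
proof -
  assume m: "m \<in> carrier M"
  have "\<zero> \<odot>\<^bsub>M\<^esub> m \<oplus>\<^bsub>M\<^esub> \<zero> \<odot>\<^bsub>M\<^esub> m = \<zero> \<odot>\<^bsub>M\<^esub> m"
    using rsmult_ring_distr[OF R.zero_closed R.zero_closed m] by simp
  then show ?thesis using rsmult_closed[OF R.zero_closed m] M.add.r_cancel_one' by metis
qed

lemma smult_uminus_one:
  assumes m: "m \<in> carrier M" shows "m \<oplus>\<^bsub>M\<^esub> (\<ominus> \<one>) \<odot>\<^bsub>M\<^esub> m = \<zero>\<^bsub>M\<^esub>"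
proof -
  have "(\<one> \<oplus> \<ominus> \<one>) \<odot>\<^bsub>M\<^esub> m = \<one> \<odot>\<^bsub>M\<^esub> m \<oplus>\<^bsub>M\<^esub> (\<ominus> \<one>) \<odot>\<^bsub>M\<^esub> m"
    using m by (intro rsmult_ring_distr) auto
  then show ?thesis using m by (simp add: rsmult_one smult_l_zero R.r_neg)
qed

lemma finsum_smult:
  assumes r: "r \<in> carrier R" and f: "f \<in> A \<rightarrow> carrier M"
  shows "r \<odot>\<^bsub>M\<^esub> finsum M f A = (\<Oplus>\<^bsub>M\<^esub>x\<in>A. r \<odot>\<^bsub>M\<^esub> f x)"
  using f
proof (induction A rule: infinite_finite_induct)
  case (insert x A)
  then have c: "f x \<in> carrier M" "f \<in> A \<rightarrow> carrier M" "(\<lambda>x. r \<odot>\<^bsub>M\<^esub> f x) \<in> A \<rightarrow> carrier M"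
    using r rsmult_closed by (auto simp: Pi_iff)
  then have "r \<odot>\<^bsub>M\<^esub> finsum M f (insert x A) = r \<odot>\<^bsub>M\<^esub> f x \<oplus>\<^bsub>M\<^esub> r \<odot>\<^bsub>M\<^esub> finsum M f A"
    using insert r by (simp add: rsmult_module_distr)
  also have "\<dots> = (\<Oplus>\<^bsub>M\<^esub>x\<in>insert x A. r \<odot>\<^bsub>M\<^esub> f x)"
    using insert c r rsmult_closed by simp
  finally show ?case .
qed (use r smult_r_zero in auto)

lemma submodule:
  assumes N: "N \<subseteq> carrier M" "\<zero>\<^bsub>M\<^esub> \<in> N" "\<And>x y. x \<in> N \<Longrightarrow> y \<in> N \<Longrightarrow> x \<oplus>\<^bsub>M\<^esub> y \<in> N"
    "\<And>r x. r \<in> carrier R \<Longrightarrow> x \<in> N \<Longrightarrow> r \<odot>\<^bsub>M\<^esub> x \<in> N"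
  shows "right_module R (M\<lparr>carrier := N\<rparr>)"
proof (intro right_module.intro right_module_axioms.intro)
  show "ring R" by (rule R.ring_axioms)
  have Nc: "x \<in> N \<Longrightarrow> x \<in> carrier M" for x using N by auto
  show "abelian_group (M\<lparr>carrier := N\<rparr>)"
  proof (rule abelian_groupI)
    fix x assume x: "x \<in> carrier (M\<lparr>carrier := N\<rparr>)"
    have "(\<ominus> \<one>) \<odot>\<^bsub>M\<^esub> x \<in> N" using N(4) x by simp
    moreover have "(\<ominus> \<one>) \<odot>\<^bsub>M\<^esub> x \<oplus>\<^bsub>M\<^esub> x = \<zero>\<^bsub>M\<^esub>"
      using smult_uminus_one[OF Nc] Nc calculation x M.a_comm by simp
    ultimately show "\<exists>y\<in>carrier (M\<lparr>carrier := N\<rparr>). y \<oplus>\<^bsub>M\<lparr>carrier := N\<rparr>\<^esub> x = \<zero>\<^bsub>M\<lparr>carrier := N\<rparr>\<^esub>"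
      by auto
  qed (auto simp: N Nc M.a_ac)
qed (auto simp: N rsmult_ring_distr rsmult_module_distr rsmult_assoc rsmult_one subsetD[OF N(1)])

end

text \<open>The module structure carried over to another type along an injection \<open>e\<close>. Projective resolutions live in one fixed type, into
which free modules have to be encoded.\<close>

definition transport_module :: "('m \<Rightarrow> 'n) \<Rightarrow> ('r, 'm) module \<Rightarrow> ('r, 'n) module" where
  "transport_module e M = \<lparr> carrier = e ` carrier M, mult = undefined, one = undefined, zero = e \<zero>\<^bsub>M\<^esub>,
     add = (\<lambda>u v. e (inv_into (carrier M) e u \<oplus>\<^bsub>M\<^esub> inv_into (carrier M) e v)),
     smult = (\<lambda>r u. e (r \<odot>\<^bsub>M\<^esub> inv_into (carrier M) e u)) \<rparr>"

lemma right_module_transport: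
  fixes M :: "('r, 'm) module" and R :: "('r, 's) ring_scheme"
  assumes M: "right_module R M" and e: "inj_on e (carrier M)"
  shows "right_module R (transport_module e M)"
proof -
  interpret right_module R M by (rule M)
  have i: "inv_into (carrier M) e (e x) = x" if "x \<in> carrier M" for x using e that by simp
  show ?thesis
  proof (intro right_module.intro right_module_axioms.intro)
    show "ring R" by (rule R.ring_axioms)
    show "abelian_group (transport_module e M)"
    proof (rule abelian_groupI)
      fix u assume "u \<in> carrier (transport_module e M)"
      then obtain x where x: "x \<in> carrier M" "u = e x" by (auto simp: transport_module_def)
      then have "e (\<ominus>\<^bsub>M\<^esub> x) \<in> carrier (transport_module e M)" by (auto simp: transport_module_def)
      moreover have "e (\<ominus>\<^bsub>M\<^esub> x) \<oplus>\<^bsub>transport_module e M\<^esub> u = \<zero>\<^bsub>transport_module e M\<^esub>"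
        using x by (simp add: transport_module_def i M.l_neg)
      ultimately show "\<exists>v\<in>carrier (transport_module e M). v \<oplus>\<^bsub>transport_module e M\<^esub> u = \<zero>\<^bsub>transport_module e M\<^esub>" by blast
    qed (auto simp: transport_module_def i M.a_ac)
  qed (auto simp: transport_module_def i rsmult_closed rsmult_ring_distr rsmult_module_distr rsmult_assoc rsmult_one)
qed

context ring begin

lemma free_rmod_carrier:
  "f \<in> carrier (free_rmod R X) \<longleftrightarrow> (\<forall>x. f x \<in> carrier R) \<and> (\<forall>x. x \<notin> X \<longrightarrow> f x = \<zero>) \<and> finite {x. f x \<noteq> \<zero>}"
  by (auto simp: free_rmod_def)

lemma free_rmod_coeff: "f \<in> carrier (free_rmod R X) \<Longrightarrow> f x \<in> carrier R"
  by (simp add: free_rmod_carrier)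

lemma free_rmod_simps [simp]:
  "\<zero>\<^bsub>free_rmod R X\<^esub> = (\<lambda>x. \<zero>)"
  "f \<oplus>\<^bsub>free_rmod R X\<^esub> g = (\<lambda>x. f x \<oplus> g x)"
  "r \<odot>\<^bsub>free_rmod R X\<^esub> f = (\<lambda>x. f x \<otimes> r)"
  by (simp_all add: free_rmod_def)

lemma free_rmod_closed:
  "(\<lambda>x. \<zero>) \<in> carrier (free_rmod R X)"
  "f \<in> carrier (free_rmod R X) \<Longrightarrow> g \<in> carrier (free_rmod R X) \<Longrightarrow> (\<lambda>x. f x \<oplus> g x) \<in> carrier (free_rmod R X)"
  "f \<in> carrier (free_rmod R X) \<Longrightarrow> r \<in> carrier R \<Longrightarrow> (\<lambda>x. f x \<otimes> r) \<in> carrier (free_rmod R X)"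
proof -
  show "(\<lambda>x. \<zero>) \<in> carrier (free_rmod R X)" by (simp add: free_rmod_carrier)
  show "(\<lambda>x. f x \<oplus> g x) \<in> carrier (free_rmod R X)"
    if f: "f \<in> carrier (free_rmod R X)" and g: "g \<in> carrier (free_rmod R X)"
  proof -
    have "{x. f x \<oplus> g x \<noteq> \<zero>} \<subseteq> {x. f x \<noteq> \<zero>} \<union> {x. g x \<noteq> \<zero>}" by auto
    then have "finite {x. f x \<oplus> g x \<noteq> \<zero>}"
      using f g unfolding free_rmod_carrier by (meson finite_UnI finite_subset)
    then show ?thesis using f g by (simp add: free_rmod_carrier)
  qed
  show "(\<lambda>x. f x \<otimes> r) \<in> carrier (free_rmod R X)"
    if f: "f \<in> carrier (free_rmod R X)" and r: "r \<in> carrier R"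
  proof -
    have "{x. f x \<otimes> r \<noteq> \<zero>} \<subseteq> {x. f x \<noteq> \<zero>}" using r by auto
    then have "finite {x. f x \<otimes> r \<noteq> \<zero>}"
      using f unfolding free_rmod_carrier by (meson finite_subset)
    then show ?thesis using f r by (simp add: free_rmod_carrier)
  qed
qed

lemma right_module_free_rmod: "right_module R (free_rmod R X)"
proof (intro right_module.intro right_module_axioms.intro)
  show "ring R" by (rule ring_axioms)
  have c: "f x \<in> carrier R" if "f \<in> carrier (free_rmod R X)" for f x
    using that by (simp add: free_rmod_carrier)
  show "abelian_group (free_rmod R X)"
  proof (rule abelian_groupI)
    fix f assume f: "f \<in> carrier (free_rmod R X)"
    have "(\<lambda>x. f x \<otimes> (\<ominus> \<one>)) \<in> carrier (free_rmod R X)" using free_rmod_closed(3)[OF f] by simp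
    moreover have "(\<lambda>x. f x \<otimes> (\<ominus> \<one>)) \<oplus>\<^bsub>free_rmod R X\<^esub> f = \<zero>\<^bsub>free_rmod R X\<^esub>"
      using c[OF f] by (auto simp: r_minus l_neg)
    ultimately show "\<exists>g\<in>carrier (free_rmod R X). g \<oplus>\<^bsub>free_rmod R X\<^esub> f = \<zero>\<^bsub>free_rmod R X\<^esub>" by blast
  qed (auto simp: free_rmod_closed c a_ac)
qed (auto simp: free_rmod_closed free_rmod_coeff r_distr l_distr m_assoc)

end

context right_module begin

text \<open>The canonical map onto \<open>M\<close> from the free module whose basis is the set of elements of \<open>M\<close>.\<close>

definition combination :: "('m \<Rightarrow> 'r) \<Rightarrow> 'm" where
  "combination f = (\<Oplus>\<^bsub>M\<^esub>x\<in>{x. f x \<noteq> \<zero>}. f x \<odot>\<^bsub>M\<^esub> x)"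

lemma combination_superset:
  assumes f: "f \<in> carrier (free_rmod R (carrier M))" and S: "finite S" "{x. f x \<noteq> \<zero>} \<subseteq> S" "S \<subseteq> carrier M"
  shows "combination f = (\<Oplus>\<^bsub>M\<^esub>x\<in>S. f x \<odot>\<^bsub>M\<^esub> x)"
  unfolding combination_def
proof (rule M.add.finprod_mono_neutral_cong_left[OF S(1,2)])
  have c: "f x \<in> carrier R" for x using f by (simp add: R.free_rmod_carrier)
  show "f i \<odot>\<^bsub>M\<^esub> i = \<zero>\<^bsub>M\<^esub>" if "i \<in> S - {x. f x \<noteq> \<zero>}" for i
    using that S(3) smult_l_zero by auto
  show "(\<lambda>x. f x \<odot>\<^bsub>M\<^esub> x) \<in> S \<rightarrow> carrier M" using c S(3) rsmult_closed by auto
qed simp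

lemma support_subset: "f \<in> carrier (free_rmod R X) \<Longrightarrow> {x. f x \<noteq> \<zero>} \<subseteq> X"
  by (auto simp: R.free_rmod_carrier)

lemma
  assumes f: "f \<in> carrier (free_rmod R (carrier M))"
  shows combination_closed: "combination f \<in> carrier M"
    and combination_add: "g \<in> carrier (free_rmod R (carrier M)) \<Longrightarrow>
      combination (f \<oplus>\<^bsub>free_rmod R (carrier M)\<^esub> g) = combination f \<oplus>\<^bsub>M\<^esub> combination g"
    and combination_smult: "r \<in> carrier R \<Longrightarrow>
      combination (r \<odot>\<^bsub>free_rmod R (carrier M)\<^esub> f) = r \<odot>\<^bsub>M\<^esub> combination f"
proof -
  let ?F = "free_rmod R (carrier M)"
  have c: "f x \<in> carrier R" "finite {x. f x \<noteq> \<zero>}" if "f \<in> carrier ?F" for f x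
    using that by (auto simp: R.free_rmod_carrier)
  show "combination f \<in> carrier M"
    unfolding combination_def using c[OF f] support_subset[OF f] rsmult_closed by (intro M.finsum_closed) auto
  show "combination (f \<oplus>\<^bsub>?F\<^esub> g) = combination f \<oplus>\<^bsub>M\<^esub> combination g" if g: "g \<in> carrier ?F" for g
  proof -
    let ?S = "{x. f x \<noteq> \<zero>} \<union> {x. g x \<noteq> \<zero>}"
    have S: "finite ?S" "?S \<subseteq> carrier M" using c[OF f] c[OF g] support_subset[OF f] support_subset[OF g] by auto
    have fg: "f \<oplus>\<^bsub>?F\<^esub> g \<in> carrier ?F" using R.free_rmod_closed(2)[OF f g] by simp
    have "combination (f \<oplus>\<^bsub>?F\<^esub> g) = (\<Oplus>\<^bsub>M\<^esub>x\<in>?S. (f \<oplus>\<^bsub>?F\<^esub> g) x \<odot>\<^bsub>M\<^esub> x)"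
      by (rule combination_superset[OF fg S(1) _ S(2)]) auto
    also have "\<dots> = (\<Oplus>\<^bsub>M\<^esub>x\<in>?S. f x \<odot>\<^bsub>M\<^esub> x \<oplus>\<^bsub>M\<^esub> g x \<odot>\<^bsub>M\<^esub> x)"
      using c[OF f] c[OF g] S(2) rsmult_closed by (intro M.finsum_cong') (auto simp: rsmult_ring_distr)
    also have "\<dots> = (\<Oplus>\<^bsub>M\<^esub>x\<in>?S. f x \<odot>\<^bsub>M\<^esub> x) \<oplus>\<^bsub>M\<^esub> (\<Oplus>\<^bsub>M\<^esub>x\<in>?S. g x \<odot>\<^bsub>M\<^esub> x)"
      using c[OF f] c[OF g] S(2) rsmult_closed by (intro M.finsum_addf) auto
    also have "(\<Oplus>\<^bsub>M\<^esub>x\<in>?S. f x \<odot>\<^bsub>M\<^esub> x) = combination f"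
      by (rule combination_superset[OF f S(1) _ S(2), symmetric]) auto
    also have "(\<Oplus>\<^bsub>M\<^esub>x\<in>?S. g x \<odot>\<^bsub>M\<^esub> x) = combination g"
      by (rule combination_superset[OF g S(1) _ S(2), symmetric]) auto
    finally show ?thesis .
  qed
  assume r: "r \<in> carrier R"
  let ?S = "{x. f x \<noteq> \<zero>}"
  have c: "f x \<in> carrier R" "finite ?S" for x using f by (auto simp: R.free_rmod_carrier)
  note S = support_subset[OF f]
  have rf: "r \<odot>\<^bsub>?F\<^esub> f \<in> carrier ?F" using R.free_rmod_closed(3)[OF f r] by simp
  have "combination (r \<odot>\<^bsub>?F\<^esub> f) = (\<Oplus>\<^bsub>M\<^esub>x\<in>?S. (r \<odot>\<^bsub>?F\<^esub> f) x \<odot>\<^bsub>M\<^esub> x)"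
    by (rule combination_superset[OF rf c(2) _ S]) (use r in auto)
  also have "\<dots> = (\<Oplus>\<^bsub>M\<^esub>x\<in>?S. r \<odot>\<^bsub>M\<^esub> (f x \<odot>\<^bsub>M\<^esub> x))"
    using c S r rsmult_closed by (intro M.finsum_cong') (auto simp: rsmult_assoc)
  also have "\<dots> = r \<odot>\<^bsub>M\<^esub> combination f"
    unfolding combination_def using c S r rsmult_closed by (intro finsum_smult[symmetric]) auto
  finally show "combination (r \<odot>\<^bsub>?F\<^esub> f) = r \<odot>\<^bsub>M\<^esub> combination f" .
qed

lemma combination_surj: "combination ` carrier (free_rmod R (carrier M)) = carrier M"
proof
  show "combination ` carrier (free_rmod R (carrier M)) \<subseteq> carrier M"
    using combination_closed by auto
  show "carrier M \<subseteq> combination ` carrier (free_rmod R (carrier M))"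
  proof
    fix m assume m: "m \<in> carrier M"
    define f where "f = (\<lambda>x. if x = m then \<one> else \<zero>)"
    have f: "f \<in> carrier (free_rmod R (carrier M))" using m by (auto simp: R.free_rmod_carrier f_def)
    have "combination f = (\<Oplus>\<^bsub>M\<^esub>x\<in>{m}. f x \<odot>\<^bsub>M\<^esub> x)"
      by (rule combination_superset[OF f]) (use m in \<open>auto simp: f_def\<close>)
    then have "combination f = m" using m by (simp add: f_def rsmult_one)
    then show "m \<in> combination ` carrier (free_rmod R (carrier M))" using f by blast
  qed
qed

end

text \<open>Every right ideal is finitely generated and projective, expressed by a finite dual basis.\<close>

locale right_hereditary = ring R for R (structure) +
  assumes right_ideal_dual_basis: "right_ideal I R \<Longrightarrow>
    \<exists>(n::nat) g c. (\<forall>j<n. g j \<in> I) \<and> (\<forall>j<n. \<forall>f\<in>I. c j f \<in> carrier R) \<and>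
    (\<forall>j<n. \<forall>f\<in>I. \<forall>f'\<in>I. c j (f \<oplus> f') = c j f \<oplus> c j f') \<and>
    (\<forall>j<n. \<forall>f\<in>I. \<forall>r\<in>carrier R. c j (f \<otimes> r) = c j f \<otimes> r) \<and>
    (\<forall>f\<in>I. (\<Oplus>j\<in>{..<n}. g j \<otimes> c j f) = f)"
begin

text \<open>Every submodule \<open>N\<close> of a free module over a hereditary ring is projective, in the form that a linear map \<open>\<pi>\<close>
from any module onto \<open>N\<close> has a linear section \<open>t\<close>. Well-order the basis. The coefficients at \<open>x\<close> of the
elements of \<open>N\<close> supported at or below \<open>x\<close> form a right ideal \<open>I x\<close>, and by its dual basis there is a linear map
\<open>h x\<close> that lifts \<open>I x\<close> to elements with the prescribed coefficient at \<open>x\<close>. Subtracting the lift of its leading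
coefficient moves the leading index of an element of \<open>N\<close> strictly down. So the section is defined by recursion on the leading
index.\<close>

lemma free_submodule_section:
  fixes X :: "'x set" and F :: "('a, 'f) module" and \<pi> :: "'f \<Rightarrow> 'x \<Rightarrow> 'a"
  assumes F: "right_module R F"
    and \<pi>: "\<pi> \<in> rmod_hom R F (free_rmod R X)" and N: "N = \<pi> ` carrier F"
  shows "\<exists>t. t \<in> N \<rightarrow> carrier F \<and> (\<forall>p\<in>N. \<forall>q\<in>N. t (\<lambda>x. p x \<oplus> q x) = t p \<oplus>\<^bsub>F\<^esub> t q) \<and>
    (\<forall>p\<in>N. \<forall>r\<in>carrier R. t (\<lambda>x. p x \<otimes> r) = r \<odot>\<^bsub>F\<^esub> t p) \<and> (\<forall>p\<in>N. \<pi> (t p) = p)"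
proof -
  interpret F: right_module R F by (rule F)
  have \<pi>c: "\<pi> u \<in> carrier (free_rmod R X)" if "u \<in> carrier F" for u
    using \<pi> that unfolding rmod_hom_def by blast
  have \<pi>add: "\<pi> (u \<oplus>\<^bsub>F\<^esub> v) x = \<pi> u x \<oplus> \<pi> v x" if "u \<in> carrier F" "v \<in> carrier F" for u v x
  proof -
    have "\<pi> (u \<oplus>\<^bsub>F\<^esub> v) = \<pi> u \<oplus>\<^bsub>free_rmod R X\<^esub> \<pi> v" using \<pi> that unfolding rmod_hom_def by blast
    then show ?thesis by simp
  qed
  have \<pi>smult: "\<pi> (r \<odot>\<^bsub>F\<^esub> u) x = \<pi> u x \<otimes> r" if "u \<in> carrier F" "r \<in> carrier R" for u r x
  proof -
    have "\<pi> (r \<odot>\<^bsub>F\<^esub> u) = r \<odot>\<^bsub>free_rmod R X\<^esub> \<pi> u" using \<pi> that unfolding rmod_hom_def by blast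
    then show ?thesis by simp
  qed
  have Nc: "p x \<in> carrier R" "finite {x. p x \<noteq> \<zero>}" if "p \<in> N" for p x
    using that \<pi>c unfolding N by (auto simp: free_rmod_carrier)
  have \<pi>R: "\<pi> u x \<in> carrier R" if "u \<in> carrier F" for u x using Nc(1)[of "\<pi> u"] that unfolding N by blast
  have \<pi>N: "\<pi> u \<in> N" if "u \<in> carrier F" for u using that unfolding N by blast
  have Nadd: "(\<lambda>x. p x \<oplus> q x) \<in> N" if pq: "p \<in> N" "q \<in> N" for p q
  proof -
    obtain u v where u: "u \<in> carrier F" "v \<in> carrier F" "p = \<pi> u" "q = \<pi> v" using pq unfolding N by blast
    then have "(\<lambda>x. p x \<oplus> q x) = \<pi> (u \<oplus>\<^bsub>F\<^esub> v)" using \<pi>add by auto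
    then show ?thesis using u \<pi>N[of "u \<oplus>\<^bsub>F\<^esub> v"] by simp
  qed
  have Nmult: "(\<lambda>x. p x \<otimes> r) \<in> N" if p: "p \<in> N" and r: "r \<in> carrier R" for p r
  proof -
    obtain u where u: "u \<in> carrier F" "p = \<pi> u" using p unfolding N by blast
    then have "(\<lambda>x. p x \<otimes> r) = \<pi> (r \<odot>\<^bsub>F\<^esub> u)" using \<pi>smult r by auto
    then show ?thesis using u r \<pi>N[of "r \<odot>\<^bsub>F\<^esub> u"] F.rsmult_closed by simp
  qed
  have Nsub: "(\<lambda>x. p x \<ominus> q x) \<in> N" if p: "p \<in> N" and q: "q \<in> N" for p q
  proof -
    have "(\<lambda>x. p x \<oplus> q x \<otimes> (\<ominus> \<one>)) \<in> N" using Nadd[OF p Nmult[OF q]] by simp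
    moreover have "(\<lambda>x. p x \<oplus> q x \<otimes> (\<ominus> \<one>)) = (\<lambda>x. p x \<ominus> q x)"
      using Nc(1)[OF q] by (auto simp: r_minus a_minus_def)
    ultimately show ?thesis by simp
  qed
  have \<pi>zero: "\<pi> \<zero>\<^bsub>F\<^esub> = (\<lambda>x. \<zero>)"
  proof
    fix x
    have "\<pi> (\<zero> \<odot>\<^bsub>F\<^esub> \<zero>\<^bsub>F\<^esub>) x = \<pi> \<zero>\<^bsub>F\<^esub> x \<otimes> \<zero>" by (rule \<pi>smult) auto
    then show "\<pi> \<zero>\<^bsub>F\<^esub> x = \<zero>" using \<pi>R[of "\<zero>\<^bsub>F\<^esub>" x] F.smult_l_zero by simp
  qed
  have \<pi>sum: "\<pi> (finsum F f A) x = (\<Oplus>i\<in>A. \<pi> (f i) x)" if "f \<in> A \<rightarrow> carrier F" for f and A :: "nat set" and x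
    using that
  proof (induction A rule: infinite_finite_induct)
    case (insert i A)
    then have c: "f i \<in> carrier F" "f \<in> A \<rightarrow> carrier F" "(\<lambda>i. \<pi> (f i) x) \<in> A \<rightarrow> carrier R"
      using \<pi>R by (auto simp: Pi_iff)
    then show ?case using insert \<pi>R by (simp add: \<pi>add)
  qed (auto simp: \<pi>zero)
  obtain ord :: "('x \<times> 'x) set" where ord: "well_order_on UNIV ord" using well_order_on by blast
  define lt where "lt y x \<longleftrightarrow> (y, x) \<in> ord \<and> y \<noteq> x" for y x
  have wf: "wf {(y, x). lt y x}"
  proof -
    have "{(y, x). lt y x} = ord - Id" by (auto simp: lt_def)
    then show ?thesis using ord by (simp add: well_order_on_def)
  qed
  have tot: "lt x y \<or> x = y \<or> lt y x" for x y
    using ord unfolding well_order_on_def linear_order_on_def total_on_def lt_def by blast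
  have trans: "lt x z" if "lt x y" "lt y z" for x y z
    using ord that unfolding well_order_on_def linear_order_on_def partial_order_on_def preorder_on_def lt_def
    by (metis antisymD transD)
  have asym: "\<not> lt y x" if "lt x y" for x y using trans[OF that] by (auto simp: lt_def)
  \<comment> \<open>\<open>below x p\<close> says that \<open>p\<close> is supported at or below \<open>x\<close>, and \<open>sbelow\<close> that it
    is supported strictly below.\<close>
  define below where "below x p \<longleftrightarrow> (\<forall>y. p y \<noteq> \<zero> \<longrightarrow> y = x \<or> lt y x)" for x and p :: "'x \<Rightarrow> 'a"
  define sbelow where "sbelow x p \<longleftrightarrow> (\<forall>y. p y \<noteq> \<zero> \<longrightarrow> lt y x)" for x and p :: "'x \<Rightarrow> 'a"
  have ex_max: "\<exists>x\<in>S. \<forall>y\<in>S. y = x \<or> lt y x" if "finite S" "S \<noteq> {}" for S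
    using that
  proof (induction rule: finite_ne_induct)
    case (insert a S)
    obtain x where x: "x \<in> S" "\<forall>y\<in>S. y = x \<or> lt y x" using insert.IH by blast
    show ?case
    proof (cases "lt x a")
      case True
      have "y = a \<or> lt y a" if "y \<in> insert a S" for y
      proof (cases "y = a")
        case False
        then have "y = x \<or> lt y x" using that x(2) by blast
        then show ?thesis using True trans[of y x a] by auto
      qed simp
      then show ?thesis by blast
    next
      case False
      then have "a = x \<or> lt a x" using tot[of a x] by blast
      then show ?thesis using x by blast
    qed
  qed auto
  have below_add: "below x (\<lambda>y. p y \<oplus> q y)" if "below x p" "below x q" for x p q
    using that unfolding below_def by (metis l_zero zero_closed)
  have below_mult: "below x (\<lambda>y. p y \<otimes> r)" if "below x p" "r \<in> carrier R" for x p r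
    using that unfolding below_def by (metis l_null)
  define I where "I x = {p x |p. p \<in> N \<and> below x p}" for x
  have RI: "right_ideal (I x) R" for x
  proof (rule right_idealI)
    show "I x \<subseteq> carrier R" using Nc by (auto simp: I_def)
    have "(\<lambda>y. \<zero>) \<in> N" "below x (\<lambda>y. \<zero>)" using \<pi>N[OF F.M.zero_closed] \<pi>zero by (auto simp: below_def)
    then show "\<zero> \<in> I x" unfolding I_def by (intro CollectI exI[of _ "\<lambda>y. \<zero>"]) simp
    show "a \<oplus> b \<in> I x" if ab: "a \<in> I x" "b \<in> I x" for a b
    proof -
      obtain p q where "p \<in> N" "below x p" "a = p x" "q \<in> N" "below x q" "b = q x"
        using ab unfolding I_def by blast
      then show ?thesis unfolding I_def using Nadd below_add
        by (intro CollectI exI[of _ "\<lambda>y. p y \<oplus> q y"]) simp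
    qed
    show "a \<otimes> r \<in> I x" if a: "a \<in> I x" and r: "r \<in> carrier R" for a r
    proof -
      obtain p where "p \<in> N" "below x p" "a = p x" using a unfolding I_def by blast
      then show ?thesis unfolding I_def using Nmult below_mult r
        by (intro CollectI exI[of _ "\<lambda>y. p y \<otimes> r"]) simp
    qed
  qed
  have "\<exists>h. (\<forall>a\<in>I x. h a \<in> carrier F \<and> below x (\<pi> (h a)) \<and> \<pi> (h a) x = a) \<and>
      (\<forall>a\<in>I x. \<forall>b\<in>I x. h (a \<oplus> b) = h a \<oplus>\<^bsub>F\<^esub> h b) \<and>
      (\<forall>a\<in>I x. \<forall>r\<in>carrier R. h (a \<otimes> r) = r \<odot>\<^bsub>F\<^esub> h a)" for x
  proof -
    obtain n :: nat and g c where g: "\<forall>j<n. g j \<in> I x" and cc: "\<forall>j<n. \<forall>f\<in>I x. c j f \<in> carrier R"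
      and cadd: "\<forall>j<n. \<forall>f\<in>I x. \<forall>f'\<in>I x. c j (f \<oplus> f') = c j f \<oplus> c j f'"
      and cmult: "\<forall>j<n. \<forall>f\<in>I x. \<forall>r\<in>carrier R. c j (f \<otimes> r) = c j f \<otimes> r"
      and csum: "\<forall>f\<in>I x. (\<Oplus>j\<in>{..<n}. g j \<otimes> c j f) = f"
      using right_ideal_dual_basis[OF RI[of x]] by blast
    have "\<exists>u. u \<in> carrier F \<and> below x (\<pi> u) \<and> \<pi> u x = g j" if j: "j < n" for j
    proof -
      have "g j \<in> I x" using g j by blast
      then obtain p where p: "p \<in> N" "below x p" "g j = p x" unfolding I_def by blast
      then obtain u where "u \<in> carrier F" "p = \<pi> u" unfolding N by blast
      then show ?thesis using p by metis
    qed
    then obtain u where u: "\<forall>j. j < n \<longrightarrow> u j \<in> carrier F \<and> below x (\<pi> (u j)) \<and> \<pi> (u j) x = g j"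
      by (metis (no_types))
    define h where "h a = (\<Oplus>\<^bsub>F\<^esub>j\<in>{..<n}. c j a \<odot>\<^bsub>F\<^esub> u j)" for a
    have P: "(\<lambda>j. c j a \<odot>\<^bsub>F\<^esub> u j) \<in> {..<n} \<rightarrow> carrier F" if "a \<in> I x" for a
      using that cc u F.rsmult_closed by auto
    have hc: "h a \<in> carrier F" if "a \<in> I x" for a unfolding h_def by (rule F.M.finsum_closed[OF P[OF that]])
    have \<pi>h: "\<pi> (h a) y = (\<Oplus>j\<in>{..<n}. \<pi> (u j) y \<otimes> c j a)" if a: "a \<in> I x" for a y
      unfolding h_def \<pi>sum[OF P[OF a]] using a cc u \<pi>smult \<pi>R by (intro finsum_cong') auto
    have h1: "below x (\<pi> (h a))" if a: "a \<in> I x" for a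
      unfolding below_def
    proof (intro allI impI, rule ccontr)
      fix y assume y: "\<pi> (h a) y \<noteq> \<zero>" "\<not> (y = x \<or> lt y x)"
      have "\<pi> (u j) y = \<zero>" if "j < n" for j using u that y(2) unfolding below_def by blast
      then have "\<pi> (h a) y = \<zero>"
        unfolding \<pi>h[OF a] using cc a by (intro add.finprod_one_eqI) auto
      then show False using y by simp
    qed
    have h2: "\<pi> (h a) x = a" if a: "a \<in> I x" for a
    proof -
      have "\<pi> (h a) x = (\<Oplus>j\<in>{..<n}. g j \<otimes> c j a)"
        unfolding \<pi>h[OF a] using u cc a right_ideal_carrier[OF RI] g by (intro finsum_cong') auto
      then show ?thesis using csum a by simp
    qed
    have h3: "h (a \<oplus> b) = h a \<oplus>\<^bsub>F\<^esub> h b" if a: "a \<in> I x" and b: "b \<in> I x" for a b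
    proof -
      have "h (a \<oplus> b) = (\<Oplus>\<^bsub>F\<^esub>j\<in>{..<n}. c j a \<odot>\<^bsub>F\<^esub> u j \<oplus>\<^bsub>F\<^esub> c j b \<odot>\<^bsub>F\<^esub> u j)"
        unfolding h_def using a b cc cadd u F.rsmult_closed
        by (intro F.M.finsum_cong') (auto simp: F.rsmult_ring_distr)
      then show ?thesis unfolding h_def using F.M.finsum_addf[OF P[OF a] P[OF b]] by simp
    qed
    have h4: "h (a \<otimes> r) = r \<odot>\<^bsub>F\<^esub> h a" if a: "a \<in> I x" and r: "r \<in> carrier R" for a r
    proof -
      have "h (a \<otimes> r) = (\<Oplus>\<^bsub>F\<^esub>j\<in>{..<n}. r \<odot>\<^bsub>F\<^esub> (c j a \<odot>\<^bsub>F\<^esub> u j))"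
        unfolding h_def using a r cc cmult u F.rsmult_closed
        by (intro F.M.finsum_cong') (auto simp: F.rsmult_assoc)
      then show ?thesis unfolding h_def using F.finsum_smult[OF r P[OF a]] by simp
    qed
    show ?thesis by (rule exI[of _ h]) (use hc h1 h2 h3 h4 in blast)
  qed
  then obtain h where h: "\<And>x a. a \<in> I x \<Longrightarrow> h x a \<in> carrier F \<and> below x (\<pi> (h x a)) \<and> \<pi> (h x a) x = a"
    and hadd: "\<And>x a b. a \<in> I x \<Longrightarrow> b \<in> I x \<Longrightarrow> h x (a \<oplus> b) = h x a \<oplus>\<^bsub>F\<^esub> h x b"
    and hmult: "\<And>x a r. a \<in> I x \<Longrightarrow> r \<in> carrier R \<Longrightarrow> h x (a \<otimes> r) = r \<odot>\<^bsub>F\<^esub> h x a"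
    by (metis (no_types))
  have h0: "h x \<zero> = \<zero>\<^bsub>F\<^esub>" for x
  proof -
    note z = right_ideal_zero[OF RI[of x]]
    have "h x (\<zero> \<otimes> \<zero>) = \<zero> \<odot>\<^bsub>F\<^esub> h x \<zero>" using hmult[OF z zero_closed] .
    then show ?thesis using h[OF z] F.smult_l_zero by simp
  qed
  \<comment> \<open>One step of reduction: remove the coefficient at \<open>x\<close> by means of its lift.\<close>
  define red where "red x p = (\<lambda>y. p y \<ominus> \<pi> (h x (p x)) y)" for x p
  have pI: "p x \<in> I x" if "p \<in> N" "below x p" for p x using that unfolding I_def by blast
  have redN: "red x p \<in> N" if "p \<in> N" "below x p" for x p
    unfolding red_def using Nsub[OF that(1) \<pi>N] h[OF pI[OF that]] by blast
  have redb: "sbelow x (red x p)" if p: "p \<in> N" "below x p" for x p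
    unfolding sbelow_def
  proof (intro allI impI)
    fix y assume y: "red x p y \<noteq> \<zero>"
    have "red x p x = \<zero>" using h[OF pI[OF p]] Nc(1)[OF p(1)] by (simp add: red_def)
    then have "y \<noteq> x" using y by auto
    moreover have "p y \<noteq> \<zero> \<or> \<pi> (h x (p x)) y \<noteq> \<zero>" using y by (auto simp: red_def a_minus_def)
    ultimately show "lt y x" using p(2) h[OF pI[OF p]] unfolding below_def by blast
  qed
  \<comment> \<open>The recursion is well-founded because the leading index decreases.\<close>
  define rel where "rel = {(q, p). q \<in> N \<and> (\<exists>x. p x \<noteq> \<zero> \<and> below x p \<and> sbelow x q)}"
  have lead_uniq: "x = x'" if "p x \<noteq> \<zero>" "below x p" "p x' \<noteq> \<zero>" "below x' p" for p x x'
    using that asym unfolding below_def by blast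
  have ex_lead: "\<exists>x. p x \<noteq> \<zero> \<and> below x p" if "p \<in> N" "p \<noteq> (\<lambda>y. \<zero>)" for p
  proof -
    have "{x. p x \<noteq> \<zero>} \<noteq> {}" using that(2) by auto
    then show ?thesis using ex_max[OF Nc(2)[OF that(1)]] unfolding below_def by blast
  qed
  have wfrel: "wf rel"
  proof (rule wfI_min)
    fix p :: "'x \<Rightarrow> 'a" and S assume p: "p \<in> S"
    show "\<exists>z\<in>S. \<forall>y. (y, z) \<in> rel \<longrightarrow> y \<notin> S"
    proof (rule ccontr)
      assume "\<not> ?thesis"
      then have step: "\<And>z. z \<in> S \<Longrightarrow> \<exists>y. (y, z) \<in> rel \<and> y \<in> S" by blast
      have no: "z \<notin> S" if "z x \<noteq> \<zero>" "below x z" for x z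
        using that
      proof (induction x arbitrary: z rule: wf_induct_rule[OF wf])
        case (1 x)
        show ?case
        proof
          assume "z \<in> S"
          then obtain y where y: "(y, z) \<in> rel" "y \<in> S" using step by blast
          then obtain x' where x': "z x' \<noteq> \<zero>" "below x' z" "sbelow x' y" "y \<in> N" by (auto simp: rel_def)
          have "x' = x" using lead_uniq x' 1 by blast
          obtain w where "(w, y) \<in> rel" using step y(2) by blast
          then obtain x'' where x'': "y x'' \<noteq> \<zero>" "below x'' y" by (auto simp: rel_def)
          then have "lt x'' x" using x'(3) \<open>x' = x\<close> unfolding sbelow_def by blast
          then show False using 1(1)[of x'' y] x'' y(2) by blast
        qed
      qed
      obtain y where "(y, p) \<in> rel" using step p by blast
      then show False using no p by (auto simp: rel_def)
    qed
  qed
  define ld where "ld p = (THE x. p x \<noteq> \<zero> \<and> below x p)" for p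
  have ld: "ld p = x" if "p x \<noteq> \<zero>" "below x p" for p x
    unfolding ld_def using that lead_uniq by (intro the_equality) blast+
  define t where "t = wfrec rel (\<lambda>t p. if p = (\<lambda>y. \<zero>) then \<zero>\<^bsub>F\<^esub>
     else h (ld p) (p (ld p)) \<oplus>\<^bsub>F\<^esub> t (red (ld p) p))"
  have t0: "t (\<lambda>y. \<zero>) = \<zero>\<^bsub>F\<^esub>" unfolding t_def by (subst wfrec[OF wfrel]) simp
  have t_lead: "t p = h x (p x) \<oplus>\<^bsub>F\<^esub> t (red x p)" if p: "p \<in> N" "below x p" "p x \<noteq> \<zero>" for p x
  proof -
    have "(red x p, p) \<in> rel" unfolding rel_def using redN[OF p(1,2)] redb[OF p(1,2)] p by blast
    moreover have "p \<noteq> (\<lambda>y. \<zero>)" using p(3) by auto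
    ultimately show ?thesis
      unfolding t_def by (subst wfrec[OF wfrel]) (simp add: ld[OF p(3,2)] cut_apply)
  qed
  have red0: "red x p = p" if "p \<in> N" "p x = \<zero>" for x p
  proof
    fix y
    have "p y \<in> carrier R" by (rule Nc(1)[OF that(1)])
    then show "red x p y = p y" by (simp add: red_def that(2) h0 \<pi>zero a_minus_def)
  qed
  \<comment> \<open>Elements supported strictly below \<open>x\<close> are supported at or below one common smaller index, or vanish. This is how the
    induction hypothesis applies to pairs.\<close>
  have small: "(p = (\<lambda>y. \<zero>) \<and> q = (\<lambda>y. \<zero>)) \<or> (\<exists>y. lt y x \<and> below y p \<and> below y q)"
    if pq: "p \<in> N" "q \<in> N" "sbelow x p" "sbelow x q" for p q x
  proof (cases "{y. p y \<noteq> \<zero>} \<union> {y. q y \<noteq> \<zero>} = {}")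
    case True
    then have "p y = \<zero>" "q y = \<zero>" for y by blast+
    then have "p = (\<lambda>y. \<zero>)" "q = (\<lambda>y. \<zero>)" by blast+
    then show ?thesis by blast
  next
    case False
    have "finite ({y. p y \<noteq> \<zero>} \<union> {y. q y \<noteq> \<zero>})" using Nc(2)[OF pq(1)] Nc(2)[OF pq(2)] by simp
    then obtain y where y: "y \<in> {y. p y \<noteq> \<zero>} \<union> {y. q y \<noteq> \<zero>}"
      "\<forall>z\<in>{y. p y \<noteq> \<zero>} \<union> {y. q y \<noteq> \<zero>}. z = y \<or> lt z y" using ex_max[OF _ False] by blast
    then have "lt y x" using pq unfolding sbelow_def by blast
    then show ?thesis using y unfolding below_def by blast
  qed
  have main: "t p \<in> carrier F \<and> \<pi> (t p) = p \<and> t (\<lambda>y. p y \<oplus> q y) = t p \<oplus>\<^bsub>F\<^esub> t q \<and>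
      (\<forall>r\<in>carrier R. t (\<lambda>y. p y \<otimes> r) = r \<odot>\<^bsub>F\<^esub> t p)"
    if "p \<in> N" "q \<in> N" "below x p" "below x q" for x p q
    using that
  proof (induction x arbitrary: p q rule: wf_induct_rule[OF wf])
    case (1 x)
    note IH = 1(1)
    have rec: "t p \<in> carrier F \<and> \<pi> (t p) = p \<and> t (\<lambda>y. p y \<oplus> q y) = t p \<oplus>\<^bsub>F\<^esub> t q \<and>
      (\<forall>r\<in>carrier R. t (\<lambda>y. p y \<otimes> r) = r \<odot>\<^bsub>F\<^esub> t p)"
      if pq: "p \<in> N" "q \<in> N" "sbelow x p" "sbelow x q" for p q
      using small[OF pq]
    proof
      assume "p = (\<lambda>y. \<zero>) \<and> q = (\<lambda>y. \<zero>)"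
      then show ?thesis using t0 \<pi>zero F.smult_r_zero by simp
    next
      assume "\<exists>y. lt y x \<and> below y p \<and> below y q"
      then obtain y where "lt y x" "below y p" "below y q" by blast
      then show ?thesis using IH[of y p q] pq by blast
    qed
    \<comment> \<open>The recursion equation holds at every index that bounds the support, not only at the leading one. So \<open>t\<close> can be
      compared on \<open>p\<close>, \<open>q\<close> and \<open>p + q\<close>, whose leading indices may differ.\<close>
    have E: "t p = h x (p x) \<oplus>\<^bsub>F\<^esub> t (red x p)" if p: "p \<in> N" "below x p" for p
    proof (cases "p x = \<zero>")
      case True
      have "t p \<in> carrier F"
        using rec[of p p] redN[OF p] redb[OF p] red0[OF p(1) True] p(1) by simp
      then show ?thesis using True h0 red0[OF p(1) True] by simp
    next
      case False
      then show ?thesis using t_lead[OF p] by blast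
    qed
    note p = 1(2,4) and q = 1(3,5)
    note hp = h[OF pI[OF p]] and hq = h[OF pI[OF q]]
    note rp = redN[OF p] redb[OF p] and rq = redN[OF q] redb[OF q]
    note Rpq = rec[OF rp(1) rq(1) rp(2) rq(2)] and Rq = rec[OF rq(1) rp(1) rq(2) rp(2)]
    have tp: "t p \<in> carrier F" using E[OF p] hp Rpq by simp
    moreover have "\<pi> (t p) = p"
    proof
      fix y
      have "\<pi> (t p) y = \<pi> (h x (p x)) y \<oplus> red x p y"
        using E[OF p] hp Rpq \<pi>add by simp
      also have "\<dots> = p y"
        using Nc(1)[OF p(1)] \<pi>R[of "h x (p x)"] hp by (simp add: red_def a_minus_def a_lcomm r_neg)
      finally show "\<pi> (t p) y = p y" .
    qed
    moreover have "t (\<lambda>y. p y \<oplus> q y) = t p \<oplus>\<^bsub>F\<^esub> t q"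
    proof -
      let ?s = "\<lambda>y. p y \<oplus> q y"
      have s: "?s \<in> N" "below x ?s" using Nadd p q below_add by auto
      have hs: "h x (?s x) = h x (p x) \<oplus>\<^bsub>F\<^esub> h x (q x)" using hadd[OF pI[OF p] pI[OF q]] by simp
      have "red x ?s = (\<lambda>y. red x p y \<oplus> red x q y)"
        unfolding red_def hs using hp hq Nc(1)[OF p(1)] Nc(1)[OF q(1)] \<pi>R
        by (auto simp: \<pi>add a_minus_def minus_add a_ac)
      then have "t ?s = (h x (p x) \<oplus>\<^bsub>F\<^esub> h x (q x)) \<oplus>\<^bsub>F\<^esub> (t (red x p) \<oplus>\<^bsub>F\<^esub> t (red x q))"
        using E[OF s] hs Rpq by simp
      also have "\<dots> = t p \<oplus>\<^bsub>F\<^esub> t q"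
        using E[OF p] E[OF q] hp hq Rpq Rq by (simp add: F.M.a_ac)
      finally show ?thesis .
    qed
    moreover have "t (\<lambda>y. p y \<otimes> r) = r \<odot>\<^bsub>F\<^esub> t p" if r: "r \<in> carrier R" for r
    proof -
      let ?s = "\<lambda>y. p y \<otimes> r"
      have s: "?s \<in> N" "below x ?s" using Nmult p below_mult r by auto
      have hs: "h x (?s x) = r \<odot>\<^bsub>F\<^esub> h x (p x)" using hmult[OF pI[OF p] r] by simp
      have "red x ?s = (\<lambda>y. red x p y \<otimes> r)"
        unfolding red_def hs using hp Nc(1)[OF p(1)] \<pi>R r
        by (auto simp: \<pi>smult a_minus_def l_distr l_minus)
      then have "t ?s = r \<odot>\<^bsub>F\<^esub> h x (p x) \<oplus>\<^bsub>F\<^esub> r \<odot>\<^bsub>F\<^esub> t (red x p)"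
        using E[OF s] hs Rpq r by simp
      also have "\<dots> = r \<odot>\<^bsub>F\<^esub> t p"
        using E[OF p] hp Rpq r by (simp add: F.rsmult_module_distr)
      finally show ?thesis .
    qed
    ultimately show ?case by blast
  qed
  have both: "\<exists>x. below x p \<and> below x q" if pq: "p \<in> N" "q \<in> N" for p q
  proof (cases "{y. p y \<noteq> \<zero>} \<union> {y. q y \<noteq> \<zero>} = {}")
    case True
    then have "p y = \<zero>" "q y = \<zero>" for y by blast+
    then show ?thesis unfolding below_def by simp
  next
    case False
    have "finite ({y. p y \<noteq> \<zero>} \<union> {y. q y \<noteq> \<zero>})" using Nc(2)[OF pq(1)] Nc(2)[OF pq(2)] by simp
    then show ?thesis using ex_max[OF _ False] unfolding below_def by blast
  qed
  show ?thesis
  proof (intro exI[of _ t] conjI ballI funcsetI)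
    fix p assume p: "p \<in> N"
    obtain x where "below x p" using both[OF p p] by blast
    note m = main[OF p p this this]
    show "t p \<in> carrier F" "\<pi> (t p) = p" using m by blast+
    show "t (\<lambda>x. p x \<otimes> r) = r \<odot>\<^bsub>F\<^esub> t p" if "r \<in> carrier R" for r using m that by blast
    fix q assume q: "q \<in> N"
    obtain x where "below x p" "below x q" using both[OF p q] by blast
    then show "t (\<lambda>x. p x \<oplus> q x) = t p \<oplus>\<^bsub>F\<^esub> t q" using main[OF p q] by blast
  qed
qed

end

section \<open>Global dimension\<close>

lemma rmod_homI:
  assumes "\<And>x. x \<in> carrier M \<Longrightarrow> f x \<in> carrier N"
    and "\<And>x y. x \<in> carrier M \<Longrightarrow> y \<in> carrier M \<Longrightarrow> f (x \<oplus>\<^bsub>M\<^esub> y) = f x \<oplus>\<^bsub>N\<^esub> f y"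
    and "\<And>r x. r \<in> carrier R \<Longrightarrow> x \<in> carrier M \<Longrightarrow> f (r \<odot>\<^bsub>M\<^esub> x) = r \<odot>\<^bsub>N\<^esub> f x"
  shows "f \<in> rmod_hom R M N"
  using assms by (auto simp: rmod_hom_def)

lemma combination_rmod_hom:
  fixes M :: "('r, 'm) module"
  assumes "right_module R M"
  shows "right_module.combination R M \<in> rmod_hom R (free_rmod R (carrier M)) M"
proof -
  interpret right_module R M by fact
  show ?thesis
    by (rule rmod_homI) (rule combination_closed combination_add combination_smult; assumption)+
qed

lemma rmod_hom_id_submodule:
  assumes "A \<subseteq> B" shows "(\<lambda>x. x) \<in> rmod_hom R (M\<lparr>carrier := A\<rparr>) (M\<lparr>carrier := B\<rparr>)"
  using assms by (intro rmod_homI) auto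

lemma (in ring) projective_zero_submodule:
  fixes P :: "('a, 'p) module"
  assumes P: "right_module R P"
  shows "projective_rmod R (P\<lparr>carrier := {\<zero>\<^bsub>P\<^esub>}\<rparr>)"
proof -
  interpret P: right_module R P by (rule P)
  let ?Z = "P\<lparr>carrier := {\<zero>\<^bsub>P\<^esub>}\<rparr>"
  have Z: "right_module R ?Z" by (rule P.submodule) (auto simp: P.smult_r_zero)
  have "(\<lambda>_. \<lambda>_. \<zero>) \<in> rmod_hom R ?Z (free_rmod R ({} :: 'p set))"
    by (rule rmod_homI) (auto simp: free_rmod_closed)
  moreover have "(\<lambda>_. \<zero>\<^bsub>P\<^esub>) \<in> rmod_hom R (free_rmod R ({} :: 'p set)) ?Z"
    by (rule rmod_homI) (auto simp: P.smult_r_zero)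
  ultimately show ?thesis
    unfolding projective_rmod_def using Z
    by (intro conjI exI[of _ "{} :: 'p set"] exI[of _ "\<lambda>_. \<lambda>_. \<zero>"] exI[of _ "\<lambda>_. \<zero>\<^bsub>P\<^esub>"]) auto
qed

context right_hereditary begin

text \<open>A free module maps onto \<open>M\<close>, and the kernel is projective as a submodule of a free module. The encoding \<open>e\<close> only
moves the free module into the type of \<open>M\<close>.\<close>

lemma projective_dimension_le_1:
  fixes M :: "('a, 't) module" and e :: "('t \<Rightarrow> 'a) \<Rightarrow> 't"
  assumes M: "right_module R M" and e: "inj_on e (carrier (free_rmod R (carrier M)))"
  shows "projective_dimension R M \<le> 1"
proof -
  interpret M: right_module R M by (rule M)
  let ?F = "free_rmod R (carrier M)"
  interpret F: right_module R ?F by (rule right_module_free_rmod)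
  note C = M.combination_closed M.combination_add M.combination_smult
  define d where "d = inv_into (carrier ?F) e"
  have de: "d (e f) = f" if "f \<in> carrier ?F" for f using e that by (simp add: d_def)
  \<comment> \<open>The free module on the elements of \<open>M\<close>, its map \<open>\<epsilon>\<close> to \<open>M\<close>, and the kernel
    \<open>K\<close> of \<open>\<epsilon>\<close>.\<close>
  define P0 where "P0 = transport_module e ?F"
  have P0: "right_module R P0" unfolding P0_def by (rule right_module_transport[OF right_module_free_rmod e])
  have P0c: "carrier P0 = e ` carrier ?F" by (simp add: P0_def transport_module_def)
  have P0s: "\<zero>\<^bsub>P0\<^esub> = e \<zero>\<^bsub>?F\<^esub>" "\<And>u v. u \<oplus>\<^bsub>P0\<^esub> v = e (d u \<oplus>\<^bsub>?F\<^esub> d v)" "\<And>r u. r \<odot>\<^bsub>P0\<^esub> u = e (r \<odot>\<^bsub>?F\<^esub> d u)"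
    by (simp_all add: P0_def transport_module_def d_def)
  have ed: "e (d u) = u" "d u \<in> carrier ?F" if "u \<in> carrier P0" for u using that de by (auto simp: P0c)
  have d_hom: "d \<in> rmod_hom R P0 ?F"
  proof (rule rmod_homI)
    show "d u \<in> carrier ?F" if "u \<in> carrier P0" for u using ed that by blast
    show "d (u \<oplus>\<^bsub>P0\<^esub> v) = d u \<oplus>\<^bsub>?F\<^esub> d v" if "u \<in> carrier P0" "v \<in> carrier P0" for u v
      unfolding P0s by (rule de[OF F.M.a_closed[OF ed(2)[OF that(1)] ed(2)[OF that(2)]]])
    show "d (r \<odot>\<^bsub>P0\<^esub> u) = r \<odot>\<^bsub>?F\<^esub> d u" if "r \<in> carrier R" "u \<in> carrier P0" for r u
      unfolding P0s by (rule de[OF F.rsmult_closed[OF that(1) ed(2)[OF that(2)]]])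
  qed
  have e_hom: "e \<in> rmod_hom R ?F P0"
  proof (rule rmod_homI)
    show "e u \<in> carrier P0" if "u \<in> carrier ?F" for u using that P0c by blast
    show "e (u \<oplus>\<^bsub>?F\<^esub> v) = e u \<oplus>\<^bsub>P0\<^esub> e v" if "u \<in> carrier ?F" "v \<in> carrier ?F" for u v
      unfolding P0s de[OF that(1)] de[OF that(2)] ..
    show "e (r \<odot>\<^bsub>?F\<^esub> u) = r \<odot>\<^bsub>P0\<^esub> e u" if "r \<in> carrier R" "u \<in> carrier ?F" for r u
      unfolding P0s de[OF that(2)] ..
  qed
  have proj0: "projective_rmod R P0"
    unfolding projective_rmod_def
    by (intro conjI exI[of _ "carrier M"] exI[of _ d] exI[of _ e] ballI P0 d_hom e_hom ed)
  define \<epsilon> where "\<epsilon> u = M.combination (d u)" for u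
  have \<epsilon>_hom: "\<epsilon> \<in> rmod_hom R P0 M"
  proof (rule rmod_homI)
    show "\<epsilon> u \<in> carrier M" if "u \<in> carrier P0" for u unfolding \<epsilon>_def by (rule C(1)[OF ed(2)[OF that]])
    show "\<epsilon> (u \<oplus>\<^bsub>P0\<^esub> v) = \<epsilon> u \<oplus>\<^bsub>M\<^esub> \<epsilon> v" if "u \<in> carrier P0" "v \<in> carrier P0" for u v
    proof -
      have "d (u \<oplus>\<^bsub>P0\<^esub> v) = d u \<oplus>\<^bsub>?F\<^esub> d v" using d_hom that unfolding rmod_hom_def by blast
      then show ?thesis unfolding \<epsilon>_def using C(2)[OF ed(2)[OF that(1)] ed(2)[OF that(2)]] by (simp only:)
    qed
    show "\<epsilon> (r \<odot>\<^bsub>P0\<^esub> u) = r \<odot>\<^bsub>M\<^esub> \<epsilon> u" if "r \<in> carrier R" "u \<in> carrier P0" for r u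
    proof -
      have "d (r \<odot>\<^bsub>P0\<^esub> u) = r \<odot>\<^bsub>?F\<^esub> d u" using d_hom that unfolding rmod_hom_def by blast
      then show ?thesis unfolding \<epsilon>_def using C(3)[OF ed(2)[OF that(2)] that(1)] by (simp only:)
    qed
  qed
  have \<epsilon>_surj: "\<epsilon> ` carrier P0 = carrier M"
  proof -
    have "\<epsilon> ` carrier P0 = M.combination ` carrier ?F"
      unfolding P0c image_image \<epsilon>_def using de by (intro image_cong) auto
    then show ?thesis using M.combination_surj by simp
  qed
  interpret P0: right_module R P0 by (rule P0)
  define K where "K = rmod_ker P0 M \<epsilon>"
  have K: "K \<subseteq> carrier P0" "\<And>u. u \<in> K \<Longrightarrow> \<epsilon> u = \<zero>\<^bsub>M\<^esub>" unfolding K_def rmod_ker_def by auto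
  have KI: "u \<in> K" if "u \<in> carrier P0" "\<epsilon> u = \<zero>\<^bsub>M\<^esub>" for u using that unfolding K_def rmod_ker_def by blast
  have \<epsilon>z: "\<epsilon> \<zero>\<^bsub>P0\<^esub> = \<zero>\<^bsub>M\<^esub>"
  proof -
    have "\<epsilon> (\<zero> \<odot>\<^bsub>P0\<^esub> \<zero>\<^bsub>P0\<^esub>) = \<zero> \<odot>\<^bsub>M\<^esub> \<epsilon> \<zero>\<^bsub>P0\<^esub>"
      using \<epsilon>_hom P0.M.zero_closed zero_closed unfolding rmod_hom_def by blast
    moreover have "\<epsilon> \<zero>\<^bsub>P0\<^esub> \<in> carrier M" using \<epsilon>_hom P0.M.zero_closed unfolding rmod_hom_def by blast
    ultimately show ?thesis using P0.smult_l_zero[OF P0.M.zero_closed] M.smult_l_zero by simp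
  qed
  define P1 where "P1 = P0\<lparr>carrier := K\<rparr>"
  have P1: "right_module R P1"
    unfolding P1_def
  proof (rule P0.submodule[OF K(1)])
    show "\<zero>\<^bsub>P0\<^esub> \<in> K" using KI \<epsilon>z by simp
    fix x y assume xy: "x \<in> K" "y \<in> K"
    then have c: "x \<in> carrier P0" "y \<in> carrier P0" using K by auto
    have "\<epsilon> (x \<oplus>\<^bsub>P0\<^esub> y) = \<epsilon> x \<oplus>\<^bsub>M\<^esub> \<epsilon> y" using \<epsilon>_hom c unfolding rmod_hom_def by blast
    then show "x \<oplus>\<^bsub>P0\<^esub> y \<in> K" using KI c K(2) xy by simp
  next
    fix r x assume r: "r \<in> carrier R" and x: "x \<in> K"
    then have c: "x \<in> carrier P0" using K by auto
    have "\<epsilon> (r \<odot>\<^bsub>P0\<^esub> x) = r \<odot>\<^bsub>M\<^esub> \<epsilon> x" using \<epsilon>_hom c r unfolding rmod_hom_def by blast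
    then show "r \<odot>\<^bsub>P0\<^esub> x \<in> K" using KI P0.rsmult_closed[OF r c] K(2)[OF x] M.smult_r_zero[OF r] by simp
  qed
  interpret P1: right_module R P1 by (rule P1)
  have P1s: "carrier P1 = K" "\<And>u v. u \<oplus>\<^bsub>P1\<^esub> v = u \<oplus>\<^bsub>P0\<^esub> v" "\<And>r u. r \<odot>\<^bsub>P1\<^esub> u = r \<odot>\<^bsub>P0\<^esub> u"
    by (simp_all add: P1_def)
  let ?G = "free_rmod R (carrier P1)"
  note C1 = P1.combination_closed P1.combination_add P1.combination_smult
  have C1K: "P1.combination u \<in> carrier P0" if "u \<in> carrier ?G" for u
    using C1(1)[OF that] K(1) P1s(1) by blast
  define \<pi> where "\<pi> u = d (P1.combination u)" for u
  have \<pi>_hom: "\<pi> \<in> rmod_hom R ?G ?F"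
  proof (rule rmod_homI)
    show "\<pi> u \<in> carrier ?F" if "u \<in> carrier ?G" for u unfolding \<pi>_def by (rule ed(2)[OF C1K[OF that]])
    show "\<pi> (u \<oplus>\<^bsub>?G\<^esub> v) = \<pi> u \<oplus>\<^bsub>?F\<^esub> \<pi> v" if "u \<in> carrier ?G" "v \<in> carrier ?G" for u v
    proof -
      have "P1.combination (u \<oplus>\<^bsub>?G\<^esub> v) = P1.combination u \<oplus>\<^bsub>P0\<^esub> P1.combination v"
        using C1(2)[OF that] unfolding P1s .
      moreover have "d (P1.combination u \<oplus>\<^bsub>P0\<^esub> P1.combination v) = \<pi> u \<oplus>\<^bsub>?F\<^esub> \<pi> v"
        unfolding \<pi>_def using d_hom C1K[OF that(1)] C1K[OF that(2)] unfolding rmod_hom_def by blast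
      ultimately show ?thesis unfolding \<pi>_def by (simp only:)
    qed
    show "\<pi> (r \<odot>\<^bsub>?G\<^esub> u) = r \<odot>\<^bsub>?F\<^esub> \<pi> u" if "r \<in> carrier R" "u \<in> carrier ?G" for r u
    proof -
      have "P1.combination (r \<odot>\<^bsub>?G\<^esub> u) = r \<odot>\<^bsub>P0\<^esub> P1.combination u"
        using C1(3)[OF that(2,1)] unfolding P1s .
      moreover have "d (r \<odot>\<^bsub>P0\<^esub> P1.combination u) = r \<odot>\<^bsub>?F\<^esub> \<pi> u"
        unfolding \<pi>_def using d_hom C1K[OF that(2)] that(1) unfolding rmod_hom_def by blast
      ultimately show ?thesis unfolding \<pi>_def by (simp only:)
    qed
  qed
  define N where "N = \<pi> ` carrier ?G"
  have N: "N = d ` K"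
  proof -
    have "N = d ` (P1.combination ` carrier ?G)" unfolding N_def image_image \<pi>_def ..
    then show ?thesis using P1.combination_surj P1s(1) by simp
  qed
  \<comment> \<open>The kernel is the image of the free module on its elements. A section of this map exhibits it as a direct summand.\<close>
  obtain t where t: "t \<in> N \<rightarrow> carrier ?G"
    and tadd: "\<forall>p\<in>N. \<forall>q\<in>N. t (\<lambda>x. p x \<oplus> q x) = t p \<oplus>\<^bsub>?G\<^esub> t q"
    and tmult: "\<forall>p\<in>N. \<forall>r\<in>carrier R. t (\<lambda>x. p x \<otimes> r) = r \<odot>\<^bsub>?G\<^esub> t p"
    and t\<pi>: "\<forall>p\<in>N. \<pi> (t p) = p"
    using free_submodule_section[OF right_module_free_rmod \<pi>_hom N_def] by blast
  have dK: "d u \<in> N" "u \<in> carrier P0" if "u \<in> K" for u using that N K(1) by blast+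
  have proj1: "projective_rmod R P1"
    unfolding projective_rmod_def
  proof (intro conjI exI[of _ "carrier P1"] exI[of _ "\<lambda>u. t (d u)"] exI[of _ P1.combination] ballI P1)
    show "(\<lambda>u. t (d u)) \<in> rmod_hom R P1 ?G"
    proof (rule rmod_homI)
      show "t (d u) \<in> carrier ?G" if "u \<in> carrier P1" for u using that t dK unfolding P1s by blast
      show "t (d (u \<oplus>\<^bsub>P1\<^esub> v)) = t (d u) \<oplus>\<^bsub>?G\<^esub> t (d v)" if "u \<in> carrier P1" "v \<in> carrier P1" for u v
      proof -
        have uv: "u \<in> K" "v \<in> K" using that P1s by auto
        have "d (u \<oplus>\<^bsub>P1\<^esub> v) = d u \<oplus>\<^bsub>?F\<^esub> d v"
          unfolding P1s using d_hom dK(2)[OF uv(1)] dK(2)[OF uv(2)] unfolding rmod_hom_def by blast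
        then have e1: "d (u \<oplus>\<^bsub>P1\<^esub> v) = (\<lambda>x. d u x \<oplus> d v x)" by simp
        show ?thesis unfolding e1 using tadd dK(1)[OF uv(1)] dK(1)[OF uv(2)] by blast
      qed
      show "t (d (r \<odot>\<^bsub>P1\<^esub> u)) = r \<odot>\<^bsub>?G\<^esub> t (d u)" if "r \<in> carrier R" "u \<in> carrier P1" for r u
      proof -
        have u: "u \<in> K" using that P1s by auto
        have "d (r \<odot>\<^bsub>P1\<^esub> u) = r \<odot>\<^bsub>?F\<^esub> d u"
          unfolding P1s using d_hom dK(2)[OF u] that(1) unfolding rmod_hom_def by blast
        then have e1: "d (r \<odot>\<^bsub>P1\<^esub> u) = (\<lambda>x. d u x \<otimes> r)" by simp
        show ?thesis unfolding e1 using tmult dK(1)[OF u] that(1) by blast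
      qed
    qed
    show "P1.combination \<in> rmod_hom R ?G P1" by (rule combination_rmod_hom[OF P1])
    fix u assume "u \<in> carrier P1"
    then have u: "u \<in> K" using P1s by simp
    have tG: "t (d u) \<in> carrier ?G" using t dK(1)[OF u] by blast
    have "d (P1.combination (t (d u))) = d u" using t\<pi> dK(1)[OF u] unfolding \<pi>_def by blast
    then have "e (d (P1.combination (t (d u)))) = e (d u)" by simp
    then show "P1.combination (t (d u)) = u" using ed(1)[OF C1K[OF tG]] ed(1)[OF dK(2)[OF u]] by simp
  qed
  define Z where "Z = P0\<lparr>carrier := {\<zero>\<^bsub>P0\<^esub>}\<rparr>"
  have Z: "projective_rmod R Z" unfolding Z_def by (rule projective_zero_submodule[OF P0])
  define P where "P i = (if i = 0 then P0 else if i = 1 then P1 else Z)" for i :: nat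
  have PP: "P 0 = P0" "P (Suc 0) = P1" "\<And>i. P (Suc (Suc i)) = Z" by (simp_all add: P_def)
  have P0': "P0 = P0\<lparr>carrier := carrier P0\<rparr>" by simp
  have zK: "{\<zero>\<^bsub>P0\<^esub>} \<subseteq> K" using KI \<epsilon>z by simp
  have "projective_resolution R M 1 P (\<lambda>_ x. x) \<epsilon>"
    unfolding projective_resolution_def
  proof (intro conjI allI impI)
    show "projective_rmod R (P i)" for i using proj0 proj1 Z by (simp add: P_def)
    show "carrier (P i) = {\<zero>\<^bsub>P i\<^esub>}" if "1 < i" for i using that by (simp add: P_def Z_def)
    show "\<epsilon> \<in> rmod_hom R (P 0) M" using \<epsilon>_hom PP by simp
    show "(\<lambda>x. x) \<in> rmod_hom R (P (Suc i)) (P i)" for i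
    proof (cases i)
      case 0
      have "(\<lambda>x. x) \<in> rmod_hom R P1 (P0\<lparr>carrier := carrier P0\<rparr>)"
        unfolding P1_def by (rule rmod_hom_id_submodule[OF K(1)])
      then show ?thesis using 0 PP P0' by simp
    next
      case (Suc j)
      show ?thesis
      proof (cases j)
        case 0
        then show ?thesis unfolding Suc 0 PP P1_def Z_def
          using rmod_hom_id_submodule[OF zK, of R P0] PP(3)[of 0] by (simp add: Z_def)
      next
        case (Suc k)
        then show ?thesis using \<open>i = Suc j\<close> PP(3) rmod_hom_id_submodule[of "carrier Z" "carrier Z" R Z] by simp
      qed
    qed
    show "\<epsilon> ` carrier (P 0) = carrier M" using \<epsilon>_surj PP by simp
    show "(\<lambda>x. x) ` carrier (P 1) = rmod_ker (P 0) M \<epsilon>" using PP P1s by (simp add: K_def)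
    show "(\<lambda>x. x) ` carrier (P (Suc (Suc i))) = rmod_ker (P (Suc i)) (P i) (\<lambda>x. x)" for i
    proof (cases i)
      case 0
      then show ?thesis using zK by (auto simp: PP Z_def rmod_ker_def P1s)
    next
      case (Suc j)
      have "rmod_ker (P (Suc i)) (P i) (\<lambda>x. x) = {\<zero>\<^bsub>P0\<^esub>}"
        unfolding Suc PP by (cases j) (auto simp: P_def Z_def P1_def rmod_ker_def)
      then show ?thesis using PP by (simp add: Z_def)
    qed
  qed
  then have "enat 1 \<in> {enat n |n. \<exists>P d \<epsilon>. projective_resolution R M n P d \<epsilon>}" by blast
  then show ?thesis unfolding projective_dimension_def one_enat_def by (rule Inf_lower)
qed

end

text \<open>An injective encoding of finite lists of pairs of a word and a letter as single words. Every letter of a word is preceded by the marker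
\<open>z\<close>, and the marker \<open>s\<close> announces the letter that belongs to the word before it. The markers may occur as letters too, since
only the positions of the markers matter.\<close>

fun encode_word :: "'u \<Rightarrow> 'u list \<Rightarrow> 'u list" where
  "encode_word z [] = []"
| "encode_word z (c # w) = z # c # encode_word z w"

fun encode_pairs :: "'u \<Rightarrow> 'u \<Rightarrow> ('u list \<times> 'u) list \<Rightarrow> 'u list" where
  "encode_pairs z s [] = []"
| "encode_pairs z s ((w, c) # ps) = encode_word z w @ s # c # encode_pairs z s ps"

lemma encode_word_inj:
  assumes "z \<noteq> s"
  shows "encode_word z w @ s # c # r = encode_word z w' @ s # c' # r' \<Longrightarrow> w = w' \<and> c = c' \<and> r = r'"
proof (induction w arbitrary: w')
  case Nil
  then show ?case using assms by (cases w') auto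
next
  case (Cons a w)
  then show ?case using assms by (cases w') auto
qed

lemma inj_encode_pairs:
  assumes "z \<noteq> s" shows "encode_pairs z s ps = encode_pairs z s qs \<Longrightarrow> ps = qs"
proof (induction ps arbitrary: qs)
  case Nil
  show ?case
  proof (cases qs)
    case (Cons q qs')
    then show ?thesis using Nil by (cases q) auto
  qed simp
next
  case (Cons p ps)
  obtain w c where p: "p = (w, c)" by (cases p)
  show ?case
  proof (cases qs)
    case Nil
    then show ?thesis using Cons.prems p by simp
  next
    case (Cons q qs')
    obtain w' c' where q: "q = (w', c')" by (cases q)
    have "encode_word z w @ s # c # encode_pairs z s ps = encode_word z w' @ s # c' # encode_pairs z s qs'"
      using Cons.prems p q Cons by simp
    from encode_word_inj[OF assms this] show ?thesis using Cons.IH[of qs'] p q Cons by simp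
  qed
qed

context ring begin

text \<open>An element of the free module is determined by the finite list of its nonzero coefficients and their indices.\<close>

lemma ex_encoding:
  assumes "\<one> \<noteq> \<zero>"
  shows "\<exists>e :: (('a + 'm) list \<Rightarrow> 'a) \<Rightarrow> ('a + 'm) list. inj_on e (carrier (free_rmod R X))"
proof -
  define xs where "xs f = (SOME xs. set xs = {x. f x \<noteq> \<zero>})" for f :: "('a + 'm) list \<Rightarrow> 'a"
  have xs: "set (xs f) = {x. f x \<noteq> \<zero>}" if "f \<in> carrier (free_rmod R X)" for f
  proof -
    have "finite {x. f x \<noteq> \<zero>}" using that by (simp add: free_rmod_carrier)
    then have "\<exists>xs. set xs = {x. f x \<noteq> \<zero>}" by (rule finite_list)
    then show ?thesis unfolding xs_def by (rule someI_ex)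
  qed
  define e where "e f = encode_pairs (Inl \<zero>) (Inl \<one>) (map (\<lambda>x. (x, Inl (f x))) (xs f))"
    for f :: "('a + 'm) list \<Rightarrow> 'a"
  have "inj_on e (carrier (free_rmod R X))"
  proof (rule inj_onI)
    fix f g assume f: "f \<in> carrier (free_rmod R X)" and g: "g \<in> carrier (free_rmod R X)" and "e f = e g"
    have z: "(Inl \<zero> :: 'a + 'm) \<noteq> Inl \<one>" using assms by simp
    have m: "map (\<lambda>x. (x, Inl (f x) :: 'a + 'm)) (xs f) = map (\<lambda>x. (x, Inl (g x))) (xs g)"
      using inj_encode_pairs[OF z] \<open>e f = e g\<close> unfolding e_def by blast
    then have "map fst (map (\<lambda>x. (x, Inl (f x) :: 'a + 'm)) (xs f)) = map fst (map (\<lambda>x. (x, Inl (g x) :: 'a + 'm)) (xs g))"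
      by (rule arg_cong)
    then have eq: "xs f = xs g" by (simp add: comp_def)
    show "f = g"
    proof
      fix x
      show "f x = g x"
      proof (cases "x \<in> set (xs f)")
        case True
        then show ?thesis using m eq by (auto simp: map_eq_conv)
      next
        case False
        then show ?thesis using xs[OF f] xs[OF g] eq by auto
      qed
    qed
  qed
  then show ?thesis by blast
qed

text \<open>The module \<open>R/tR\<close>, where \<open>t\<close> is not right invertible and not a right zero divisor. The class of \<open>1\<close>
is nonzero and killed by \<open>t\<close>, while no nonzero element of a submodule of a free module is killed by \<open>t\<close>. The quotient is
realised on chosen representatives \<open>\<rho> r\<close> of the cosets, so that its elements can be encoded like elements of
\<open>R\<close>.\<close>

lemma ex_nonprojective_module:
  fixes e :: "'a \<Rightarrow> 't"
  assumes e: "inj e" and t: "t \<in> carrier R" "\<And>r. r \<in> carrier R \<Longrightarrow> r \<otimes> t = \<zero> \<Longrightarrow> r = \<zero>"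
    and nu: "\<And>r. r \<in> carrier R \<Longrightarrow> t \<otimes> r \<noteq> \<one>"
  shows "\<exists>M :: ('a, 't) module. right_module R M \<and> 1 \<le> projective_dimension R M"
proof -
  define I where "I = principal_right t"
  have RI: "right_ideal I R" unfolding I_def by (rule right_ideal_multiples[OF t(1)])
  define \<rho> where "\<rho> r = (SOME s. s \<in> carrier R \<and> s \<ominus> r \<in> I)" for r
  have \<rho>: "\<rho> r \<in> carrier R" "\<rho> r \<ominus> r \<in> I" if "r \<in> carrier R" for r
  proof -
    have "\<exists>s. s \<in> carrier R \<and> s \<ominus> r \<in> I" using that right_ideal_zero[OF RI] by (intro exI[of _ r]) (simp add: r_neg a_minus_def)
    then have "\<rho> r \<in> carrier R \<and> \<rho> r \<ominus> r \<in> I" unfolding \<rho>_def by (rule someI_ex)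
    then show "\<rho> r \<in> carrier R" "\<rho> r \<ominus> r \<in> I" by blast+
  qed
  have \<rho>_eq: "\<rho> r = \<rho> s" if "r \<in> carrier R" "s \<in> carrier R" "r \<ominus> s \<in> I" for r s
  proof -
    have "x \<ominus> r \<in> I \<longleftrightarrow> x \<ominus> s \<in> I" if x: "x \<in> carrier R" for x
    proof
      have e1: "x \<ominus> s = (x \<ominus> r) \<oplus> (r \<ominus> s)" "x \<ominus> r = (x \<ominus> s) \<ominus> (r \<ominus> s)"
        using x \<open>r \<in> carrier R\<close> \<open>s \<in> carrier R\<close> by algebra+
      show "x \<ominus> s \<in> I" if "x \<ominus> r \<in> I" unfolding e1(1) by (rule right_ideal_add[OF RI that \<open>r \<ominus> s \<in> I\<close>])
      show "x \<ominus> r \<in> I" if "x \<ominus> s \<in> I" unfolding e1(2) by (rule right_ideal_minus[OF RI that \<open>r \<ominus> s \<in> I\<close>])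
    qed
    then have "(\<lambda>x. x \<in> carrier R \<and> x \<ominus> r \<in> I) = (\<lambda>x. x \<in> carrier R \<and> x \<ominus> s \<in> I)" by blast
    then show ?thesis unfolding \<rho>_def by (rule arg_cong)
  qed
  have \<rho>_eq_iff: "r \<ominus> s \<in> I" if r: "r \<in> carrier R" and s: "s \<in> carrier R" and e: "\<rho> r = \<rho> s" for r s
  proof -
    have "r \<ominus> s = (\<rho> s \<ominus> s) \<ominus> (\<rho> s \<ominus> r)" using r s \<rho>(1)[OF s] by algebra
    moreover have "\<rho> s \<ominus> r \<in> I" using \<rho>(2)[OF r] e by simp
    ultimately show ?thesis using right_ideal_minus[OF RI \<rho>(2)[OF s]] by simp
  qed
  have \<rho>_add: "\<rho> (\<rho> r \<oplus> s) = \<rho> (r \<oplus> s)" "\<rho> (s \<oplus> \<rho> r) = \<rho> (s \<oplus> r)" if r: "r \<in> carrier R" and s: "s \<in> carrier R" for r s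
  proof -
    have "(\<rho> r \<oplus> s) \<ominus> (r \<oplus> s) = \<rho> r \<ominus> r" "(s \<oplus> \<rho> r) \<ominus> (s \<oplus> r) = \<rho> r \<ominus> r" using r s \<rho>(1)[OF r] by algebra+
    then show "\<rho> (\<rho> r \<oplus> s) = \<rho> (r \<oplus> s)" "\<rho> (s \<oplus> \<rho> r) = \<rho> (s \<oplus> r)"
      using \<rho>[OF r] r s by (intro \<rho>_eq; simp)+
  qed
  have \<rho>_mult: "\<rho> (\<rho> r \<otimes> s) = \<rho> (r \<otimes> s)" if r: "r \<in> carrier R" and s: "s \<in> carrier R" for r s
  proof (rule \<rho>_eq)
    have "\<rho> r \<otimes> s \<ominus> r \<otimes> s = (\<rho> r \<ominus> r) \<otimes> s" using r s \<rho>(1)[OF r] by algebra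
    then show "\<rho> r \<otimes> s \<ominus> r \<otimes> s \<in> I" using right_ideal_mult[OF RI \<rho>(2)[OF r] s] by simp
  qed (use r s \<rho>(1)[OF r] in auto)
  define Q :: "('a, 'a) module" where "Q = \<lparr> carrier = \<rho> ` carrier R, mult = undefined, one = undefined, zero = \<rho> \<zero>,
     add = (\<lambda>x y. \<rho> (x \<oplus> y)), smult = (\<lambda>r x. \<rho> (x \<otimes> r)) \<rparr>"
  have Qc: "x \<in> carrier R" "\<rho> x = x" if xQ: "x \<in> carrier Q" for x
  proof -
    obtain r where r: "r \<in> carrier R" "x = \<rho> r" using xQ by (auto simp: Q_def)
    then show "x \<in> carrier R" "\<rho> x = x" using \<rho>[OF r(1)] by (auto intro: \<rho>_eq)
  qed
  have Q: "right_module R Q"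
  proof (intro right_module.intro right_module_axioms.intro)
    show "ring R" by (rule ring_axioms)
    show "abelian_group Q"
    proof (rule abelian_groupI)
      fix x assume "x \<in> carrier Q"
      then obtain r where r: "r \<in> carrier R" "x = \<rho> r" by (auto simp: Q_def)
      have "\<rho> (\<ominus> r) \<oplus>\<^bsub>Q\<^esub> x = \<zero>\<^bsub>Q\<^esub>" using r by (simp add: Q_def \<rho>_add \<rho>(1) l_neg)
      moreover have "\<rho> (\<ominus> r) \<in> carrier Q" using r by (simp add: Q_def)
      ultimately show "\<exists>y\<in>carrier Q. y \<oplus>\<^bsub>Q\<^esub> x = \<zero>\<^bsub>Q\<^esub>" by blast
    next
      fix x y z assume xyz: "x \<in> carrier Q" "y \<in> carrier Q" "z \<in> carrier Q"
      note c = Qc[OF xyz(1)] Qc[OF xyz(2)] Qc[OF xyz(3)]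
      show "x \<oplus>\<^bsub>Q\<^esub> y \<in> carrier Q" using c by (simp add: Q_def)
      show "x \<oplus>\<^bsub>Q\<^esub> y = y \<oplus>\<^bsub>Q\<^esub> x" using c by (simp add: Q_def a_comm)
      show "\<zero>\<^bsub>Q\<^esub> \<oplus>\<^bsub>Q\<^esub> x = x" using c by (simp add: Q_def \<rho>_add)
      show "x \<oplus>\<^bsub>Q\<^esub> y \<oplus>\<^bsub>Q\<^esub> z = x \<oplus>\<^bsub>Q\<^esub> (y \<oplus>\<^bsub>Q\<^esub> z)" using c by (simp add: Q_def \<rho>_add a_assoc)
    qed (simp add: Q_def)
  next
    fix r s x y assume r: "r \<in> carrier R" and s: "s \<in> carrier R" and x: "x \<in> carrier Q" and y: "y \<in> carrier Q"
    note c = Qc[OF x] Qc[OF y]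
    show "r \<odot>\<^bsub>Q\<^esub> x \<in> carrier Q" using r c by (simp add: Q_def)
    show "(r \<oplus> s) \<odot>\<^bsub>Q\<^esub> x = r \<odot>\<^bsub>Q\<^esub> x \<oplus>\<^bsub>Q\<^esub> s \<odot>\<^bsub>Q\<^esub> x"
      using r s c by (simp add: Q_def \<rho>_add \<rho>(1) r_distr)
    show "r \<odot>\<^bsub>Q\<^esub> (x \<oplus>\<^bsub>Q\<^esub> y) = r \<odot>\<^bsub>Q\<^esub> x \<oplus>\<^bsub>Q\<^esub> r \<odot>\<^bsub>Q\<^esub> y"
      using r c by (simp add: Q_def \<rho>_add \<rho>_mult \<rho>(1) l_distr)
    show "(r \<otimes> s) \<odot>\<^bsub>Q\<^esub> x = s \<odot>\<^bsub>Q\<^esub> (r \<odot>\<^bsub>Q\<^esub> x)"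
      using r s c by (simp add: Q_def \<rho>_mult m_assoc)
  next
    show "\<one> \<odot>\<^bsub>Q\<^esub> x = x" if "x \<in> carrier Q" for x using Qc[OF that] by (simp add: Q_def)
  qed
  define M where "M = transport_module e Q"
  have einj: "inj_on e (carrier Q)" using e by (rule inj_on_subset) simp
  have M: "right_module R M" unfolding M_def by (rule right_module_transport[OF Q einj])
  interpret M: right_module R M by (rule M)
  define w where "w = e (\<rho> \<one>)"
  have w: "w \<in> carrier M" by (simp add: w_def M_def transport_module_def Q_def)
  have "\<rho> (\<rho> \<one> \<otimes> t) = \<rho> \<zero>"
  proof -
    have "t \<ominus> \<zero> = t" using t(1) by (simp add: a_minus_def)
    then have "\<rho> t = \<rho> \<zero>" using generator_in_multiples[OF t(1)] t(1) by (intro \<rho>_eq) (auto simp: I_def)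
    then show ?thesis using \<rho>_mult[OF one_closed t(1)] t(1) by simp
  qed
  moreover have "inv_into (carrier Q) e (e (\<rho> \<one>)) = \<rho> \<one>" using einj by (simp add: Q_def)
  ultimately have tw: "t \<odot>\<^bsub>M\<^esub> w = \<zero>\<^bsub>M\<^esub>" by (simp add: w_def M_def transport_module_def) (simp add: Q_def)
  have w0: "w \<noteq> \<zero>\<^bsub>M\<^esub>"
  proof
    assume "w = \<zero>\<^bsub>M\<^esub>"
    then have "\<rho> \<one> = \<rho> \<zero>" using e by (simp add: w_def M_def transport_module_def Q_def inj_eq)
    then have "\<one> \<ominus> \<zero> \<in> I" by (intro \<rho>_eq_iff) auto
    then have "\<one> \<in> I" by (simp add: a_minus_def)
    then show False using nu unfolding I_def principal_right_iff by metis
  qed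
  \<comment> \<open>A resolution of length \<open>0\<close> would make \<open>M\<close> isomorphic to a projective module.\<close>
  have "\<not> projective_resolution R M 0 P d \<epsilon>" for P d \<epsilon>
  proof
    assume res: "projective_resolution R M 0 P d \<epsilon>"
    have proj: "projective_rmod R (P 0)" "projective_rmod R (P 1)" and P1: "carrier (P 1) = {\<zero>\<^bsub>P 1\<^esub>}"
      and \<epsilon>: "\<epsilon> \<in> rmod_hom R (P 0) M" "\<epsilon> ` carrier (P 0) = carrier M"
      and ex: "d 0 ` carrier (P 1) = rmod_ker (P 0) M \<epsilon>"
      using res unfolding projective_resolution_def by auto
    interpret P0: right_module R "P 0" using proj(1) unfolding projective_rmod_def by blast
    obtain X f g where f: "f \<in> rmod_hom R (P 0) (free_rmod R (X :: 't set))"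
      and g: "g \<in> rmod_hom R (free_rmod R X) (P 0)" and gf: "\<forall>p\<in>carrier (P 0). g (f p) = p"
      using proj(1) unfolding projective_rmod_def by blast
    obtain p where p: "p \<in> carrier (P 0)" "\<epsilon> p = w" using \<epsilon>(2) w by (metis imageE)
    have z: "\<zero>\<^bsub>P 0\<^esub> \<in> rmod_ker (P 0) M \<epsilon>"
    proof -
      have "\<epsilon> (\<zero> \<odot>\<^bsub>P 0\<^esub> \<zero>\<^bsub>P 0\<^esub>) = \<zero> \<odot>\<^bsub>M\<^esub> \<epsilon> \<zero>\<^bsub>P 0\<^esub>"
        using \<epsilon>(1) P0.M.zero_closed zero_closed unfolding rmod_hom_def by blast
      moreover have "\<epsilon> \<zero>\<^bsub>P 0\<^esub> \<in> carrier M" using \<epsilon>(1) P0.M.zero_closed unfolding rmod_hom_def by blast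
      ultimately have "\<epsilon> \<zero>\<^bsub>P 0\<^esub> = \<zero>\<^bsub>M\<^esub>"
        using P0.smult_l_zero[OF P0.M.zero_closed] M.smult_l_zero by simp
      then show ?thesis unfolding rmod_ker_def by simp
    qed
    have tp: "t \<odot>\<^bsub>P 0\<^esub> p \<in> carrier (P 0)" using P0.rsmult_closed[OF t(1) p(1)] .
    have "\<epsilon> (t \<odot>\<^bsub>P 0\<^esub> p) = t \<odot>\<^bsub>M\<^esub> \<epsilon> p" using \<epsilon>(1) t(1) p(1) unfolding rmod_hom_def by blast
    then have "t \<odot>\<^bsub>P 0\<^esub> p \<in> rmod_ker (P 0) M \<epsilon>" using tp tw p(2) unfolding rmod_ker_def by simp
    then have "t \<odot>\<^bsub>P 0\<^esub> p = \<zero>\<^bsub>P 0\<^esub>" using z ex P1 by (metis image_empty image_insert singletonD)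
    moreover have "f (t \<odot>\<^bsub>P 0\<^esub> p) = t \<odot>\<^bsub>free_rmod R X\<^esub> f p" using f t(1) p(1) unfolding rmod_hom_def by blast
    moreover have "f \<zero>\<^bsub>P 0\<^esub> = (\<lambda>x. \<zero>)"
    proof -
      have "f (\<zero> \<odot>\<^bsub>P 0\<^esub> \<zero>\<^bsub>P 0\<^esub>) = \<zero> \<odot>\<^bsub>free_rmod R X\<^esub> f \<zero>\<^bsub>P 0\<^esub>"
        using f P0.M.zero_closed zero_closed unfolding rmod_hom_def by blast
      moreover have "f \<zero>\<^bsub>P 0\<^esub> \<in> carrier (free_rmod R X)"
        using f P0.M.zero_closed unfolding rmod_hom_def by blast
      ultimately show ?thesis
        using P0.smult_l_zero[OF P0.M.zero_closed] free_rmod_coeff[of "f \<zero>\<^bsub>P 0\<^esub>" X] by simp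
    qed
    ultimately have fpt: "(\<lambda>x. f p x \<otimes> t) = (\<lambda>x. \<zero>)" by simp
    have fp: "f p \<in> carrier (free_rmod R X)" using f p(1) unfolding rmod_hom_def by blast
    have "f p x = \<zero>" for x using t(2)[OF free_rmod_coeff[OF fp]] fun_cong[OF fpt] by blast
    then have "f p = f \<zero>\<^bsub>P 0\<^esub>" using \<open>f \<zero>\<^bsub>P 0\<^esub> = _\<close> by auto
    then have "p = \<zero>\<^bsub>P 0\<^esub>" using gf p(1) P0.M.zero_closed by metis
    then have "w = \<zero>\<^bsub>M\<^esub>" using z p(2) unfolding rmod_ker_def by simp
    then show False using w0 by simp
  qed
  then have no: "n \<noteq> 0" if "projective_resolution R M n P d \<epsilon>" for n P d \<epsilon>
    using that by (cases n) blast+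
  have "1 \<le> projective_dimension R M"
    unfolding projective_dimension_def
  proof (rule Inf_greatest)
    fix m assume "m \<in> {enat n |n. \<exists>P d \<epsilon>. projective_resolution R M n P d \<epsilon>}"
    then obtain n where "m = enat n" "n \<noteq> 0" using no by blast
    then show "1 \<le> m" by (simp add: one_enat_def)
  qed
  then show ?thesis using M by blast
qed

end

sublocale skew_dedekind \<subseteq> RH: right_hereditary "skew_laurent D \<sigma>"
  by unfold_locales (rule right_ideal_dual_basis)

context skew_dedekind begin

lemma right_global_dimension_1:
  assumes "\<not> field D" shows "right_global_dimension TYPE('m) R = 1"
proof (rule antisym)
  note one0 = R_one_not_zero
  have "projective_dimension R M \<le> 1" if M: "right_module R M" for M :: "(int \<Rightarrow> 'a, ((int \<Rightarrow> 'a) + 'm) list) module"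
  proof -
    obtain e :: "(((int \<Rightarrow> 'a) + 'm) list \<Rightarrow> (int \<Rightarrow> 'a)) \<Rightarrow> ((int \<Rightarrow> 'a) + 'm) list"
      where "inj_on e (carrier (free_rmod R (carrier M)))" using R.ex_encoding[OF one0] by blast
    then show ?thesis by (rule RH.projective_dimension_le_1[OF M])
  qed
  then show "right_global_dimension TYPE('m) R \<le> 1"
    unfolding right_global_dimension_def by (intro Sup_least) blast
  obtain t where t: "t \<in> carrier D" "t \<noteq> \<zero>" "\<And>u. u \<in> carrier D \<Longrightarrow> t \<otimes> u \<noteq> \<one>"
    using ex_nonunit[OF assms] by blast
  note mt = monomial_nonzero[OF t(2), of 0]
  have "\<exists>M :: (int \<Rightarrow> 'a, ((int \<Rightarrow> 'a) + 'm) list) module. right_module R M \<and> 1 \<le> projective_dimension R M"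
  proof (rule R.ex_nonprojective_module[of "\<lambda>r. [Inl r]" "monomial t 0"])
    show "inj (\<lambda>r. [Inl r])" by (rule injI) simp
    show "monomial t 0 \<in> carrier R" using t monomial_closed by simp
    show "r = \<zero>\<^bsub>R\<^esub>" if "r \<in> carrier R" "r \<otimes>\<^bsub>R\<^esub> monomial t 0 = \<zero>\<^bsub>R\<^esub>" for r
      using R_no_zero_divisors[OF that(1) monomial_closed[OF t(1)] that(2)] mt by blast
    show "monomial t 0 \<otimes>\<^bsub>R\<^esub> r \<noteq> \<one>\<^bsub>R\<^esub>" if "r \<in> carrier R" for r
      by (rule monomial_not_right_invertible[OF t(1,3) that])
  qed
  then obtain M :: "(int \<Rightarrow> 'a, ((int \<Rightarrow> 'a) + 'm) list) module"
    where M: "right_module R M" "1 \<le> projective_dimension R M" by blast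
  show "1 \<le> right_global_dimension TYPE('m) R"
    unfolding right_global_dimension_def by (rule order_trans[OF M(2) Sup_upper]) (use M(1) in blast)
qed

end

theorem theorem3:
  fixes D :: "('a, 'b) ring_scheme" and \<sigma> :: "'a \<Rightarrow> 'a"
  assumes "dedekind_domain D"
    and "\<not> field D"
    and "\<sigma> \<in> ring_iso D D"
  shows "has_right_krull_dimension (skew_laurent D \<sigma>) 1 \<and>
         right_global_dimension TYPE('m) (skew_laurent D \<sigma>) = 1 \<and>
         stable_rank (skew_laurent D \<sigma>) = 2 \<and>
         (acts_trivially_on_class_group D \<sigma> \<longrightarrow>
            general_linear_rank (skew_laurent D \<sigma>) = 1)"
proof -
  have ded: "domain D" "\<And>I. ideal I D \<Longrightarrow> I \<noteq> {\<zero>\<^bsub>D\<^esub>} \<Longrightarrow> invertible_ideal D I"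
    using assms(1) by (auto simp: dedekind_domain_def)
  interpret skew_dedekind D \<sigma>
    by (intro skew_dedekind.intro dedekind.intro dedekind_axioms.intro
        skew_laurent_ring.intro skew_laurent_ring_axioms.intro ded assms(3))
  show ?thesis
    using right_krull_dimension[OF assms(2)] right_global_dimension_1[OF assms(2)]
      stable_rank_2[OF assms(2)] general_linear_rank_1 by blast
qed

end
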